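(* Let $V\in L^\infty(\mathbb R^2)$ be real and supported in $\Sigma_\beta$. For $\varepsilon\in(0,\beta)$ define $V_\varepsilon(x)=\frac\beta\varepsilon V\big(x_\Sigma+\frac\beta\varepsilon t\,\nu(x_\Sigma)\big)$ if $x=x_\Sigma+t\nu(x_\Sigma)\in\Sigma_\varepsilon$ and $V_\varepsilon(x)=0$ if $x\notin\Sigma_\varepsilon$, and let $H_\varepsilon=A_0+V_\varepsilon$ with $\mathrm{dom}\,H_\varepsilon=\mathrm{dom}\,A_0$. Define $\alpha\in L^\infty(\Sigma)$ by $\alpha(x_\Sigma)=\int_{-\beta}^\beta V(x_\Sigma+t\nu(x_\Sigma))\,dt$. Then for every $\lambda\in\mathbb C\setminus\mathbb R$ there is $c>0$ (depending on $\lambda$) such that $$\big\|(H_\varepsilon-\lambda)^{-1}-(A_\alpha-\lambda)^{-1}\big\|\le c\sqrt\varepsilon\quad\text{for all }\varepsilon\in(0,\beta);$$ in particular $H_\varepsilon\to A_\alpha$ in the norm resolvent sense as $\varepsilon\to0$.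
   Context: Fix $B>0$, $\mathbf{A}(x)=\tfrac{B}{2}(-x_2,x_1)^\top$, $\nabla_{\mathbf A}:=i\nabla+\mathbf{A}$. The Landau Hamiltonian $A_0$ is the self-adjoint operator in $L^2(\mathbb{R}^2)$ associated with the form $(\nabla_{\mathbf A}f,\nabla_{\mathbf A}g)_{L^2(\mathbb R^2;\mathbb C^2)}$ on $\mathcal H^1_{\mathbf A}(\mathbb R^2)=\{f\in L^2:|\nabla_{\mathbf A}f|\in L^2\}$, with $\mathrm{dom}\,A_0=\{f\in\mathcal H^1_{\mathbf A}(\mathbb R^2):\nabla_{\mathbf A}^2f\in L^2\}$. Let $\Omega_{\rm i}$ be a bounded simply connected $C^{1,1}$-domain in $\mathbb R^2$, so $\Sigma=\partial\Omega_{\rm i}$ is a closed regular $C^{1,1}$-curve without self-intersections; $\Omega_{\rm e}=\mathbb{R}^2\setminus\overline{\Omega_{\rm i}}$, $\nu$ the outward unit normal of $\Omega_{\rm i}$. For $\varepsilon>0$ let $\Sigma_\varepsilon=\{x_\Sigma+t\nu(x_\Sigma):x_\Sigma\in\Sigma,\ t\in(-\varepsilon,\varepsilon)\}$, and let $\beta>0$ be such that $\Sigma\times(-\varepsilon,\varepsilon)\ni(x_\Sigma,t)\mapsto x_\Sigma+t\nu(x_\Sigma)\in\Sigma_\varepsilon$ is bijective for all $\varepsilon\in(0,\beta)$. Let $\mathcal D_{\rm i}=\{f\in H^{3/2}(\Omega_{\rm i}):\Delta f\in L^2(\Omega_{\rm i})\}$ and, for a fixed bounded open $K\supset\overline{\Omega_{\rm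 i}}$, $\mathcal D_{\rm e}=\{f\in L^2(\Omega_{\rm e}): |\nabla_{\mathbf A} f|,\nabla_{\mathbf A}^2f\in L^2(\Omega_{\rm e}),\ f|_{K\cap\Omega_{\rm e}}\in H^{3/2},\ \Delta f\in L^2(K\cap\Omega_{\rm e})\}$. For real $\alpha\in L^\infty(\Sigma)$, $A_\alpha f=\nabla_{\mathbf A}^2f_{\rm i}\oplus\nabla_{\mathbf A}^2f_{\rm e}$ on $\mathrm{dom}\,A_\alpha=\{f_{\rm i}\oplus f_{\rm e}\in\mathcal D_{\rm i}\oplus\mathcal D_{\rm e}: f_{\rm i}|_\Sigma=f_{\rm e}|_\Sigma,\ \partial_\nu f_{\rm e}|_\Sigma-\partial_\nu f_{\rm i}|_\Sigma=\alpha f|_\Sigma\}$, a self-adjoint operator. *)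

theory Defs
  imports "HOL-Analysis.Analysis"
begin

type_synonym R2 = "real^2"

definition pd :: "2 \<Rightarrow> (R2 \<Rightarrow> complex) \<Rightarrow> R2 \<Rightarrow> complex" where
  "pd j \<phi> x = frechet_derivative \<phi> (at x) (axis j 1)"

inductive_set derivs :: "(R2 \<Rightarrow> complex) \<Rightarrow> (R2 \<Rightarrow> complex) set" for \<phi> where
  base: "\<phi> \<in> derivs \<phi>"
| step: "g \<in> derivs \<phi> \<Longrightarrow> pd j g \<in> derivs \<phi>"

definition smooth_fun :: "(R2 \<Rightarrow> complex) \<Rightarrow> bool" where
  "smooth_fun \<phi> \<longleftrightarrow> (\<forall>g\<in>derivs \<phi>. \<forall>x. g differentiable (at x))"

definition test_fun :: "R2 set \<Rightarrow> (R2 \<Rightarrow> complex) \<Rightarrow> bool" where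
  "test_fun U \<phi> \<longleftrightarrow> smooth_fun \<phi> \<and> compact (closure {x. \<phi> x \<noteq> 0})
      \<and> closure {x. \<phi> x \<noteq> 0} \<subseteq> U"

definition lap :: "(R2 \<Rightarrow> complex) \<Rightarrow> R2 \<Rightarrow> complex" where
  "lap \<phi> x = (\<Sum>j\<in>UNIV. pd j (pd j \<phi>) x)"

definition Amag :: "real \<Rightarrow> 2 \<Rightarrow> R2 \<Rightarrow> real" where
  "Amag B j x = (if j = 1 then - (B/2) * x$2 else (B/2) * x$1)"

definition MG :: "real \<Rightarrow> 2 \<Rightarrow> (R2 \<Rightarrow> complex) \<Rightarrow> R2 \<Rightarrow> complex" where
  "MG B j \<phi> x = \<i> * pd j \<phi> x + complex_of_real (Amag B j x) * \<phi> x"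

definition mlap :: "real \<Rightarrow> (R2 \<Rightarrow> complex) \<Rightarrow> R2 \<Rightarrow> complex" where
  "mlap B \<phi> x = (\<Sum>j\<in>UNIV. MG B j (MG B j \<phi>) x)"

definition L2 :: "R2 set \<Rightarrow> (R2 \<Rightarrow> complex) \<Rightarrow> bool" where
  "L2 U f \<longleftrightarrow> f \<in> borel_measurable lebesgue
      \<and> set_integrable lebesgue U (\<lambda>x. (cmod (f x))\<^sup>2)"

definition norm2 :: "(R2 \<Rightarrow> complex) \<Rightarrow> real" where
  "norm2 f = sqrt (LINT x|lebesgue. (cmod (f x))\<^sup>2)"

definition ip :: "R2 set \<Rightarrow> (R2 \<Rightarrow> complex) \<Rightarrow> (R2 \<Rightarrow> complex) \<Rightarrow> complex" where
  "ip U f g = (LINT x:U|lebesgue. f x * cnj (g x))"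

definition weak_grad :: "R2 set \<Rightarrow> (R2 \<Rightarrow> complex) \<Rightarrow> (R2 \<Rightarrow> complex^2) \<Rightarrow> bool" where
  "weak_grad U f g \<longleftrightarrow> (\<forall>\<phi> j. test_fun U \<phi> \<longrightarrow>
      ip U (\<lambda>x. g x $ j) \<phi> = - ip U f (pd j \<phi>))"

definition weak_lap :: "R2 set \<Rightarrow> (R2 \<Rightarrow> complex) \<Rightarrow> (R2 \<Rightarrow> complex) \<Rightarrow> bool" where
  "weak_lap U f h \<longleftrightarrow> (\<forall>\<phi>. test_fun U \<phi> \<longrightarrow> ip U h \<phi> = ip U f (lap \<phi>))"

text \<open>g is the weak magnetic gradient (i\<nabla>+A) f on U (the operator is formally symmetric).\<close>
definition weak_mgrad :: "real \<Rightarrow> R2 set \<Rightarrow> (R2 \<Rightarrow> complex) \<Rightarrow> (R2 \<Rightarrow> complex^2) \<Rightarrow> bool" where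
  "weak_mgrad B U f g \<longleftrightarrow> (\<forall>\<phi> j. test_fun U \<phi> \<longrightarrow>
      ip U (\<lambda>x. g x $ j) \<phi> = ip U f (MG B j \<phi>))"

definition weak_mlap :: "real \<Rightarrow> R2 set \<Rightarrow> (R2 \<Rightarrow> complex) \<Rightarrow> (R2 \<Rightarrow> complex) \<Rightarrow> bool" where
  "weak_mlap B U f h \<longleftrightarrow> (\<forall>\<phi>. test_fun U \<phi> \<longrightarrow> ip U h \<phi> = ip U f (mlap B \<phi>))"

definition L2v :: "R2 set \<Rightarrow> (R2 \<Rightarrow> complex^2) \<Rightarrow> bool" where
  "L2v U g \<longleftrightarrow> (\<forall>j. L2 U (\<lambda>x. g x $ j))"

definition H1 :: "R2 set \<Rightarrow> (R2 \<Rightarrow> complex) \<Rightarrow> bool" where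
  "H1 U f \<longleftrightarrow> L2 U f \<and> (\<exists>g. weak_grad U f g \<and> L2v U g)"

text \<open>Sobolev(-Slobodeckij) space H^{3/2}(U): f in H^1(U) with gradient in H^{1/2}(U).\<close>
definition H32 :: "R2 set \<Rightarrow> (R2 \<Rightarrow> complex) \<Rightarrow> bool" where
  "H32 U f \<longleftrightarrow> L2 U f \<and> (\<exists>g. weak_grad U f g \<and> L2v U g \<and>
     (\<forall>j. (\<integral>\<^sup>+ p. indicator (U \<times> U) p *
            ennreal ((cmod (g (fst p) $ j - g (snd p) $ j))\<^sup>2 / (dist (fst p) (snd p)) ^ 3)
          \<partial>(lebesgue \<Otimes>\<^sub>M lebesgue)) < \<infinity>))"

definition H1A :: "real \<Rightarrow> R2 set \<Rightarrow> (R2 \<Rightarrow> complex) \<Rightarrow> bool" where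
  "H1A B U f \<longleftrightarrow> L2 U f \<and> (\<exists>g. weak_mgrad B U f g \<and> L2v U g)"

definition C11_domain :: "R2 set \<Rightarrow> (real \<Rightarrow> R2) \<Rightarrow> real \<Rightarrow> bool" where
  "C11_domain Oi \<gamma> L \<longleftrightarrow> open Oi \<and> bounded Oi \<and> connected Oi \<and> simply_connected Oi
     \<and> L > 0 \<and> (\<forall>s. \<gamma> (s + L) = \<gamma> s) \<and> inj_on \<gamma> {0..<L}
     \<and> (\<forall>s. \<gamma> differentiable (at s))
     \<and> (\<forall>s. norm (vector_derivative \<gamma> (at s)) = 1)
     \<and> (\<exists>M. \<forall>s t. norm (vector_derivative \<gamma> (at s) - vector_derivative \<gamma> (at t)) \<le> M * \<bar>s - t\<bar>)
     \<and> frontier Oi = \<gamma> ` {0..L}"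

definition outward_normal :: "R2 set \<Rightarrow> (real \<Rightarrow> R2) \<Rightarrow> real \<Rightarrow> (R2 \<Rightarrow> R2) \<Rightarrow> bool" where
  "outward_normal Oi \<gamma> L \<nu> \<longleftrightarrow> (\<forall>s. norm (\<nu> (\<gamma> s)) = 1
     \<and> \<nu> (\<gamma> s) \<bullet> vector_derivative \<gamma> (at s) = 0
     \<and> (\<exists>d>0. \<forall>t. 0 < t \<and> t < d \<longrightarrow> \<gamma> s + t *\<^sub>R \<nu> (\<gamma> s) \<notin> closure Oi))"

definition tube :: "R2 set \<Rightarrow> (R2 \<Rightarrow> R2) \<Rightarrow> real \<Rightarrow> R2 set" where
  "tube S \<nu> e = {xs + t *\<^sub>R \<nu> xs | xs t. xs \<in> S \<and> \<bar>t\<bar> < e}"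

definition V_eps :: "R2 set \<Rightarrow> (R2 \<Rightarrow> R2) \<Rightarrow> real \<Rightarrow> (R2 \<Rightarrow> real) \<Rightarrow> real \<Rightarrow> R2 \<Rightarrow> real" where
  "V_eps S \<nu> \<beta> V e x =
     (if x \<in> tube S \<nu> e then
        (let p = (THE p. fst p \<in> S \<and> \<bar>snd p\<bar> < e \<and> x = fst p + snd p *\<^sub>R \<nu> (fst p))
         in (\<beta> / e) * V (fst p + ((\<beta> / e) * snd p) *\<^sub>R \<nu> (fst p)))
      else 0)"

definition alpha_of :: "(R2 \<Rightarrow> R2) \<Rightarrow> real \<Rightarrow> (R2 \<Rightarrow> real) \<Rightarrow> R2 \<Rightarrow> real" where
  "alpha_of \<nu> \<beta> V xs = (LBINT t=ereal (-\<beta>)..ereal \<beta>. V (xs + t *\<^sub>R \<nu> xs))"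

section \<open>Traces on Sigma (defined through Green's formula)\<close>

definition L2_Sigma :: "(real \<Rightarrow> R2) \<Rightarrow> real \<Rightarrow> (R2 \<Rightarrow> complex) \<Rightarrow> bool" where
  "L2_Sigma \<gamma> L h \<longleftrightarrow> (\<lambda>s. h (\<gamma> s)) \<in> borel_measurable lborel
     \<and> set_integrable lborel {0..L} (\<lambda>s. (cmod (h (\<gamma> s)))\<^sup>2)"

text \<open>h is the (Dirichlet) trace on Sigma of f from the side U; sg = 1 if nu points out of U,
  sg = -1 if it points into U; test functions supported in W.\<close>
definition is_trace :: "(real \<Rightarrow> R2) \<Rightarrow> real \<Rightarrow> (R2 \<Rightarrow> R2) \<Rightarrow> R2 set \<Rightarrow> R2 set \<Rightarrow> real
    \<Rightarrow> (R2 \<Rightarrow> complex) \<Rightarrow> (R2 \<Rightarrow> complex) \<Rightarrow> bool" where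
  "is_trace \<gamma> L \<nu> U W sg f h \<longleftrightarrow> L2_Sigma \<gamma> L h \<and> (\<exists>g. weak_grad U f g \<and> L2v U g \<and>
     (\<forall>\<phi> j. test_fun W \<phi> \<longrightarrow>
        ip U (\<lambda>x. g x $ j) \<phi> + ip U f (pd j \<phi>)
        = complex_of_real sg * (LINT s:{0..L}|lborel.
              h (\<gamma> s) * cnj (\<phi> (\<gamma> s)) * complex_of_real (\<nu> (\<gamma> s) $ j))))"

text \<open>h is the normal derivative (with respect to nu) on Sigma of f from the side U.\<close>
definition is_normal_deriv :: "(real \<Rightarrow> R2) \<Rightarrow> real \<Rightarrow> R2 set \<Rightarrow> R2 set \<Rightarrow> real
    \<Rightarrow> (R2 \<Rightarrow> complex) \<Rightarrow> (R2 \<Rightarrow> complex) \<Rightarrow> bool" where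
  "is_normal_deriv \<gamma> L U W sg f h \<longleftrightarrow> L2_Sigma \<gamma> L h \<and> (\<exists>g d. weak_grad U f g \<and> L2v U g
     \<and> weak_lap U f d \<and> L2 U d \<and>
     (\<forall>\<phi>. test_fun W \<phi> \<longrightarrow>
        ip U d \<phi> + (\<Sum>j\<in>UNIV. ip U (\<lambda>x. g x $ j) (pd j \<phi>))
        = complex_of_real sg * (LINT s:{0..L}|lborel. h (\<gamma> s) * cnj (\<phi> (\<gamma> s)))))"

text \<open>u \<in> dom A_0 and (A_0 + V_eps - lam) u = f.\<close>
definition resolvent_eq_H :: "real \<Rightarrow> (R2 \<Rightarrow> real) \<Rightarrow> complex \<Rightarrow> (R2 \<Rightarrow> complex)
    \<Rightarrow> (R2 \<Rightarrow> complex) \<Rightarrow> bool" where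
  "resolvent_eq_H B W lam f u \<longleftrightarrow> H1A B UNIV u \<and> (\<exists>h. weak_mlap B UNIV u h \<and> L2 UNIV h)
     \<and> weak_mlap B UNIV u (\<lambda>x. f x + lam * u x - complex_of_real (W x) * u x)"

text \<open>u \<in> dom A_alpha and (A_alpha - lam) u = f.\<close>
definition resolvent_eq_A :: "real \<Rightarrow> R2 set \<Rightarrow> R2 set \<Rightarrow> (real \<Rightarrow> R2) \<Rightarrow> real \<Rightarrow> (R2 \<Rightarrow> R2)
    \<Rightarrow> (R2 \<Rightarrow> real) \<Rightarrow> complex \<Rightarrow> (R2 \<Rightarrow> complex) \<Rightarrow> (R2 \<Rightarrow> complex) \<Rightarrow> bool" where
  "resolvent_eq_A B Oi K \<gamma> L \<nu> \<alpha> lam f u \<longleftrightarrow>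
    (let Oe = - closure Oi in
      \<comment> \<open>interior part in D_i\<close>
      H32 Oi u \<and> (\<exists>d. weak_lap Oi u d \<and> L2 Oi d)
      \<comment> \<open>exterior part in D_e\<close>
      \<and> H1A B Oe u \<and> (\<exists>h. weak_mlap B Oe u h \<and> L2 Oe h)
      \<and> H32 (K \<inter> Oe) u \<and> (\<exists>d. weak_lap (K \<inter> Oe) u d \<and> L2 (K \<inter> Oe) d)
      \<comment> \<open>transmission conditions\<close>
      \<and> (\<exists>ti te ni ne.
           is_trace \<gamma> L \<nu> Oi UNIV 1 u ti \<and> is_trace \<gamma> L \<nu> (K \<inter> Oe) K (-1) u te
         \<and> is_normal_deriv \<gamma> L Oi UNIV 1 u ni \<and> is_normal_deriv \<gamma> L (K \<inter> Oe) K (-1) u ne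
         \<and> (AE s in lborel. s \<in> {0..L} \<longrightarrow> ti (\<gamma> s) = te (\<gamma> s))
         \<and> (AE s in lborel. s \<in> {0..L} \<longrightarrow>
              ne (\<gamma> s) - ni (\<gamma> s) = complex_of_real (\<alpha> (\<gamma> s)) * ti (\<gamma> s)))
      \<comment> \<open>the equation (A_alpha - lam) u = f, piecewise\<close>
      \<and> weak_mlap B Oi u (\<lambda>x. f x + lam * u x)
      \<and> weak_mlap B Oe u (\<lambda>x. f x + lam * u x))"

end

theory Submission
  imports Defs
begin

text \<open>Both resolvent equations are put into weak form. For \<open>u = (A\<^sub>\<alpha> - \<lambda>)\<^sup>-\<^sup>1 f\<close> the two
  one-sided Green identities glue to an identity on the whole plane in which the jump condition becomes
  the boundary form \<open>\<integral>\<^sub>\<Sigma> \<alpha> u cnj \<psi>\<close>; for \<open>u\<^sub>\<epsilon> = (H\<^sub>\<epsilon> - \<lambda>)\<^sup>-\<^sup>1 f\<close> it is replaced by \<open>\<integral> V\<^sub>\<epsilon> u\<^sub>\<epsilon> cnj \<psi>\<close>.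
  In tubular coordinates, with Jacobian \<open>1 + O(\<epsilon>)\<close>, the two forms differ on \<open>H\<^sup>1\<close> by \<open>O(\<surd>\<epsilon>)\<close>: along each
  normal segment a function moves by at most \<open>\<surd>\<epsilon>\<close> times the \<open>L\<^sup>2\<close> norm of its derivative, while the mass of
  \<open>V\<^sub>\<epsilon>\<close> on the segment is \<open>\<alpha>\<close>. Testing the difference of the weak equations with \<open>u\<^sub>\<epsilon> - u\<close> itself,
  the imaginary part controls the \<open>L\<^sup>2\<close> norm and the real part the energy. Absorption then gives
  \<open>\<parallel>u\<^sub>\<epsilon> - u\<parallel>\<^sub>H\<^sub>1 = O(\<surd>\<epsilon>) \<parallel>u\<parallel>\<^sub>H\<^sub>1\<close>, and the same argument bounds the \<open>H\<^sup>1\<close> norm of \<open>u\<close> by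
  the norm of \<open>f\<close>.\<close>

subsection \<open>Smooth functions\<close>

text \<open>Neither \<open>u\<close> nor the coordinates are smooth. The normal is only Lipschitz,
  so \<Phi> has no classical Jacobian; instead \<Phi> is a near isometry on pieces of size
  \<epsilon>, and Lipschitz bounds for \<Phi> and its inverse compare measures up to the factors (1
  + 2M\<epsilon>)^2 and (1 - 2M\<epsilon>)^2. Boundary values of \<open>u\<close> are known only
  through Green's formula, as an L2 function paired with the components of the normal. Estimates are
  therefore proved for test functions and carried over along sequences converging in the form norm,
  and the boundary form is kept as the limit of the forms of such a sequence. That this limit is the
  form of the given trace rests on a divergence theorem for the C^{1,1} domain, on density of
  restrictions of test functions in L2 of the curve, and on n_1^2 + n_2^2 = 1. The a priori bound of
  \<open>u\<close> compares the boundary form with \<open>W\<close> at one fixed small width, so the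
  bound for the potentials serves for \<alpha> as well. The tubular estimates hold for widths up to
  a threshold \<open>e0\<close>; above it the two resolvents are bounded separately and the factor
  \<epsilon> is paid for by 1 / \<open>e0\<close>.\<close>

lemma smooth_fun_coinduct:
 assumes "\<phi> \<in> C" "\<And>g x. g \<in> C ==> g differentiable (at x)" "\<And>g j. g \<in> C ==> pd j g \<in> C"
 shows "smooth_fun \<phi>"
proof -
 have "g \<in> C" if "g \<in> derivs \<phi>" for g using that by induct (auto simp: assms)
 then show ?thesis unfolding smooth_fun_def using assms(2) by blast
qed

lemma smooth_fun_differentiable: "smooth_fun \<phi> ==> \<phi> differentiable (at x)"
 unfolding smooth_fun_def using derivs.base by blast

lemma derivs_pd: "g \<in> derivs (pd j \<phi>) ==> g \<in> derivs \<phi>" by (induct rule: derivs.induct) (auto intro: derivs.intros)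

lemma smooth_fun_pd: "smooth_fun \<phi> ==> smooth_fun (pd j \<phi>)" unfolding smooth_fun_def using derivs_pd by blast

lemma smooth_fun_continuous_on: "smooth_fun \<phi> ==> continuous_on S \<phi>"
 by (meson continuous_at_imp_continuous_on differentiable_imp_continuous_within
   smooth_fun_differentiable)

lemma pd_eqI: "(\<phi> has_derivative D) (at x) ==> pd j \<phi> x = D (axis j 1)"
 unfolding pd_def by (metis frechet_derivative_at)

lemma has_derivative_pd:
 assumes "\<phi> differentiable (at x)"
 shows "(\<phi> has_derivative (\<lambda>h. \<Sum>j\<in>UNIV. of_real (h $ j) * pd j \<phi> x)) (at x)"
proof -
 let ?D = "frechet_derivative \<phi> (at x)"
 have D: "(\<phi> has_derivative ?D) (at x)" using assms frechet_derivative_works by blast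
 then have lin: "linear ?D" by (simp add: has_derivative_linear)
 have "?D h = (\<Sum>j\<in>UNIV. of_real (h $ j) * pd j \<phi> x)" for h
 proof -
  have "h = (\<Sum>j\<in>UNIV. (h $ j) *\<^sub>R axis j 1)"
   using basis_expansion[of h] by (simp add: scalar_mult_eq_scaleR del: scaleR_conv_of_real)
  then have "?D h = (\<Sum>j\<in>UNIV. ?D ((h $ j) *\<^sub>R axis j 1))" using linear_sum[OF lin] by metis
  then show ?thesis by (simp only: linear_scale[OF lin] pd_def) (simp add: scaleR_conv_of_real)
 qed
 then show ?thesis using D by presburger
qed

lemma pd_const: "pd j (\<lambda>x. c) = (\<lambda>x. 0)"
 by (rule ext, subst pd_eqI[where D="\<lambda>h. 0"]) (auto intro!: derivative_eq_intros)

lemma pd_coord: "pd j (\<lambda>x. of_real (x $ k)) = (\<lambda>x. if j = k then 1 else 0)"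
proof
 fix x
 have "bounded_linear (\<lambda>x::R2. of_real (x $ k) :: complex)"
  by (intro bounded_linear_compose[OF bounded_linear_of_real] bounded_linear_vec_nth)
 then have "((\<lambda>x::R2. of_real (x $ k) :: complex) has_derivative (\<lambda>h. of_real (h $ k))) (at x)"
  by (rule bounded_linear_imp_has_derivative)
 from pd_eqI[OF this, of j] show "pd j (\<lambda>x. of_real (x $ k)) x = (if j = k then 1 else 0)" by (simp add: axis_def)
qed

lemma pd_add:
 assumes "f differentiable (at x)" "g differentiable (at x)"
 shows "pd j (\<lambda>x. f x + g x) x = pd j f x + pd j g x"
 by (subst pd_eqI[OF has_derivative_add[OF assms[unfolded frechet_derivative_works]]]) (simp add: pd_def)

lemma pd_mult:
 assumes "f differentiable (at x)" "g differentiable (at x)"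
 shows "pd j (\<lambda>x. f x * g x) x = f x * pd j g x + pd j f x * g x"
 by (subst pd_eqI[OF has_derivative_mult[OF assms[unfolded frechet_derivative_works]]]) (simp add: pd_def)

lemma pd_cmult:
 assumes "f differentiable (at x)"
 shows "pd j (\<lambda>x. c * f x) x = c * pd j f x" using pd_mult[of "\<lambda>x. c" x f j] assms by (simp add: pd_const)

lemma pd_cnj:
 assumes "f differentiable (at x)"
 shows "pd j (\<lambda>x. cnj (f x)) x = cnj (pd j f x)"
 by (subst pd_eqI[OF bounded_linear.has_derivative[OF bounded_linear_cnj
    assms[unfolded frechet_derivative_works]]]) (simp add: pd_def)

text \<open>By the Leibniz rule the hull is closed under \<open>pd\<close> as soon as the
  derivatives of its generators lie in it. This serves families whose derivatives are not members
  themselves but products of members with other smooth functions.\<close>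

inductive_set alg_hull :: "(R2 => complex) set => (R2 => complex) set" for S where
 gen: "g \<in> S ==> g \<in> alg_hull S"
| add: "f \<in> alg_hull S ==> g \<in> alg_hull S ==> (\<lambda>x. f x + g x) \<in> alg_hull S"
| mult: "f \<in> alg_hull S ==> g \<in> alg_hull S ==> (\<lambda>x. f x * g x) \<in> alg_hull S"

lemma smooth_fun_alg_hull:
 assumes d: "\<And>g x. g \<in> S ==> g differentiable (at x)"
  and p: "\<And>g j. g \<in> S ==> pd j g \<in> alg_hull S"
  and "f \<in> alg_hull S"
 shows "smooth_fun f"
proof (rule smooth_fun_coinduct[OF assms(3)])
 show diff: "g differentiable (at x)" if "g \<in> alg_hull S" for g x
  using that by induct (auto intro: d differentiable_add differentiable_mult)
 show "pd j g \<in> alg_hull S" if "g \<in> alg_hull S" for g j using that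
 proof induct
  case (add f g)
  have "pd j (\<lambda>x. f x + g x) = (\<lambda>x. pd j f x + pd j g x)" using add diff pd_add by fast
  then show ?case using add by (auto intro: alg_hull.intros)
 next
  case (mult f g)
  have "pd j (\<lambda>x. f x * g x) = (\<lambda>x. f x * pd j g x + pd j f x * g x)" using mult diff pd_mult by fast
  then show ?case using mult by (auto intro: alg_hull.intros)
 qed (rule p)
qed

lemma
 assumes "smooth_fun f" "smooth_fun g"
 shows smooth_fun_add: "smooth_fun (\<lambda>x. f x + g x)"
  and smooth_fun_mult: "smooth_fun (\<lambda>x. f x * g x)"
proof -
 have hull: "f \<in> alg_hull (Collect smooth_fun)" "g \<in> alg_hull (Collect smooth_fun)"
  using assms by (auto intro: alg_hull.gen)
 have "smooth_fun h" if "h \<in> alg_hull (Collect smooth_fun)" for h using that by (rule smooth_fun_alg_hull[rotated 2])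
   (simp_all add: smooth_fun_differentiable alg_hull.gen smooth_fun_pd)
 then show "smooth_fun (\<lambda>x. f x + g x)" "smooth_fun (\<lambda>x. f x * g x)"
  using alg_hull.add[OF hull] alg_hull.mult[OF hull] by blast+
qed

lemma smooth_fun_const: "smooth_fun (\<lambda>x. c)"
 by (rule smooth_fun_coinduct[of _ "range (\<lambda>c x. c)"]) (auto simp: pd_const)

lemma smooth_fun_coord: "smooth_fun (\<lambda>x. of_real (x $ k))"
proof (rule smooth_fun_coinduct[of _ "insert (\<lambda>x. of_real (x $ k)) (range (\<lambda>c x. c))"])
 have "bounded_linear (\<lambda>x::R2. of_real (x $ k) :: complex)"
  by (intro bounded_linear_compose[OF bounded_linear_of_real] bounded_linear_vec_nth)
 then show "g differentiable at x"
  if "g \<in> insert (\<lambda>x. of_real (x $ k)) (range (\<lambda>c x. c))" for g :: "R2 => complex" and x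
  using that bounded_linear_imp_differentiable by auto
qed (auto simp: pd_coord pd_const)

lemma smooth_fun_cnj:
 assumes "smooth_fun f"
 shows "smooth_fun (\<lambda>x. cnj (f x))"
proof (rule smooth_fun_coinduct[of _ "(\<lambda>g x. cnj (g x)) ` Collect smooth_fun"])
 fix g x assume "g \<in> (\<lambda>g x. cnj (g x)) ` Collect smooth_fun"
 then obtain h where h: "smooth_fun h" "g = (\<lambda>x. cnj (h x))" by auto
 show "g differentiable (at x)" unfolding h(2) using smooth_fun_differentiable[OF h(1)]
  unfolding differentiable_def using bounded_linear.has_derivative[OF bounded_linear_cnj] by blast
 fix j
 show "pd j g \<in> (\<lambda>g x. cnj (g x)) ` Collect smooth_fun"
  unfolding h(2) using pd_cnj[OF smooth_fun_differentiable[OF h(1)]] smooth_fun_pd[OF h(1)] by fastforce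
qed (use assms in auto)

section \<open>The standard bump function and its derivatives\<close>

definition bump_exp :: "real poly => real => real" where
 "bump_exp p t = (if t > 0 then poly p (1/t) * exp (- 1/t) else 0)"

lemma poly_exp_tendsto_0: "((\<lambda>y::real. poly p y * exp (- y)) \<longlongrightarrow> 0) at_top"
proof -
 have "((\<lambda>y::real. \<Sum>i\<le>degree p. coeff p i * (y ^ i / exp y)) \<longlongrightarrow> (\<Sum>i\<le>degree p. coeff p i * 0)) at_top"
  by (intro tendsto_intros tendsto_power_div_exp_0)
 then show ?thesis by (simp add: poly_altdef exp_minus sum_distrib_right divide_inverse mult.assoc)
qed

text \<open>With y = 1/t the derivative of p(y) exp(-y) in t is y^2 (p(y) - p'(y)) exp(-y). The
  family indexed by polynomials is therefore closed under differentiation; \<open>[:0,0,1:]\<close>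
  is the polynomial X^2.\<close>

lemma bump_exp_has_derivative:
 "(bump_exp p has_real_derivative bump_exp ([:0,0,1:] * (p - pderiv p)) t) (at t)"
proof -
 consider "t > 0" | "t < 0" | "t = 0" by linarith
 then show ?thesis
 proof cases
  case 1
  have "((\<lambda>t. poly p (1/t) * exp (- 1/t)) has_real_derivative
    bump_exp ([:0,0,1:] * (p - pderiv p)) t) (at t)"
   using 1 by (auto intro!: derivative_eq_intros simp: bump_exp_def field_simps power2_eq_square)
  moreover have "\<forall>\<^sub>F s in nhds t. bump_exp p s = poly p (1/s) * exp (- 1/s)"
   using 1 by (intro eventually_mono[OF eventually_nhds_in_open[of "{0<..}"]]) (auto simp: bump_exp_def)
  ultimately show ?thesis using 1 by (subst DERIV_cong_ev[OF refl _ refl]) auto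
 next
  case 2
  have "\<forall>\<^sub>F s in nhds t. bump_exp p s = 0"
   using 2 by (intro eventually_mono[OF eventually_nhds_in_open[of "{..<0}"]]) (auto simp: bump_exp_def)
  then show ?thesis using 2 by (subst DERIV_cong_ev[OF refl _ refl]) (auto simp: bump_exp_def)
 next
  case 3
  \<comment> \<open>At 0 the right difference quotient equals y p(y) exp(-y) with y = 1/h, and
    \<open>pCons 0 p\<close> is the polynomial X p; exponential decay beats it.\<close>
  have "((\<lambda>h. poly (pCons 0 p) (inverse h) * exp (- inverse h)) \<longlongrightarrow> 0) (at_right 0)"
   by (rule filterlim_compose[OF poly_exp_tendsto_0 filterlim_inverse_at_top_right])
  then have "((\<lambda>h. (bump_exp p h - bump_exp p 0) / (h - 0)) \<longlongrightarrow> 0) (at_right 0)" by (rule Lim_transform_eventually)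
    (auto simp: bump_exp_def eventually_at_filter field_simps)
  moreover have "((\<lambda>h. (bump_exp p h - bump_exp p 0) / (h - 0)) \<longlongrightarrow> 0) (at_left 0)"
   by (rule Lim_transform_eventually[OF tendsto_const]) (auto simp: bump_exp_def eventually_at_filter)
  ultimately have "((\<lambda>h. (bump_exp p h - bump_exp p 0) / (h - 0)) \<longlongrightarrow> 0) (at 0)" using filterlim_split_at by blast
  then show ?thesis using 3 by (simp add: has_field_derivative_iff bump_exp_def)
 qed
qed

definition bump :: "real poly => R2 => real => R2 => complex" where
 "bump p a d x = of_real (bump_exp p (d\<^sup>2 - (x - a) \<bullet> (x - a)))"

lemma bump_has_derivative:
 "(bump p a d has_derivative
   (\<lambda>h. of_real (bump_exp ([:0,0,1:] * (p - pderiv p)) (d\<^sup>2 - (x - a) \<bullet> (x - a)) * (- 2 * ((x - a) \<bullet> h))))) (at x)"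
proof -
 have "((\<lambda>x. d\<^sup>2 - (x - a) \<bullet> (x - a)) has_derivative (\<lambda>h. - 2 * ((x - a) \<bullet> h))) (at x)"
  by (auto intro!: derivative_eq_intros simp: inner_commute)
 from has_derivative_compose[OF this bump_exp_has_derivative[unfolded has_field_derivative_def]]
 show ?thesis unfolding bump_def by (intro bounded_linear.has_derivative[OF bounded_linear_of_real])
qed

text \<open>Differentiation turns a radial bump into another member of the family times the smooth
  factor -2 (x_j - a_j). The hull is therefore generated by all bumps with this centre and radius
  together with all smooth functions.\<close>

lemma smooth_fun_bump: "smooth_fun (bump p a d)"
proof (rule smooth_fun_alg_hull[where S = "Collect smooth_fun \<union> (\<Union>q. {bump q a d})"])
 fix g x j assume g: "g \<in> Collect smooth_fun \<union> (\<Union>q. {bump q a d})"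
 show "g differentiable (at x)" using g bump_has_derivative smooth_fun_differentiable differentiable_def by blast
 show "pd j g \<in> alg_hull (Collect smooth_fun \<union> (\<Union>q. {bump q a d}))"
 proof (cases "smooth_fun g")
  case False
  then obtain q where q: "g = bump q a d" using g by auto
  let ?S = "Collect smooth_fun \<union> (\<Union>q. {bump q a d})"
  have eq: "pd j g = (\<lambda>x. bump ([:0,0,1:] * (q - pderiv q)) a d x * (- 2 * (of_real (x $ j) + of_real (- (a $ j)))))"
   unfolding q by (rule ext, subst pd_eqI[OF bump_has_derivative]) (simp add: bump_def inner_axis algebra_simps)
  have "smooth_fun (\<lambda>x. - 2 * (of_real (x $ j) + of_real (- (a $ j))))"
   by (intro smooth_fun_mult smooth_fun_add smooth_fun_const smooth_fun_coord)
  then have 1: "(\<lambda>x. - 2 * (of_real (x $ j) + of_real (- (a $ j)))) \<in> ?S" by blast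
  have 2: "bump ([:0,0,1:] * (q - pderiv q)) a d \<in> ?S" by blast
  show ?thesis unfolding eq by (rule alg_hull.mult[OF alg_hull.gen[OF 2] alg_hull.gen[OF 1]])
 qed (auto intro: alg_hull.gen smooth_fun_pd)
qed (auto intro: alg_hull.gen)

subsection \<open>Test functions\<close>

lemma test_funI:
 assumes "smooth_fun \<phi>" "\<And>x. \<phi> x \<noteq> 0 ==> x \<in> C" "compact C" "C \<subseteq> U"
 shows "test_fun U \<phi>"
proof -
 have "closure {x. \<phi> x \<noteq> 0} \<subseteq> C" using assms by (intro closure_minimal) (auto intro: compact_imp_closed)
 then show ?thesis unfolding test_fun_def using assms by (meson closed_closure compact_closure bounded_subset
   compact_imp_bounded subset_trans compact_eq_bounded_closed)
qed

lemma test_fun_smooth: "test_fun U \<phi> ==> smooth_fun \<phi>" by (simp add: test_fun_def)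

lemma test_fun_mono: "test_fun U \<phi> ==> U \<subseteq> W ==> test_fun W \<phi>" by (auto simp: test_fun_def)

lemma test_fun_UNIV: "test_fun U \<phi> ==> test_fun UNIV \<phi>" by (auto simp: test_fun_def)

lemma test_fun_eq_0: "test_fun U \<phi> ==> x \<notin> U ==> \<phi> x = 0"
 using closure_subset[of "{x. \<phi> x \<noteq> 0}"] by (auto simp: test_fun_def)

lemma pd_eq_0:
 assumes "x \<notin> closure {x. \<phi> x \<noteq> 0}"
 shows "pd j \<phi> x = 0"
proof -
 have "(\<phi> has_derivative (\<lambda>h. 0)) (at x)"
 proof (rule has_derivative_transform_within_open[where s = "- closure {x. \<phi> x \<noteq> 0}"])
  show "((\<lambda>x. 0) has_derivative (\<lambda>h. 0)) (at x)" by simp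
  show "0 = \<phi> y" if "y \<in> - closure {x. \<phi> x \<noteq> 0}" for y using that closure_subset by force
 qed (use assms in auto)
 then show ?thesis by (subst pd_eqI) auto
qed

lemma test_fun_pd: "test_fun U \<phi> ==> test_fun U (pd j \<phi>)" by (rule test_funI[of _ "closure {x. \<phi> x \<noteq> 0}"])
  (use pd_eq_0 in \<open>auto simp: test_fun_def smooth_fun_pd\<close>)

lemma test_fun_mult1: "test_fun U \<phi> ==> smooth_fun f ==> test_fun U (\<lambda>x. f x * \<phi> x)"
 by (rule test_funI[of _ "closure {x. \<phi> x \<noteq> 0}"])
  (auto simp: test_fun_def smooth_fun_mult intro!: closure_subset[THEN subsetD])

lemma test_fun_mult2: "test_fun U \<phi> ==> smooth_fun f ==> test_fun U (\<lambda>x. \<phi> x * f x)"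
 using test_fun_mult1[of U \<phi> f] by (simp add: mult.commute)

lemma test_fun_cnj: "test_fun U \<phi> ==> test_fun U (\<lambda>x. cnj (\<phi> x))" by (auto simp: test_fun_def smooth_fun_cnj)

lemma test_fun_add: "test_fun U \<phi> ==> test_fun U \<psi> ==> test_fun U (\<lambda>x. \<phi> x + \<psi> x)"
 using closure_subset[of "{x. \<phi> x \<noteq> 0}"] closure_subset[of "{x. \<psi> x \<noteq> 0}"]
 by (intro test_funI[of _ "closure {x. \<phi> x \<noteq> 0} \<union> closure {x. \<psi> x \<noteq> 0}"])
  (auto simp: test_fun_def smooth_fun_add intro!: compact_Un, force)

lemma test_fun_cmult: "test_fun U \<phi> ==> test_fun U (\<lambda>x. c * \<phi> x)"
 by (rule test_fun_mult1) (auto simp: smooth_fun_const)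

lemma test_fun_sum: "finite I ==> (\<And>i. i \<in> I ==> test_fun U (\<phi> i)) ==> test_fun U (\<lambda>x. \<Sum>i\<in>I. \<phi> i x)"
proof (induction rule: finite_induct)
 case empty
 have "closure {x::R2. (0::complex) \<noteq> 0} = {}" by simp
 then show ?case by (simp add: test_fun_def smooth_fun_const)
qed (simp add: test_fun_add)

lemma smooth_fun_Amag: "smooth_fun (\<lambda>x. of_real (Amag B j x))"
proof -
 have "smooth_fun (\<lambda>x. of_real (- (B/2)) * of_real (x $ 2))" "smooth_fun (\<lambda>x. of_real (B/2) * of_real (x $ 1))"
  by (intro smooth_fun_mult smooth_fun_const smooth_fun_coord)+
 then show ?thesis unfolding Amag_def by (cases "j = 1") auto
qed

lemma test_fun_Amag: "test_fun U \<phi> ==> test_fun U (\<lambda>x. of_real (Amag B j x) * \<phi> x)"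
 by (simp add: smooth_fun_Amag test_fun_mult1)

lemma test_fun_MG: "test_fun U \<phi> ==> test_fun U (MG B j \<phi>)"
 unfolding MG_def by (intro test_fun_add test_fun_cmult test_fun_pd test_fun_Amag)

text \<open>The j-th component of the potential does not depend on x_j. Hence the potential is
  divergence free and \<open>pd j\<close> commutes with multiplication by its j-th component, which
  is used when Green's formula is expanded.\<close>

lemma pd_Amag_same: "pd j (\<lambda>x. of_real (Amag B j x)) x = 0"
proof -
 have *: "pd j (\<lambda>x. of_real (c * x $ k)) x = 0" if "j \<noteq> k" for c k
  using that by (simp add: pd_cmult smooth_fun_differentiable smooth_fun_coord pd_coord)
 show ?thesis unfolding Amag_def using *[of 2 "- (B/2)"] *[of 1 "B/2"] by (cases "j = 1") auto
qed

lemma test_fun_bump: "test_fun U (bump p a d)" if "cball a d \<subseteq> U" "d > 0"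
proof (rule test_funI[of _ "cball a d"])
 fix x assume "bump p a d x \<noteq> 0"
 then have "(dist a x)\<^sup>2 < d\<^sup>2"
  by (auto simp: bump_def bump_exp_def dist_norm power2_norm_eq_inner norm_minus_commute split: if_splits)
   (simp add: inner_diff_left inner_diff_right inner_commute)
 then show "x \<in> cball a d" using that by (simp add: power2_less_imp_less less_imp_le)
qed (use that in \<open>auto simp: smooth_fun_bump\<close>)

lemma test_fun_bounded:
 assumes "test_fun U \<phi>"
 obtains C where "\<And>x. cmod (\<phi> x) \<le> C" "C > 0"
proof -
 let ?S = "closure {x. \<phi> x \<noteq> 0}"
 have "compact (\<phi> ` ?S)"
  using assms by (intro compact_continuous_image) (auto simp: test_fun_def smooth_fun_continuous_on)
 then obtain C where C: "\<And>y. y \<in> \<phi> ` ?S ==> norm y \<le> C" "C > 0" by (meson bounded_pos compact_imp_bounded)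
 have "cmod (\<phi> x) \<le> C" for x using C closure_subset[of "{x. \<phi> x \<noteq> 0}"] by (cases "\<phi> x = 0") (auto simp: less_imp_le)
 then show ?thesis using C(2) that by blast
qed

lemma test_fun_lipschitz:
 assumes "test_fun U \<phi>"
 obtains C where "\<And>x y. cmod (\<phi> x - \<phi> y) \<le> C * norm (x - y)" "C > 0"
proof -
 have "\<exists>C. \<forall>x. cmod (pd j \<phi> x) \<le> C" for j using test_fun_bounded[OF test_fun_pd[OF assms]] by metis
 then obtain C where C: "\<And>j x. cmod (pd j \<phi> x) \<le> C j" by metis
 let ?D = "\<lambda>x h. \<Sum>j\<in>UNIV. of_real (h $ j) * pd j \<phi> x"
 have "norm (\<phi> x - \<phi> y) \<le> (\<Sum>j\<in>UNIV. C j) * norm (x - y)" for x y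
 proof (rule differentiable_bound[of UNIV])
  show "(\<phi> has_derivative ?D x) (at x within UNIV)" for x
   using has_derivative_pd smooth_fun_differentiable test_fun_smooth[OF assms] by blast
  show "onorm (?D x) \<le> (\<Sum>j\<in>UNIV. C j)" for x
  proof (rule onorm_le)
   fix h
   have "norm (?D x h) \<le> (\<Sum>j\<in>UNIV. norm h * C j)"
    by (rule sum_norm_le) (auto simp: norm_mult intro!: mult_mono C component_le_norm_cart)
   then show "norm (?D x h) \<le> (\<Sum>j\<in>UNIV. C j) * norm h" by (simp add: sum_distrib_left mult.commute)
  qed
 qed auto
 then have "norm (\<phi> x - \<phi> y) \<le> (max 1 (\<Sum>j\<in>UNIV. C j)) * norm (x - y)" for x y
  by (smt (verit) mult_right_mono norm_ge_zero)
 then show ?thesis using that[of "max 1 (\<Sum>j\<in>UNIV. C j)"] by auto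
qed

lemma test_fun_measurable: "test_fun U \<phi> ==> \<phi> \<in> borel_measurable borel"
 by (meson borel_measurable_continuous_onI smooth_fun_continuous_on test_fun_smooth)

subsection \<open>Square-integrable functions\<close>

definition sqi :: "'a measure => ('a => complex) => bool" where
 "sqi M f \<longleftrightarrow> f \<in> borel_measurable M \<and> integrable M (\<lambda>x. (cmod (f x))\<^sup>2)"

text \<open>The square of the L2 norm. Without the root, the triangle inequality is used with a
  factor 2 (\<open>sqn_add_le\<close>) and Young's inequality with a free weight
  (\<open>sqn_mult_bound\<close>) takes the place of Cauchy-Schwarz.\<close>

definition sqn :: "'a measure => ('a => complex) => real" where
 "sqn M f = (\<integral>x. (cmod (f x))\<^sup>2 \<partial>M)"

definition sqlim :: "'a measure => (nat => 'a => complex) => ('a => complex) => bool" where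
 "sqlim M f F \<longleftrightarrow> (\<forall>k. sqi M (f k)) \<and> sqi M F \<and> (\<lambda>k. sqn M (\<lambda>x. f k x - F x)) \<longlonglongrightarrow> 0"

lemma sqn_nonneg: "0 \<le> sqn M f" by (simp add: sqn_def)

lemma sqi_measurable: "sqi M f ==> f \<in> borel_measurable M" by (simp add: sqi_def)

lemma cmod_add_sq_le: "(cmod (a + b))\<^sup>2 \<le> 2 * (cmod a)\<^sup>2 + 2 * (cmod b)\<^sup>2"
proof -
 have "(cmod (a + b))\<^sup>2 \<le> (cmod a + cmod b)\<^sup>2" by (intro power_mono norm_triangle_ineq) auto
 also have "\<dots> \<le> 2 * (cmod a)\<^sup>2 + 2 * (cmod b)\<^sup>2"
  using sum_squares_bound[of "cmod a" "cmod b"] by (simp add: power2_eq_square algebra_simps)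
 finally show ?thesis .
qed

text \<open>The inequality 2xy \<le> x^2 + y^2 for x = sqrt t * a and y = b / sqrt t. The free
  weight is what later allows one of the two terms to be absorbed.\<close>

lemma young_mult: "0 < (t::real) ==> a * b \<le> t / 2 * a\<^sup>2 + 1 / (2 * t) * b\<^sup>2"
 using sum_squares_bound[of "sqrt t * a" "b / sqrt t"] by (simp add: power_mult_distrib power_divide field_simps)

lemma sqi_bound:
 assumes "sqi M f" "g \<in> borel_measurable M" "AE x in M. cmod (g x) \<le> C * cmod (f x)"
 shows "sqi M g" unfolding sqi_def
proof
 show "integrable M (\<lambda>x. (cmod (g x))\<^sup>2)"
 proof (rule Bochner_Integration.integrable_bound)
  show "integrable M (\<lambda>x. C\<^sup>2 * (cmod (f x))\<^sup>2)" using assms(1) by (simp add: sqi_def)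
  show "AE x in M. norm ((cmod (g x))\<^sup>2) \<le> norm (C\<^sup>2 * (cmod (f x))\<^sup>2)" using assms(3)
  proof eventually_elim
   fix x assume "cmod (g x) \<le> C * cmod (f x)"
   then show "norm ((cmod (g x))\<^sup>2) \<le> norm (C\<^sup>2 * (cmod (f x))\<^sup>2)"
    using power_mono[of "cmod (g x)" "C * cmod (f x)" 2] by (simp add: power_mult_distrib)
  qed
 qed (use assms in \<open>simp_all add: sqi_def\<close>)
qed (rule assms)

lemma sqi_add: "sqi M f ==> sqi M g ==> sqi M (\<lambda>x. f x + g x)" unfolding sqi_def
proof safe
 assume a: "f \<in> borel_measurable M" "g \<in> borel_measurable M"
  "integrable M (\<lambda>x. (cmod (f x))\<^sup>2)" "integrable M (\<lambda>x. (cmod (g x))\<^sup>2)"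
 show "integrable M (\<lambda>x. (cmod (f x + g x))\<^sup>2)"
 proof (rule Bochner_Integration.integrable_bound)
  show "integrable M (\<lambda>x. 2 * (cmod (f x))\<^sup>2 + 2 * (cmod (g x))\<^sup>2)" using a by simp
  show "AE x in M. norm ((cmod (f x + g x))\<^sup>2) \<le> norm (2 * (cmod (f x))\<^sup>2 + 2 * (cmod (g x))\<^sup>2)"
   using cmod_add_sq_le by (intro AE_I2) simp
 qed (use a in measurable)
qed auto

lemma sqi_cmult: "sqi M f ==> sqi M (\<lambda>x. c * f x)"
 by (rule sqi_bound[of M f _ "cmod c"]) (auto simp: sqi_def norm_mult)

lemma sqi_diff: "sqi M f ==> sqi M g ==> sqi M (\<lambda>x. f x - g x)"
 using sqi_add[of M f "\<lambda>x. -1 * g x"] sqi_cmult[of M g "-1"] by simp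

lemma sqi_cnj: "sqi M f ==> sqi M (\<lambda>x. cnj (f x))"
 unfolding sqi_def by (auto intro!: measurable_compose[of f M borel cnj] borel_measurable_continuous_onI continuous_intros)

lemma sqi_bmult:
 assumes "sqi M f" "b \<in> borel_measurable M" "AE x in M. cmod (b x) \<le> C"
 shows "sqi M (\<lambda>x. b x * f x)"
proof (rule sqi_bound[OF assms(1)])
 show "AE x in M. cmod (b x * f x) \<le> C * cmod (f x)"
  using assms(3) by eventually_elim (auto simp: norm_mult intro: mult_right_mono)
qed (use assms(1,2) in \<open>auto simp: sqi_def\<close>)

lemma sqi_mult_integrable:
 assumes "sqi M f" "sqi M g"
 shows "integrable M (\<lambda>x. f x * g x)"
proof (rule Bochner_Integration.integrable_bound)
 show "integrable M (\<lambda>x. (cmod (f x))\<^sup>2 + (cmod (g x))\<^sup>2)" using assms by (simp add: sqi_def)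
 show "AE x in M. norm (f x * g x) \<le> norm ((cmod (f x))\<^sup>2 + (cmod (g x))\<^sup>2)"
 proof (rule AE_I2)
  fix x
  have "cmod (f x) * cmod (g x) \<le> (cmod (f x))\<^sup>2 + (cmod (g x))\<^sup>2"
   using sum_squares_bound[of "cmod (f x)" "cmod (g x)"]
    mult_nonneg_nonneg[OF norm_ge_zero[of "f x"] norm_ge_zero[of "g x"]] by linarith
  then show "norm (f x * g x) \<le> norm ((cmod (f x))\<^sup>2 + (cmod (g x))\<^sup>2)" by (simp add: norm_mult)
 qed
qed (use assms in \<open>auto simp: sqi_def\<close>)

lemma sqn_mult_bound:
 assumes "sqi M f" "sqi M g" "t > 0"
 shows "cmod (\<integral>x. f x * g x \<partial>M) \<le> t / 2 * sqn M f + 1 / (2 * t) * sqn M g"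
proof -
 have "cmod (\<integral>x. f x * g x \<partial>M) \<le> (\<integral>x. cmod (f x * g x) \<partial>M)" by (rule integral_norm_bound)
 also have "\<dots> \<le> (\<integral>x. t / 2 * (cmod (f x))\<^sup>2 + 1 / (2 * t) * (cmod (g x))\<^sup>2 \<partial>M)"
 proof (rule integral_mono)
  show "integrable M (\<lambda>x. cmod (f x * g x))" using sqi_mult_integrable[OF assms(1,2)] by (rule integrable_norm)
  show "cmod (f x * g x) \<le> t / 2 * (cmod (f x))\<^sup>2 + 1 / (2 * t) * (cmod (g x))\<^sup>2" for x
   unfolding norm_mult by (rule young_mult[OF assms(3)])
 qed (use assms in \<open>simp add: sqi_def\<close>)
 also have "\<dots> = t / 2 * sqn M f + 1 / (2 * t) * sqn M g" using assms by (simp add: sqi_def sqn_def)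
 finally show ?thesis .
qed

lemma sqn_add_le:
 assumes "sqi M f" "sqi M g"
 shows "sqn M (\<lambda>x. f x + g x) \<le> 2 * sqn M f + 2 * sqn M g"
proof -
 have "sqn M (\<lambda>x. f x + g x) \<le> (\<integral>x. 2 * (cmod (f x))\<^sup>2 + 2 * (cmod (g x))\<^sup>2 \<partial>M)"
  unfolding sqn_def using assms sqi_add[OF assms]
  by (intro integral_mono) (auto simp: sqi_def intro: cmod_add_sq_le)
 then show ?thesis using assms by (simp add: sqi_def sqn_def)
qed

lemma sqn_cmult: "sqn M (\<lambda>x. c * f x) = (cmod c)\<^sup>2 * sqn M f" by (simp add: sqn_def norm_mult power_mult_distrib)

lemma sqn_minus: "sqn M (\<lambda>x. f x - g x) = sqn M (\<lambda>x. g x - f x)" by (simp add: sqn_def norm_minus_commute)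

lemma sqn_bmult_le:
 assumes "sqi M f" "b \<in> borel_measurable M" "AE x in M. cmod (b x) \<le> C"
 shows "sqn M (\<lambda>x. b x * f x) \<le> C\<^sup>2 * sqn M f"
proof -
 have "sqn M (\<lambda>x. b x * f x) \<le> (\<integral>x. C\<^sup>2 * (cmod (f x))\<^sup>2 \<partial>M)" unfolding sqn_def
 proof (rule integral_mono_AE)
  show "AE x in M. (cmod (b x * f x))\<^sup>2 \<le> C\<^sup>2 * (cmod (f x))\<^sup>2" using assms(3)
  proof eventually_elim
   fix x assume "cmod (b x) \<le> C"
   then show "(cmod (b x * f x))\<^sup>2 \<le> C\<^sup>2 * (cmod (f x))\<^sup>2"
    by (simp add: norm_mult power_mult_distrib mult_right_mono power_mono)
  qed
 qed (use assms(1) sqi_bmult[OF assms] in \<open>simp_all add: sqi_def\<close>)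
 then show ?thesis by (simp add: sqn_def)
qed

lemma sqlimD: "sqlim M f F ==> sqi M (f k)" "sqlim M f F ==> sqi M F" by (auto simp: sqlim_def)

lemma sqlim_add:
 assumes "sqlim M f F" "sqlim M g G"
 shows "sqlim M (\<lambda>k x. f k x + g k x) (\<lambda>x. F x + G x)" unfolding sqlim_def
proof (intro conjI allI)
 show "(\<lambda>k. sqn M (\<lambda>x. f k x + g k x - (F x + G x))) \<longlonglongrightarrow> 0"
 proof (rule tendsto_sandwich[where f = "\<lambda>_. 0"])
  show "\<forall>\<^sub>F k in sequentially. sqn M (\<lambda>x. f k x + g k x - (F x + G x))
    \<le> 2 * sqn M (\<lambda>x. f k x - F x) + 2 * sqn M (\<lambda>x. g k x - G x)"
   using sqn_add_le[OF sqi_diff[OF sqlimD[OF assms(1)]] sqi_diff[OF sqlimD[OF assms(2)]]]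
   by (intro always_eventually allI) (simp add: add_diff_add)
  show "(\<lambda>k. 2 * sqn M (\<lambda>x. f k x - F x) + 2 * sqn M (\<lambda>x. g k x - G x)) \<longlonglongrightarrow> 0"
   using assms unfolding sqlim_def by (auto intro!: tendsto_eq_intros)
 qed (auto simp: sqn_nonneg)
qed (rule sqi_add[OF sqlimD(1)[OF assms(1)] sqlimD(1)[OF assms(2)]],
  rule sqi_add[OF sqlimD(2)[OF assms(1)] sqlimD(2)[OF assms(2)]])

lemma sqlim_bmult:
 assumes "sqlim M f F" "b \<in> borel_measurable M" "AE x in M. cmod (b x) \<le> C"
 shows "sqlim M (\<lambda>k x. b x * f k x) (\<lambda>x. b x * F x)" unfolding sqlim_def
proof (intro conjI allI)
 show "(\<lambda>k. sqn M (\<lambda>x. b x * f k x - b x * F x)) \<longlonglongrightarrow> 0"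
 proof (rule tendsto_sandwich[where f = "\<lambda>_. 0"])
  show "\<forall>\<^sub>F k in sequentially. sqn M (\<lambda>x. b x * f k x - b x * F x) \<le> C\<^sup>2 * sqn M (\<lambda>x. f k x - F x)"
   using sqn_bmult_le[OF sqi_diff[OF sqlimD[OF assms(1)]] assms(2,3)]
   by (intro always_eventually allI) (simp add: right_diff_distrib)
  show "(\<lambda>k. C\<^sup>2 * sqn M (\<lambda>x. f k x - F x)) \<longlonglongrightarrow> 0"
   using assms(1) unfolding sqlim_def by (auto intro!: tendsto_eq_intros)
 qed (auto simp: sqn_nonneg)
qed (rule sqi_bmult[OF _ assms(2,3)], rule sqlimD[OF assms(1)])+

lemma sqlim_cmult: "sqlim M f F ==> sqlim M (\<lambda>k x. c * f k x) (\<lambda>x. c * F x)"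
 by (rule sqlim_bmult[where C = "cmod c"]) auto

lemma sqlim_diff: "sqlim M f F ==> sqlim M g G ==> sqlim M (\<lambda>k x. f k x - g k x) (\<lambda>x. F x - G x)"
 using sqlim_add[of M f F "\<lambda>k x. -1 * g k x" "\<lambda>x. -1 * G x"] sqlim_cmult[of M g G "-1"] by simp

lemma sqlim_cnj: "sqlim M f F ==> sqlim M (\<lambda>k x. cnj (f k x)) (\<lambda>x. cnj (F x))"
 by (simp add: sqlim_def sqi_cnj sqn_def flip: complex_cnj_diff)

lemma sqlim_const: "sqi M f ==> sqlim M (\<lambda>k. f) f" by (simp add: sqlim_def sqn_def)

lemma sqlim_mult1:
 assumes "sqlim M f F" "sqi M g"
 shows "(\<lambda>k. \<integral>x. f k x * g x \<partial>M) \<longlonglongrightarrow> (\<integral>x. F x * g x \<partial>M)"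
proof (rule LIMSEQ_I)
 fix e :: real assume "e > 0"
 \<comment> \<open>With this weight the second Young term stays below e/2 for every
   \<open>k\<close>; the summand 1 keeps \<open>t\<close> positive when \<open>g\<close> is
   null.\<close>
 define t where "t = (sqn M g + 1) / e"
 have "t > 0" using \<open>e > 0\<close> sqn_nonneg[of M g] by (simp add: t_def)
 have "(\<lambda>k. sqn M (\<lambda>x. f k x - F x)) \<longlonglongrightarrow> 0" using assms(1) by (simp add: sqlim_def)
 from LIMSEQ_D[OF this, of "e / t"] obtain N
  where N: "\<And>k. k \<ge> N ==> sqn M (\<lambda>x. f k x - F x) < e / t" using \<open>e > 0\<close> \<open>t > 0\<close> by (auto simp: sqn_nonneg)
 have "norm ((\<integral>x. f k x * g x \<partial>M) - (\<integral>x. F x * g x \<partial>M)) < e" if "k \<ge> N" for k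
 proof -
  have i: "integrable M (\<lambda>x. f k x * g x)" "integrable M (\<lambda>x. F x * g x)"
   using assms by (auto intro!: sqi_mult_integrable dest: sqlimD)
  have "norm ((\<integral>x. f k x * g x \<partial>M) - (\<integral>x. F x * g x \<partial>M)) = cmod (\<integral>x. (f k x - F x) * g x \<partial>M)"
   using i by (simp add: left_diff_distrib)
  also have "\<dots> \<le> t / 2 * sqn M (\<lambda>x. f k x - F x) + 1 / (2 * t) * sqn M g"
   using assms \<open>t > 0\<close> by (intro sqn_mult_bound sqi_diff) (auto dest: sqlimD)
  also have "t / 2 * sqn M (\<lambda>x. f k x - F x) < e / 2" using N[OF that] \<open>t > 0\<close> by (simp add: field_simps)
  also have "1 / (2 * t) * sqn M g \<le> e / 2"
   using \<open>e > 0\<close> sqn_nonneg[of M g] unfolding t_def by (simp add: field_simps)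
  finally show ?thesis by simp
 qed
 then show "\<exists>no. \<forall>n\<ge>no. norm ((\<integral>x. f n x * g x \<partial>M) - (\<integral>x. F x * g x \<partial>M)) < e" by blast
qed

text \<open>Integrate f g = (f - F)(g - G) + f G + g F - F G: the first product tends to 0 by
  Young's inequality, the mixed ones converge because only one factor varies.\<close>

lemma sqlim_mult:
 assumes "sqlim M f F" "sqlim M g G"
 shows "(\<lambda>k. \<integral>x. f k x * g k x \<partial>M) \<longlonglongrightarrow> (\<integral>x. F x * G x \<partial>M)"
proof -
 have "(\<lambda>k. \<integral>x. (f k x - F x) * (g k x - G x) \<partial>M) \<longlonglongrightarrow> 0"
 proof (rule Lim_null_comparison)
  show "\<forall>\<^sub>F k in sequentially. norm (\<integral>x. (f k x - F x) * (g k x - G x) \<partial>M)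
    \<le> 1 / 2 * sqn M (\<lambda>x. f k x - F x) + 1 / (2 * 1) * sqn M (\<lambda>x. g k x - G x)"
   using assms by (intro always_eventually allI sqn_mult_bound sqi_diff) (auto dest: sqlimD)
  show "(\<lambda>k. 1 / 2 * sqn M (\<lambda>x. f k x - F x) + 1 / (2 * 1) * sqn M (\<lambda>x. g k x - G x)) \<longlonglongrightarrow> 0"
   using assms unfolding sqlim_def by (auto intro!: tendsto_eq_intros)
 qed
 moreover have "(\<lambda>k. \<integral>x. f k x * G x \<partial>M) \<longlonglongrightarrow> (\<integral>x. F x * G x \<partial>M)"
  "(\<lambda>k. \<integral>x. g k x * F x \<partial>M) \<longlonglongrightarrow> (\<integral>x. G x * F x \<partial>M)" using assms by (auto intro!: sqlim_mult1 dest: sqlimD)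
 ultimately have "(\<lambda>k. (\<integral>x. (f k x - F x) * (g k x - G x) \<partial>M) + (\<integral>x. f k x * G x \<partial>M)
   + (\<integral>x. g k x * F x \<partial>M) - (\<integral>x. F x * G x \<partial>M)) \<longlonglongrightarrow>
   0 + (\<integral>x. F x * G x \<partial>M) + (\<integral>x. G x * F x \<partial>M) - (\<integral>x. F x * G x \<partial>M)" by (intro tendsto_intros)
 moreover have "(\<integral>x. (f k x - F x) * (g k x - G x) \<partial>M) + (\<integral>x. f k x * G x \<partial>M)
   + (\<integral>x. g k x * F x \<partial>M) - (\<integral>x. F x * G x \<partial>M) = (\<integral>x. f k x * g k x \<partial>M)" for k
 proof -
  have *: "sqi M (f k)" "sqi M F" "sqi M (g k)" "sqi M G" using assms by (auto dest: sqlimD)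
  have "(\<integral>x. (f k x - F x) * (g k x - G x) \<partial>M) = (\<integral>x. f k x * g k x - f k x * G x - g k x * F x + F x * G x \<partial>M)"
   by (simp add: algebra_simps)
  also have "\<dots> = (\<integral>x. f k x * g k x \<partial>M) - (\<integral>x. f k x * G x \<partial>M) - (\<integral>x. g k x * F x \<partial>M) + (\<integral>x. F x * G x \<partial>M)"
   using * by (simp add: sqi_mult_integrable)
  finally show ?thesis by simp
 qed
 ultimately show ?thesis by (simp add: mult.commute[of "G _"])
qed

lemma integral_cmod_sq:
 assumes "sqi M f"
 shows "(\<integral>x. f x * cnj (f x) \<partial>M) = of_real (sqn M f)"
 unfolding sqn_def complex_norm_square[symmetric] by (rule integral_complex_of_real)

lemma sqlim_sqn:
 assumes "sqlim M f F"
 shows "(\<lambda>k. sqn M (f k)) \<longlonglongrightarrow> sqn M F"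
proof -
 have "(\<lambda>k. Re (\<integral>x. f k x * cnj (f k x) \<partial>M)) \<longlonglongrightarrow> Re (\<integral>x. F x * cnj (F x) \<partial>M)"
  by (intro tendsto_Re sqlim_mult sqlim_cnj assms)
 then show ?thesis using assms by (simp add: integral_cmod_sq sqlimD)
qed

text \<open>The bound passes to the limit function, so |f k - F|^2 is dominated by 4 C^2 |w|^2 and
  dominated convergence applies to the squares.\<close>

lemma sqlim_dominated:
 assumes "\<And>k. f k \<in> borel_measurable M" "F \<in> borel_measurable M" "sqi M w"
  and "\<And>k. AE x in M. cmod (f k x) \<le> C * cmod (w x)" "AE x in M. (\<lambda>k. f k x) \<longlonglongrightarrow> F x"
 shows "sqlim M f F"
proof -
 have b: "AE x in M. \<forall>k. cmod (f k x) \<le> C * cmod (w x)" using assms(4) by (simp add: AE_all_countable)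
 have F: "AE x in M. cmod (F x) \<le> C * cmod (w x)" using b assms(5)
 proof eventually_elim
  case (elim x)
  have "(\<lambda>k. cmod (f k x)) \<longlonglongrightarrow> cmod (F x)" using elim(2) by (rule tendsto_norm)
  then show ?case using elim(1) by (intro LIMSEQ_le_const2) auto
 qed
 have "sqi M (f k)" for k by (rule sqi_bound[OF assms(3,1,4)])
 moreover have "sqi M F" by (rule sqi_bound[OF assms(3,2) F])
 moreover have "(\<lambda>k. \<integral>x. (cmod (f k x - F x))\<^sup>2 \<partial>M) \<longlonglongrightarrow> (\<integral>x. 0 \<partial>M)"
 proof (rule integral_dominated_convergence)
  show "integrable M (\<lambda>x. 4 * C\<^sup>2 * (cmod (w x))\<^sup>2)" using assms(3) by (simp add: sqi_def)
  show "AE x in M. (\<lambda>k. (cmod (f k x - F x))\<^sup>2) \<longlonglongrightarrow> 0" using assms(5)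
  proof eventually_elim
   case (elim x)
   then have "(\<lambda>k. f k x - F x) \<longlonglongrightarrow> 0" by (simp add: LIM_zero)
   then show ?case by (auto intro!: tendsto_eq_intros simp: tendsto_norm_zero_iff)
  qed
  show "AE x in M. norm ((cmod (f k x - F x))\<^sup>2) \<le> 4 * C\<^sup>2 * (cmod (w x))\<^sup>2" for k using b F
  proof eventually_elim
   case (elim x)
   have "cmod (f k x - F x) \<le> 2 * (C * cmod (w x))"
    using elim norm_triangle_ineq4[of "f k x" "F x"] by (smt (verit))
   then have "(cmod (f k x - F x))\<^sup>2 \<le> (2 * (C * cmod (w x)))\<^sup>2" by (intro power_mono) auto
   then show ?case by (simp add: power_mult_distrib)
  qed
 qed (use assms(1,2) in simp_all)
 ultimately show ?thesis by (simp add: sqlim_def sqn_def)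
qed

lemma continuous_lebesgue_measurable:
 fixes f :: "'a::euclidean_space => 'b::topological_space"
 shows "continuous_on UNIV f ==> f \<in> borel_measurable lebesgue"
 using borel_measurable_continuous_onI[of f] by (simp add: measurable_completion)

subsection \<open>Density of continuous functions with compact support\<close>

text \<open>Radial projection onto the disc of radius \<open>m\<close>. The maximum in the
  denominator keeps the formula continuous at 0 and makes it the identity inside the disc.\<close>

definition cclamp :: "real => complex => complex" where
 "cclamp m z = of_real (m / max m (cmod z)) * z"

lemma
 assumes "m > 0"
 shows cclamp_le: "cmod (cclamp m z) \<le> m" "cmod (cclamp m z) \<le> cmod z"
  and continuous_on_cclamp: "continuous_on UNIV (cclamp m)"
  and cclamp_id: "cmod z \<le> m ==> cclamp m z = z"
proof -
 show "cmod (cclamp m z) \<le> m" "cmod (cclamp m z) \<le> cmod z" "cmod z \<le> m ==> cclamp m z = z"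
  using assms by (auto simp: cclamp_def norm_mult norm_divide max_def field_simps)
 show "continuous_on UNIV (cclamp m)" unfolding cclamp_def using assms by (intro continuous_intros) auto
qed

text \<open>Take dist as the distance to the complement of \<open>U\<close> joined with the outside
  of the ball of radius m + 1, and clip m dist - 1 to the unit interval. For positive m this
  vanishes where dist is at most 1/m and equals 1 where it is at least 2/m; the ball makes the
  supports compact.\<close>

lemma cut_function:
 fixes U :: "'a::euclidean_space set"
 assumes "open U"
 obtains \<theta> :: "nat => 'a => real" and C :: "nat => 'a set" where
  "\<And>m. continuous_on UNIV (\<theta> m)" "\<And>m x. 0 \<le> \<theta> m x \<and> \<theta> m x \<le> 1"
  "\<And>m. compact (C m)" "\<And>m. C m \<subseteq> U" "\<And>m x. x \<notin> C m ==> \<theta> m x = 0"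
  "\<And>x. x \<in> U ==> (\<lambda>m. \<theta> m x) \<longlonglongrightarrow> 1"
proof -
 define F where "F m = - U \<union> {x::'a. real m + 1 \<le> norm x}" for m
 have Fn: "F m \<noteq> {}" for m
 proof -
  obtain x :: 'a where "norm x = real m + 1" using vector_choose_size[of "real m + 1"] by auto
  then have "x \<in> F m" by (simp add: F_def)
  then show ?thesis by blast
 qed
 define \<theta> where "\<theta> m x = min 1 (max 0 (real m * infdist x (F m) - 1))" for m x
 define C where "C m = {x. 1 \<le> real m * infdist x (F m)}" for m
 show ?thesis
 proof
  show "continuous_on UNIV (\<theta> m)" for m unfolding \<theta>_def by (intro continuous_intros)
  show "0 \<le> \<theta> m x \<and> \<theta> m x \<le> 1" "x \<notin> C m ==> \<theta> m x = 0" for m x by (auto simp: \<theta>_def C_def)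
  have sub: "x \<notin> F m" if "x \<in> C m" for x m
  proof
   assume "x \<in> F m"
   then have "infdist x (F m) = 0" by simp
   then show False using that by (simp add: C_def)
  qed
  then show "C m \<subseteq> U" for m by (auto simp: F_def)
  have "closed (C m)" for m unfolding C_def by (intro closed_Collect_le continuous_intros)
  moreover have "C m \<subseteq> cball 0 (real m + 1)" for m using sub by (force simp: F_def)
  ultimately show "compact (C m)" for m by (meson bounded_cball bounded_subset compact_eq_bounded_closed)
  fix x assume "x \<in> U"
  then obtain r where r: "r > 0" "ball x r \<subseteq> U" using assms openE by blast
  define d where "d = min r 1"
  have d: "infdist x (F m) \<ge> d" if "real m \<ge> norm x" for m unfolding infdist_notempty[OF Fn]
  proof (rule cINF_greatest[OF Fn])
   fix y assume "y \<in> F m"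
   then consider "y \<notin> U" | "real m + 1 \<le> norm y" by (auto simp: F_def)
   then show "d \<le> dist x y"
   proof cases
    case 1
    then show ?thesis using r by (force simp: d_def subset_eq min_def)
   next
    case 2
    then show ?thesis using that norm_triangle_ineq2[of y x] by (simp add: d_def dist_norm norm_minus_commute)
   qed
  qed
  have "d > 0" using r by (simp add: d_def)
  have "\<theta> m x = 1" if "m \<ge> nat \<lceil>norm x\<rceil> + nat \<lceil>2 / d\<rceil>" for m
  proof -
   have *: "norm x \<le> real m" "2 / d \<le> real m" using that by linarith+
   then have "2 \<le> real m * d" using \<open>d > 0\<close> by (simp add: field_simps)
   also have "\<dots> \<le> real m * infdist x (F m)" using d[OF *(1)] by (intro mult_left_mono) auto
   finally show ?thesis by (simp add: \<theta>_def)
  qed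
  then show "(\<lambda>m. \<theta> m x) \<longlonglongrightarrow> 1" by (intro tendsto_eventually eventually_sequentiallyI)
 qed
qed

text \<open>Two approximations, each with error below e/4. First \<open>v\<close> is cut off and
  clamped, with \<open>v\<close> itself as dominating function. Then \<open>v\<close> is replaced
  inside this expression by continuous functions converging to it almost everywhere; cut-off and
  clamp remain, so the approximants are bounded and live in one compact subset of
  \<open>U\<close>.\<close>

lemma continuous_compact_dense:
 fixes v :: "'a::euclidean_space => complex"
 assumes v: "sqi lebesgue v" and "open U" and v0: "\<And>x. x \<notin> U ==> v x = 0" and "e > 0"
 shows "\<exists>g C. continuous_on UNIV g \<and> compact C \<and> C \<subseteq> U \<and> (\<forall>x. x \<notin> C --> g x = 0)
  \<and> sqi lebesgue g \<and> sqn lebesgue (\<lambda>x. g x - v x) < e"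
proof -
 obtain \<theta> :: "nat => 'a => real" and C :: "nat => 'a set" where
  \<theta>c: "\<And>m. continuous_on UNIV (\<theta> m)" and \<theta>01: "\<And>m x. 0 \<le> \<theta> m x \<and> \<theta> m x \<le> 1" and
  C: "\<And>m. compact (C m)" "\<And>m. C m \<subseteq> U" and \<theta>0: "\<And>m x. x \<notin> C m ==> \<theta> m x = 0" and
  \<theta>lim: "\<And>x. x \<in> U ==> (\<lambda>m. \<theta> m x) \<longlonglongrightarrow> 1" using cut_function[OF \<open>open U\<close>] by metis
 have vm: "v \<in> borel_measurable lebesgue" using v by (rule sqi_measurable)
 have \<theta>m[measurable]: "\<theta> m \<in> borel_measurable lebesgue" for m using \<theta>c by (rule continuous_lebesgue_measurable)
 have clm: "cclamp m \<in> borel_measurable borel" if "m > 0" for m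
  using continuous_on_cclamp[OF that] by (rule borel_measurable_continuous_onI)
 define w where "w m x = of_real (\<theta> m x) * cclamp (real (Suc m)) (v x)" for m x
 have wm: "w m \<in> borel_measurable lebesgue" for m
  unfolding w_def using measurable_compose[OF vm clm[of "real (Suc m)"]]
  by (intro borel_measurable_times) (auto intro!: borel_measurable_of_real)
 have "sqlim lebesgue w v"
 proof (rule sqlim_dominated[OF wm vm v, where C = 1])
  show "AE x in lebesgue. cmod (w m x) \<le> 1 * cmod (v x)" for m
  proof (rule AE_I2)
   fix x
   have "cmod (w m x) = \<bar>\<theta> m x\<bar> * cmod (cclamp (real (Suc m)) (v x))" by (simp add: w_def norm_mult)
   also have "\<dots> \<le> 1 * cmod (v x)" using \<theta>01 cclamp_le(2)[of "real (Suc m)"] by (intro mult_mono) auto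
   finally show "cmod (w m x) \<le> 1 * cmod (v x)" .
  qed
  show "AE x in lebesgue. (\<lambda>m. w m x) \<longlonglongrightarrow> v x"
  proof (rule AE_I2)
   fix x
   have 1: "(\<lambda>m. cclamp (real (Suc m)) (v x)) \<longlonglongrightarrow> v x"
   proof (rule tendsto_eventually, rule eventually_sequentiallyI)
    fix m assume "m \<ge> nat \<lceil>cmod (v x)\<rceil>"
    then have "cmod (v x) \<le> real (Suc m)" by linarith
    then show "cclamp (real (Suc m)) (v x) = v x" by (intro cclamp_id) auto
   qed
   show "(\<lambda>m. w m x) \<longlonglongrightarrow> v x"
   proof (cases "x \<in> U")
    case True
    have "(\<lambda>m. w m x) \<longlonglongrightarrow> of_real 1 * v x" unfolding w_def by (intro tendsto_mult tendsto_of_real 1 \<theta>lim True)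
    then show ?thesis by simp
   next
    case False
    then show ?thesis using v0 by (simp add: w_def cclamp_def)
   qed
  qed
 qed
 then have "(\<lambda>m. sqn lebesgue (\<lambda>x. w m x - v x)) \<longlonglongrightarrow> 0" by (simp add: sqlim_def)
 from LIMSEQ_D[OF this, of "e / 4"] obtain m where m: "sqn lebesgue (\<lambda>x. w m x - v x) < e / 4"
  using \<open>e > 0\<close> by (fastforce simp: sqn_nonneg)
 obtain N h where N: "negligible N" and h: "\<And>n. continuous_on UNIV (h n)"
  and hl: "\<And>x. x \<notin> N ==> (\<lambda>n. h n x) \<longlonglongrightarrow> v x"
  using lebesgue_measurable_imp_measurable_on[OF vm, of UNIV] unfolding measurable_on_def by auto
 define g where "g n x = of_real (\<theta> m x) * cclamp (real (Suc m)) (h n x)" for n x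
 have gc: "continuous_on UNIV (g n)" for n unfolding g_def
  by (intro continuous_intros \<theta>c continuous_on_compose2[OF continuous_on_cclamp h]) auto
 have "sqlim lebesgue g (w m)"
 proof (rule sqlim_dominated[OF _ wm, where C = "real (Suc m)"])
  show "g n \<in> borel_measurable lebesgue" for n using gc by (rule continuous_lebesgue_measurable)
  have "C m \<in> lmeasurable" using C(1) by (rule lmeasurable_compact)
  then have "integrable lebesgue (indicator (C m) :: _ => real)"
   by (intro integrable_real_indicator) (auto simp: fmeasurable_def)
  moreover have "(cmod (indicator (C m) x))\<^sup>2 = indicator (C m) x" for x by (auto split: split_indicator)
  ultimately show "sqi lebesgue (\<lambda>x. indicator (C m) x)"
   using \<open>C m \<in> lmeasurable\<close> by (auto simp: sqi_def fmeasurable_def intro!: borel_measurable_indicator)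
  show "AE x in lebesgue. cmod (g n x) \<le> real (Suc m) * cmod (indicator (C m) x)" for n
  proof (rule AE_I2)
   fix x
   have "cmod (g n x) = \<theta> m x * cmod (cclamp (real (Suc m)) (h n x))"
    using \<theta>01[of m x] by (simp add: g_def norm_mult)
   also have "\<dots> \<le> indicator (C m) x * real (Suc m)" using \<theta>01[of m x] \<theta>0[of x m] cclamp_le(1)[of "real (Suc m)"]
    by (intro mult_mono) (auto split: split_indicator)
   finally show "cmod (g n x) \<le> real (Suc m) * cmod (indicator (C m) x)" by (auto split: split_indicator)
  qed
  have "(\<lambda>n. g n x) \<longlonglongrightarrow> w m x" if "x \<notin> N" for x unfolding g_def w_def
   by (intro tendsto_mult tendsto_const continuous_on_tendsto_compose[OF continuous_on_cclamp hl[OF that]]) auto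
  then show "AE x in lebesgue. (\<lambda>n. g n x) \<longlonglongrightarrow> w m x"
   using N by (auto intro!: AE_I'[of N] simp: negligible_iff_null_sets)
 qed
 then have gl: "(\<lambda>n. sqn lebesgue (\<lambda>x. g n x - w m x)) \<longlonglongrightarrow> 0" and gs: "\<And>n. sqi lebesgue (g n)"
  and ws: "sqi lebesgue (w m)" by (auto simp: sqlim_def)
 from LIMSEQ_D[OF gl, of "e / 4"] obtain n where n: "sqn lebesgue (\<lambda>x. g n x - w m x) < e / 4"
  using \<open>e > 0\<close> by (fastforce simp: sqn_nonneg)
 have "sqn lebesgue (\<lambda>x. g n x - v x) = sqn lebesgue (\<lambda>x. (g n x - w m x) + (w m x - v x))" by simp
 also have "\<dots> \<le> 2 * sqn lebesgue (\<lambda>x. g n x - w m x) + 2 * sqn lebesgue (\<lambda>x. w m x - v x)"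
  by (intro sqn_add_le sqi_diff gs ws v)
 also have "\<dots> < e" using m n by simp
 finally show ?thesis using gc C[of m] gs \<theta>0[of _ m] by (intro exI[of _ "g n"] exI[of _ "C m"]) (auto simp: g_def)
qed

subsection \<open>Mollification\<close>

lemma bounded_subset_cball0:
 fixes S :: "'a::real_normed_vector set"
 shows "bounded S ==> \<exists>R. S \<subseteq> cball 0 R" by (meson ball_subset_cball bounded_subset_ballD subset_trans)

lemma integrable_bounded_support:
 fixes f :: "'a::euclidean_space => 'b::{banach, second_countable_topology}"
 assumes "f \<in> borel_measurable lebesgue" "\<And>x. norm (f x) \<le> B" "\<And>x. x \<notin> C ==> f x = 0" "bounded C"
 shows "integrable lebesgue f"
proof -
 obtain R where R: "C \<subseteq> cball 0 R" using assms(4) bounded_subset_cball0 by blast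
 show ?thesis
 proof (rule Bochner_Integration.integrable_bound)
  have "cball (0::'a) R \<in> lmeasurable" by simp
  then show "integrable lebesgue (\<lambda>x. B * indicator (cball (0::'a) R) x)"
   by (intro integrable_mult_right integrable_real_indicator) (auto simp: fmeasurable_def)
  show "AE x in lebesgue. norm (f x) \<le> norm (B * indicator (cball 0 R) x)"
   using assms(2) assms(3) R by (intro AE_I2) (force simp: indicator_def intro: order_trans[OF _ abs_ge_self])
 qed (rule assms(1))
qed

lemma norm_integral_bound:
 fixes f :: "'a => 'b::{banach, second_countable_topology}"
 assumes "integrable M f" "integrable M g" "\<And>x. norm (f x) \<le> g x"
 shows "norm (integral\<^sup>L M f) \<le> integral\<^sup>L M g"
 using integral_norm_bound[of M f] integral_mono[OF integrable_norm[OF assms(1)] assms(2,3)] by linarith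

lemma continuous_imp_borel: "continuous_on UNIV f ==> f \<in> borel_measurable borel"
 by (rule borel_measurable_continuous_onI)

lemma continuous_on_bump_exp: "continuous_on S (bump_exp p)"
 using bump_exp_has_derivative DERIV_continuous_on has_field_derivative_at_within by metis

lemma bump_exp_one_nonneg: "0 \<le> bump_exp 1 t" by (simp add: bump_exp_def)

lemma bump_exp_one_le: "bump_exp 1 t \<le> 1" by (simp add: bump_exp_def)

lemma inner_self_less_iff:
 fixes x :: "'a::real_inner"
 assumes "d > 0"
 shows "x \<bullet> x < d\<^sup>2 \<longleftrightarrow> norm x < d" unfolding power2_norm_eq_inner[symmetric]
proof
 show "norm x < d" if "(norm x)\<^sup>2 < d\<^sup>2" using power2_less_imp_less[OF that] assms by simp
 show "(norm x)\<^sup>2 < d\<^sup>2" if "norm x < d" using that by (intro power_strict_mono) auto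
qed

definition mass :: "real => real" where
 "mass d = (\<integral>x. bump_exp 1 (d\<^sup>2 - x \<bullet> x) \<partial>(lebesgue :: R2 measure))"

definition kern :: "real => R2 => real" where
 "kern d z = bump_exp 1 (d\<^sup>2 - z \<bullet> z) / mass d"

definition mollify :: "real => (R2 => complex) => R2 => complex" where
 "mollify d v x = (\<integral>y. of_real (kern d (x - y)) * v y \<partial>lebesgue)"

text \<open>The kernel is kept arbitrary because the derivative of a mollification is again a
  convolution of the same \<open>v\<close>, now with a derivative of the kernel.\<close>

definition conv :: "(R2 => complex) => (R2 => complex) => R2 => complex" where
 "conv \<sigma> v x = (\<integral>y. \<sigma> (x - y) * v y \<partial>lebesgue)"

lemma mollify_conv: "mollify d = conv (\<lambda>z. of_real (kern d z))" by (intro ext) (simp add: mollify_def conv_def)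

lemma bump_integrable:
 assumes "d > 0"
 shows "integrable lebesgue (\<lambda>x::R2. bump_exp 1 (d\<^sup>2 - x \<bullet> x))"
proof (rule integrable_bounded_support[where B = 1 and C = "ball 0 d"])
 show "(\<lambda>x::R2. bump_exp 1 (d\<^sup>2 - x \<bullet> x)) \<in> borel_measurable lebesgue"
  by (intro continuous_lebesgue_measurable continuous_on_compose2[OF continuous_on_bump_exp[of UNIV]])
   (auto intro!: continuous_intros)
 show "x \<notin> ball 0 d ==> bump_exp 1 (d\<^sup>2 - x \<bullet> x) = 0" for x :: R2
  using inner_self_less_iff[OF assms, of x] by (simp add: bump_exp_def)
qed (auto simp: bump_exp_one_nonneg bump_exp_one_le)

lemma mass_pos:
 assumes "d > 0"
 shows "mass d > 0"
proof (rule ccontr)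
 assume "\<not> mass d > 0"
 then have "mass d = 0" by (simp add: mass_def bump_exp_one_nonneg order_antisym)
 then have "AE x in lebesgue. bump_exp 1 (d\<^sup>2 - x \<bullet> (x::R2)) = 0"
  unfolding mass_def by (subst integral_nonneg_eq_0_iff_AE[symmetric])
   (auto simp: bump_integrable assms bump_exp_one_nonneg)
 then have "AE x::R2 in lebesgue. x \<notin> ball 0 d"
  by eventually_elim (auto simp: bump_exp_def inner_self_less_iff[OF assms, symmetric])
 then have "negligible (ball (0::R2) d)" by (simp add: AE_iff_null_sets negligible_iff_null_sets)
 then show False using open_not_negligible[of "ball (0::R2) d"] assms by simp
qed

lemma
 assumes "d > 0"
 shows kern_nonneg: "0 \<le> kern d z"
  and kern_eq_0: "norm z \<ge> d ==> kern d z = 0"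
  and kern_minus: "kern d (x - y) = kern d (y - x)"
  and test_fun_kern: "test_fun UNIV (\<lambda>z. of_real (kern d z))"
  and test_fun_kern_shift: "cball x d \<subseteq> U ==> test_fun U (\<lambda>y. of_real (kern d (x - y)))"
  and continuous_on_kern: "continuous_on UNIV (kern d)"
proof -
 note m = mass_pos[OF assms]
 show "0 \<le> kern d z"
  using m by (auto simp: kern_def bump_exp_one_nonneg bump_exp_one_le divide_right_mono)
 show "norm z \<ge> d ==> kern d z = 0" using inner_self_less_iff[OF assms, of z] by (simp add: kern_def bump_exp_def)
 show sym: "kern d (x - y) = kern d (y - x)" for x y
  unfolding kern_def by (metis inner_minus_left inner_minus_right minus_diff_eq minus_minus)
 show sh: "test_fun U (\<lambda>y. of_real (kern d (x - y)))" if "cball x d \<subseteq> U" for x U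
 proof -
  have "test_fun U (\<lambda>y. of_real (1 / mass d) * bump 1 x d y)" by (intro test_fun_cmult test_fun_bump that assms)
  then show ?thesis unfolding sym[of x] by (simp add: kern_def bump_def)
 qed
 from sh[of 0 UNIV] show "test_fun UNIV (\<lambda>z. of_real (kern d z))" by (simp add: kern_def)
 have "continuous_on UNIV (\<lambda>z::R2. bump_exp 1 (d\<^sup>2 - z \<bullet> z))"
  by (rule continuous_on_compose2[OF continuous_on_bump_exp[of UNIV]]) (auto intro!: continuous_intros)
 then show "continuous_on UNIV (kern d)"
  unfolding kern_def using m by (intro continuous_on_divide continuous_on_const) auto
qed

lemma kern_measurable: "d > 0 ==> kern d \<in> borel_measurable borel"
 by (rule continuous_imp_borel[OF continuous_on_kern])

lemma nn_integral_kern: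
 assumes "d > 0"
 shows "(\<integral>\<^sup>+y. ennreal (kern d (x - y)) \<partial>lebesgue) = 1"
proof -
 note [measurable] = kern_measurable[OF assms]
 have "(\<integral>\<^sup>+y. ennreal (kern d (x - y)) \<partial>lebesgue) = (\<integral>\<^sup>+y. ennreal (kern d (y - x)) \<partial>lborel)"
  unfolding kern_minus[OF assms, of x] by (simp add: nn_integral_completion)
 also have "\<dots> = (\<integral>\<^sup>+y. ennreal (kern d ((+) (- x) y)) \<partial>lborel)" by simp
 also have "\<dots> = (\<integral>\<^sup>+y. ennreal (kern d y) \<partial>distr lborel borel ((+) (- x)))"
  by (rule nn_integral_distr[symmetric]) measurable
 also have "\<dots> = (\<integral>\<^sup>+y. ennreal (kern d y) \<partial>lborel)"
  by (rule arg_cong[where f = "\<lambda>M. nn_integral M _"], rule lborel_distr_plus)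
 also have "\<dots> = (\<integral>\<^sup>+y. ennreal (kern d y) \<partial>lebesgue)" by (simp add: nn_integral_completion)
 also have "\<dots> = ennreal (\<integral>y. kern d y \<partial>lebesgue)"
  using bump_integrable[OF assms] by (intro nn_integral_eq_integral) (auto simp: kern_def bump_exp_one_nonneg mass_pos[OF assms] less_imp_le)
 also have "(\<integral>y. kern d y \<partial>lebesgue) = 1" using mass_pos[OF assms] by (simp add: kern_def mass_def)
 finally show ?thesis by simp
qed

lemma
 assumes "d > 0"
 shows kern_shift_integrable: "integrable lebesgue (\<lambda>y. kern d (x - y))"
  and integral_kern: "(\<integral>y. kern d (x - y) \<partial>lebesgue) = 1"
proof -
 note [measurable] = kern_measurable[OF assms]
 have [measurable]: "(\<lambda>y. kern d (x - y)) \<in> borel_measurable lebesgue" by (rule measurable_completion) simp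
 show i: "integrable lebesgue (\<lambda>y. kern d (x - y))"
  using nn_integral_kern[OF assms] by (intro integrableI_nonneg) (auto simp: kern_nonneg assms)
 have "ennreal (\<integral>y. kern d (x - y) \<partial>lebesgue) = 1"
  using nn_integral_kern[OF assms] nn_integral_eq_integral[OF i] by (simp add: kern_nonneg assms)
 then show "(\<integral>y. kern d (x - y) \<partial>lebesgue) = 1" by simp
qed

text \<open>The mean value inequality for \<sigma> minus its linear part at \<open>z\<close>, whose
  derivative near \<open>z\<close> is small because the first derivatives are Lipschitz. The
  constant does not depend on \<open>z\<close>, which is what differentiation under the integral
  needs.\<close>

lemma test_fun_taylor:
 assumes "test_fun U \<sigma>"
 shows "\<exists>C. \<forall>z h. cmod (\<sigma> (z + h) - \<sigma> z - (\<Sum>j\<in>UNIV. of_real (h $ j) * pd j \<sigma> z)) \<le> C * (norm h)\<^sup>2"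
proof -
 have "\<exists>C. \<forall>x y. cmod (pd j \<sigma> x - pd j \<sigma> y) \<le> C * norm (x - y)" for j
  using test_fun_lipschitz[OF test_fun_pd[OF assms]] by metis
 then obtain C where C: "\<And>j x y. cmod (pd j \<sigma> x - pd j \<sigma> y) \<le> C j * norm (x - y)" by metis
 have C0: "C j \<ge> 0" for j
  using C[of j 0 "axis 1 1"] by (smt (verit) mult_less_0_iff norm_ge_zero norm_axis_1 norm_minus_cancel diff_0 zero_le_mult_iff)
 have "cmod (\<sigma> (z + h) - \<sigma> z - (\<Sum>j\<in>UNIV. of_real (h $ j) * pd j \<sigma> z)) \<le> (\<Sum>j\<in>UNIV. C j) * (norm h)\<^sup>2" for z h
 proof -
  let ?D = "\<lambda>x h. \<Sum>j\<in>UNIV. of_real (h $ j) * pd j \<sigma> x"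
  define \<tau> where "\<tau> y = \<sigma> y - ?D z y" for y
  have bl: "bounded_linear (?D z)"
   using has_derivative_pd[OF smooth_fun_differentiable[OF test_fun_smooth[OF assms]]]
   by (rule has_derivative_bounded_linear)
  have "norm (\<tau> (z + h) - \<tau> z) \<le> ((\<Sum>j\<in>UNIV. C j) * norm h) * norm (z + h - z)"
  proof (rule differentiable_bound[of "cball z (norm h)"])
   fix y assume y: "y \<in> cball z (norm h)"
   show "(\<tau> has_derivative (\<lambda>k. ?D y k - ?D z k)) (at y within cball z (norm h))" unfolding \<tau>_def
    by (rule has_derivative_at_withinI[OF has_derivative_diff[OF
       has_derivative_pd[OF smooth_fun_differentiable[OF test_fun_smooth[OF assms]]]
       bounded_linear_imp_has_derivative[OF bl]]])
   show "onorm (\<lambda>k. ?D y k - ?D z k) \<le> (\<Sum>j\<in>UNIV. C j) * norm h"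
   proof (rule onorm_le)
    fix k
    have "norm (?D y k - ?D z k) = norm (\<Sum>j\<in>UNIV. of_real (k $ j) * (pd j \<sigma> y - pd j \<sigma> z))"
     by (simp add: right_diff_distrib sum_subtractf)
    also have "\<dots> \<le> (\<Sum>j\<in>UNIV. norm k * (C j * norm h))"
    proof (rule sum_norm_le)
     fix j
     have "cmod (pd j \<sigma> y - pd j \<sigma> z) \<le> C j * norm (y - z)" by (rule C)
     also have "\<dots> \<le> C j * norm h" using y C0 by (intro mult_left_mono) (auto simp: dist_norm norm_minus_commute)
     finally show "norm (of_real (k $ j) * (pd j \<sigma> y - pd j \<sigma> z)) \<le> norm k * (C j * norm h)"
      unfolding norm_mult by (intro mult_mono) (auto simp: component_le_norm_cart)
    qed
    finally show "norm (?D y k - ?D z k) \<le> (\<Sum>j\<in>UNIV. C j) * norm h * norm k"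
     by (simp add: sum_distrib_left sum_distrib_right mult_ac)
   qed
  qed (auto simp: dist_norm)
  moreover have "\<tau> (z + h) - \<tau> z = \<sigma> (z + h) - \<sigma> z - ?D z h"
   using linear_add[OF bounded_linear.linear[OF bl], of z h] by (simp add: \<tau>_def)
  ultimately show ?thesis by (simp add: power2_eq_square mult.assoc)
 qed
 then show ?thesis by blast
qed

lemma conv_integrable:
 assumes "test_fun UNIV \<sigma>" "integrable lebesgue v"
 shows "integrable lebesgue (\<lambda>y. \<sigma> (x - y) * v y)"
proof -
 obtain C where C: "\<And>z. cmod (\<sigma> z) \<le> C" "C > 0" using test_fun_bounded[OF assms(1)] by metis
 have "(\<lambda>y. \<sigma> (x - y)) \<in> borel_measurable lebesgue"
  by (intro measurable_completion) (use test_fun_measurable[OF assms(1)] in measurable)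
 moreover have "v \<in> borel_measurable lebesgue" using assms(2) by simp
 ultimately show ?thesis
 proof (rule_tac Bochner_Integration.integrable_bound[of lebesgue "\<lambda>y. C * cmod (v y)"])
  show "AE y in lebesgue. norm (\<sigma> (x - y) * v y) \<le> norm (C * cmod (v y))"
   using C by (intro AE_I2) (simp add: norm_mult mult_right_mono)
 qed (use assms(2) in auto)
qed

text \<open>The uniform Taylor remainder of the kernel, integrated against |v|, leaves an error of
  order |h|^2.\<close>

lemma conv_has_derivative:
 assumes \<sigma>: "test_fun UNIV \<sigma>" and v: "integrable lebesgue v"
 shows "(conv \<sigma> v has_derivative (\<lambda>h. \<Sum>j\<in>UNIV. of_real (h $ j) * conv (pd j \<sigma>) v x)) (at x)"
proof -
 obtain C where C: "\<And>z h. cmod (\<sigma> (z + h) - \<sigma> z - (\<Sum>j\<in>UNIV. of_real (h $ j) * pd j \<sigma> z)) \<le> C * (norm h)\<^sup>2"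
  using test_fun_taylor[OF \<sigma>] by blast
 define K where "K = C * (\<integral>y. cmod (v y) \<partial>lebesgue)"
 let ?D = "\<lambda>h. \<Sum>j\<in>UNIV. of_real (h $ j) * conv (pd j \<sigma>) v x"
 note i = conv_integrable[OF \<sigma> v] conv_integrable[OF test_fun_pd[OF \<sigma>] v]
 have bnd: "norm (conv \<sigma> v (x + h) - conv \<sigma> v x - ?D h) \<le> K * (norm h)\<^sup>2" for h
 proof -
  have "conv \<sigma> v (x + h) - conv \<sigma> v x - ?D h = (\<integral>y. \<sigma> (x + h - y) * v y - \<sigma> (x - y) * v y
    - (\<Sum>j\<in>UNIV. of_real (h $ j) * (pd j \<sigma> (x - y) * v y)) \<partial>lebesgue)" unfolding conv_def using i by simp
  also have "\<dots> = (\<integral>y. (\<sigma> ((x - y) + h) - \<sigma> (x - y) - (\<Sum>j\<in>UNIV. of_real (h $ j) * pd j \<sigma> (x - y))) * v y \<partial>lebesgue)"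
   by (intro Bochner_Integration.integral_cong refl)
    (simp add: left_diff_distrib sum_distrib_right mult.assoc add_diff_eq diff_add_eq)
  also have "norm \<dots> \<le> (\<integral>y. (C * (norm h)\<^sup>2) * cmod (v y) \<partial>lebesgue)"
  proof (rule norm_integral_bound)
   have "integrable lebesgue (\<lambda>y. \<sigma> (x + h - y) * v y - \<sigma> (x - y) * v y
    - (\<Sum>j\<in>UNIV. of_real (h $ j) * (pd j \<sigma> (x - y) * v y)))" using i by auto
   then show "integrable lebesgue (\<lambda>y. (\<sigma> ((x - y) + h) - \<sigma> (x - y) - (\<Sum>j\<in>UNIV. of_real (h $ j) * pd j \<sigma> (x - y))) * v y)"
    by (rule Bochner_Integration.integrable_cong[THEN iffD1, rotated 2])
     (simp_all add: left_diff_distrib sum_distrib_right mult.assoc add_diff_eq diff_add_eq)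
   show "norm ((\<sigma> ((x - y) + h) - \<sigma> (x - y) - (\<Sum>j\<in>UNIV. of_real (h $ j) * pd j \<sigma> (x - y))) * v y)
     \<le> (C * (norm h)\<^sup>2) * cmod (v y)" for y unfolding norm_mult by (intro mult_right_mono C) auto
  qed (use v in simp)
  finally show ?thesis by (simp add: K_def mult_ac)
 qed
 have bl: "bounded_linear ?D" by (intro bounded_linear_sum bounded_linear_mult_left[THEN bounded_linear_compose]
    bounded_linear_compose[OF bounded_linear_of_real] bounded_linear_vec_nth)
 show ?thesis unfolding has_derivative_at
 proof (intro conjI bl)
  show "(\<lambda>h. norm (conv \<sigma> v (x + h) - conv \<sigma> v x - ?D h) / norm h) \<midarrow>0\<rightarrow> 0"
  proof (rule Lim_null_comparison)
   show "\<forall>\<^sub>F h in at 0. norm (norm (conv \<sigma> v (x + h) - conv \<sigma> v x - ?D h) / norm h) \<le> K * norm h"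
    unfolding eventually_at_filter
   proof (intro always_eventually allI impI)
    fix h :: R2 assume "h \<noteq> 0"
    then show "norm (norm (conv \<sigma> v (x + h) - conv \<sigma> v x - ?D h) / norm h) \<le> K * norm h"
     using bnd[of h] by (simp add: divide_le_eq power2_eq_square mult.assoc)
   qed
   have "((\<lambda>h::R2. K * norm h) \<longlongrightarrow> K * norm (0::R2)) (at 0)" by (intro tendsto_intros)
   then show "((\<lambda>h::R2. K * norm h) \<longlongrightarrow> 0) (at 0)" by simp
  qed
 qed
qed

lemma
 assumes "test_fun UNIV \<sigma>" "integrable lebesgue v"
 shows pd_conv: "pd j (conv \<sigma> v) = conv (pd j \<sigma>) v"
  and smooth_fun_conv: "smooth_fun (conv \<sigma> v)"
proof -
 have pd: "pd j (conv \<sigma> v) = conv (pd j \<sigma>) v" if "test_fun UNIV \<sigma>" for \<sigma> j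
 proof
  show "pd j (conv \<sigma> v) x = conv (pd j \<sigma>) v x" for x by (subst pd_eqI[OF conv_has_derivative[OF that assms(2)]])
    (simp add: axis_def if_distrib[of of_real] if_distrib[of "\<lambda>z. z * _"] cong: if_cong)
 qed
 from pd[OF assms(1)] show "pd j (conv \<sigma> v) = conv (pd j \<sigma>) v" .
 show "smooth_fun (conv \<sigma> v)"
 \<comment> \<open>The kernel varies while \<open>v\<close> stays fixed: convolutions of
   \<open>v\<close> with arbitrary test functions form a class closed under
   \<open>pd\<close>.\<close>
 proof (rule smooth_fun_coinduct[of _ "(\<lambda>\<sigma>. conv \<sigma> v) ` Collect (test_fun UNIV)"])
  fix g x j assume "g \<in> (\<lambda>\<sigma>. conv \<sigma> v) ` Collect (test_fun UNIV)"
  then obtain \<tau> where \<tau>: "g = conv \<tau> v" "test_fun UNIV \<tau>" by blast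
  show "g differentiable at x" unfolding \<tau>(1) using conv_has_derivative[OF \<tau>(2) assms(2)] by (rule differentiableI)
  show "pd j g \<in> (\<lambda>\<sigma>. conv \<sigma> v) ` Collect (test_fun UNIV)"
   unfolding \<tau>(1) pd[OF \<tau>(2)] using test_fun_pd[OF \<tau>(2)] by blast
 next
  show "conv \<sigma> v \<in> (\<lambda>\<sigma>. conv \<sigma> v) ` Collect (test_fun UNIV)" using assms(1) by blast
 qed
qed

lemma mollify_test_fun:
 assumes "d > 0" "integrable lebesgue v" "\<And>x. x \<notin> C ==> v x = 0" "compact C"
  and U: "\<And>x. x \<in> C ==> cball x d \<subseteq> U"
 shows "test_fun U (mollify d v)"
proof (rule test_funI)
 show "smooth_fun (mollify d v)" unfolding mollify_conv by (intro smooth_fun_conv test_fun_kern assms)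
 show "compact {x + y | x y. x \<in> C \<and> y \<in> cball 0 d}" using assms(4) by (intro compact_sums) auto
 show "{x + y | x y. x \<in> C \<and> y \<in> cball 0 d} \<subseteq> U"
 proof safe
  fix x y :: R2 assume "x \<in> C" "y \<in> cball 0 d"
  then show "x + y \<in> U" using U[of x] by (auto simp: subset_eq dist_norm)
 qed
 fix x assume nz: "mollify d v x \<noteq> 0"
 show "x \<in> {x + y | x y. x \<in> C \<and> y \<in> cball 0 d}"
 proof (rule ccontr)
  assume *: "x \<notin> {x + y | x y. x \<in> C \<and> y \<in> cball 0 d}"
  have "complex_of_real (kern d (x - y)) * v y = 0" for y
  proof (cases "y \<in> C")
   case True
   have "norm (x - y) > d"
   proof (rule ccontr)
    assume "\<not> norm (x - y) > d"
    then have "x = y + (x - y) \<and> y \<in> C \<and> x - y \<in> cball 0 d" using True by simp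
    then show False using * by blast
   qed
   then show ?thesis using kern_eq_0[OF assms(1), of "x - y"] by simp
  qed (simp add: assms(3))
  then have "mollify d v x = 0" unfolding mollify_def by (simp only: integral_zero)
  then show False using nz by simp
 qed
qed

lemma sqi_bounded_support_integrable:
 fixes v :: "'a::euclidean_space => complex"
 assumes "sqi lebesgue v" "\<And>x. x \<notin> C ==> v x = 0" "bounded C"
 shows "integrable lebesgue v"
proof -
 obtain R where R: "C \<subseteq> cball 0 R" using assms(3) bounded_subset_cball0 by blast
 have "integrable lebesgue (indicator (cball (0::'a) R) :: _ => real)"
  using lmeasurable_cball[of "0::'a" R] by (intro integrable_real_indicator) (auto simp: fmeasurable_def)
 moreover have "(cmod (indicator (cball (0::'a) R) x))\<^sup>2 = indicator (cball 0 R) x" for x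
  by (auto split: split_indicator)
 ultimately have "sqi lebesgue (indicator (cball (0::'a) R) :: _ => complex)"
  by (auto simp: sqi_def intro!: borel_measurable_indicator)
 from sqi_mult_integrable[OF this assms(1)]
 have "integrable lebesgue (\<lambda>x. indicator (cball 0 R) x * v x)" .
 moreover have "indicator (cball 0 R) x * v x = v x" for x using assms(2) R by (cases "x \<in> C") auto
 ultimately show ?thesis by simp
qed

text \<open>The kernel is a probability density supported in a ball, so the left side is an average
  of g - c near \<open>x\<close>. With c = g x this gives uniform approximation; with \<eta> = 0 it
  computes the value of a cut-off exactly where \<open>g\<close> is locally constant.\<close>

lemma mollify_dist:
 assumes "d > 0" "integrable lebesgue g" "\<And>y. norm (x - y) < d ==> cmod (g y - c) \<le> \<eta>"
 shows "cmod (mollify d g x - c) \<le> \<eta>"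
proof -
 have i: "integrable lebesgue (\<lambda>y. of_real (kern d (x - y)) * g y)"
  by (rule conv_integrable[OF test_fun_kern[OF assms(1)] assms(2)])
 have i2: "integrable lebesgue (\<lambda>y. complex_of_real (kern d (x - y)))"
  by (intro integrable_of_real kern_shift_integrable assms)
 have "mollify d g x - c = (\<integral>y. of_real (kern d (x - y)) * g y \<partial>lebesgue) - (\<integral>y. of_real (kern d (x - y)) * c \<partial>lebesgue)"
  by (simp add: mollify_def integral_kern assms)
 also have "\<dots> = (\<integral>y. of_real (kern d (x - y)) * (g y - c) \<partial>lebesgue)" using i i2 by (simp add: right_diff_distrib)
 also have "cmod \<dots> \<le> (\<integral>y. \<eta> * kern d (x - y) \<partial>lebesgue)"
 proof (rule norm_integral_bound)
  show "integrable lebesgue (\<lambda>y. of_real (kern d (x - y)) * (g y - c))" using i i2 by (simp add: right_diff_distrib)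
  show "norm (of_real (kern d (x - y)) * (g y - c)) \<le> \<eta> * kern d (x - y)" for y
   using mult_left_mono[OF assms(3)[of y] kern_nonneg[OF assms(1), of "x - y"]]
    kern_eq_0[OF assms(1), of "x - y"] kern_nonneg[OF assms(1), of "x - y"]
   by (cases "norm (x - y) < d") (auto simp: norm_mult mult.commute)
 qed (use kern_shift_integrable[OF assms(1)] in simp)
 also have "\<dots> = \<eta>" by (simp add: integral_kern assms)
 finally show ?thesis .
qed

lemma sigma_finite_lebesgue: "sigma_finite_measure (lebesgue :: 'a::euclidean_space measure)"
proof
 obtain A where "countable A" "A \<subseteq> sets lborel" "\<Union>A = space (lborel :: 'a measure)" "\<forall>a\<in>A. emeasure lborel a \<noteq> \<infinity>"
  using lborel.sigma_finite_countable by metis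
 then show "\<exists>A. countable A \<and> A \<subseteq> sets lebesgue \<and> \<Union>A = space (lebesgue :: 'a measure) \<and> (\<forall>a\<in>A. emeasure lebesgue a \<noteq> \<infinity>)"
  by (intro exI[of _ A]) (auto simp: subset_eq)
qed

text \<open>Young's convolution inequality: the kernel is split into two square roots,
  Cauchy-Schwarz is applied pointwise using total mass 1, and Tonelli moves the remaining kernel
  onto the other variable, where it integrates to 1 again.\<close>

lemma mollify_sqi:
 assumes d: "d > 0" and v: "sqi lebesgue v" "integrable lebesgue v"
 shows "sqi lebesgue (mollify d v)" "sqn lebesgue (mollify d v) \<le> sqn lebesgue v"
proof -
 interpret L: sigma_finite_measure "lebesgue :: R2 measure" by (rule sigma_finite_lebesgue)
 interpret P: pair_sigma_finite "lebesgue :: R2 measure" "lebesgue :: R2 measure" ..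
 note [measurable] = kern_measurable[OF d]
 have vm[measurable]: "v \<in> borel_measurable lebesgue" using v by (simp add: sqi_def)
 have mm: "mollify d v \<in> borel_measurable lebesgue" unfolding mollify_conv
  by (intro continuous_lebesgue_measurable smooth_fun_continuous_on smooth_fun_conv test_fun_kern d v)
 have km: "(\<lambda>y. kern d (x - y)) \<in> borel_measurable lebesgue" for x by (intro measurable_completion) simp
 have pt: "ennreal ((cmod (mollify d v x))\<^sup>2) \<le> (\<integral>\<^sup>+y. ennreal (kern d (x - y)) * ennreal ((cmod (v y))\<^sup>2) \<partial>lebesgue)" for x
 proof -
  have i: "integrable lebesgue (\<lambda>y. of_real (kern d (x - y)) * v y)"
   by (rule conv_integrable[OF test_fun_kern[OF d] v(2)])
  have "ennreal (cmod (mollify d v x)) \<le> (\<integral>\<^sup>+y. ennreal (cmod (of_real (kern d (x - y)) * v y)) \<partial>lebesgue)"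
   unfolding mollify_def by (rule integral_norm_bound_ennreal[OF i])
  also have "\<dots> = (\<integral>\<^sup>+y. ennreal (sqrt (kern d (x - y))) * ennreal (sqrt (kern d (x - y)) * cmod (v y)) \<partial>lebesgue)"
   by (intro nn_integral_cong) (simp add: norm_mult kern_nonneg d flip: ennreal_mult)
  finally have "(ennreal (cmod (mollify d v x)))\<^sup>2 \<le> (\<dots>)\<^sup>2" by (intro power_mono) auto
  also have "\<dots> \<le> (\<integral>\<^sup>+y. (ennreal (sqrt (kern d (x - y))))\<^sup>2 \<partial>lebesgue) * (\<integral>\<^sup>+y. (ennreal (sqrt (kern d (x - y)) * cmod (v y)))\<^sup>2 \<partial>lebesgue)"
  proof (rule Cauchy_Schwarz_nn_integral)
   have *: "(\<lambda>y. sqrt (kern d (x - y))) \<in> borel_measurable lebesgue"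
    by (rule measurable_compose[OF km borel_measurable_sqrt])
   then show "(\<lambda>y. ennreal (sqrt (kern d (x - y)))) \<in> borel_measurable lebesgue" by simp
   show "(\<lambda>y. ennreal (sqrt (kern d (x - y)) * cmod (v y))) \<in> borel_measurable lebesgue"
    using borel_measurable_times[OF *, of "\<lambda>y. cmod (v y)"] by simp
  qed
  also have "\<dots> = (\<integral>\<^sup>+y. ennreal (kern d (x - y)) \<partial>lebesgue) * (\<integral>\<^sup>+y. ennreal (kern d (x - y)) * ennreal ((cmod (v y))\<^sup>2) \<partial>lebesgue)"
   by (intro arg_cong2[where f = "(*)"] nn_integral_cong)
    (simp_all add: ennreal_power kern_nonneg d power_mult_distrib flip: ennreal_mult)
  finally show ?thesis by (simp add: nn_integral_kern d ennreal_power)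
 qed
 have pm: "(\<lambda>(x, y). ennreal (kern d (x - y)) * ennreal ((cmod (v y))\<^sup>2)) \<in> borel_measurable (lebesgue \<Otimes>\<^sub>M lebesgue)"
 proof -
  have f: "fst \<in> lebesgue \<Otimes>\<^sub>M lebesgue \<rightarrow>\<^sub>M (borel :: R2 measure)" "snd \<in> lebesgue \<Otimes>\<^sub>M lebesgue \<rightarrow>\<^sub>M (borel :: R2 measure)"
   by (auto intro!: measurable_compose[OF measurable_fst] measurable_compose[OF measurable_snd] measurable_completion)
  have "(\<lambda>p. kern d (fst p - snd p)) \<in> borel_measurable (lebesgue \<Otimes>\<^sub>M lebesgue)"
   by (intro measurable_compose[OF _ kern_measurable[OF d]] borel_measurable_diff f)
  moreover have "(\<lambda>p. (cmod (v (snd p)))\<^sup>2) \<in> borel_measurable (lebesgue \<Otimes>\<^sub>M lebesgue)" by measurable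
  ultimately show ?thesis by (simp add: split_beta)
 qed
 have "(\<integral>\<^sup>+x. ennreal ((cmod (mollify d v x))\<^sup>2) \<partial>lebesgue)
   \<le> (\<integral>\<^sup>+x. \<integral>\<^sup>+y. ennreal (kern d (x - y)) * ennreal ((cmod (v y))\<^sup>2) \<partial>lebesgue \<partial>lebesgue)"
  by (intro nn_integral_mono pt)
 also have "\<dots> = (\<integral>\<^sup>+y. \<integral>\<^sup>+x. ennreal (kern d (x - y)) * ennreal ((cmod (v y))\<^sup>2) \<partial>lebesgue \<partial>lebesgue)"
  by (rule P.Fubini'[OF pm, symmetric])
 also have "\<dots> = (\<integral>\<^sup>+y. (\<integral>\<^sup>+x. ennreal (kern d (y - x)) \<partial>lebesgue) * ennreal ((cmod (v y))\<^sup>2) \<partial>lebesgue)"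
  using km by (intro nn_integral_cong) (simp add: nn_integral_multc kern_minus[OF d])
 also have "\<dots> = (\<integral>\<^sup>+y. ennreal ((cmod (v y))\<^sup>2) \<partial>lebesgue)" by (simp add: nn_integral_kern d)
 also have "\<dots> = ennreal (sqn lebesgue v)"
  unfolding sqn_def using v(1) by (intro nn_integral_eq_integral) (auto simp: sqi_def)
 finally have le: "(\<integral>\<^sup>+x. ennreal ((cmod (mollify d v x))\<^sup>2) \<partial>lebesgue) \<le> ennreal (sqn lebesgue v)" .
 then have i: "integrable lebesgue (\<lambda>x. (cmod (mollify d v x))\<^sup>2)"
  using mm by (intro integrableI_nonneg) (auto simp: order_le_less_trans[OF le])
 then show "sqi lebesgue (mollify d v)" using mm by (simp add: sqi_def)
 have "ennreal (sqn lebesgue (mollify d v)) \<le> ennreal (sqn lebesgue v)"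
  using le unfolding sqn_def[of _ "mollify d v"] by (subst nn_integral_eq_integral[OF i, symmetric]) auto
 then show "sqn lebesgue (mollify d v) \<le> sqn lebesgue v" by (simp add: sqn_nonneg)
qed

lemma uniformly_continuous_compact_support:
 fixes g :: "'a::euclidean_space => complex"
 assumes "continuous_on UNIV g" "bounded C" "\<And>x. x \<notin> C ==> g x = 0" "\<eta> > 0"
 obtains d where "d > 0" "\<And>x y. norm (x - y) < d ==> cmod (g y - g x) < \<eta>"
proof -
 obtain R where R: "C \<subseteq> cball 0 R" using assms(2) bounded_subset_cball0 by blast
 \<comment> \<open>The margin 1 ensures that two points at distance below 1 lie either both in this
   ball or both outside \<open>C\<close>.\<close>
 have "uniformly_continuous_on (cball 0 (R + 1)) g"
  using assms(1) by (intro compact_uniformly_continuous) (auto intro: continuous_on_subset)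
 then obtain d where d: "d > 0"
  "\<And>x y. x \<in> cball 0 (R + 1) ==> y \<in> cball 0 (R + 1) ==> dist y x < d ==> dist (g y) (g x) < \<eta>"
  unfolding uniformly_continuous_on_def using assms(4) by metis
 have "cmod (g y - g x) < \<eta>" if "norm (x - y) < min d 1" for x y
 proof (cases "x \<in> cball 0 (R + 1) \<and> y \<in> cball 0 (R + 1)")
  case True
  then show ?thesis using d(2)[of x y] that by (simp add: dist_norm norm_minus_commute)
 next
  case False
  then have "norm x > R" "norm y > R" using that norm_triangle_ineq2[of x y] norm_triangle_ineq2[of y x]
   by (auto simp: norm_minus_commute not_le)
  then have "x \<notin> C" "y \<notin> C" using R by (auto simp: subset_eq)
  then show ?thesis using assms(3,4) by simp
 qed
 then show ?thesis using that[of "min d 1"] d(1) by simp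
qed

lemma mollify_uniform:
 assumes "continuous_on UNIV g" "compact C" "\<And>x. x \<notin> C ==> g x = 0" "\<eta> > 0"
 obtains d where "d > 0" "\<And>e x. 0 < e ==> e \<le> d ==> cmod (mollify e g x - g x) \<le> \<eta>"
proof -
 have "bounded (g ` C)"
  using assms(1,2) by (meson compact_continuous_image compact_imp_bounded continuous_on_subset subset_UNIV)
 then obtain B where B: "\<And>x. x \<in> C ==> cmod (g x) \<le> B" "B > 0" by (auto simp: bounded_pos)
 have "cmod (g x) \<le> B" for x using B assms(3) by (cases "x \<in> C") auto
 then have gi: "integrable lebesgue g"
  using assms(2,3) by (intro integrable_bounded_support[OF continuous_lebesgue_measurable[OF assms(1)], where C = C]) (auto intro: compact_imp_bounded)
 obtain d where d: "d > 0" "\<And>x y. norm (x - y) < d ==> cmod (g y - g x) < \<eta>"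
  using uniformly_continuous_compact_support[OF assms(1) compact_imp_bounded[OF assms(2)] assms(3,4)] by metis
 show ?thesis
 proof (rule that[OF d(1)])
  show "cmod (mollify e g x - g x) \<le> \<eta>" if "0 < e" "e \<le> d" for e x
   using that d(2)[of x] by (intro mollify_dist gi) (auto intro: less_imp_le)
 qed
qed

lemma sqn_bounded_support_le:
 fixes f :: "'a::euclidean_space => complex"
 assumes "f \<in> borel_measurable lebesgue" "\<And>x. cmod (f x) \<le> \<eta>" "\<And>x. x \<notin> cball 0 R ==> f x = 0"
 shows "sqn lebesgue f \<le> \<eta>\<^sup>2 * measure lebesgue (cball (0::'a) R)"
proof -
 have "sqn lebesgue f \<le> (\<integral>x. \<eta>\<^sup>2 * indicator (cball (0::'a) R) x \<partial>lebesgue)" unfolding sqn_def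
 proof (rule Bochner_Integration.integral_mono')
  show "integrable lebesgue (\<lambda>x. \<eta>\<^sup>2 * indicator (cball (0::'a) R) x)"
   using lmeasurable_cball[of "0::'a" R] by (intro integrable_mult_right integrable_real_indicator) (auto simp: fmeasurable_def)
  show "(cmod (f x))\<^sup>2 \<le> \<eta>\<^sup>2 * indicator (cball 0 R) x" for x
   using assms(2)[of x] assms(3)[of x] by (auto split: split_indicator intro: power_mono)
 qed auto
 then show ?thesis by simp
qed

text \<open>With a continuous compactly supported \<open>g\<close> near \<open>v\<close>, the error
  splits into the mollification of v - g, which contracts, the uniformly small error for
  \<open>g\<close>, and g - v. The tolerances e/12 and e/24 add up to 2e/3 after the factors 2 of
  the triangle inequality.\<close>

lemma sqlim_mollify:
 assumes v: "sqi lebesgue v" and supp: "\<And>x. x \<notin> C ==> v x = 0" "bounded C"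
 shows "sqlim lebesgue (\<lambda>k. mollify (1 / real (Suc k)) v) v"
proof -
 have vi: "integrable lebesgue v" by (rule sqi_bounded_support_integrable[OF v supp])
 have "(\<lambda>k. sqn lebesgue (\<lambda>x. mollify (1 / real (Suc k)) v x - v x)) \<longlonglongrightarrow> 0"
 proof (rule LIMSEQ_I)
  fix e :: real assume e: "e > 0"
  obtain g K where g: "continuous_on UNIV g" "compact K" "\<And>x. x \<notin> K ==> g x = 0"
   "sqi lebesgue g" "sqn lebesgue (\<lambda>x. g x - v x) < e / 12"
   using continuous_compact_dense[OF v open_UNIV, of "e / 12"] e by auto
  have gi: "integrable lebesgue g" by (rule sqi_bounded_support_integrable[OF g(4,3) compact_imp_bounded[OF g(2)]])
  obtain R where R: "K \<subseteq> cball 0 R" using compact_imp_bounded[OF g(2)] bounded_subset_cball0 by blast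
  define m where "m = measure lebesgue (cball (0::R2) (R + 1))"
  \<comment> \<open>Chosen so that \<eta>^2 times the area \<open>m\<close> is at most e/24. The
    ball of radius R + 1 contains the support of the mollified \<open>g\<close> because all scales
    are at most 1.\<close>
  define \<eta> where "\<eta> = sqrt (e / (24 * (m + 1)))"
  have m: "m \<ge> 0" by (simp add: m_def)
  then have "\<eta> > 0" using e by (simp add: \<eta>_def)
  then obtain d where d: "d > 0" "\<And>e x. 0 < e ==> e \<le> d ==> cmod (mollify e g x - g x) \<le> \<eta>"
   using mollify_uniform[OF g(1,2,3)] by metis
  obtain N where N: "1 / real (Suc N) < d" using d(1) nat_approx_posE by metis
  have "norm (sqn lebesgue (\<lambda>x. mollify (1 / real (Suc k)) v x - v x) - 0) < e" if "k \<ge> N" for k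
  proof -
   define s where "s = 1 / real (Suc k)"
   have s: "0 < s" "s \<le> 1" "s \<le> d"
   proof -
    have "1 / real (Suc k) \<le> 1 / real (Suc N)" using that by (intro divide_left_mono) auto
    then show "s \<le> d" using N by (simp add: s_def)
   qed (simp_all add: s_def)
   have vg: "sqi lebesgue (\<lambda>x. v x - g x)" "integrable lebesgue (\<lambda>x. v x - g x)"
    using v g vi gi by (auto intro: sqi_diff)
   have lin: "mollify s (\<lambda>x. v x - g x) x = mollify s v x - mollify s g x" for x unfolding mollify_def
    using conv_integrable[OF test_fun_kern[OF s(1)] vi] conv_integrable[OF test_fun_kern[OF s(1)] gi]
    by (simp add: right_diff_distrib)
   have tf: "test_fun UNIV (mollify s g)" by (rule mollify_test_fun[OF s(1) gi g(3,2)]) auto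
   have tfs: "test_fun (cball 0 (R + 1)) (mollify s g)"
   proof (rule mollify_test_fun[OF s(1) gi g(3,2)])
    fix x assume "x \<in> K"
    then have "norm x \<le> R" using R by auto
    then show "cball x s \<subseteq> cball 0 (R + 1)"
     using s(2) by (auto simp: dist_norm) (smt (verit) norm_triangle_ineq3 norm_minus_commute)
   qed auto
   have b: "sqn lebesgue (\<lambda>x. mollify s g x - g x) \<le> \<eta>\<^sup>2 * m" unfolding m_def
   proof (rule sqn_bounded_support_le)
    show "(\<lambda>x. mollify s g x - g x) \<in> borel_measurable lebesgue"
     using test_fun_measurable[OF tf] sqi_measurable[OF g(4)]
     by (intro borel_measurable_diff) (auto intro: measurable_completion)
    show "cmod (mollify s g x - g x) \<le> \<eta>" for x using d(2) s by simp
    fix x :: R2 assume "x \<notin> cball 0 (R + 1)"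
    moreover from this have "x \<notin> K" using R by auto
    ultimately show "mollify s g x - g x = 0" using test_fun_eq_0[OF tfs] g(3) by simp
   qed
   have c: "\<eta>\<^sup>2 * m \<le> e / 24"
   proof -
    have "\<eta>\<^sup>2 * m = e / (24 * (m + 1)) * m" using e m by (simp add: \<eta>_def)
    also have "\<dots> \<le> e / 24" using e m by (simp add: field_simps)
    finally show ?thesis .
   qed
   have ms: "sqi lebesgue (mollify s g)" "sqi lebesgue (mollify s v)" by (intro mollify_sqi s g gi v vi)+
   have "sqn lebesgue (\<lambda>x. mollify s v x - v x) =
    sqn lebesgue (\<lambda>x. mollify s (\<lambda>x. v x - g x) x + ((mollify s g x - g x) + (g x - v x)))" by (simp add: lin)
   also have "\<dots> \<le> 2 * sqn lebesgue (mollify s (\<lambda>x. v x - g x)) + 2 * sqn lebesgue (\<lambda>x. (mollify s g x - g x) + (g x - v x))"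
    by (intro sqn_add_le mollify_sqi s vg sqi_add sqi_diff ms g v)
   also have "sqn lebesgue (mollify s (\<lambda>x. v x - g x)) \<le> sqn lebesgue (\<lambda>x. v x - g x)" by (intro mollify_sqi s vg)
   also have "sqn lebesgue (\<lambda>x. v x - g x) \<le> e / 12" using g(5) by (simp add: sqn_minus[of _ v])
   also have "sqn lebesgue (\<lambda>x. (mollify s g x - g x) + (g x - v x)) \<le> 2 * sqn lebesgue (\<lambda>x. mollify s g x - g x) + 2 * sqn lebesgue (\<lambda>x. g x - v x)"
    by (intro sqn_add_le sqi_diff ms g v)
   also have "\<dots> \<le> 2 * (e / 24) + 2 * (e / 12)" using b c g(5) by linarith
   finally have "sqn lebesgue (\<lambda>x. mollify s v x - v x) < e" using e by simp
   then show ?thesis by (simp add: sqn_nonneg s_def)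
  qed
  then show "\<exists>no. \<forall>n\<ge>no. norm (sqn lebesgue (\<lambda>x. mollify (1 / real (Suc n)) v x - v x) - 0) < e" by blast
 qed
 then show ?thesis using mollify_sqi[OF _ v vi] v by (simp add: sqlim_def)
qed

subsection \<open>Weak derivatives\<close>

text \<open>Functions of interest are meaningful only on \<open>U\<close>. Extension by zero lets
  all L2 facts be used over the whole plane, without restricted measures.\<close>

abbreviation sqU :: "R2 set => (R2 => complex) => bool" where
 "sqU U f \<equiv> sqi lebesgue (\<lambda>x. indicator U x * f x)"

lemma L2_sqU:
 assumes "L2 U f" "open U"
 shows "sqU U f"
proof -
 have [measurable]: "f \<in> borel_measurable lebesgue" "U \<in> sets lebesgue" using assms by (auto simp: L2_def)
 have "(\<lambda>x. (cmod (indicator U x * f x))\<^sup>2) = (\<lambda>x. indicator U x *\<^sub>R (cmod (f x))\<^sup>2)" by (auto simp: indicator_def)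
 then show ?thesis using assms by (simp add: sqi_def L2_def set_integrable_def)
qed

lemma L2_UNIV_sqi: "L2 UNIV f \<longleftrightarrow> sqi lebesgue f" by (simp add: L2_def sqi_def set_integrable_def)

lemma ip_altdef: "ip U f g = (\<integral>x. (indicator U x * f x) * cnj (g x) \<partial>lebesgue)"
proof -
 have "(\<lambda>x. indicator U x *\<^sub>R (f x * cnj (g x))) = (\<lambda>x. (indicator U x * f x) * cnj (g x))"
  by (auto simp: indicator_def)
 then show ?thesis by (simp add: ip_def set_lebesgue_integral_def)
qed

lemma ip_UNIV: "ip UNIV f g = (\<integral>x. f x * cnj (g x) \<partial>lebesgue)" by (simp add: ip_altdef)

lemma test_fun_sqi:
 assumes "test_fun U \<phi>"
 shows "sqi lebesgue \<phi>"
proof -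
 have m: "\<phi> \<in> borel_measurable lebesgue"
  using test_fun_smooth[OF assms] by (intro continuous_lebesgue_measurable smooth_fun_continuous_on)
 obtain C where C: "\<And>x. cmod (\<phi> x) \<le> C" "C > 0" using test_fun_bounded[OF assms] by metis
 have "integrable lebesgue (\<lambda>x. (cmod (\<phi> x))\<^sup>2)"
 proof (rule integrable_bounded_support[where B = "C\<^sup>2" and C = "closure {x. \<phi> x \<noteq> 0}"])
  show "norm ((cmod (\<phi> x))\<^sup>2) \<le> C\<^sup>2" for x using C by (simp add: power_mono)
  show "(cmod (\<phi> x))\<^sup>2 = 0" if "x \<notin> closure {x. \<phi> x \<noteq> 0}" for x using that closure_subset[of "{x. \<phi> x \<noteq> 0}"] by auto
  show "bounded (closure {x. \<phi> x \<noteq> 0})" using assms by (auto simp: test_fun_def compact_imp_bounded)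
 qed (use m in measurable)
 then show ?thesis using m by (simp add: sqi_def)
qed

lemma cmod_indicator_le: "cmod (indicator S x) \<le> 1" by (simp add: indicator_def)

lemma indicator_lebesgue:
 "S \<in> sets lebesgue ==> (indicator S :: 'a::euclidean_space => complex) \<in> borel_measurable lebesgue"
 by (rule borel_measurable_indicator)

lemma sqi_indicator:
 fixes f :: "'a::euclidean_space => complex"
 assumes "sqi lebesgue f" "S \<in> sets lebesgue"
 shows "sqi lebesgue (\<lambda>x. indicator S x * f x)"
 by (rule sqi_bmult[OF assms(1) indicator_lebesgue[OF assms(2)] AE_I2[OF cmod_indicator_le]])

lemma indicator_integrable:
 fixes C :: "'a::euclidean_space set"
 assumes "compact C"
 shows "integrable lebesgue (indicator C :: 'a => complex)"
proof (rule integrable_bounded_support[OF _ cmod_indicator_le _ compact_imp_bounded[OF assms]])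
 show "(indicator C :: 'a => complex) \<in> borel_measurable lebesgue"
  using assms by (intro indicator_lebesgue) (simp add: compact_imp_closed)
qed simp

lemma ip_add_left:
 assumes "sqU U f" "sqU U g" "test_fun W \<phi>"
 shows "ip U (\<lambda>x. f x + g x) \<phi> = ip U f \<phi> + ip U g \<phi>" unfolding ip_altdef distrib_left distrib_right
 by (intro Bochner_Integration.integral_add sqi_mult_integrable assms sqi_cnj test_fun_sqi[OF assms(3)])

lemma ip_add_right:
 assumes "sqU U f" "test_fun W \<phi>" "test_fun W' \<psi>"
 shows "ip U f (\<lambda>x. \<phi> x + \<psi> x) = ip U f \<phi> + ip U f \<psi>" unfolding ip_altdef distrib_left complex_cnj_add
 by (intro Bochner_Integration.integral_add sqi_mult_integrable assms sqi_cnj test_fun_sqi[OF assms(2)] test_fun_sqi[OF assms(3)])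

lemma ip_cmult_left: "ip U (\<lambda>x. c * f x) \<phi> = c * ip U f \<phi>"
 unfolding ip_altdef by (simp add: mult.left_commute[of _ c] mult.assoc flip: integral_mult_right_zero)

lemma ip_cmult_right: "ip U f (\<lambda>x. c * \<phi> x) = cnj c * ip U f \<phi>"
 unfolding ip_altdef by (simp add: mult.left_commute[of _ "cnj c"] mult.assoc flip: integral_mult_right_zero)

lemma ip_move: "ip U (\<lambda>x. b x * f x) \<phi> = ip U f (\<lambda>x. cnj (b x) * \<phi> x)" unfolding ip_altdef by (simp add: mult_ac)

lemma ip_diff_left:
 assumes "sqU U f" "sqU U g" "test_fun W \<phi>"
 shows "ip U (\<lambda>x. f x - g x) \<phi> = ip U f \<phi> - ip U g \<phi>"
proof -
 have "sqU U (\<lambda>x. -1 * g x)" using sqi_cmult[OF assms(2), of "-1"] by (simp add: mult_ac)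
 from ip_add_left[OF assms(1) this assms(3)] show ?thesis using ip_cmult_left[of U "-1" g \<phi>] by simp
qed

text \<open>The mollification of a function orthogonal to all test functions on U vanishes away
 from the boundary of U.\<close>
lemma test_zero_imp_AE:
 assumes U: "open U" and h: "sqU U h" and z: "\<And>\<phi>. test_fun U \<phi> ==> ip U h \<phi> = 0"
 shows "AE x in lebesgue. x \<in> U --> h x = 0"
proof -
 \<comment> \<open>\<open>v n\<close> truncates to a ball so that it is integrable and can be
   mollified; \<open>W n\<close> collects the points where all its mollifications from index
   \<open>n\<close> on vanish. The L2 limit forces \<open>v n\<close> to vanish almost everywhere on
   \<open>W n\<close>, and each point of \<open>U\<close> lies in \<open>W n\<close> for all large
   \<open>n\<close>.\<close>
 define v where "v n x = indicator (cball 0 (real n + 1)) x * (indicator U x * h x)" for n :: nat and x :: R2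
 define W where "W n = {x. \<forall>k\<ge>n. mollify (1 / real (Suc k)) (v n) x = 0}" for n
 have v: "sqi lebesgue (v n)" for n unfolding v_def by (rule sqi_indicator[OF h]) simp
 have v0: "v n x = 0" if "x \<notin> cball 0 (real n + 1)" for n x using that by (simp add: v_def)
 have vi: "integrable lebesgue (v n)" for n
  by (rule sqi_bounded_support_integrable[OF v, of "cball 0 (real n + 1)"]) (auto simp: v0)
 have "closed (W n)" for n
 proof -
  have "W n = (\<Inter>k\<in>{n..}. {x. mollify (1 / real (Suc k)) (v n) x = 0})" by (auto simp: W_def)
  also have "closed \<dots>" unfolding mollify_conv
   by (intro closed_INT ballI closed_Collect_eq continuous_on_const smooth_fun_continuous_on
     smooth_fun_conv test_fun_kern vi) auto
  finally show ?thesis .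
 qed
 then have Wm: "W n \<in> sets lebesgue" for n by auto
 have "AE x in lebesgue. x \<in> W n --> v n x = 0" for n
 proof -
  define g where "g x = indicator (W n) x * v n x" for x
  have gs: "sqi lebesgue g" unfolding g_def by (rule sqi_indicator[OF v Wm])
  have lim: "(\<lambda>k. sqn lebesgue (\<lambda>x. mollify (1 / real (Suc k)) (v n) x - v n x)) \<longlonglongrightarrow> 0"
   using sqlim_mollify[OF v, of "cball 0 (real n + 1)" n] v0 by (auto simp: sqlim_def)
  have "sqn lebesgue g \<le> sqn lebesgue (\<lambda>x. mollify (1 / real (Suc k)) (v n) x - v n x)" if "k \<ge> n" for k
   unfolding sqn_def
  proof (rule integral_mono)
   show "integrable lebesgue (\<lambda>x. (cmod (mollify (1 / real (Suc k)) (v n) x - v n x))\<^sup>2)"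
    using sqi_diff[OF mollify_sqi(1)[OF _ v vi] v, of "1 / real (Suc k)" n n] by (simp add: sqi_def)
   show "(cmod (g x))\<^sup>2 \<le> (cmod (mollify (1 / real (Suc k)) (v n) x - v n x))\<^sup>2" for x
    using that by (auto simp: g_def W_def indicator_def)
  qed (use gs in \<open>simp add: sqi_def\<close>)
  then have "sqn lebesgue g \<le> 0" by (intro LIMSEQ_le_const[OF lim]) auto
  then have "sqn lebesgue g = 0" using sqn_nonneg[of lebesgue g] by simp
  then have "AE x in lebesgue. (cmod (g x))\<^sup>2 = 0"
   unfolding sqn_def using gs by (subst integral_nonneg_eq_0_iff_AE[symmetric]) (auto simp: sqi_def)
  then show ?thesis by eventually_elim (auto simp: g_def indicator_def)
 qed
 then have ae: "AE x in lebesgue. \<forall>n. x \<in> W n --> v n x = 0" by (simp add: AE_all_countable)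
 have W: "x \<in> W n" if x: "norm x \<le> real n" "cball x (1 / real (Suc n)) \<subseteq> U" for x n unfolding W_def
 proof (intro CollectI allI impI)
  fix k assume "k \<ge> n"
  define d where "d = 1 / real (Suc k)"
  have "d > 0" by (simp add: d_def)
  have dn: "d \<le> 1 / real (Suc n)" "d \<le> 1" using \<open>k \<ge> n\<close> by (auto simp: d_def frac_le)
  then have sub: "cball x d \<subseteq> U" using x(2) by (meson cball_subset_cball_iff order_trans subset_cball)
  have "mollify d (v n) x = ip U h (\<lambda>y. of_real (kern d (x - y)))" unfolding mollify_def ip_altdef
  proof (rule Bochner_Integration.integral_cong[OF refl])
   fix y :: R2
   show "of_real (kern d (x - y)) * v n y = indicator U y * h y * cnj (of_real (kern d (x - y)))"
   proof (cases "norm (x - y) \<ge> d")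
    case True
    then show ?thesis using kern_eq_0[OF \<open>d > 0\<close>, of "x - y"] by simp
   next
    case False
    then have "norm y \<le> real n + 1" using x(1) dn(2) norm_triangle_ineq2[of y x] by (simp add: norm_minus_commute)
    then show ?thesis by (simp add: v_def mult.commute)
   qed
  qed
  also have "\<dots> = 0" by (intro z test_fun_kern_shift sub \<open>d > 0\<close>)
  finally show "mollify (1 / real (Suc k)) (v n) x = 0" by (simp add: d_def)
 qed
 show ?thesis using ae
 proof eventually_elim
  fix x assume *: "\<forall>n. x \<in> W n --> v n x = 0"
  show "x \<in> U --> h x = 0"
  proof
   assume "x \<in> U"
   then obtain r where r: "r > 0" "cball x r \<subseteq> U" using U open_contains_cball by blast
   obtain m where m: "1 / real (Suc m) < r" using r(1) nat_approx_posE by metis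
   define n where "n = m + nat \<lceil>norm x\<rceil>"
   have nx: "norm x \<le> real n" unfolding n_def by linarith
   have "m \<le> n" by (simp add: n_def)
   then have "1 / real (Suc n) \<le> 1 / real (Suc m)" by (intro divide_left_mono) auto
   then have "cball x (1 / real (Suc n)) \<subseteq> U" using r(2) m by (meson less_imp_le order_trans subset_cball)
   then have "v n x = 0" using * W[OF nx] by blast
   moreover have "norm x \<le> real n + 1" using nx by linarith
   ultimately show "h x = 0" using \<open>x \<in> U\<close> by (auto simp: v_def indicator_def)
  qed
 qed
qed

lemma test_eq_imp_AE:
 assumes "open U" "sqU U f" "sqU U g" "\<And>\<phi>. test_fun U \<phi> ==> ip U f \<phi> = ip U g \<phi>"
 shows "AE x in lebesgue. x \<in> U --> f x = g x"
proof -
 have "sqU U (\<lambda>x. f x - g x)" using sqi_diff[OF assms(2,3)] by (simp add: right_diff_distrib)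
 then have "AE x in lebesgue. x \<in> U --> f x - g x = 0"
  using assms by (intro test_zero_imp_AE) (auto simp: ip_diff_left)
 then show ?thesis by eventually_elim auto
qed

section \<open>Smooth cut-offs and density of test functions for the magnetic gradient\<close>

lemma cnj_mollify:
 assumes "\<And>y. cnj (v y) = v y"
 shows "cnj (mollify d v x) = mollify d v x"
proof -
 have "(\<integral>y. cnj (of_real (kern d (x - y)) * v y) \<partial>lebesgue) = cnj (mollify d v x)"
  by (simp only: Bochner_Integration.integral_cnj mollify_def)
 then show ?thesis by (simp add: mollify_def assms)
qed

text \<open>Mollify at scale d = e/3 the indicator of the closed 2d-neighbourhood of
  \<open>C\<close>. The result is 1 on the d-neighbourhood and is supported within distance 3d = e,
  hence in \<open>U\<close>.\<close>

lemma exists_cutoff: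
 fixes C U :: "R2 set"
 assumes "compact C" "open U" "C \<subseteq> U"
 shows "\<exists>\<eta> W. test_fun U \<eta> \<and> open W \<and> C \<subseteq> W \<and> (\<forall>x\<in>W. \<eta> x = 1) \<and> (\<forall>x. cnj (\<eta> x) = \<eta> x)"
proof -
 obtain e where e: "e > 0" "(\<Union>x\<in>C. cball x e) \<subseteq> U"
  using compact_subset_open_imp_cball_epsilon_subset[OF assms] by blast
 define d where "d = e / 3"
 have "d > 0" using e by (simp add: d_def)
 define S where "S = {x + y | x y. x \<in> C \<and> y \<in> cball 0 (2 * d)}"
 define v :: "R2 => complex" where "v = indicator S"
 have S: "compact S" unfolding S_def using assms(1) by (intro compact_sums) auto
 have "integrable lebesgue v" unfolding v_def by (rule indicator_integrable[OF S])
 show ?thesis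
 proof (intro exI conjI ballI allI)
  show "test_fun U (mollify d v)"
  proof (rule mollify_test_fun[OF \<open>d > 0\<close> \<open>integrable lebesgue v\<close> _ S])
   fix x assume "x \<in> S"
   then obtain c y where "c \<in> C" "norm y \<le> 2 * d" "x = c + y" by (auto simp: S_def)
   have "dist c x \<le> 2 * d" using \<open>norm y \<le> 2 * d\<close> \<open>x = c + y\<close> by (simp add: dist_norm)
   then have "cball x d \<subseteq> cball c e" using dist_triangle[of c _ x] by (fastforce simp: d_def intro: order_trans)
   then show "cball x d \<subseteq> U" using e(2) \<open>c \<in> C\<close> by auto
  qed (simp add: v_def)
  show "open (\<Union>x\<in>C. ball x d)" "C \<subseteq> (\<Union>x\<in>C. ball x d)" using \<open>d > 0\<close> by auto
  show "mollify d v x = 1" if x: "x \<in> (\<Union>x\<in>C. ball x d)" for x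
  proof -
   obtain c where c: "c \<in> C" "dist c x < d" using x by auto
   have "cmod (mollify d v x - 1) \<le> 0"
   proof (rule mollify_dist[OF \<open>d > 0\<close> \<open>integrable lebesgue v\<close>])
    fix y assume "norm (x - y) < d"
    then have "dist c y < 2 * d" using c(2) dist_triangle[of c y x] by (simp add: dist_norm)
    then have "y = c + (y - c) \<and> c \<in> C \<and> y - c \<in> cball 0 (2 * d)"
     using c by (simp add: dist_norm norm_minus_commute)
    then have "y \<in> S" unfolding S_def by blast
    then show "cmod (v y - 1) \<le> 0" by (simp add: v_def)
   qed
   then show ?thesis by simp
  qed
  show "cnj (mollify d v x) = mollify d v x" for x by (rule cnj_mollify) (simp add: v_def indicator_def)
 qed
qed

lemma pd_eq_0_const:
 assumes "open W" "x \<in> W" "\<And>y. y \<in> W ==> f y = c"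
 shows "pd j f x = 0"
proof -
 have "(f has_derivative (\<lambda>h. 0)) (at x)"
  by (rule has_derivative_transform_within_open[OF has_derivative_const assms(1,2)]) (simp add: assms(3))
 then show ?thesis by (subst pd_eqI) auto
qed

text \<open>Indicators of growing balls are mollified at the fixed scale 1, so the first derivatives
  are bounded by derivatives of one kernel, uniformly in \<open>n\<close>. The radius n + 2 leaves
  the value 1 on the open ball of radius n + 1, so derivatives vanish on the closed ball of radius
  n.\<close>

lemma exhausting_cutoffs:
 obtains \<eta> :: "nat => R2 => complex" and B where
  "\<And>n. test_fun UNIV (\<eta> n)" "\<And>n x. cmod (\<eta> n x) \<le> 1" "\<And>n x. cnj (\<eta> n x) = \<eta> n x"
  "\<And>n x. norm x \<le> real n ==> \<eta> n x = 1" "\<And>n j x. cmod (pd j (\<eta> n) x) \<le> B"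
  "\<And>n j x. norm x \<le> real n ==> pd j (\<eta> n) x = 0"
  "\<And>n x. real n + 3 < norm x ==> \<eta> n x = 0"
proof -
 define v :: "nat => R2 => complex" where "v n = indicator (cball 0 (real n + 2))" for n
 define \<eta> where "\<eta> n = mollify 1 (v n)" for n
 let ?K = "\<lambda>z. complex_of_real (kern 1 z)"
 have K: "test_fun UNIV ?K" by (rule test_fun_kern) simp
 have vi: "integrable lebesgue (v n)" for n unfolding v_def by (rule indicator_integrable) simp
 have tf: "test_fun (cball 0 (real n + 3)) (\<eta> n)" for n unfolding \<eta>_def
 proof (rule mollify_test_fun[OF _ vi])
  show "cball x 1 \<subseteq> cball 0 (real n + 3)" if "x \<in> cball 0 (real n + 2)" for x :: R2
  proof
   fix y assume "y \<in> cball x 1"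
   then show "y \<in> cball 0 (real n + 3)"
    using that norm_triangle_ineq2[of y x] by (simp add: dist_norm norm_minus_commute)
  qed
 qed (auto simp: v_def)
 have one: "\<eta> n x = 1" if "norm x < real n + 1" for n x
 proof -
  have "cmod (\<eta> n x - 1) \<le> 0" unfolding \<eta>_def
  proof (rule mollify_dist[OF _ vi])
   fix y assume "norm (x - y) < 1"
   then have "norm y \<le> real n + 2" using that norm_triangle_ineq2[of y x] by (simp add: norm_minus_commute)
   then show "cmod (v n y - 1) \<le> 0" by (simp add: v_def)
  qed simp
  then show ?thesis by simp
 qed
 have "\<exists>C. \<forall>x. cmod (pd j ?K x) \<le> C" for j using test_fun_bounded[OF test_fun_pd[OF K]] by metis
 then obtain C where C: "\<And>j x. cmod (pd j ?K x) \<le> C j" by metis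
 have C0: "C j \<ge> 0" for j using C[of j 0] by (rule order_trans[OF norm_ge_zero])
 have K0: "pd j ?K z = 0" if "norm z > 1" for j z
 proof (rule pd_eq_0_const[of "- cball 0 1" _ _ 0])
  show "complex_of_real (kern 1 y) = 0" if "y \<in> - cball 0 1" for y using that by (simp add: kern_eq_0)
 qed (use that in auto)
 define B where "B = (\<Sum>j\<in>UNIV. C j) * measure lebesgue (cball (0::R2) 1)"
 show ?thesis
 proof
  show "test_fun UNIV (\<eta> n)" for n using tf test_fun_UNIV by blast
  show "cmod (\<eta> n x) \<le> 1" for n x
  proof -
   have "cmod (\<eta> n x - 0) \<le> 1" unfolding \<eta>_def by (rule mollify_dist[OF _ vi]) (auto simp: v_def indicator_def)
   then show ?thesis by simp
  qed
  show "cnj (\<eta> n x) = \<eta> n x" for n x unfolding \<eta>_def by (rule cnj_mollify) (simp add: v_def indicator_def)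
  show "norm x \<le> real n ==> \<eta> n x = 1" for n x using one[of x n] by simp
  show "norm x \<le> real n ==> pd j (\<eta> n) x = 0" for n j x
   by (rule pd_eq_0_const[of "ball 0 (real n + 1)" _ _ 1]) (auto simp: one)
  show "real n + 3 < norm x ==> \<eta> n x = 0" for n x using test_fun_eq_0[OF tf, of x n] by simp
  show "cmod (pd j (\<eta> n) x) \<le> B" for n j x
  proof -
   have "cmod (pd j (\<eta> n) x) = cmod (\<integral>y. pd j ?K (x - y) * v n y \<partial>lebesgue)"
    unfolding \<eta>_def mollify_conv pd_conv[OF K vi] by (simp add: conv_def)
   also have "\<dots> \<le> (\<integral>y. C j * indicator (cball x 1) y \<partial>lebesgue)"
   proof (rule norm_integral_bound)
    show "integrable lebesgue (\<lambda>y. pd j ?K (x - y) * v n y)" by (rule conv_integrable[OF test_fun_pd[OF K] vi])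
    show "integrable lebesgue (\<lambda>y. C j * indicator (cball x 1) y)"
     using lmeasurable_cball[of x 1] by (intro integrable_mult_right integrable_real_indicator) (auto simp: fmeasurable_def)
    show "norm (pd j ?K (x - y) * v n y) \<le> C j * indicator (cball x 1) y" for y
     using C[of j "x - y"] C0[of j] K0[of "x - y" j]
     by (cases "norm (x - y) > 1") (auto simp: norm_mult v_def indicator_def dist_norm)
   qed
   also have "\<dots> = C j * measure lebesgue (cball x 1)" by simp
   also have "measure lebesgue (cball x 1) = measure lebesgue (cball (0::R2) 1)" by (simp add: content_cball)
   also have "C j * \<dots> \<le> B" unfolding B_def by (intro mult_right_mono member_le_sum) (auto simp: C0)
   finally show ?thesis .
  qed
 qed
qed

lemma test_fun_MG_mult:
 assumes "smooth_fun f" "smooth_fun \<phi>"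
 shows "MG B j (\<lambda>x. f x * \<phi> x) x = f x * MG B j \<phi> x + \<i> * pd j f x * \<phi> x" unfolding MG_def
 by (subst pd_mult) (auto simp: smooth_fun_differentiable assms algebra_simps)

text \<open>Mollification commutes with derivatives but not with multiplication by the potential. So
  the weak i times derivative, which is g - A_j v, is mollified and the term A_j (mollified v) is
  added afterwards; no commutator has to be estimated.\<close>

lemma MG_mollify:
 assumes d: "d > 0" and v: "integrable lebesgue v" and g: "integrable lebesgue g"
  and w: "\<And>\<phi>. test_fun UNIV \<phi> ==> ip UNIV g \<phi> = ip UNIV v (MG B j \<phi>)"
  and av: "integrable lebesgue (\<lambda>x. of_real (Amag B j x) * v x)"
 shows "MG B j (mollify d v) x =
  mollify d (\<lambda>x. g x - of_real (Amag B j x) * v x) x + of_real (Amag B j x) * mollify d v x"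
proof -
 let ?K = "\<lambda>z. complex_of_real (kern d z)"
 let ?\<phi> = "\<lambda>y. ?K (x - y)"
 have K: "test_fun UNIV ?K" and \<phi>: "test_fun UNIV ?\<phi>" by (auto intro!: test_fun_kern test_fun_kern_shift d)
 have pdK: "pd j ?\<phi> y = - pd j ?K (x - y)" for y
 proof -
  have "(?K has_derivative (\<lambda>h. \<Sum>j\<in>UNIV. of_real (h $ j) * pd j ?K (x - y))) (at (x - y))"
   by (intro has_derivative_pd smooth_fun_differentiable test_fun_smooth[OF K])
  moreover have "((\<lambda>y. x - y) has_derivative (\<lambda>h. - h)) (at y)" by (auto intro!: derivative_eq_intros)
  ultimately have "(?\<phi> has_derivative (\<lambda>h. \<Sum>j\<in>UNIV. of_real ((- h) $ j) * pd j ?K (x - y))) (at y)"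
   using has_derivative_compose[of "\<lambda>y. x - y" "\<lambda>h. - h" y UNIV ?K] by blast
  from pd_eqI[OF this, of j] show ?thesis
   by (simp add: axis_def sum_negf if_distrib[of of_real] if_distrib[of "\<lambda>z. z * _"] cong: if_cong)
 qed
 have real: "cnj (pd j ?K z) = pd j ?K z" for z
  using pd_cnj[of ?K z j] smooth_fun_differentiable[OF test_fun_smooth[OF K]] by simp
 have i: "integrable lebesgue (\<lambda>y. pd j ?K (x - y) * v y)" "integrable lebesgue (\<lambda>y. ?K (x - y) * g y)"
  "integrable lebesgue (\<lambda>y. ?K (x - y) * (of_real (Amag B j y) * v y))"
  using conv_integrable[OF test_fun_pd[OF K] v] conv_integrable[OF K g] conv_integrable[OF K av] by auto
 have "(\<integral>y. ?K (x - y) * g y \<partial>lebesgue) = ip UNIV g ?\<phi>" by (simp add: ip_UNIV mult.commute)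
 also have "\<dots> = ip UNIV v (MG B j ?\<phi>)" by (rule w[OF \<phi>])
 also have "\<dots> = (\<integral>y. \<i> * (pd j ?K (x - y) * v y) + ?K (x - y) * (of_real (Amag B j y) * v y) \<partial>lebesgue)"
  unfolding ip_UNIV MG_def pdK by (intro Bochner_Integration.integral_cong refl) (simp add: real algebra_simps)
 also have "\<dots> = \<i> * (\<integral>y. pd j ?K (x - y) * v y \<partial>lebesgue) + (\<integral>y. ?K (x - y) * (of_real (Amag B j y) * v y) \<partial>lebesgue)"
  using i by simp
 also have "(\<integral>y. pd j ?K (x - y) * v y \<partial>lebesgue) = pd j (mollify d v) x"
  unfolding mollify_conv pd_conv[OF K v] by (simp add: conv_def)
 finally have "\<i> * pd j (mollify d v) x = (\<integral>y. ?K (x - y) * g y \<partial>lebesgue) - (\<integral>y. ?K (x - y) * (of_real (Amag B j y) * v y) \<partial>lebesgue)"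
  by simp
 also have "\<dots> = mollify d (\<lambda>x. g x - of_real (Amag B j x) * v x) x"
  using i by (simp add: mollify_def right_diff_distrib)
 finally show ?thesis by (simp add: MG_def)
qed

lemma Amag_bound: "\<bar>Amag B j x\<bar> \<le> \<bar>B\<bar> * norm x"
proof -
 have "\<bar>B / 2 * x $ k\<bar> \<le> \<bar>B\<bar> * norm x" for k
  unfolding abs_mult using component_le_norm_cart[of x k] by (intro mult_mono) auto
 from this[of 1] this[of 2] show ?thesis by (auto simp: Amag_def)
qed

lemma Amag_measurable: "(\<lambda>x. complex_of_real (Amag B j x)) \<in> borel_measurable lebesgue"
 by (intro continuous_lebesgue_measurable smooth_fun_continuous_on smooth_fun_Amag)

text \<open>The potential is unbounded, but with compact support it may be replaced by
  \<open>a\<close>, its truncation to the ball of radius R + 1. Mollification scales are at most 1,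
  so the approximants stay in that ball and the truncation changes nothing.\<close>

lemma compact_H1A_dense:
 assumes v: "sqi lebesgue v" and g: "\<And>j. sqi lebesgue (g j)"
  and w: "\<And>j \<phi>. test_fun UNIV \<phi> ==> ip UNIV (g j) \<phi> = ip UNIV v (MG B j \<phi>)"
  and v0: "\<And>x. norm x > R ==> v x = 0" and g0: "\<And>j x. norm x > R ==> g j x = 0"
 shows "\<exists>\<phi>. (\<forall>k. test_fun UNIV (\<phi> k)) \<and> sqlim lebesgue \<phi> v \<and> (\<forall>j. sqlim lebesgue (\<lambda>k. MG B j (\<phi> k)) (g j))"
proof (intro exI conjI allI)
 let ?C = "cball (0::R2) R"
 have vi: "integrable lebesgue v" by (rule sqi_bounded_support_integrable[OF v, of ?C]) (auto simp: v0)
 have gi: "integrable lebesgue (g j)" for j by (rule sqi_bounded_support_integrable[OF g, of ?C]) (auto simp: g0)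
 define a where "a j x = complex_of_real (Amag B j x) * indicator (cball 0 (R + 1)) x" for j and x :: R2
 have am: "a j \<in> borel_measurable lebesgue" for j
  unfolding a_def using Amag_measurable by (intro borel_measurable_times borel_measurable_indicator) auto
 have ab: "cmod (a j x) \<le> \<bar>B\<bar> * \<bar>R + 1\<bar>" for j x
 proof (cases "x \<in> cball 0 (R + 1)")
  case True
  then have "\<bar>B\<bar> * norm x \<le> \<bar>B\<bar> * \<bar>R + 1\<bar>" by (intro mult_left_mono) auto
  then show ?thesis using Amag_bound[of B j x] True by (simp add: a_def norm_mult)
 qed (simp add: a_def)
 have av: "of_real (Amag B j x) * v x = a j x * v x" for j x using v0[of x] by (auto simp: a_def indicator_def)
 have avs: "sqi lebesgue (\<lambda>x. of_real (Amag B j x) * v x)" for j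
  unfolding av by (rule sqi_bmult[OF v am AE_I2[OF ab]])
 have avi: "integrable lebesgue (\<lambda>x. of_real (Amag B j x) * v x)" for j
  by (rule sqi_bounded_support_integrable[OF avs, of ?C]) (auto simp: v0)
 define \<phi> where "\<phi> k = mollify (1 / real (Suc k)) v" for k
 show "test_fun UNIV (\<phi> k)" for k unfolding \<phi>_def by (rule mollify_test_fun[OF _ vi, of _ ?C]) (auto simp: v0)
 show lv: "sqlim lebesgue \<phi> v" unfolding \<phi>_def by (rule sqlim_mollify[OF v, of ?C]) (auto simp: v0)
 have tf: "test_fun (cball 0 (R + 1)) (\<phi> k)" for k unfolding \<phi>_def
 proof (rule mollify_test_fun[OF _ vi, of _ ?C])
  fix x :: R2 assume x: "x \<in> ?C"
  show "cball x (1 / real (Suc k)) \<subseteq> cball 0 (R + 1)"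
  proof
   fix y assume "y \<in> cball x (1 / real (Suc k))"
   then have "norm (y - x) \<le> 1 / real (Suc k)" by (simp add: dist_norm norm_minus_commute)
   also have "\<dots> \<le> 1" by simp
   finally have "norm (y - x) \<le> 1" .
   then show "y \<in> cball 0 (R + 1)" using x norm_triangle_ineq2[of y x] by simp
  qed
 qed (auto simp: v0)
 fix j
 have "sqlim lebesgue (\<lambda>k x. mollify (1 / real (Suc k)) (\<lambda>x. g j x - of_real (Amag B j x) * v x) x + a j x * \<phi> k x)
   (\<lambda>x. (g j x - of_real (Amag B j x) * v x) + a j x * v x)"
 proof (rule sqlim_add)
  show "sqlim lebesgue (\<lambda>k. mollify (1 / real (Suc k)) (\<lambda>x. g j x - of_real (Amag B j x) * v x)) (\<lambda>x. g j x - of_real (Amag B j x) * v x)"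
   by (rule sqlim_mollify[of _ ?C]) (auto simp: v0 g0 intro!: sqi_diff g avs)
  show "sqlim lebesgue (\<lambda>k x. a j x * \<phi> k x) (\<lambda>x. a j x * v x)" by (rule sqlim_bmult[OF lv am AE_I2[OF ab]])
 qed
 moreover have "MG B j (\<phi> k) = (\<lambda>x. mollify (1 / real (Suc k)) (\<lambda>x. g j x - of_real (Amag B j x) * v x) x + a j x * \<phi> k x)" for k
 proof
  fix x
  have "of_real (Amag B j x) * \<phi> k x = a j x * \<phi> k x"
   using test_fun_eq_0[OF tf, of x k] by (auto simp: a_def indicator_def)
  then show "MG B j (\<phi> k) x = mollify (1 / real (Suc k)) (\<lambda>x. g j x - of_real (Amag B j x) * v x) x + a j x * \<phi> k x"
   unfolding \<phi>_def by (subst MG_mollify[OF _ vi gi w avi]) auto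
 qed
 ultimately show "sqlim lebesgue (\<lambda>k. MG B j (\<phi> k)) (g j)" by (simp add: av)
qed

lemma sqlim_eventually:
 assumes "sqlim M f F" "e > 0"
 shows "\<forall>\<^sub>F n in sequentially. sqn M (\<lambda>x. f n x - F x) < e"
proof -
 have "(\<lambda>n. sqn M (\<lambda>x. f n x - F x)) \<longlonglongrightarrow> 0" using assms(1) by (simp add: sqlim_def)
 then show ?thesis using assms(2) by (rule order_tendstoD(2))
qed

text \<open>Multiplication by the cut-off \<eta> n adds i (pd j (\<eta> n)) u to the magnetic
  gradient. This term tends to 0 in L2, being dominated by a multiple of |u| and vanishing on the
  ball of radius n. The truncated functions are then mollified, and a diagonal choice with tolerance
  1/(k+1) gives one sequence for the function and both components.\<close>

lemma H1A_dense:
 assumes u: "sqi lebesgue u" and G: "\<And>j. sqi lebesgue (\<lambda>x. G x $ j)" and w: "weak_mgrad B UNIV u G"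
 shows "\<exists>\<phi>. (\<forall>k. test_fun UNIV (\<phi> k)) \<and> sqlim lebesgue \<phi> u \<and> (\<forall>j. sqlim lebesgue (\<lambda>k. MG B j (\<phi> k)) (\<lambda>x. G x $ j))"
proof -
 obtain \<eta> C where \<eta>: "\<And>n. test_fun UNIV (\<eta> n)" "\<And>n x. cmod (\<eta> n x) \<le> 1" "\<And>n x. cnj (\<eta> n x) = \<eta> n x"
  "\<And>n x. norm x \<le> real n ==> \<eta> n x = 1" "\<And>n j x. cmod (pd j (\<eta> n) x) \<le> C"
  "\<And>n j x. norm x \<le> real n ==> pd j (\<eta> n) x = 0"
  "\<And>n x. real n + 3 < norm x ==> \<eta> n x = 0" using exhausting_cutoffs by blast
 have um: "u \<in> borel_measurable lebesgue" and Gm: "\<And>j. (\<lambda>x. G x $ j) \<in> borel_measurable lebesgue"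
  using u G by (auto intro: sqi_measurable)
 have \<eta>m: "\<eta> n \<in> borel_measurable lebesgue" "pd j (\<eta> n) \<in> borel_measurable lebesgue" for n j
  using \<eta>(1) by (auto intro!: sqi_measurable test_fun_sqi test_fun_pd)
 have cpd: "cnj (pd j (\<eta> n) x) = pd j (\<eta> n) x" for j n x
  using pd_cnj[of "\<eta> n" x j] smooth_fun_differentiable[OF test_fun_smooth[OF \<eta>(1)]] \<eta>(3) by simp
 define v where "v n x = \<eta> n x * u x" for n x
 define g where "g n j x = \<eta> n x * G x $ j + \<i> * (pd j (\<eta> n) x * u x)" for n j x
 have ev: "(\<lambda>n. f n) \<longlonglongrightarrow> L" if *: "\<And>n. norm x \<le> real n ==> f n = L" for f :: "nat => complex" and L and x :: R2
 proof (rule tendsto_eventually, rule eventually_sequentiallyI)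
  show "f n = L" if "nat \<lceil>norm x\<rceil> \<le> n" for n using that by (intro *) linarith
 qed
 have lv: "sqlim lebesgue v u"
 proof (rule sqlim_dominated[OF _ um u, where C = 1])
  show "v n \<in> borel_measurable lebesgue" for n unfolding v_def using \<eta>m um by (intro borel_measurable_times)
  show "AE x in lebesgue. cmod (v n x) \<le> 1 * cmod (u x)" for n
   using \<eta>(2) by (intro AE_I2) (simp add: v_def norm_mult mult_left_le_one_le)
  show "AE x in lebesgue. (\<lambda>n. v n x) \<longlonglongrightarrow> u x"
  proof (rule AE_I2)
   fix x
   show "(\<lambda>n. v n x) \<longlonglongrightarrow> u x" by (rule ev[of x]) (simp add: v_def \<eta>(4))
  qed
 qed
 have lg: "sqlim lebesgue (\<lambda>n. g n j) (\<lambda>x. G x $ j)" for j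
 proof -
  have "sqlim lebesgue (\<lambda>n x. \<eta> n x * G x $ j) (\<lambda>x. G x $ j)"
  proof (rule sqlim_dominated[OF _ Gm G, where C = 1])
   show "(\<lambda>x. \<eta> n x * G x $ j) \<in> borel_measurable lebesgue" for n using \<eta>m Gm by (intro borel_measurable_times)
   show "AE x in lebesgue. cmod (\<eta> n x * G x $ j) \<le> 1 * cmod (G x $ j)" for n
    using \<eta>(2) by (intro AE_I2) (simp add: norm_mult mult_left_le_one_le)
   show "AE x in lebesgue. (\<lambda>n. \<eta> n x * G x $ j) \<longlonglongrightarrow> G x $ j"
   proof (rule AE_I2)
   fix x
   show "(\<lambda>n. \<eta> n x * G x $ j) \<longlonglongrightarrow> G x $ j" by (rule ev[of x]) (simp add: \<eta>(4))
  qed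
  qed
  moreover have "sqlim lebesgue (\<lambda>n x. pd j (\<eta> n) x * u x) (\<lambda>x. 0)"
  proof (rule sqlim_dominated[OF _ _ u, where C = C])
   show "(\<lambda>x. pd j (\<eta> n) x * u x) \<in> borel_measurable lebesgue" for n using \<eta>m um by (intro borel_measurable_times)
   show "AE x in lebesgue. cmod (pd j (\<eta> n) x * u x) \<le> C * cmod (u x)" for n
    using \<eta>(5) by (intro AE_I2) (simp add: norm_mult mult_right_mono)
   show "AE x in lebesgue. (\<lambda>n. pd j (\<eta> n) x * u x) \<longlonglongrightarrow> 0"
   proof (rule AE_I2)
   fix x
   show "(\<lambda>n. pd j (\<eta> n) x * u x) \<longlonglongrightarrow> 0" by (rule ev[of x]) (simp add: \<eta>(6))
  qed
  qed simp
  ultimately have "sqlim lebesgue (\<lambda>n x. \<eta> n x * G x $ j + \<i> * (pd j (\<eta> n) x * u x)) (\<lambda>x. G x $ j + \<i> * 0)"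
   by (intro sqlim_add sqlim_cmult)
  then show ?thesis unfolding g_def by simp
 qed
 have wv: "ip UNIV (g n j) \<phi> = ip UNIV (v n) (MG B j \<phi>)" if \<phi>: "test_fun UNIV \<phi>" for n j \<phi>
 proof -
  have t: "test_fun UNIV (\<lambda>x. \<eta> n x * \<phi> x)" by (intro test_fun_mult1 \<phi> test_fun_smooth[OF \<eta>(1)])
  have t2: "test_fun UNIV (\<lambda>x. pd j (\<eta> n) x * \<phi> x)"
   by (intro test_fun_mult1 \<phi> smooth_fun_pd test_fun_smooth[OF \<eta>(1)])
  have s: "sqi lebesgue (\<lambda>x. \<eta> n x * G x $ j)" "sqi lebesgue (\<lambda>x. \<i> * (pd j (\<eta> n) x * u x))"
   by (rule sqi_bmult[OF G \<eta>m(1) AE_I2[OF \<eta>(2)]],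
     rule sqi_cmult[OF sqi_bmult[OF u \<eta>m(2) AE_I2[OF \<eta>(5)]]])
  have "ip UNIV (g n j) \<phi> = ip UNIV (\<lambda>x. \<eta> n x * G x $ j) \<phi> + ip UNIV (\<lambda>x. \<i> * (pd j (\<eta> n) x * u x)) \<phi>"
   unfolding g_def using s \<phi> by (intro ip_add_left) auto
  also have "ip UNIV (\<lambda>x. \<eta> n x * G x $ j) \<phi> = ip UNIV (\<lambda>x. G x $ j) (\<lambda>x. \<eta> n x * \<phi> x)" by (simp add: ip_move \<eta>(3))
  also have "\<dots> = ip UNIV u (MG B j (\<lambda>x. \<eta> n x * \<phi> x))" using w t by (auto simp: weak_mgrad_def)
  also have "MG B j (\<lambda>x. \<eta> n x * \<phi> x) = (\<lambda>x. \<eta> n x * MG B j \<phi> x + \<i> * (pd j (\<eta> n) x * \<phi> x))"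
   using test_fun_MG_mult[OF test_fun_smooth[OF \<eta>(1)] test_fun_smooth[OF \<phi>]] by (auto simp: mult.assoc)
  also have "ip UNIV u \<dots> = ip UNIV u (\<lambda>x. \<eta> n x * MG B j \<phi> x) + ip UNIV u (\<lambda>x. \<i> * (pd j (\<eta> n) x * \<phi> x))"
   using u by (intro ip_add_right[where W = UNIV and W' = UNIV] test_fun_mult1 test_fun_MG \<phi> test_fun_smooth[OF \<eta>(1)] test_fun_cmult t2) auto
  also have "ip UNIV u (\<lambda>x. \<i> * (pd j (\<eta> n) x * \<phi> x)) = - ip UNIV (\<lambda>x. \<i> * (pd j (\<eta> n) x * u x)) \<phi>"
   unfolding ip_cmult_right ip_cmult_left ip_move cpd by simp
  also have "ip UNIV u (\<lambda>x. \<eta> n x * MG B j \<phi> x) = ip UNIV (v n) (MG B j \<phi>)" unfolding v_def ip_move \<eta>(3) ..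
  finally show ?thesis by simp
 qed
 have appr: "\<exists>\<phi>. test_fun UNIV \<phi> \<and> sqn lebesgue (\<lambda>x. \<phi> x - u x) < e \<and>
   (\<forall>j. sqn lebesgue (\<lambda>x. MG B j \<phi> x - G x $ j) < e)" if "e > 0" for e
 proof -
  have e4: "e / 4 > 0" using that by simp
  have "\<forall>\<^sub>F n in sequentially. sqn lebesgue (\<lambda>x. v n x - u x) < e / 4" using sqlim_eventually[OF lv e4] .
  moreover have "\<forall>\<^sub>F n in sequentially. \<forall>j\<in>UNIV. sqn lebesgue (\<lambda>x. g n j x - G x $ j) < e / 4"
   using sqlim_eventually[OF lg e4] by (intro eventually_ball_finite) auto
  ultimately have "\<forall>\<^sub>F n in sequentially. sqn lebesgue (\<lambda>x. v n x - u x) < e / 4 \<and> (\<forall>j\<in>UNIV. sqn lebesgue (\<lambda>x. g n j x - G x $ j) < e / 4)"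
   by (rule eventually_conj)
  then obtain n where n: "sqn lebesgue (\<lambda>x. v n x - u x) < e / 4" "\<And>j. sqn lebesgue (\<lambda>x. g n j x - G x $ j) < e / 4"
   by (auto dest!: eventually_happens)
  have vs: "sqi lebesgue (v n)" and gs: "sqi lebesgue (g n j)" for j using sqlimD(1)[OF lv] sqlimD(1)[OF lg] by auto
  have p0: "pd j (\<eta> n) x = 0" if "norm x > real n + 3" for j x
   by (rule pd_eq_0_const[of "- cball 0 (real n + 3)" _ _ 0]) (use that \<eta>(7) in auto)
  obtain \<phi> where \<phi>: "\<And>k. test_fun UNIV (\<phi> k)" "sqlim lebesgue \<phi> (v n)" "\<And>j. sqlim lebesgue (\<lambda>k. MG B j (\<phi> k)) (g n j)"
   using compact_H1A_dense[OF vs gs wv, of "real n + 3"] \<eta>(7) p0 by (auto simp: v_def g_def)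
  have "\<forall>\<^sub>F k in sequentially. sqn lebesgue (\<lambda>x. \<phi> k x - v n x) < e / 4" using sqlim_eventually[OF \<phi>(2) e4] .
  moreover have "\<forall>\<^sub>F k in sequentially. \<forall>j\<in>UNIV. sqn lebesgue (\<lambda>x. MG B j (\<phi> k) x - g n j x) < e / 4"
   using sqlim_eventually[OF \<phi>(3) e4] by (intro eventually_ball_finite) auto
  ultimately have "\<forall>\<^sub>F k in sequentially. sqn lebesgue (\<lambda>x. \<phi> k x - v n x) < e / 4 \<and> (\<forall>j\<in>UNIV. sqn lebesgue (\<lambda>x. MG B j (\<phi> k) x - g n j x) < e / 4)"
   by (rule eventually_conj)
  then obtain k where k: "sqn lebesgue (\<lambda>x. \<phi> k x - v n x) < e / 4" "\<And>j. sqn lebesgue (\<lambda>x. MG B j (\<phi> k) x - g n j x) < e / 4"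
   by (auto dest!: eventually_happens)
  have "sqn lebesgue (\<lambda>x. \<phi> k x - u x) < e"
   using sqn_add_le[OF sqi_diff[OF test_fun_sqi[OF \<phi>(1)] vs] sqi_diff[OF vs u], of k] n(1) k(1) by simp
  moreover have "sqn lebesgue (\<lambda>x. MG B j (\<phi> k) x - G x $ j) < e" for j
  proof -
   have "sqi lebesgue (MG B j (\<phi> k))" by (rule test_fun_sqi[OF test_fun_MG[OF \<phi>(1)]])
   from sqn_add_le[OF sqi_diff[OF this gs[of j]] sqi_diff[OF gs[of j] G[of j]]]
   show ?thesis using n(2)[of j] k(2)[of j] by simp
  qed
  ultimately show ?thesis using \<phi>(1) by blast
 qed
 have "\<forall>k. \<exists>\<phi>. test_fun UNIV \<phi> \<and> sqn lebesgue (\<lambda>x. \<phi> x - u x) < 1 / real (Suc k) \<and>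
   (\<forall>j. sqn lebesgue (\<lambda>x. MG B j \<phi> x - G x $ j) < 1 / real (Suc k))" by (rule allI, rule appr) simp
 from choice[OF this] obtain \<phi> where "\<forall>k. test_fun UNIV (\<phi> k) \<and> sqn lebesgue (\<lambda>x. \<phi> k x - u x) < 1 / real (Suc k) \<and>
   (\<forall>j. sqn lebesgue (\<lambda>x. MG B j (\<phi> k) x - G x $ j) < 1 / real (Suc k))" ..
 then have \<phi>: "test_fun UNIV (\<phi> k)" "sqn lebesgue (\<lambda>x. \<phi> k x - u x) < 1 / real (Suc k)"
   "sqn lebesgue (\<lambda>x. MG B j (\<phi> k) x - G x $ j) < 1 / real (Suc k)" for k j by blast+
 have lim0: "f \<longlonglongrightarrow> 0" if "\<And>k. 0 \<le> f k" "\<And>k. f k < 1 / real (Suc k)" for f :: "nat => real"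
 proof (rule tendsto_sandwich[OF _ _ tendsto_const LIMSEQ_inverse_real_of_nat])
  show "\<forall>\<^sub>F k in sequentially. 0 \<le> f k" by (intro always_eventually allI that(1))
  show "\<forall>\<^sub>F k in sequentially. f k \<le> inverse (real (Suc k))"
   unfolding inverse_eq_divide using that(2) by (intro always_eventually allI less_imp_le)
 qed
 show ?thesis unfolding sqlim_def
 proof (intro exI[of _ \<phi>] conjI allI)
  show "(\<lambda>k. sqn lebesgue (\<lambda>x. \<phi> k x - u x)) \<longlonglongrightarrow> 0" by (rule lim0[OF sqn_nonneg \<phi>(2)])
  show "(\<lambda>k. sqn lebesgue (\<lambda>x. MG B j (\<phi> k) x - G x $ j)) \<longlonglongrightarrow> 0" for j by (rule lim0[OF sqn_nonneg \<phi>(3)])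
 qed (rule \<phi>(1) u G test_fun_sqi[OF \<phi>(1)] test_fun_sqi[OF test_fun_MG[OF \<phi>(1)]])+
qed

subsection \<open>Measure of Lipschitz images\<close>

text \<open>By Vitali, almost all of \<open>S\<close> is covered by disjoint balls centred in
  \<open>S\<close> and contained in an open set of nearly the same measure. A ball of radius r has
  image, on \<open>S\<close>, inside a ball of radius \<Lambda> r, and the uncovered null set has a
  null image. Using balls on both sides yields exactly \<Lambda>^n with no dimensional factor, so
  comparison constants can tend to 1. The two types differ since the plane is compared with pairs of
  reals.\<close>

lemma lipschitz_image_outer:
 fixes f :: "'a::euclidean_space => 'b::euclidean_space"
 assumes dim: "DIM('a) = DIM('b)" and S: "S \<in> lmeasurable" and "\<Lambda> \<ge> 0" "e > 0"
  and lip: "\<And>x y. x \<in> S ==> y \<in> S ==> norm (f x - f y) \<le> \<Lambda> * norm (x - y)"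
 shows "\<exists>T. T \<in> lmeasurable \<and> f ` S \<subseteq> T \<and> measure lebesgue T \<le> \<Lambda> ^ DIM('a) * measure lebesgue S + e"
proof -
 define n where "n = DIM('a)"
 \<comment> \<open>The excess of the open cover is multiplied by \<Lambda>^n; the summand 1 avoids
   division by zero when \<Lambda> = 0.\<close>
 define e' where "e' = e / (\<Lambda> ^ n + 1)"
 have pos: "\<Lambda> ^ n + 1 > 0" using \<open>\<Lambda> \<ge> 0\<close> by (simp add: add_nonneg_pos)
 then have "e' > 0" using \<open>e > 0\<close> by (simp add: e'_def)
 obtain U where U: "open U" "S \<subseteq> U" "U - S \<in> lmeasurable" "emeasure lebesgue (U - S) < ennreal e'"
  using S \<open>e' > 0\<close> sets_lebesgue_outer_open[of S e'] by (auto simp: fmeasurable_def)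
 have Um: "U \<in> lmeasurable" using fmeasurable.Un[OF S U(3)] U(2) by (simp add: Un_absorb1)
 have "measure lebesgue (U - S) \<le> e'" using U(3,4) \<open>e' > 0\<close> by (simp add: emeasure_eq_measure2 ennreal_less_iff)
 moreover have "measure lebesgue U \<le> measure lebesgue S + measure lebesgue (U - S)"
  using measure_Un_le[of S lebesgue "U - S"] S U by (simp add: Un_absorb1 fmeasurable_def)
 ultimately have Ume: "measure lebesgue U \<le> measure lebesgue S + e'" by simp
 define K where "K = {(x, r). x \<in> S \<and> 0 < r \<and> cball x r \<subseteq> U}"
 have cov: "\<exists>i. i \<in> K \<and> x \<in> cball (fst i) (snd i) \<and> snd i < d" if "x \<in> S" "0 < d" for x d
 proof -
  have "x \<in> U" using U(2) that(1) by (rule subsetD)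
  then obtain r where r: "r > 0" "cball x r \<subseteq> U" using U(1) unfolding open_contains_cball by auto
  have "cball x (min r (d / 2)) \<subseteq> U" using r(2) by (meson min.cobounded1 order_trans subset_cball)
  then show ?thesis using that r by (intro exI[of _ "(x, min r (d / 2))"]) (auto simp: K_def)
 qed
 have Kpos: "0 < snd i" if "i \<in> K" for i using that by (auto simp: K_def)
 obtain C where C: "countable C" "C \<subseteq> K"
   "pairwise (\<lambda>i j. disjnt (cball (fst i) (snd i)) (cball (fst j) (snd j))) C"
   "negligible (S - (\<Union>i \<in> C. cball (fst i) (snd i)))"
  using Vitali_covering_theorem_cballs[of K snd S fst, OF Kpos cov] by blast
 let ?N = "S - (\<Union>i \<in> C. cball (fst i) (snd i))"
 have neg: "negligible (f ` ?N)"
 proof (rule negligible_locally_Lipschitz_image[OF _ C(4)])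
  show "\<exists>T B. open T \<and> x \<in> T \<and> (\<forall>y\<in>?N \<inter> T. norm (f y - f x) \<le> B * norm (y - x))" if "x \<in> ?N" for x
   using that lip by (intro exI[of _ UNIV] exI[of _ \<Lambda>]) auto
 qed (simp add: dim)
 define W where "W = (\<Union>i\<in>C. cball (f (fst i)) (\<Lambda> * snd i))"
 have bnd: "measure lebesgue (\<Union>i\<in>I. cball (f (fst i)) (\<Lambda> * snd i)) \<le> \<Lambda> ^ n * measure lebesgue U"
  if I: "I \<subseteq> C" "finite I" for I
 proof -
  have "measure lebesgue (\<Union>i\<in>I. cball (f (fst i)) (\<Lambda> * snd i)) \<le> (\<Sum>i\<in>I. measure lebesgue (cball (f (fst i)) (\<Lambda> * snd i)))"
   by (intro measure_UNION_le I) auto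
  also have "\<dots> = (\<Sum>i\<in>I. \<Lambda> ^ n * measure lebesgue (cball (fst i) (snd i)))"
  proof (intro sum.cong refl)
   fix i assume "i \<in> I"
   then have "snd i > 0" using I C(2) by (auto simp: K_def)
   then show "measure lebesgue (cball (f (fst i)) (\<Lambda> * snd i)) = \<Lambda> ^ n * measure lebesgue (cball (fst i) (snd i))"
    using \<open>\<Lambda> \<ge> 0\<close> by (simp add: content_cball n_def dim power_mult_distrib)
  qed
  also have "\<dots> = \<Lambda> ^ n * (\<Sum>i\<in>I. measure lebesgue (cball (fst i) (snd i)))" by (simp add: sum_distrib_left)
  also have "(\<Sum>i\<in>I. measure lebesgue (cball (fst i) (snd i))) = measure lebesgue (\<Union>i\<in>I. cball (fst i) (snd i))"
  proof (rule measure_negligible_finite_Union_image[symmetric])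
   show "pairwise (\<lambda>x y. negligible (cball (fst x) (snd x) \<inter> cball (fst y) (snd y))) I"
    using pairwise_subset[OF C(3) I(1)] by (rule pairwise_mono) (auto simp: disjnt_def)
  qed (use I in auto)
  also have "\<dots> \<le> measure lebesgue U"
  proof (rule measure_mono_fmeasurable[OF _ _ Um])
   show "(\<Union>i\<in>I. cball (fst i) (snd i)) \<subseteq> U"
   proof (rule UN_least)
    fix i assume "i \<in> I"
    then have "i \<in> K" using I C(2) by blast
    then show "cball (fst i) (snd i) \<subseteq> U" by (simp add: K_def split_beta)
   qed
  qed (use I in auto)
  finally show ?thesis using \<open>\<Lambda> \<ge> 0\<close> by (simp add: mult_left_mono)
 qed
 have W: "W \<in> lmeasurable" "measure lebesgue W \<le> \<Lambda> ^ n * measure lebesgue U" unfolding W_def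
  by (rule fmeasurable_UN_bound[OF C(1) lmeasurable_cball bnd], assumption+)
   (rule measure_UN_bound[OF C(1) lmeasurable_cball bnd], assumption+)
 show ?thesis
 proof (intro exI conjI)
  have nm: "f ` ?N \<in> lmeasurable" using neg by (rule negligible_imp_measurable)
  show "W \<union> f ` ?N \<in> lmeasurable" by (rule fmeasurable.Un[OF W(1) nm])
  show "f ` S \<subseteq> W \<union> f ` ?N"
  proof
   fix y assume "y \<in> f ` S"
   then obtain x where x: "x \<in> S" "y = f x" by blast
   show "y \<in> W \<union> f ` ?N"
   proof (cases "x \<in> ?N")
    case False
    then obtain i where i: "i \<in> C" "x \<in> cball (fst i) (snd i)" using x by blast
    then have "fst i \<in> S" using C(2) by (auto simp: K_def)
    then have "norm (f (fst i) - f x) \<le> \<Lambda> * norm (fst i - x)" using lip x by blast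
    also have "\<dots> \<le> \<Lambda> * snd i" using i \<open>\<Lambda> \<ge> 0\<close> by (intro mult_left_mono) (auto simp: dist_norm)
    finally have "y \<in> cball (f (fst i)) (\<Lambda> * snd i)" by (simp add: x dist_norm)
    then show ?thesis using i by (auto simp: W_def)
   qed (use x in blast)
  qed
  have "measure lebesgue (W \<union> f ` ?N) \<le> measure lebesgue W + measure lebesgue (f ` ?N)"
   using W nm by (intro measure_Un_le) auto
  also have "\<dots> \<le> \<Lambda> ^ n * measure lebesgue U" using W(2) neg by (simp add: negligible_imp_measure0)
  also have "\<dots> \<le> \<Lambda> ^ n * (measure lebesgue S + e')" using Ume \<open>\<Lambda> \<ge> 0\<close> by (intro mult_left_mono) auto
  also have "\<Lambda> ^ n * e' \<le> e" using pos \<open>e > 0\<close> by (simp add: e'_def field_simps)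
  then have "\<Lambda> ^ n * (measure lebesgue S + e') \<le> \<Lambda> ^ n * measure lebesgue S + e" by (simp add: distrib_left)
  finally show "measure lebesgue (W \<union> f ` ?N) \<le> \<Lambda> ^ DIM('a) * measure lebesgue S + e" by (simp add: n_def)
 qed
qed

lemma lipschitz_image_measure:
 fixes f :: "'a::euclidean_space => 'b::euclidean_space"
 assumes dim: "DIM('a) = DIM('b)" and S: "S \<in> lmeasurable" and "\<Lambda> \<ge> 0"
  and lip: "\<And>x y. x \<in> S ==> y \<in> S ==> norm (f x - f y) \<le> \<Lambda> * norm (x - y)"
  and A: "A \<in> sets lebesgue" "A \<subseteq> f ` S"
 shows "emeasure lebesgue A \<le> ennreal (\<Lambda> ^ DIM('a)) * emeasure lebesgue S"
proof -
 have "emeasure lebesgue A \<le> ennreal (\<Lambda> ^ DIM('a) * measure lebesgue S) + ennreal e" if e: "e > 0" for e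
 proof -
  obtain T where T: "T \<in> lmeasurable" "f ` S \<subseteq> T" "measure lebesgue T \<le> \<Lambda> ^ DIM('a) * measure lebesgue S + e"
   using lipschitz_image_outer[OF dim S \<open>\<Lambda> \<ge> 0\<close> e lip] by blast
  have "emeasure lebesgue A \<le> emeasure lebesgue T" using A T by (intro emeasure_mono) (auto simp: fmeasurable_def)
  also have "\<dots> = ennreal (measure lebesgue T)" using T(1) by (simp add: emeasure_eq_measure2)
  also have "\<dots> \<le> ennreal (\<Lambda> ^ DIM('a) * measure lebesgue S + e)" using T(3) by (rule ennreal_leI)
  finally show ?thesis using e \<open>\<Lambda> \<ge> 0\<close> by (simp add: ennreal_plus[symmetric] del: ennreal_plus)
 qed
 then have "emeasure lebesgue A \<le> ennreal (\<Lambda> ^ DIM('a) * measure lebesgue S)" by (rule ennreal_le_epsilon)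
 also have "\<dots> = ennreal (\<Lambda> ^ DIM('a)) * emeasure lebesgue S"
  using S \<open>\<Lambda> \<ge> 0\<close> by (simp add: ennreal_mult emeasure_eq_measure2)
 finally show ?thesis .
qed

subsection \<open>Tubular neighbourhoods\<close>

lemma plane_orthonormal_expansion:
 fixes T n v :: R2
 assumes "norm T = 1" "norm n = 1" "n \<bullet> T = 0"
 shows "v = (v \<bullet> T) *\<^sub>R T + (v \<bullet> n) *\<^sub>R n"
proof -
 define a b c d where abcd: "a = T $ 1" "b = T $ 2" "c = n $ 1" "d = n $ 2"
 have 1: "a * a + b * b = 1" "c * c + d * d = 1" "a * c + b * d = 0"
  using assms by (simp_all add: abcd norm_eq_1 inner_vec_def UNIV_2 mult.commute)
 \<comment> \<open>The determinant of the frame, that is its orientation sign; it expresses the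
   normal as D times the rotated tangent.\<close>
 define D where "D = a * d - b * c"
 have D: "D * D = 1" using 1 unfolding D_def by algebra
 have c: "c = - b * D" "d = a * D" using 1 unfolding D_def by algebra+
 have "v $ 1 = (v $ 1 * a + v $ 2 * b) * a + (v $ 1 * c + v $ 2 * d) * c"
  "v $ 2 = (v $ 1 * a + v $ 2 * b) * b + (v $ 1 * c + v $ 2 * d) * d" unfolding c using 1(1) D by algebra+
 then show ?thesis by (simp add: vec_eq_iff forall_2 inner_vec_def UNIV_2 abcd)
qed

text \<open>The curve is parametrised by arc length on the whole line, periodically, so that no seam
  appears in derivatives. The field \<open>n\<close> is any Lipschitz unit normal, not yet the
  outward one: the locale is first instantiated with the rotated tangent in order to find out which
  side is outside.\<close>

locale tube_curve =
 fixes \<gamma> n T :: "real => R2" and L M \<beta> :: real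
 assumes L_pos: "L > 0" and M_pos: "M > 0" and \<beta>_pos: "\<beta> > 0"
  and per: "\<gamma> (s + L) = \<gamma> s" and per_n: "n (s + L) = n s"
  and deriv: "(\<gamma> has_vector_derivative T s) (at s)"
  and norm_T: "norm (T s) = 1" and norm_n: "norm (n s) = 1" and n_T: "n s \<bullet> T s = 0"
  and Lip_T: "norm (T s - T t) \<le> M * \<bar>s - t\<bar>"
  and Lip_n: "norm (n s - n t) \<le> M * \<bar>s - t\<bar>"
  and sep0: "s \<in> {0..<L} ==> s' \<in> {0..<L} ==> \<gamma> s + t *\<^sub>R n s = \<gamma> s' + t' *\<^sub>R n s'
   ==> \<bar>t\<bar> < \<beta> ==> \<bar>t'\<bar> < \<beta> ==> s = s' \<and> t = t'"
begin

definition \<Sigma> where "\<Sigma> = \<gamma> ` {0..L}"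

definition \<Phi> :: "real \<times> real => R2" where "\<Phi> p = \<gamma> (fst p) + snd p *\<^sub>R n (fst p)"

lemma period_nat: "\<gamma> (s + real k * L) = \<gamma> s \<and> n (s + real k * L) = n s"
proof (induction k)
 case (Suc k)
 have "s + real (Suc k) * L = (s + real k * L) + L" by (simp add: algebra_simps)
 then show ?case using Suc per per_n by metis
qed simp

lemma period_int: "\<gamma> (s + of_int k * L) = \<gamma> s \<and> n (s + of_int k * L) = n s"
proof (cases "k \<ge> 0")
 case True
 then show ?thesis using period_nat[of s "nat k"] by simp
next
 case False
 then show ?thesis using period_nat[of "s + of_int k * L" "nat (- k)"] by simp
qed

lemma reduce: "\<exists>s'\<in>{0..<L}. \<gamma> s = \<gamma> s' \<and> n s = n s'"
proof (rule bexI)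
 define k where "k = \<lfloor>s / L\<rfloor>"
 show "\<gamma> s = \<gamma> (s + of_int (- k) * L) \<and> n s = n (s + of_int (- k) * L)" using period_int by presburger
 have "of_int k \<le> s / L" "s / L < of_int k + 1" unfolding k_def by linarith+
 then have "of_int k * L \<le> s" "s < (of_int k + 1) * L" using L_pos by (auto simp: field_simps)
 then show "s + of_int (- k) * L \<in> {0..<L}" by (simp add: algebra_simps)
qed

lemma inj: "inj_on \<gamma> {0..<L}" using sep0[of _ _ 0 0] \<beta>_pos by (intro inj_onI) simp

lemma sep:
 assumes "\<gamma> s + t *\<^sub>R n s = \<gamma> s' + t' *\<^sub>R n s'" "\<bar>t\<bar> < \<beta>" "\<bar>t'\<bar> < \<beta>"
 shows "\<gamma> s = \<gamma> s' \<and> t = t'"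
proof -
 obtain r r' where r: "r \<in> {0..<L}" "\<gamma> s = \<gamma> r" "n s = n r" "r' \<in> {0..<L}" "\<gamma> s' = \<gamma> r'" "n s' = n r'"
  using reduce[of s] reduce[of s'] by blast
 then show ?thesis using sep0[of r r' t t'] assms by simp
qed

lemma \<gamma>_continuous: "continuous_on S \<gamma>"
 using deriv by (meson continuous_at_imp_continuous_on has_vector_derivative_continuous)

lemma n_continuous: "continuous_on S n"
proof -
 have "M-lipschitz_on S n" using M_pos Lip_n by (intro lipschitz_onI) (auto simp: dist_norm)
 then show ?thesis by (rule lipschitz_on_continuous_on)
qed

lemma \<Sigma>_compact: "compact \<Sigma>" unfolding \<Sigma>_def using \<gamma>_continuous by (intro compact_continuous_image) auto

lemma \<gamma>_in_\<Sigma>: "\<gamma> s \<in> \<Sigma>" using reduce[of s] by (auto simp: \<Sigma>_def)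

lemma \<Sigma>_nonempty: "\<Sigma> \<noteq> {}" using \<gamma>_in_\<Sigma> by blast

lemma \<gamma>_taylor: "norm (\<gamma> s - \<gamma> t - (s - t) *\<^sub>R T t) \<le> M * (s - t)\<^sup>2"
proof -
 define g where "g r = \<gamma> r - r *\<^sub>R T t" for r
 let ?I = "{min s t..max s t}"
 have "norm (g s - g t) \<le> (M * \<bar>s - t\<bar>) * norm (s - t)"
 proof (rule differentiable_bound[of ?I])
  fix r assume r: "r \<in> ?I"
  have "(g has_vector_derivative (T r - T t)) (at r)" unfolding g_def by (auto intro!: derivative_eq_intros deriv)
  then show "(g has_derivative (\<lambda>h. h *\<^sub>R (T r - T t))) (at r within ?I)"
   by (simp add: has_vector_derivative_def has_derivative_at_withinI)
  show "onorm (\<lambda>h. h *\<^sub>R (T r - T t)) \<le> M * \<bar>s - t\<bar>"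
  proof (rule onorm_le)
   fix h :: real
   have "norm (T r - T t) \<le> M * \<bar>r - t\<bar>" by (rule Lip_T)
   also have "\<dots> \<le> M * \<bar>s - t\<bar>" using r M_pos by (intro mult_left_mono) auto
   finally show "norm (h *\<^sub>R (T r - T t)) \<le> M * \<bar>s - t\<bar> * norm h" by (simp add: mult.commute mult_left_mono)
  qed
 qed auto
 moreover have "g s - g t = \<gamma> s - \<gamma> t - (s - t) *\<^sub>R T t" by (simp add: g_def algebra_simps)
 ultimately show ?thesis by (simp add: power2_eq_square mult.assoc)
qed

text \<open>At a nearest point the squared distance along the curve is minimal, so its derivative
  vanishes; then x - \<gamma> s is orthogonal to the tangent and hence a multiple of the
  normal.\<close>

lemma nearest_point:
 assumes "infdist x \<Sigma> < \<beta>"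
 shows "\<exists>s t. x = \<Phi> (s, t) \<and> \<bar>t\<bar> = infdist x \<Sigma>"
proof -
 obtain y where y: "y \<in> \<Sigma>" "infdist x \<Sigma> = dist x y"
  using infdist_attains_inf[OF compact_imp_closed[OF \<Sigma>_compact] \<Sigma>_nonempty] by metis
 then obtain s where s: "y = \<gamma> s" by (auto simp: \<Sigma>_def)
 define f where "f r = (x - \<gamma> r) \<bullet> (x - \<gamma> r)" for r
 have min: "f s \<le> f r" for r
 proof -
  have "dist x y \<le> dist x (\<gamma> r)" using infdist_le[OF \<gamma>_in_\<Sigma>, of x r] y by simp
  then show ?thesis by (simp add: f_def s dist_norm power2_norm_eq_inner[symmetric] power_mono)
 qed
 have "(\<gamma> has_derivative (\<lambda>h. h *\<^sub>R T s)) (at s)" using deriv by (simp add: has_vector_derivative_def)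
 then have "(f has_derivative (\<lambda>h. - 2 * h * ((x - \<gamma> s) \<bullet> T s))) (at s)"
  unfolding f_def by (auto intro!: derivative_eq_intros simp: algebra_simps inner_commute)
 then have "(f has_real_derivative (- 2 * ((x - \<gamma> s) \<bullet> T s))) (at s)"
  unfolding has_field_derivative_def by (rule has_derivative_eq_rhs) (simp add: fun_eq_iff)
 then have "- 2 * ((x - \<gamma> s) \<bullet> T s) = 0" by (rule DERIV_local_min[of _ _ _ 1]) (use min in auto)
 then have T0: "(x - \<gamma> s) \<bullet> T s = 0" by simp
 define c where "c = (x - \<gamma> s) \<bullet> n s"
 have c: "x - \<gamma> s = c *\<^sub>R n s"
  using plane_orthonormal_expansion[OF norm_T norm_n n_T, of "x - \<gamma> s" s] unfolding T0 c_def by simp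
 have "norm (x - \<gamma> s) = \<bar>c\<bar>" unfolding c by (simp add: norm_n)
 moreover have "x = \<Phi> (s, c)" unfolding \<Phi>_def by (simp flip: c)
 ultimately show ?thesis using y(2) by (auto simp: s dist_norm)
qed

text \<open>The nearest point provides a second representation \<Phi> (s', t') with |t'| equal to
  the distance; injectivity of the tubular map forces t' = t. Tubes defined by normals thus coincide
  with metric neighbourhoods.\<close>

lemma infdist_\<Phi>:
 assumes "\<bar>t\<bar> < \<beta>"
 shows "infdist (\<Phi> (s, t)) \<Sigma> = \<bar>t\<bar>"
proof -
 have "infdist (\<Phi> (s, t)) \<Sigma> \<le> dist (\<Phi> (s, t)) (\<gamma> s)" by (rule infdist_le[OF \<gamma>_in_\<Sigma>])
 also have "\<dots> = \<bar>t\<bar>" by (simp add: \<Phi>_def dist_norm norm_n)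
 finally have "infdist (\<Phi> (s, t)) \<Sigma> < \<beta>" using assms by simp
 then obtain s' t' where "\<Phi> (s, t) = \<Phi> (s', t')" "\<bar>t'\<bar> = infdist (\<Phi> (s, t)) \<Sigma>" using nearest_point by blast
 moreover from this have "\<bar>t'\<bar> < \<beta>" using \<open>infdist (\<Phi> (s, t)) \<Sigma> < \<beta>\<close> by simp
 ultimately show ?thesis using sep[of s t s' t'] assms by (auto simp: \<Phi>_def)
qed

definition tub :: "real => R2 set" where "tub e = {x. infdist x \<Sigma> < e}"

lemma tub_open: "open (tub e)" unfolding tub_def by (intro open_Collect_less continuous_intros)

lemma \<Phi>_in_tub: "\<bar>t\<bar> < e ==> e \<le> \<beta> ==> \<Phi> (s, t) \<in> tub e" by (simp add: tub_def infdist_\<Phi>)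

lemma tub_eq: "e \<le> \<beta> ==> tub e = \<Phi> ` ({0..<L} \<times> {-e<..<e})"
proof (intro equalityI subsetI)
 fix x assume e: "e \<le> \<beta>" and "x \<in> tub e"
 then obtain s t where st: "x = \<Phi> (s, t)" "\<bar>t\<bar> = infdist x \<Sigma>" using nearest_point by (force simp: tub_def)
 obtain s' where "s' \<in> {0..<L}" "\<gamma> s = \<gamma> s'" "n s = n s'" using reduce by blast
 then have "x = \<Phi> (s', t)" "(s', t) \<in> {0..<L} \<times> {-e<..<e}" using st \<open>x \<in> tub e\<close> by (auto simp: \<Phi>_def tub_def)
 then show "x \<in> \<Phi> ` ({0..<L} \<times> {-e<..<e})" by blast
next
 fix x assume "e \<le> \<beta>" "x \<in> \<Phi> ` ({0..<L} \<times> {-e<..<e})"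
 then show "x \<in> tub e" by (auto intro!: \<Phi>_in_tub)
qed

lemma \<Phi>_inj: "inj_on \<Phi> ({0..<L} \<times> {-\<beta><..<\<beta>})"
proof (rule inj_onI)
 fix p q assume p: "p \<in> {0..<L} \<times> {-\<beta><..<\<beta>}" "q \<in> {0..<L} \<times> {-\<beta><..<\<beta>}" "\<Phi> p = \<Phi> q"
 then have "\<gamma> (fst p) = \<gamma> (fst q) \<and> snd p = snd q"
  using sep[of "fst p" "snd p" "fst q" "snd q"] by (auto simp: \<Phi>_def abs_less_iff mem_Times_iff)
 then show "p = q" using p inj_onD[OF inj, of "fst p" "fst q"] by (auto simp: prod_eq_iff mem_Times_iff)
qed

text \<open>Federer's inequality for sets of positive reach: a ball of radius |t| < \<beta> around
  \<gamma> s + t n contains no curve point in its interior. Expanding the square gives the bound for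
  each such t, in both directions of the normal, and t tends to \<beta>.\<close>

lemma reach: "2 * \<beta> * \<bar>n s \<bullet> (\<gamma> s' - \<gamma> s)\<bar> \<le> (norm (\<gamma> s' - \<gamma> s))\<^sup>2"
proof -
 let ?d = "\<gamma> s' - \<gamma> s"
 have *: "2 * t * (n s \<bullet> ?d) \<le> (norm ?d)\<^sup>2" if "\<bar>t\<bar> < \<beta>" for t
 proof -
  have "\<bar>t\<bar> \<le> dist (\<Phi> (s, t)) (\<gamma> s')" using infdist_le[OF \<gamma>_in_\<Sigma>, of "\<Phi> (s, t)" s'] infdist_\<Phi>[OF that] by simp
  then have "t\<^sup>2 \<le> (norm (t *\<^sub>R n s - ?d))\<^sup>2"
   by (simp add: \<Phi>_def dist_norm algebra_simps abs_le_square_iff[symmetric])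
  also have "\<dots> = t\<^sup>2 - 2 * t * (n s \<bullet> ?d) + (norm ?d)\<^sup>2" using norm_n[of s] unfolding power2_norm_eq_inner
   by (simp add: inner_diff_left inner_diff_right inner_commute norm_eq_1 power2_eq_square algebra_simps)
  finally show ?thesis by simp
 qed
 have *: "2 * t * \<bar>n s \<bullet> ?d\<bar> \<le> (norm ?d)\<^sup>2" if "t < \<beta>" "t \<ge> 0" for t
  using *[of t] *[of "- t"] that by (cases "n s \<bullet> ?d \<ge> 0") auto
 then have **: "2 * (c * \<beta>) * \<bar>n s \<bullet> ?d\<bar> \<le> (norm ?d)\<^sup>2" if "0 < c" "c < 1" for c using that \<beta>_pos by (intro *) auto
 then have "c * (2 * \<beta> * \<bar>n s \<bullet> ?d\<bar>) \<le> (norm ?d)\<^sup>2" if "0 < c" "c < 1" for c using **[OF that] by (simp add: mult_ac)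
 then show ?thesis by (rule field_le_mult_one_interval)
qed

text \<open>The nearest point projection is Lipschitz on smaller tubes. In the inner product of the
  two differences the normal offsets contribute at most e/\<beta> times |\<gamma> s - \<gamma>
  s'|^2, by \<open>reach\<close> at both foot points; Cauchy-Schwarz finishes.\<close>

lemma foot_lipschitz:
 assumes "\<bar>t\<bar> \<le> e" "\<bar>t'\<bar> \<le> e" "e < \<beta>"
 shows "(1 - e / \<beta>) * norm (\<gamma> s - \<gamma> s') \<le> norm (\<Phi> (s, t) - \<Phi> (s', t'))"
proof (cases "\<gamma> s = \<gamma> s'")
 case False
 let ?y = "\<gamma> s - \<gamma> s'" and ?x = "\<Phi> (s, t) - \<Phi> (s', t')"
 have r: "\<bar>n s \<bullet> ?y\<bar> \<le> (norm ?y)\<^sup>2 / (2 * \<beta>)" "\<bar>n s' \<bullet> ?y\<bar> \<le> (norm ?y)\<^sup>2 / (2 * \<beta>)"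
 proof -
  have "n s \<bullet> ?y = - (n s \<bullet> (\<gamma> s' - \<gamma> s))" by (simp add: inner_diff_right)
  then show "\<bar>n s \<bullet> ?y\<bar> \<le> (norm ?y)\<^sup>2 / (2 * \<beta>)"
   using reach[of s s'] \<beta>_pos by (simp add: norm_minus_commute field_simps)
  show "\<bar>n s' \<bullet> ?y\<bar> \<le> (norm ?y)\<^sup>2 / (2 * \<beta>)" using reach[of s' s] \<beta>_pos by (simp add: field_simps)
 qed
 have "\<bar>t * (n s \<bullet> ?y)\<bar> \<le> e * ((norm ?y)\<^sup>2 / (2 * \<beta>))" "\<bar>t' * (n s' \<bullet> ?y)\<bar> \<le> e * ((norm ?y)\<^sup>2 / (2 * \<beta>))"
  unfolding abs_mult using mult_mono[OF assms(1) r(1)] mult_mono[OF assms(2) r(2)] assms(1) by auto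
 moreover have "e * ((norm ?y)\<^sup>2 / (2 * \<beta>)) + e * ((norm ?y)\<^sup>2 / (2 * \<beta>)) = (norm ?y)\<^sup>2 * (e / \<beta>)"
  by (simp add: field_simps)
 moreover have "?x \<bullet> ?y = (norm ?y)\<^sup>2 + t * (n s \<bullet> ?y) - t' * (n s' \<bullet> ?y)"
  unfolding power2_norm_eq_inner \<Phi>_def by (simp add: inner_diff_left inner_add_left)
 ultimately have "(norm ?y)\<^sup>2 - (norm ?y)\<^sup>2 * (e / \<beta>) \<le> ?x \<bullet> ?y" by linarith
 also have "\<dots> \<le> norm ?x * norm ?y" by (rule norm_cauchy_schwarz)
 finally have "norm ?y * ((1 - e / \<beta>) * norm ?y) \<le> norm ?y * norm ?x" by (simp add: power2_eq_square algebra_simps)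
 then show ?thesis using False by simp
qed simp

text \<open>The linearisation \<open>A\<close> in the orthonormal frame at s' is an exact isometry.
  The deviation consists of the second order error of the curve and of t (n s - n s'); each is at
  most M e |s - s'|. Smallness of |s - s'| is needed, so this is a statement about short
  pieces.\<close>

lemma \<Phi>_near_isometry:
 assumes "\<bar>s - s'\<bar> \<le> e" "\<bar>t\<bar> \<le> e"
 shows "\<bar>norm (\<Phi> (s, t) - \<Phi> (s', t')) - norm ((s, t) - (s', t'))\<bar> \<le> 2 * M * e * norm ((s, t) - (s', t'))"
proof -
 define A where "A = (s - s') *\<^sub>R T s' + (t - t') *\<^sub>R n s'"
 have "(norm A)\<^sup>2 = (s - s')\<^sup>2 + (t - t')\<^sup>2" unfolding A_def power2_norm_eq_inner
  using norm_T[of s'] norm_n[of s'] n_T[of s']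
  by (simp add: inner_add_left inner_add_right norm_eq_1 inner_commute power2_eq_square)
 then have A: "norm A = norm ((s, t) - (s', t'))" by (simp add: norm_Pair real_sqrt_unique)
 have "e \<ge> 0" using assms(2) by simp
 have s: "\<bar>s - s'\<bar> \<le> norm ((s, t) - (s', t'))" using norm_fst_le[of "s - s'" "t - t'"] by simp
 have "\<Phi> (s, t) - \<Phi> (s', t') - A = (\<gamma> s - \<gamma> s' - (s - s') *\<^sub>R T s') + t *\<^sub>R (n s - n s')"
  by (simp add: \<Phi>_def A_def algebra_simps)
 also have "norm \<dots> \<le> norm (\<gamma> s - \<gamma> s' - (s - s') *\<^sub>R T s') + norm (t *\<^sub>R (n s - n s'))" by (rule norm_triangle_ineq)
 also have "\<dots> \<le> M * (s - s')\<^sup>2 + e * (M * \<bar>s - s'\<bar>)" using \<gamma>_taylor[of s s'] Lip_n[of s s'] assms(2) \<open>e \<ge> 0\<close>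
  by (intro add_mono) (auto intro!: mult_mono)
 also have "\<dots> \<le> M * (e * \<bar>s - s'\<bar>) + e * (M * \<bar>s - s'\<bar>)"
 proof -
  have "(s - s')\<^sup>2 = \<bar>s - s'\<bar> * \<bar>s - s'\<bar>" by (simp add: power2_eq_square)
  also have "\<dots> \<le> e * \<bar>s - s'\<bar>" using assms(1) by (intro mult_right_mono) auto
  finally show ?thesis using M_pos by simp
 qed
 also have "\<dots> = 2 * M * e * \<bar>s - s'\<bar>" by simp
 also have "\<dots> \<le> 2 * M * e * norm ((s, t) - (s', t'))" using s M_pos \<open>e \<ge> 0\<close> by (intro mult_left_mono) auto
 finally have "norm (\<Phi> (s, t) - \<Phi> (s', t') - A) \<le> 2 * M * e * norm ((s, t) - (s', t'))" .
 then show ?thesis unfolding A[symmetric] using norm_triangle_ineq3[of "\<Phi> (s, t) - \<Phi> (s', t')" A] by simp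
qed

lemma \<Phi>_continuous: "continuous_on S \<Phi>" unfolding \<Phi>_def
 by (intro continuous_intros continuous_on_compose2[OF \<gamma>_continuous[of UNIV]] continuous_on_compose2[OF n_continuous[of UNIV]]) auto

end

section \<open>Lebesgue measure in tubular coordinates\<close>

context tube_curve
begin

definition Q :: "real => (real \<times> real) set" where "Q e = {0..<L} \<times> {-e<..<e}"

lemma Q_borel: "Q e \<in> sets borel" unfolding Q_def by (intro borel_Times) auto

lemma \<Phi>_borel: "\<Phi> \<in> borel_measurable borel" by (rule borel_measurable_continuous_onI[OF \<Phi>_continuous])

text \<open>The half-open rectangle is a countable union of compact rectangles, and continuous
  images of compact sets are Borel.\<close>

lemma \<Phi>_piece_borel: "\<Phi> ` ({a..<b} \<times> {-e<..<e}) \<in> sets borel"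
proof -
 define C where "C k = {a..b - 1 / real (Suc k)} \<times> {-e + 1 / real (Suc k)..e - 1 / real (Suc k)}" for k
 have "{a..<b} \<times> {-e<..<e} = (\<Union>k. C k)"
 proof (intro equalityI subsetI)
  fix p assume p: "p \<in> {a..<b} \<times> {-e<..<e}"
  define d where "d = min (b - fst p) (min (snd p + e) (e - snd p))"
  have "d > 0" using p by (auto simp: d_def)
  then obtain k where "1 / real (Suc k) < d" using nat_approx_posE by metis
  then have "p \<in> C k" using p by (auto simp: C_def d_def)
  then show "p \<in> (\<Union>k. C k)" by blast
 next
  fix p assume "p \<in> (\<Union>k. C k)"
  then obtain k where "p \<in> C k" by blast
  then have "\<exists>d>0. p \<in> {a..b - d} \<times> {-e + d..e - d}" by (intro exI[of _ "1 / real (Suc k)"]) (simp add: C_def)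
  then show "p \<in> {a..<b} \<times> {-e<..<e}" by auto
 qed
 then have "\<Phi> ` ({a..<b} \<times> {-e<..<e}) = (\<Union>k. \<Phi> ` C k)" by blast
 also have "\<dots> \<in> sets borel"
 proof (intro sets.countable_UN, safe)
  fix k
  have "compact (\<Phi> ` C k)" unfolding C_def by (intro compact_continuous_image \<Phi>_continuous compact_Times) auto
  then show "\<Phi> ` C k \<in> sets borel" by (simp add: borel_compact)
 qed
 finally show ?thesis .
qed

text \<open>The coordinate strip is cut into pieces of arc length \<open>e\<close>, on each of which
  \<Phi> has Lipschitz constant 1 + x and its inverse 1/(1 - x), where x = 2 M e. In dimension two
  this gives squared factors, and countable additivity reassembles the pieces.\<close>

lemma tube_measure:
 assumes e: "0 < e" "e \<le> \<beta>" "2 * M * e < 1" and A: "A \<in> sets borel"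
 shows "emeasure lborel (A \<inter> tub e) \<le> ennreal ((1 + 2 * M * e)\<^sup>2) * emeasure lborel (\<Phi> -` A \<inter> Q e)"
  and "ennreal ((1 - 2 * M * e)\<^sup>2) * emeasure lborel (\<Phi> -` A \<inter> Q e) \<le> emeasure lborel (A \<inter> tub e)"
proof -
 define x where "x = 2 * M * e"
 have x: "0 < x" "x < 1" using e M_pos by (auto simp: x_def)
 \<comment> \<open>The length \<open>e\<close> matches the half width \<open>e\<close>, so the near
   isometry applies to any two points of a piece. Pieces beyond the period are empty, which permits
   summation over all naturals.\<close>
 define P where "P i = {real i * e..<min ((real i + 1) * e) L} \<times> {-e<..<e}" for i
 define E where "E i = \<Phi> -` A \<inter> P i" for i
 have Pb: "P i \<in> sets borel" for i unfolding P_def by (intro borel_Times) auto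
 have Eb: "E i \<in> sets borel" for i unfolding E_def using measurable_sets[OF \<Phi>_borel A] Pb by (intro sets.Int) auto
 have PQ: "P i \<subseteq> Q e" for i
 proof
  fix p assume p: "p \<in> P i"
  have "0 \<le> real i * e" using e(1) by simp
  moreover have "real i * e \<le> fst p" using p by (simp add: P_def mem_Times_iff)
  ultimately have "0 \<le> fst p" by linarith
  then show "p \<in> Q e" using p by (auto simp: P_def Q_def)
 qed
 have QP: "Q e = (\<Union>i. P i)"
 proof (intro equalityI subsetI)
  fix p assume p: "p \<in> Q e"
  define i where "i = nat \<lfloor>fst p / e\<rfloor>"
  have "fst p / e \<ge> 0" using p e by (auto simp: Q_def)
  then have "real i \<le> fst p / e" "fst p / e < real i + 1" unfolding i_def by linarith+
  then have "p \<in> P i" using p e(1) by (auto simp: P_def Q_def field_simps)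
  then show "p \<in> (\<Union>i. P i)" by blast
 qed (use PQ in blast)
 have disP: "disjoint_family P"
 proof -
  have "i = j" if "p \<in> P i" "p \<in> P j" for p i j
  proof -
   have "real i * e \<le> fst p" "real j * e \<le> fst p" "fst p < (real i + 1) * e" "fst p < (real j + 1) * e"
    using that by (simp_all add: P_def mem_Times_iff)
   then have "real i * e < (real j + 1) * e" "real j * e < (real i + 1) * e" by linarith+
   from mult_right_less_imp_less[OF this(1)] mult_right_less_imp_less[OF this(2)]
   have "real i < real j + 1" "real j < real i + 1" using e(1) by simp_all
   then show ?thesis by linarith
  qed
  then show ?thesis by (auto simp: disjoint_family_on_def)
 qed
 have Qsub: "Q e \<subseteq> {0..<L} \<times> {-\<beta><..<\<beta>}" using e(2) by (auto simp: Q_def)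
 have inj: "inj_on \<Phi> (Q e)" by (rule inj_on_subset[OF \<Phi>_inj Qsub])
 have imE: "\<Phi> ` E i = A \<inter> \<Phi> ` P i" for i by (auto simp: E_def)
 have im: "\<Phi> ` E i \<in> sets borel" for i unfolding imE using A \<Phi>_piece_borel by (intro sets.Int) (auto simp: P_def)
 have At: "A \<inter> tub e = (\<Union>i. \<Phi> ` E i)" unfolding imE tub_eq[OF e(2)] Q_def[symmetric] QP by blast
 have disI: "disjoint_family (\<lambda>i. \<Phi> ` E i)" unfolding disjoint_family_on_def
 proof safe
  fix i j :: nat and p q assume ij: "i \<noteq> j" and p: "p \<in> E i" "q \<in> E j" "\<Phi> p = \<Phi> q"
  then have "p = q" using inj_onD[OF inj p(3)] PQ by (auto simp: E_def)
  then show "\<Phi> p \<in> {}" using p disP ij by (auto simp: E_def disjoint_family_on_def)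
 qed
 have near: "\<bar>norm (\<Phi> p - \<Phi> q) - norm (p - q)\<bar> \<le> x * norm (p - q)" if "p \<in> P i" "q \<in> P i" for p q i
 proof -
  have *: "real i * e \<le> fst p" "fst p < real i * e + e" "real i * e \<le> fst q" "fst q < real i * e + e" "\<bar>snd p\<bar> \<le> e"
   using that by (auto simp: P_def algebra_simps)
  then have "\<bar>fst p - fst q\<bar> \<le> e" by linarith
  from \<Phi>_near_isometry[OF this *(5), of "snd q"] show ?thesis by (simp add: x_def)
 qed
 have El: "E i \<in> lmeasurable" for i
 proof -
  have "bounded (P i)" unfolding P_def by (intro bounded_Times) auto
  then have "bounded (E i)" by (rule bounded_subset) (auto simp: E_def)
  then show ?thesis using Eb by (intro bounded_set_imp_lmeasurable) auto
 qed
 have up: "emeasure lborel (\<Phi> ` E i) \<le> ennreal ((1 + x)\<^sup>2) * emeasure lborel (E i)" for i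
 proof -
  have "emeasure lebesgue (\<Phi> ` E i) \<le> ennreal ((1 + x) ^ DIM(real \<times> real)) * emeasure lebesgue (E i)"
  proof (rule lipschitz_image_measure[OF _ El])
   fix p q assume "p \<in> E i" "q \<in> E i"
   then show "norm (\<Phi> p - \<Phi> q) \<le> (1 + x) * norm (p - q)" using near[of p i q] by (auto simp: E_def distrib_right)
  qed (use x im in auto)
  then show ?thesis using im Eb by (simp add: power2_eq_square)
 qed
 have low: "ennreal ((1 - x)\<^sup>2) * emeasure lborel (E i) \<le> emeasure lborel (\<Phi> ` E i)" for i
 proof -
  define g where "g = inv_into (E i) \<Phi>"
  have injE: "inj_on \<Phi> (E i)" using inj by (rule inj_on_subset) (use PQ in \<open>auto simp: E_def\<close>)
  have g: "g (\<Phi> p) = p" if "p \<in> E i" for p using inv_into_f_f[OF injE that] by (simp add: g_def)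
  have Lip: "norm (g y - g z) \<le> 1 / (1 - x) * norm (y - z)" if yz: "y \<in> \<Phi> ` E i" "z \<in> \<Phi> ` E i" for y z
  proof -
   obtain p q where pq: "p \<in> E i" "q \<in> E i" "y = \<Phi> p" "z = \<Phi> q" using yz by blast
   then have "norm (p - q) - norm (y - z) \<le> x * norm (p - q)" using near[of p i q] by (auto simp: E_def)
   then have "(1 - x) * norm (p - q) \<le> norm (y - z)" by (simp add: left_diff_distrib)
   then show ?thesis using x(2) pq g by (simp add: field_simps)
  qed
  have bdd: "bounded (\<Phi> ` E i)"
  proof -
   have "\<Phi> ` E i \<subseteq> \<Phi> ` ({0..L} \<times> {-e..e})" using PQ by (force simp: E_def Q_def)
   moreover have "compact (\<Phi> ` ({0..L} \<times> {-e..e}))"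
    by (intro compact_continuous_image \<Phi>_continuous compact_Times) auto
   ultimately show ?thesis using bounded_subset compact_imp_bounded by blast
  qed
  have "emeasure lebesgue (E i) \<le> ennreal ((1 / (1 - x)) ^ DIM(R2)) * emeasure lebesgue (\<Phi> ` E i)"
  proof (rule lipschitz_image_measure[of "\<Phi> ` E i" _ g])
   show "\<Phi> ` E i \<in> lmeasurable" using bdd im by (intro bounded_set_imp_lmeasurable) auto
   show "E i \<subseteq> g ` \<Phi> ` E i" using g by force
  qed (use x Eb Lip in auto)
  then have "emeasure lborel (E i) \<le> ennreal ((1 / (1 - x))\<^sup>2) * emeasure lborel (\<Phi> ` E i)" using im Eb by simp
  then have "ennreal ((1 - x)\<^sup>2) * emeasure lborel (E i) \<le> ennreal ((1 - x)\<^sup>2) * (ennreal ((1 / (1 - x))\<^sup>2) * emeasure lborel (\<Phi> ` E i))"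
   by (intro mult_left_mono) auto
  also have "\<dots> = (ennreal ((1 - x)\<^sup>2 * (1 / (1 - x))\<^sup>2)) * emeasure lborel (\<Phi> ` E i)"
   by (simp add: ennreal_mult mult.assoc)
  also have "(1 - x)\<^sup>2 * (1 / (1 - x))\<^sup>2 = 1" using x by (simp add: power_divide)
  finally show ?thesis by simp
 qed
 have sumE: "emeasure lborel (\<Phi> -` A \<inter> Q e) = (\<Sum>i. emeasure lborel (E i))"
 proof -
  have "\<Phi> -` A \<inter> Q e = (\<Union>i. E i)" unfolding QP E_def by blast
  moreover have "disjoint_family E" using disP by (auto simp: disjoint_family_on_def E_def)
  ultimately show ?thesis using Eb suminf_emeasure[of E lborel] by (simp add: image_subset_iff)
 qed
 have sumI: "emeasure lborel (A \<inter> tub e) = (\<Sum>i. emeasure lborel (\<Phi> ` E i))"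
  unfolding At using im disI by (intro suminf_emeasure[symmetric]) auto
 show "emeasure lborel (A \<inter> tub e) \<le> ennreal ((1 + 2 * M * e)\<^sup>2) * emeasure lborel (\<Phi> -` A \<inter> Q e)"
  unfolding sumE sumI x_def[symmetric] ennreal_suminf_cmult[symmetric] by (intro suminf_le up) auto
 show "ennreal ((1 - 2 * M * e)\<^sup>2) * emeasure lborel (\<Phi> -` A \<inter> Q e) \<le> emeasure lborel (A \<inter> tub e)"
  unfolding sumE sumI x_def[symmetric] ennreal_suminf_cmult[symmetric] by (intro suminf_le low) auto
qed

text \<open>The set inequalities say that two measures are comparable, namely Lebesgue measure on
  the tube and the image under \<Phi> of Lebesgue measure on the strip. Integrals are monotone in
  the measure.\<close>

lemma tube_nn_integral:
 assumes e: "0 < e" "e \<le> \<beta>" "2 * M * e < 1" and f: "f \<in> borel_measurable borel"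
 shows "(\<integral>\<^sup>+x. f x * indicator (tub e) x \<partial>lborel) \<le> ennreal ((1 + 2 * M * e)\<^sup>2) * (\<integral>\<^sup>+p. f (\<Phi> p) * indicator (Q e) p \<partial>lborel)"
  and "ennreal ((1 - 2 * M * e)\<^sup>2) * (\<integral>\<^sup>+p. f (\<Phi> p) * indicator (Q e) p \<partial>lborel) \<le> (\<integral>\<^sup>+x. f x * indicator (tub e) x \<partial>lborel)"
proof -
 have tb: "tub e \<in> sets borel" using tub_open[of e] by simp
 define N1 where "N1 = density lborel (indicator (tub e) :: R2 => ennreal)"
 define N2 where "N2 = distr (density lborel (indicator (Q e) :: real \<times> real => ennreal)) borel \<Phi>"
 have \<Phi>m: "\<Phi> \<in> density lborel (indicator (Q e) :: real \<times> real => ennreal) \<rightarrow>\<^sub>M borel" using \<Phi>_borel by simp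
 have s: "sets N1 = sets borel" "sets N2 = sets borel" by (auto simp: N1_def N2_def)
 have sp: "space N1 = UNIV" "space N2 = UNIV" by (auto simp: N1_def N2_def)
 have e1: "emeasure N1 A = emeasure lborel (A \<inter> tub e)" if "A \<in> sets borel" for A
 proof -
  have "emeasure N1 A = (\<integral>\<^sup>+x. indicator (tub e) x * indicator A x \<partial>lborel)"
   unfolding N1_def by (rule emeasure_density) (use that tb in simp_all)
  also have "\<dots> = (\<integral>\<^sup>+x. indicator (A \<inter> tub e) x \<partial>lborel)" by (intro nn_integral_cong) (auto split: split_indicator)
  also have "\<dots> = emeasure lborel (A \<inter> tub e)" using that tb by (intro nn_integral_indicator) auto
  finally show ?thesis .
 qed
 have e2: "emeasure N2 A = emeasure lborel (\<Phi> -` A \<inter> Q e)" if A: "A \<in> sets borel" for A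
 proof -
  have m: "\<Phi> -` A \<in> sets borel" using measurable_sets[OF \<Phi>_borel A] by simp
  have "emeasure N2 A = emeasure (density lborel (indicator (Q e))) (\<Phi> -` A)"
   unfolding N2_def using A by (subst emeasure_distr[OF \<Phi>m]) auto
  also have "\<dots> = (\<integral>\<^sup>+x. indicator (Q e) x * indicator (\<Phi> -` A) x \<partial>lborel)"
   by (rule emeasure_density) (use m Q_borel[of e] in simp_all)
  also have "\<dots> = (\<integral>\<^sup>+x. indicator (\<Phi> -` A \<inter> Q e) x \<partial>lborel)"
   by (intro nn_integral_cong) (auto split: split_indicator)
  also have "\<dots> = emeasure lborel (\<Phi> -` A \<inter> Q e)" using m Q_borel[of e] by (intro nn_integral_indicator) auto
  finally show ?thesis .
 qed
 have i1: "nn_integral N1 f = (\<integral>\<^sup>+x. f x * indicator (tub e) x \<partial>lborel)"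
  unfolding N1_def using f tb by (subst nn_integral_density) (auto simp: mult.commute)
 have i2: "nn_integral N2 f = (\<integral>\<^sup>+p. f (\<Phi> p) * indicator (Q e) p \<partial>lborel)"
 proof -
  have "nn_integral N2 f = (\<integral>\<^sup>+p. f (\<Phi> p) \<partial>density lborel (indicator (Q e)))"
   unfolding N2_def using f by (subst nn_integral_distr[OF \<Phi>m]) auto
  also have "\<dots> = (\<integral>\<^sup>+p. indicator (Q e) p * f (\<Phi> p) \<partial>lborel)"
   using measurable_compose[OF \<Phi>_borel f] Q_borel[of e] by (subst nn_integral_density) auto
  finally show ?thesis by (simp add: mult.commute)
 qed
 have "N1 \<le> scale_measure (ennreal ((1 + 2 * M * e)\<^sup>2)) N2"
  using s sp tube_measure(1)[OF e] by (subst le_measure) (auto simp: e1 e2)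
 from nn_integral_mono_measure[OF _ this, of f]
 show "(\<integral>\<^sup>+x. f x * indicator (tub e) x \<partial>lborel) \<le> ennreal ((1 + 2 * M * e)\<^sup>2) * (\<integral>\<^sup>+p. f (\<Phi> p) * indicator (Q e) p \<partial>lborel)"
  using f s by (simp add: nn_integral_scale_measure i1 i2 cong: measurable_cong_sets)
 have "scale_measure (ennreal ((1 - 2 * M * e)\<^sup>2)) N2 \<le> N1"
  using s sp tube_measure(2)[OF e] by (subst le_measure) (auto simp: e1 e2)
 from nn_integral_mono_measure[OF _ this, of f]
 show "ennreal ((1 - 2 * M * e)\<^sup>2) * (\<integral>\<^sup>+p. f (\<Phi> p) * indicator (Q e) p \<partial>lborel) \<le> (\<integral>\<^sup>+x. f x * indicator (tub e) x \<partial>lborel)"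
  using f s by (simp add: nn_integral_scale_measure i1 i2 cong: measurable_cong_sets)
qed

lemma tube_integrable:
 fixes f :: "R2 => 'b::{banach, second_countable_topology}"
 assumes e: "0 < e" "e \<le> \<beta>" "2 * M * e < 1" and f: "f \<in> borel_measurable borel"
 shows "integrable lborel (\<lambda>x. indicator (tub e) x *\<^sub>R f x) \<longleftrightarrow> integrable lborel (\<lambda>p. indicator (Q e) p *\<^sub>R f (\<Phi> p))"
proof -
 have tb: "tub e \<in> sets borel" using tub_open[of e] by simp
 have fn: "(\<lambda>x. ennreal (norm (f x))) \<in> borel_measurable borel" using f by measurable
 have 1: "(\<integral>\<^sup>+x. ennreal (norm (indicator (tub e) x *\<^sub>R f x)) \<partial>lborel) = (\<integral>\<^sup>+x. ennreal (norm (f x)) * indicator (tub e) x \<partial>lborel)"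
  by (intro nn_integral_cong) (auto split: split_indicator)
 have 2: "(\<integral>\<^sup>+p. ennreal (norm (indicator (Q e) p *\<^sub>R f (\<Phi> p))) \<partial>lborel) = (\<integral>\<^sup>+p. ennreal (norm (f (\<Phi> p))) * indicator (Q e) p \<partial>lborel)"
  by (intro nn_integral_cong) (auto split: split_indicator)
 have m: "(\<lambda>x. indicator (tub e) x *\<^sub>R f x) \<in> borel_measurable lborel"
  "(\<lambda>p. indicator (Q e) p *\<^sub>R f (\<Phi> p)) \<in> borel_measurable lborel"
  using f tb Q_borel[of e] measurable_compose[OF \<Phi>_borel f] by auto
 have pos: "(1 - 2 * M * e)\<^sup>2 > 0" using e(3) by simp
 let ?a = "\<integral>\<^sup>+x. ennreal (norm (f x)) * indicator (tub e) x \<partial>lborel"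
 let ?b = "\<integral>\<^sup>+p. ennreal (norm (f (\<Phi> p))) * indicator (Q e) p \<partial>lborel"
 have "?a < \<infinity> \<longleftrightarrow> ?b < \<infinity>"
 proof
  assume "?b < \<infinity>"
  then have "ennreal ((1 + 2 * M * e)\<^sup>2) * ?b < \<infinity>" by (simp add: ennreal_mult_less_top)
  then show "?a < \<infinity>" using tube_nn_integral(1)[OF e fn] by (rule le_less_trans[rotated])
 next
  assume "?a < \<infinity>"
  then have "ennreal ((1 - 2 * M * e)\<^sup>2) * ?b < \<infinity>" using tube_nn_integral(2)[OF e fn] by (rule le_less_trans[rotated])
  then show "?b < \<infinity>" using pos by (auto simp: ennreal_mult_less_top)
 qed
 then show ?thesis unfolding integrable_iff_bounded 1 2 using m by blast
qed

lemma tube_integral_nonneg: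
 fixes f :: "R2 => real"
 assumes e: "0 < e" "e \<le> \<beta>" "2 * M * e < 1" and f: "f \<in> borel_measurable borel" "\<And>x. 0 \<le> f x"
  and i: "integrable lborel (\<lambda>p. indicator (Q e) p *\<^sub>R f (\<Phi> p))"
 shows "\<bar>(\<integral>x. indicator (tub e) x *\<^sub>R f x \<partial>lborel) - (\<integral>p. indicator (Q e) p *\<^sub>R f (\<Phi> p) \<partial>lborel)\<bar>
  \<le> 6 * M * e * (\<integral>p. indicator (Q e) p *\<^sub>R f (\<Phi> p) \<partial>lborel)"
  and "(\<integral>p. indicator (Q e) p *\<^sub>R f (\<Phi> p) \<partial>lborel) * (1 - 2 * M * e)\<^sup>2 \<le> (\<integral>x. indicator (tub e) x *\<^sub>R f x \<partial>lborel)"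
proof -
 let ?I = "\<integral>p. indicator (Q e) p *\<^sub>R f (\<Phi> p) \<partial>lborel" and ?J = "\<integral>x. indicator (tub e) x *\<^sub>R f x \<partial>lborel"
 have iJ: "integrable lborel (\<lambda>x. indicator (tub e) x *\<^sub>R f x)" using tube_integrable[OF e f(1)] i by blast
 have fn: "(\<lambda>x. ennreal (f x)) \<in> borel_measurable borel" using f by measurable
 have 1: "(\<integral>\<^sup>+x. ennreal (f x) * indicator (tub e) x \<partial>lborel) = ennreal ?J"
  using f(2) by (subst nn_integral_eq_integral[OF iJ, symmetric]) (auto intro!: nn_integral_cong split: split_indicator)
 have 2: "(\<integral>\<^sup>+p. ennreal (f (\<Phi> p)) * indicator (Q e) p \<partial>lborel) = ennreal ?I"
  using f(2) by (subst nn_integral_eq_integral[OF i, symmetric]) (auto intro!: nn_integral_cong split: split_indicator)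
 have I0: "?I \<ge> 0" and J0: "?J \<ge> 0" using f(2) by (auto intro!: Bochner_Integration.integral_nonneg)
 have u: "?J \<le> (1 + 2 * M * e)\<^sup>2 * ?I" and l: "(1 - 2 * M * e)\<^sup>2 * ?I \<le> ?J"
  using tube_nn_integral[OF e fn] unfolding 1 2 using I0 J0 by (simp_all flip: ennreal_mult)
 show "?I * (1 - 2 * M * e)\<^sup>2 \<le> ?J" using l by (simp add: mult.commute)
 define x where "x = 2 * M * e"
 have x: "0 < x" "x < 1" using e M_pos by (auto simp: x_def)
 have "x * x \<le> x" using x by (simp add: mult_left_le)
 \<comment> \<open>Linearised bounds: 3x = 6 M e is the relative error of the change of
   variables.\<close>
 then have xx: "(1 + x)\<^sup>2 \<le> 1 + 3 * x" "1 - 3 * x \<le> (1 - x)\<^sup>2" using x by (auto simp: power2_eq_square algebra_simps)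
 have "?J \<le> (1 + 3 * x) * ?I" using u mult_right_mono[OF xx(1) I0] by (simp add: x_def)
 moreover have "(1 - 3 * x) * ?I \<le> ?J" using l mult_right_mono[OF xx(2) I0] by (simp add: x_def)
 ultimately show "\<bar>?J - ?I\<bar> \<le> 6 * M * e * ?I" by (simp add: x_def algebra_simps abs_le_iff)
qed

lemma tube_integral_real:
 fixes f :: "R2 => real"
 assumes e: "0 < e" "e \<le> \<beta>" "2 * M * e < 1" and f: "f \<in> borel_measurable borel"
  and i: "integrable lborel (\<lambda>p. indicator (Q e) p *\<^sub>R f (\<Phi> p))"
 shows "\<bar>(\<integral>x. indicator (tub e) x *\<^sub>R f x \<partial>lborel) - (\<integral>p. indicator (Q e) p *\<^sub>R f (\<Phi> p) \<partial>lborel)\<bar>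
  \<le> 6 * M * e * (\<integral>p. indicator (Q e) p *\<^sub>R \<bar>f (\<Phi> p)\<bar> \<partial>lborel)"
proof -
 define g h where "g x = max 0 (f x)" and "h x = max 0 (- f x)" for x
 have gh: "f x = g x - h x" "\<bar>f x\<bar> = g x + h x" for x by (auto simp: g_def h_def)
 have m: "g \<in> borel_measurable borel" "h \<in> borel_measurable borel" unfolding g_def h_def using f by auto
 have nn: "0 \<le> g x" "0 \<le> h x" for x by (auto simp: g_def h_def)
 have "(\<lambda>p. indicator (Q e) p *\<^sub>R g (\<Phi> p)) = (\<lambda>p. max 0 (indicator (Q e) p *\<^sub>R f (\<Phi> p)))"
  "(\<lambda>p. indicator (Q e) p *\<^sub>R h (\<Phi> p)) = (\<lambda>p. max 0 (- (indicator (Q e) p *\<^sub>R f (\<Phi> p))))"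
  by (auto simp: g_def h_def indicator_def)
 then have ig: "integrable lborel (\<lambda>p. indicator (Q e) p *\<^sub>R g (\<Phi> p))" and ih: "integrable lborel (\<lambda>p. indicator (Q e) p *\<^sub>R h (\<Phi> p))"
  using i by (auto intro!: integrable_max)
 have jg: "integrable lborel (\<lambda>x. indicator (tub e) x *\<^sub>R g x)" and jh: "integrable lborel (\<lambda>x. indicator (tub e) x *\<^sub>R h x)"
  using tube_integrable[OF e] m ig ih by blast+
 show ?thesis using tube_integral_nonneg(1)[OF e m(1) nn(1) ig] tube_integral_nonneg(1)[OF e m(2) nn(2) ih]
  unfolding gh(2) unfolding gh(1) scaleR_diff_right scaleR_add_right
   Bochner_Integration.integral_diff[OF ig ih] Bochner_Integration.integral_add[OF ig ih]
   Bochner_Integration.integral_diff[OF jg jh] distrib_left by linarith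
qed

text \<open>Real and imaginary part each cost 6 M e, hence the factor 12.\<close>

lemma tube_integral:
 fixes f :: "R2 => complex"
 assumes e: "0 < e" "e \<le> \<beta>" "2 * M * e < 1" and f: "f \<in> borel_measurable borel"
  and i: "integrable lborel (\<lambda>p. indicator (Q e) p *\<^sub>R f (\<Phi> p))"
 shows "cmod ((\<integral>x. indicator (tub e) x *\<^sub>R f x \<partial>lborel) - (\<integral>p. indicator (Q e) p *\<^sub>R f (\<Phi> p) \<partial>lborel))
  \<le> 12 * M * e * (\<integral>p. indicator (Q e) p *\<^sub>R cmod (f (\<Phi> p)) \<partial>lborel)"
proof -
 let ?N = "\<integral>p. indicator (Q e) p *\<^sub>R cmod (f (\<Phi> p)) \<partial>lborel"
 let ?D = "(\<integral>x. indicator (tub e) x *\<^sub>R f x \<partial>lborel) - (\<integral>p. indicator (Q e) p *\<^sub>R f (\<Phi> p) \<partial>lborel)"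
 have j: "integrable lborel (\<lambda>x. indicator (tub e) x *\<^sub>R f x)" using tube_integrable[OF e f] i by blast
 have m: "(\<lambda>x. Re (f x)) \<in> borel_measurable borel" "(\<lambda>x. Im (f x)) \<in> borel_measurable borel"
  using f by (auto intro!: measurable_compose[OF f borel_measurable_continuous_onI] continuous_intros)
 have iN: "integrable lborel (\<lambda>p. indicator (Q e) p *\<^sub>R cmod (f (\<Phi> p)))" using integrable_norm[OF i] by simp
 have key: "\<bar>r ?D\<bar> \<le> 6 * M * e * ?N"
  if r: "bounded_linear r" "\<And>z. \<bar>r z\<bar> \<le> cmod z" "(\<lambda>x. r (f x)) \<in> borel_measurable borel" for r :: "complex => real"
 proof -
  interpret r: bounded_linear r by (rule r)
  have ir: "integrable lborel (\<lambda>p. indicator (Q e) p *\<^sub>R r (f (\<Phi> p)))"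
   using integrable_bounded_linear[OF r(1) i] by (simp add: r.scaleR)
  have "r ?D = (\<integral>x. indicator (tub e) x *\<^sub>R r (f x) \<partial>lborel) - (\<integral>p. indicator (Q e) p *\<^sub>R r (f (\<Phi> p)) \<partial>lborel)"
   using integral_bounded_linear[OF r(1) i] integral_bounded_linear[OF r(1) j] by (simp add: r.diff r.scaleR)
  then have "\<bar>r ?D\<bar> \<le> 6 * M * e * (\<integral>p. indicator (Q e) p *\<^sub>R \<bar>r (f (\<Phi> p))\<bar> \<partial>lborel)"
   using tube_integral_real[OF e r(3) ir] by simp
  also have "\<dots> \<le> 6 * M * e * ?N"
  proof (intro mult_left_mono Bochner_Integration.integral_mono iN)
   show "integrable lborel (\<lambda>p. indicator (Q e) p *\<^sub>R \<bar>r (f (\<Phi> p))\<bar>)"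
    using integrable_norm[OF ir] by (simp add: abs_mult)
  qed (use r(2) e M_pos in \<open>auto split: split_indicator\<close>)
  finally show ?thesis .
 qed
 have "cmod ?D \<le> \<bar>Re ?D\<bar> + \<bar>Im ?D\<bar>" by (rule cmod_le)
 also have "\<dots> \<le> 6 * M * e * ?N + 6 * M * e * ?N"
  by (intro add_mono key bounded_linear_Re bounded_linear_Im abs_Re_le_cmod abs_Im_le_cmod m)
 finally show ?thesis by simp
qed

end

subsection \<open>The two sides of the boundary curve\<close>

text \<open>Here the normal points outward in the strong sense that the two halves of the whole tube
  lie on the two sides of the curve. The geometric definition only speaks of small positive offsets,
  with a size depending on the point; \<open>tube_domain_exists\<close> bridges the gap.\<close>

locale tube_domain = tube_curve +
 fixes Oi :: "R2 set"
 assumes Oi_open: "open Oi" and Oi_bounded: "bounded Oi" and frontier_Oi: "frontier Oi = \<gamma> ` {0..L}"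
  and inside: "-\<beta> < t ==> t < 0 ==> \<gamma> s + t *\<^sub>R n s \<in> Oi"
  and outside: "0 < t ==> t < \<beta> ==> \<gamma> s + t *\<^sub>R n s \<notin> closure Oi"

definition rot :: "R2 => R2" where "rot v = vector [- v $ 2, v $ 1]"

lemma rot_simps: "norm (rot v) = norm v" "rot v \<bullet> v = 0" "rot v - rot w = rot (v - w)"
proof -
 have c: "rot v $ 1 = - v $ 2" "rot v $ 2 = v $ 1" for v by (simp_all add: rot_def)
 show "norm (rot v) = norm v" by (simp add: norm_vec_def L2_set_def UNIV_2 c add.commute)
 show "rot v \<bullet> v = 0" by (simp add: inner_vec_def UNIV_2 c)
 show "rot v - rot w = rot (v - w)" by (simp add: vec_eq_iff forall_2 c)
qed

text \<open>The given \<nu> is prescribed point by point with no continuity, so it is compared with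
  the rotated tangent \<open>n0\<close>, which is Lipschitz; the two agree up to a sign at each
  point. A connectedness argument for the two half tubes of \<open>n0\<close> shows that the sign is
  constant.\<close>

lemma tube_domain_exists:
 assumes C: "C11_domain Oi \<gamma> L" and N: "outward_normal Oi \<gamma> L \<nu>" and "\<beta> > 0"
  and I: "inj_on (\<lambda>p. fst p + snd p *\<^sub>R \<nu> (fst p)) (\<gamma> ` {0..L} \<times> {-\<beta><..<\<beta>})"
 obtains T M where "tube_domain \<gamma> (\<lambda>s. \<nu> (\<gamma> s)) T L M \<beta> Oi"
proof -
 define T where "T s = vector_derivative \<gamma> (at s)" for s
 define n0 where "n0 s = rot (T s)" for s
 obtain M0 where M0: "\<And>s t. norm (T s - T t) \<le> M0 * \<bar>s - t\<bar>" using C unfolding C11_domain_def T_def by blast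
 define M where "M = max M0 1"
 have L: "L > 0" and per: "\<And>s. \<gamma> (s + L) = \<gamma> s" and inj: "inj_on \<gamma> {0..<L}"
  and diff: "\<And>s. \<gamma> differentiable (at s)" and nT: "\<And>s. norm (T s) = 1"
  and fr: "frontier Oi = \<gamma> ` {0..L}" and op: "open Oi" and bd: "bounded Oi"
  using C unfolding C11_domain_def T_def by auto
 have der: "(\<gamma> has_vector_derivative T s) (at s)" for s unfolding T_def using diff vector_derivative_works by blast
 have perT: "T (s + L) = T s" for s
 proof -
  have "((\<lambda>r. r + L) has_vector_derivative 1) (at s)" by (auto intro!: derivative_eq_intros)
  from vector_diff_chain_at[OF this, of \<gamma> "T (s + L)"] der
  have "((\<lambda>r. \<gamma> (r + L)) has_vector_derivative (1 *\<^sub>R T (s + L))) (at s)" by (simp add: o_def)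
  then have "(\<gamma> has_vector_derivative T (s + L)) (at s)" by (simp add: per)
  then show ?thesis using der vector_derivative_unique_at by blast
 qed
 have LT: "norm (T s - T t) \<le> M * \<bar>s - t\<bar>" for s t
 proof -
  have "M0 * \<bar>s - t\<bar> \<le> M * \<bar>s - t\<bar>" by (intro mult_right_mono) (auto simp: M_def)
  then show ?thesis using M0[of s t] by linarith
 qed
 have nu: "norm (\<nu> (\<gamma> s)) = 1" "\<nu> (\<gamma> s) \<bullet> T s = 0" for s using N unfolding outward_normal_def T_def by auto
 have out: "\<exists>d>0. \<forall>t. 0 < t \<and> t < d --> \<gamma> s + t *\<^sub>R \<nu> (\<gamma> s) \<notin> closure Oi" for s
  using N unfolding outward_normal_def by blast
 have n0: "norm (n0 s) = 1" "n0 s \<bullet> T s = 0" for s unfolding n0_def using nT rot_simps by auto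
 have sgn: "\<exists>c. (c = 1 \<or> c = -1) \<and> \<nu> (\<gamma> s) = c *\<^sub>R n0 s" for s
 proof -
  define c where "c = \<nu> (\<gamma> s) \<bullet> n0 s"
  have e: "\<nu> (\<gamma> s) = c *\<^sub>R n0 s"
   using plane_orthonormal_expansion[OF nT[of s] n0(1)[of s] n0(2)[of s], of "\<nu> (\<gamma> s)"] nu by (simp add: c_def)
  have "\<bar>c\<bar> = 1" using nu(1)[of s] n0(1)[of s] unfolding e by simp
  then show ?thesis using e by (intro exI[of _ c]) auto
 qed
 \<comment> \<open>Stated for every field equal to \<nu> up to a sign: it is used for
   \<open>n0\<close> to open the tubular calculus and for \<nu> itself at the end.\<close>
 have sepg: "s = s' \<and> t = t'"
  if m: "\<And>r. \<exists>c. (c = 1 \<or> c = -1) \<and> m r = c *\<^sub>R \<nu> (\<gamma> r)"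
   and s: "s \<in> {0..<L}" "s' \<in> {0..<L}" "\<gamma> s + t *\<^sub>R m s = \<gamma> s' + t' *\<^sub>R m s'" "\<bar>t\<bar> < \<beta>" "\<bar>t'\<bar> < \<beta>"
  for m and s s' t t' :: real
 proof -
  obtain c c' where c: "c = 1 \<or> c = -1" "m s = c *\<^sub>R \<nu> (\<gamma> s)" "c' = 1 \<or> c' = -1" "m s' = c' *\<^sub>R \<nu> (\<gamma> s')"
   using m[of s] m[of s'] by blast
  have "(\<gamma> s, t * c) = (\<gamma> s', t' * c')"
  proof (rule inj_onD[OF I])
   show "fst (\<gamma> s, t * c) + snd (\<gamma> s, t * c) *\<^sub>R \<nu> (fst (\<gamma> s, t * c)) = fst (\<gamma> s', t' * c') + snd (\<gamma> s', t' * c') *\<^sub>R \<nu> (fst (\<gamma> s', t' * c'))"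
    using s(3) c by simp
  qed (use s c in auto)
  then have "\<gamma> s = \<gamma> s'" "t * c = t' * c'" by auto
  then have "s = s'" using inj_onD[OF inj] s by blast
  have "\<nu> (\<gamma> s) \<noteq> 0" using nu(1)[of s] by auto
  then have "c = c'" using c(2,4) \<open>s = s'\<close> by simp
  then show ?thesis using \<open>s = s'\<close> \<open>t * c = t' * c'\<close> c by auto
 qed
 have TC0: "tube_curve \<gamma> n0 T L M \<beta>"
 proof
  show "norm (n0 s - n0 t) \<le> M * \<bar>s - t\<bar>" for s t unfolding n0_def rot_simps using LT by simp
  show "n0 (s + L) = n0 s" for s by (simp add: n0_def perT)
  have "\<exists>c. (c = 1 \<or> c = -1) \<and> n0 r = c *\<^sub>R \<nu> (\<gamma> r)" for r
   using sgn[of r] by (metis scaleR_one scaleR_scaleR mult_minus1 minus_minus)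
  then show "s \<in> {0..<L} ==> s' \<in> {0..<L} ==> \<gamma> s + t *\<^sub>R n0 s = \<gamma> s' + t' *\<^sub>R n0 s'
   ==> \<bar>t\<bar> < \<beta> ==> \<bar>t'\<bar> < \<beta> ==> s = s' \<and> t = t'" for s s' t t' using sepg[of n0] by blast
 qed (use L \<open>\<beta> > 0\<close> per der nT n0 LT in \<open>auto simp: M_def\<close>)
 then interpret C0: tube_curve \<gamma> n0 T L M \<beta> .
 have \<Sigma>: "C0.\<Sigma> = frontier Oi" by (simp add: C0.\<Sigma>_def fr)
 define P where "P A = C0.\<Phi> ` (UNIV \<times> A)" for A
 \<comment> \<open>A half tube is connected and misses the curve, since points off the curve have
   distance |t| > 0 from it. It therefore cannot meet both the domain and its complement.\<close>
 have side: "P A \<subseteq> Oi \<or> P A \<inter> closure Oi = {}" if A: "convex A" "A \<subseteq> {-\<beta><..<\<beta>}" "0 \<notin> A" for A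
 proof -
  have "connected (P A)"
   unfolding P_def using A(1) by (intro connected_continuous_image C0.\<Phi>_continuous convex_connected convex_Times) auto
  moreover have dis: "P A \<inter> frontier Oi = {}"
  proof (rule ccontr)
   assume "P A \<inter> frontier Oi \<noteq> {}"
   then obtain s t where st: "t \<in> A" "C0.\<Phi> (s, t) \<in> C0.\<Sigma>" by (auto simp: P_def \<Sigma>)
   then have "infdist (C0.\<Phi> (s, t)) C0.\<Sigma> = 0" by simp
   moreover have t: "t \<in> {-\<beta><..<\<beta>}" using A(2) st(1) by (rule subsetD)
   moreover have "t \<noteq> 0" using st(1) A(3) by blast
   moreover have "\<bar>t\<bar> < \<beta>" using t unfolding abs_less_iff by auto
   ultimately show False using C0.infdist_\<Phi>[of t s] by simp
  qed
  ultimately have "P A \<inter> Oi = {} \<or> P A \<subseteq> Oi" using connected_Int_frontier[of "P A" Oi] by blast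
  then show ?thesis using dis op by (auto simp: frontier_def interior_open)
 qed
 have Pp: "P {0<..<\<beta>} \<subseteq> Oi \<or> P {0<..<\<beta>} \<inter> closure Oi = {}" by (rule side) (use \<open>\<beta> > 0\<close> in auto)
 have Pm: "P {-\<beta><..<0} \<subseteq> Oi \<or> P {-\<beta><..<0} \<inter> closure Oi = {}" by (rule side) (use \<open>\<beta> > 0\<close> in auto)
 have mem: "\<gamma> s + t *\<^sub>R n0 s \<in> P A" if "t \<in> A" for s t A using that by (force simp: P_def C0.\<Phi>_def)
 have outp: "\<exists>t. 0 < t \<and> t < \<beta> \<and> \<gamma> s + t *\<^sub>R \<nu> (\<gamma> s) \<notin> closure Oi" for s
 proof -
  obtain d where "d > 0" "\<forall>t. 0 < t \<and> t < d --> \<gamma> s + t *\<^sub>R \<nu> (\<gamma> s) \<notin> closure Oi" using out by blast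
  then show ?thesis using \<open>\<beta> > 0\<close> by (intro exI[of _ "min d \<beta> / 2"]) auto
 qed
 \<comment> \<open>If both halves avoided the domain, a neighbourhood of the curve would do so, yet
   curve points are limits of points of the domain.\<close>
 have some_in: "P {0<..<\<beta>} \<subseteq> Oi \<or> P {-\<beta><..<0} \<subseteq> Oi"
 proof (rule ccontr)
  assume "\<not> ?thesis"
  then have e: "P {0<..<\<beta>} \<inter> closure Oi = {}" "P {-\<beta><..<0} \<inter> closure Oi = {}" using Pp Pm by auto
  have "C0.tub \<beta> \<inter> Oi = {}"
  proof (rule ccontr)
   assume "C0.tub \<beta> \<inter> Oi \<noteq> {}"
   then obtain s t where st: "\<bar>t\<bar> < \<beta>" "C0.\<Phi> (s, t) \<in> Oi" using C0.tub_eq[of \<beta>] by fastforce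
   have "t \<noteq> 0"
   proof
    assume "t = 0"
    then have "\<gamma> s \<in> Oi" using st by (simp add: C0.\<Phi>_def)
    moreover have "\<gamma> s \<in> frontier Oi" using C0.\<gamma>_in_\<Sigma> \<Sigma> by blast
    ultimately show False using op by (auto simp: frontier_def interior_open)
   qed
   then have "C0.\<Phi> (s, t) \<in> P {0<..<\<beta>} \<union> P {-\<beta><..<0}"
    using st mem[of t "{0<..<\<beta>}" s] mem[of t "{-\<beta><..<0}" s] by (cases "t > 0") (auto simp: C0.\<Phi>_def)
   then show False using e st(2) closure_subset by blast
  qed
  then have "C0.tub \<beta> \<inter> closure Oi = {}" using open_Int_closure_eq_empty[OF C0.tub_open] by blast
  moreover have "\<gamma> 0 \<in> C0.tub \<beta>" using C0.\<Phi>_in_tub[of 0 \<beta> 0] \<open>\<beta> > 0\<close> by (simp add: C0.\<Phi>_def)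
  moreover have "\<gamma> 0 \<in> closure Oi" using C0.\<gamma>_in_\<Sigma>[of 0] \<Sigma> by (auto simp: frontier_def)
  ultimately show False by blast
 qed
 have not_both: "\<not> (P {0<..<\<beta>} \<subseteq> Oi \<and> P {-\<beta><..<0} \<subseteq> Oi)"
 proof
  assume b: "P {0<..<\<beta>} \<subseteq> Oi \<and> P {-\<beta><..<0} \<subseteq> Oi"
  obtain t where t: "0 < t" "t < \<beta>" "\<gamma> 0 + t *\<^sub>R \<nu> (\<gamma> 0) \<notin> closure Oi" using outp by blast
  obtain c where "c = 1 \<or> c = -1" "\<nu> (\<gamma> 0) = c *\<^sub>R n0 0" using sgn by blast
  then have "\<gamma> 0 + t *\<^sub>R \<nu> (\<gamma> 0) \<in> P {0<..<\<beta>} \<union> P {-\<beta><..<0}"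
   using t mem[of t "{0<..<\<beta>}" 0] mem[of "- t" "{-\<beta><..<0}" 0] by auto
  then show False using b t closure_subset by blast
 qed
 obtain c0 where c0: "c0 = 1 \<or> c0 = -1"
  and ins: "\<And>s t. -\<beta> < t ==> t < 0 ==> \<gamma> s + (c0 * t) *\<^sub>R n0 s \<in> Oi"
  and outs: "\<And>s t. 0 < t ==> t < \<beta> ==> \<gamma> s + (c0 * t) *\<^sub>R n0 s \<notin> closure Oi"
 proof (cases "P {0<..<\<beta>} \<subseteq> Oi")
  case True
  then have "P {-\<beta><..<0} \<inter> closure Oi = {}" using not_both Pm by blast
  then show thesis using True mem[of "- _" "{0<..<\<beta>}"] mem[of "- _" "{-\<beta><..<0}"]
   by (intro that[of "-1"]) (auto simp: disjoint_iff)
 next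
  case False
  then have "P {-\<beta><..<0} \<subseteq> Oi" "P {0<..<\<beta>} \<inter> closure Oi = {}" using some_in Pp by blast+
  then show thesis using mem[of _ "{0<..<\<beta>}"] mem[of _ "{-\<beta><..<0}"] by (intro that[of 1]) (auto simp: disjoint_iff)
 qed
 \<comment> \<open>With the opposite sign, the outward offsets at this point would land in the half
   tube already known to lie inside.\<close>
 have nu_eq: "\<nu> (\<gamma> s) = c0 *\<^sub>R n0 s" for s
 proof -
  obtain c where c: "c = 1 \<or> c = -1" "\<nu> (\<gamma> s) = c *\<^sub>R n0 s" using sgn by blast
  obtain t where t: "0 < t" "t < \<beta>" "\<gamma> s + t *\<^sub>R \<nu> (\<gamma> s) \<notin> closure Oi" using outp by blast
  have "c = c0"
  proof (rule ccontr)
   assume "c \<noteq> c0"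
   then have "c = - c0" using c c0 by auto
   then have "\<gamma> s + t *\<^sub>R \<nu> (\<gamma> s) \<in> Oi" using ins[of "- t" s] t c by (simp add: mult.commute)
   then show False using t(3) closure_subset by blast
  qed
  then show ?thesis using c by simp
 qed
 show ?thesis
 proof (rule that[of T M], unfold_locales)
  fix s t
  have "norm (\<nu> (\<gamma> s) - \<nu> (\<gamma> t)) = \<bar>c0\<bar> * norm (n0 s - n0 t)" unfolding nu_eq by (simp flip: scaleR_diff_right)
  also have "\<dots> = norm (n0 s - n0 t)" using c0 by auto
  finally show "norm (\<nu> (\<gamma> s) - \<nu> (\<gamma> t)) \<le> M * \<bar>s - t\<bar>" using C0.Lip_n by simp
 next
  fix s s' t t' assume "s \<in> {0..<L}" "s' \<in> {0..<L}" "\<gamma> s + t *\<^sub>R \<nu> (\<gamma> s) = \<gamma> s' + t' *\<^sub>R \<nu> (\<gamma> s')" "\<bar>t\<bar> < \<beta>" "\<bar>t'\<bar> < \<beta>"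
  moreover have "\<exists>c. (c = 1 \<or> c = -1) \<and> \<nu> (\<gamma> r) = c *\<^sub>R \<nu> (\<gamma> r)" for r by (intro exI[of _ 1]) simp
  ultimately show "s = s' \<and> t = t'" using sepg[of "\<lambda>s. \<nu> (\<gamma> s)"] by blast
 next
  fix s t assume "- \<beta> < t" "t < 0"
  then show "\<gamma> s + t *\<^sub>R \<nu> (\<gamma> s) \<in> Oi" using ins[of t s] unfolding nu_eq scaleR_scaleR mult.commute[of t] by blast
 next
  fix s t assume "0 < t" "t < \<beta>"
  then show "\<gamma> s + t *\<^sub>R \<nu> (\<gamma> s) \<notin> closure Oi" using outs[of t s] unfolding nu_eq scaleR_scaleR mult.commute[of t] by blast
 qed (use L C0.M_pos \<open>\<beta> > 0\<close> per der nT nu LT op bd fr in auto)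
qed

subsection \<open>The divergence theorem\<close>

lemma tendsto_difference_quotient:
 fixes f :: "'a::real_normed_vector => 'b::real_normed_vector"
 assumes f: "(f has_derivative D) (at x)" and e: "norm e = 1"
 defines "h \<equiv> \<lambda>k. inverse (real (Suc k))"
 shows "(\<lambda>k. (f (x + h k *\<^sub>R e) - f x) /\<^sub>R h k) \<longlonglongrightarrow> D e"
proof -
 have h: "h k > 0" for k by (simp add: h_def)
 have bl: "bounded_linear D" using f by (rule has_derivative_bounded_linear)
 have lim: "(\<lambda>v. norm (f (x + v) - f x - D v) / norm v) \<midarrow>0\<rightarrow> 0" using f by (simp add: has_derivative_at)
 have "(\<lambda>k. h k *\<^sub>R e) \<longlonglongrightarrow> 0 *\<^sub>R e" unfolding h_def by (intro tendsto_intros LIMSEQ_inverse_real_of_nat)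
 then have "filterlim (\<lambda>k. h k *\<^sub>R e) (at 0) sequentially"
  unfolding filterlim_at using h e by (auto intro!: always_eventually simp: less_imp_neq[THEN not_sym])
 from filterlim_compose[OF lim this]
 have "(\<lambda>k. norm (f (x + h k *\<^sub>R e) - f x - D (h k *\<^sub>R e)) / norm (h k *\<^sub>R e)) \<longlonglongrightarrow> 0" .
 moreover have "norm (f (x + h k *\<^sub>R e) - f x - D (h k *\<^sub>R e)) / norm (h k *\<^sub>R e)
   = norm ((f (x + h k *\<^sub>R e) - f x) /\<^sub>R h k - D e)" for k
 proof -
  have "(f (x + h k *\<^sub>R e) - f x) /\<^sub>R h k - D e = (f (x + h k *\<^sub>R e) - f x - D (h k *\<^sub>R e)) /\<^sub>R h k"
   using h[of k] by (simp add: scaleR_diff_right linear_scale[OF bounded_linear.linear[OF bl]])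
  then show ?thesis using h[of k] e by (simp add: divide_inverse mult.commute)
 qed
 ultimately have "(\<lambda>k. norm ((f (x + h k *\<^sub>R e) - f x) /\<^sub>R h k - D e)) \<longlonglongrightarrow> 0" by simp
 then show ?thesis by (rule LIM_zero_cancel[OF tendsto_norm_zero_cancel])
qed

lemma lborel_integral_translate:
 fixes f :: "'a::euclidean_space => 'b::{banach, second_countable_topology}"
 assumes "f \<in> borel_measurable borel"
 shows "(\<integral>x. f (v + x) \<partial>lborel) = (\<integral>x. f x \<partial>lborel)"
proof -
 have "(\<integral>x. f x \<partial>lborel) = (\<integral>x. f x \<partial>distr lborel borel ((+) v))" by (simp only: lborel_distr_plus)
 also have "\<dots> = (\<integral>x. f (v + x) \<partial>lborel)" using assms by (intro integral_distr) auto
 finally show ?thesis by simp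
qed

lemma continuous_compact_integrable:
 fixes f :: "'a::euclidean_space => complex"
 assumes "continuous_on UNIV f" "\<And>x. x \<notin> cball 0 R ==> f x = 0"
 shows "integrable lborel f"
proof -
 have "integrable lborel (\<lambda>x. indicator (cball 0 R) x *\<^sub>R f x)"
  using assms(1) by (intro borel_integrable_compact) (auto intro: continuous_on_subset)
 moreover have "(\<lambda>x. indicator (cball 0 R) x *\<^sub>R f x) = f" using assms(2) by (auto simp: indicator_def)
 ultimately show ?thesis by simp
qed

lemma test_fun_support_ball:
 assumes "test_fun U \<phi>"
 obtains R where "R > 0" "\<And>x. x \<notin> cball 0 R ==> \<phi> x = 0"
proof -
 have "bounded (closure {x. \<phi> x \<noteq> 0})" using assms by (auto simp: test_fun_def compact_imp_bounded)
 then obtain R where R: "closure {x. \<phi> x \<noteq> 0} \<subseteq> cball 0 R" using bounded_subset_cball0 by blast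
 have "\<phi> x = 0" if "x \<notin> cball 0 (max R 1)" for x using that R closure_subset[of "{x. \<phi> x \<noteq> 0}"] by auto
 then show ?thesis using that[of "max R 1"] by auto
qed

section \<open>Depth below the boundary and its directional derivatives\<close>

context tube_domain
begin

definition dep :: "R2 => real" where "dep x = infdist x (- Oi)"

lemma \<gamma>_frontier: "\<gamma> s \<in> frontier Oi" using \<gamma>_in_\<Sigma> by (simp add: \<Sigma>_def frontier_Oi)

lemma \<gamma>_notin: "\<gamma> s \<notin> Oi" using \<gamma>_frontier[of s] Oi_open by (simp add: frontier_def interior_open)

text \<open>Every segment leaving the domain crosses the curve.\<close>

lemma infdist_le_dep:
 assumes x: "x \<in> Oi"
 shows "infdist x \<Sigma> \<le> dep x"
proof -
 have ne: "- Oi \<noteq> {}" using \<gamma>_notin by blast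
 show ?thesis unfolding dep_def infdist_notempty[OF ne]
 proof (rule cINF_greatest[OF ne])
  fix y assume y: "y \<in> - Oi"
  have "closed_segment x y \<inter> frontier Oi \<noteq> {}" using x y by (intro connected_Int_frontier) auto
  then obtain z where z: "z \<in> closed_segment x y" "z \<in> \<Sigma>" by (auto simp: frontier_Oi \<Sigma>_def)
  have "infdist x \<Sigma> \<le> dist x z" by (rule infdist_le[OF z(2)])
  also have "\<dots> \<le> dist x y" using z(1) segment_bound(1)[of z x y] by (simp add: dist_norm norm_minus_commute)
  finally show "infdist x \<Sigma> \<le> dist x y" .
 qed
qed

lemma dep_le: "dep x \<le> norm (x - \<gamma> s)"
 unfolding dep_def using infdist_le[of "\<gamma> s" "- Oi" x] \<gamma>_notin by (simp add: dist_norm)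

lemma dep_inside:
 assumes "-\<beta> < t" "t < 0"
 shows "dep (\<Phi> (s, t)) = - t"
proof -
 have "\<Phi> (s, t) \<in> Oi" using inside[OF assms] by (simp add: \<Phi>_def)
 then have "- t \<le> dep (\<Phi> (s, t))" using infdist_le_dep infdist_\<Phi>[of t s] assms by fastforce
 moreover have "dep (\<Phi> (s, t)) \<le> - t" using dep_le[of "\<Phi> (s, t)" s] assms by (simp add: \<Phi>_def norm_n)
 ultimately show ?thesis by simp
qed

lemma dep_outside: "x \<notin> Oi ==> dep x = 0" by (simp add: dep_def)

lemma dep_lipschitz: "\<bar>dep x - dep y\<bar> \<le> norm (x - y)"
 unfolding dep_def using infdist_triangle_abs[of x "- Oi" y] by (simp add: dist_norm)

lemma dep_continuous: "continuous_on S dep" unfolding dep_def by (intro continuous_intros)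

lemma dep_nonneg: "0 \<le> dep x" by (simp add: dep_def infdist_nonneg)

lemma dep_pos: "x \<in> Oi ==> 0 < dep x"
proof -
 assume "x \<in> Oi"
 have "closed (- Oi)" "- Oi \<noteq> {}" using Oi_open \<gamma>_notin by auto
 then have "dep x \<noteq> 0" using in_closed_iff_infdist_zero[of "- Oi" x] \<open>x \<in> Oi\<close> by (auto simp: dep_def)
 then show ?thesis using dep_nonneg[of x] by simp
qed

text \<open>Differentiability is obtained by squeezing. From above, the depth is at most the
  distance to \<gamma> s; from below, it is at least the depth of a deeper point \<Phi> (s, t0)
  minus the distance to it, with t0 halfway between -\<beta> and t. Both barriers touch the depth at
  \<Phi> (s, t), and their difference quotients in direction -e have the same limit.\<close>

lemma dep_quotient:
 assumes t: "-\<beta> < t" "t < 0" and e: "norm e = 1"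
 defines "h \<equiv> \<lambda>k. inverse (real (Suc k))"
 shows "(\<lambda>k. (dep (\<Phi> (s, t) - h k *\<^sub>R e) - dep (\<Phi> (s, t))) / h k) \<longlonglongrightarrow> n s \<bullet> e"
proof -
 let ?x = "\<Phi> (s, t)"
 define t0 where "t0 = (t - \<beta>) / 2"
 have t0: "-\<beta> < t0" "t0 < t" using t by (auto simp: t0_def)
 have h: "h k > 0" for k by (simp add: h_def)
 have *: "(\<lambda>k. (norm (c *\<^sub>R n s + h k *\<^sub>R (- e)) - norm (c *\<^sub>R n s)) /\<^sub>R h k) \<longlonglongrightarrow> - e \<bullet> sgn (c *\<^sub>R n s)"
  if "c \<noteq> 0" for c
 proof -
  have "n s \<noteq> 0" using norm_n[of s] by auto
  then have "(norm has_derivative (\<lambda>v. v \<bullet> sgn (c *\<^sub>R n s))) (at (c *\<^sub>R n s))"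
   using that by (intro has_derivative_norm) auto
  from tendsto_difference_quotient[OF this, of "- e"] e show ?thesis by (simp add: h_def)
 qed
 have sg: "sgn (c *\<^sub>R n s) = sgn c *\<^sub>R n s" for c by (simp add: sgn_scaleR sgn_div_norm norm_n)
 have up: "(\<lambda>k. (norm (t *\<^sub>R n s + h k *\<^sub>R (- e)) - norm (t *\<^sub>R n s)) /\<^sub>R h k) \<longlonglongrightarrow> n s \<bullet> e"
  using *[of t] t unfolding sg by (simp add: inner_commute)
 have "(\<lambda>k. - ((norm ((t - t0) *\<^sub>R n s + h k *\<^sub>R (- e)) - norm ((t - t0) *\<^sub>R n s)) /\<^sub>R h k)) \<longlonglongrightarrow> - (- e \<bullet> sgn ((t - t0) *\<^sub>R n s))"
  using *[of "t - t0"] t0 by (intro tendsto_minus) auto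
 then have lo: "(\<lambda>k. - ((norm ((t - t0) *\<^sub>R n s + h k *\<^sub>R (- e)) - norm ((t - t0) *\<^sub>R n s)) /\<^sub>R h k)) \<longlonglongrightarrow> n s \<bullet> e"
  using t0 unfolding sg by (simp add: inner_commute)
 have q: "- (a /\<^sub>R r) \<le> b / r" if "r > 0" "- a \<le> b" for a b r :: real
  using divide_right_mono[OF that(2), of r] that(1) by (simp add: divide_inverse mult.commute)
 show ?thesis
 proof (rule tendsto_sandwich[OF _ _ lo up]; intro always_eventually allI)
  fix k
  have "dep (?x - h k *\<^sub>R e) \<le> norm (t *\<^sub>R n s + h k *\<^sub>R (- e))"
   using dep_le[of "?x - h k *\<^sub>R e" s] by (simp add: \<Phi>_def)
  then have "dep (?x - h k *\<^sub>R e) - dep ?x \<le> norm (t *\<^sub>R n s + h k *\<^sub>R (- e)) - norm (t *\<^sub>R n s)"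
   using dep_inside[OF t] t by (simp add: norm_n)
  then show "(dep (?x - h k *\<^sub>R e) - dep ?x) / h k \<le> (norm (t *\<^sub>R n s + h k *\<^sub>R (- e)) - norm (t *\<^sub>R n s)) /\<^sub>R h k"
   using h[of k] by (simp add: divide_inverse mult.commute mult_left_mono)
  have "dep (\<Phi> (s, t0)) \<le> dep (?x - h k *\<^sub>R e) + norm (?x - h k *\<^sub>R e - \<Phi> (s, t0))"
   using dep_lipschitz[of "?x - h k *\<^sub>R e" "\<Phi> (s, t0)"] by linarith
  also have "?x - h k *\<^sub>R e - \<Phi> (s, t0) = (t - t0) *\<^sub>R n s + h k *\<^sub>R (- e)" by (simp add: \<Phi>_def algebra_simps)
  finally have "- (norm ((t - t0) *\<^sub>R n s + h k *\<^sub>R (- e)) - norm ((t - t0) *\<^sub>R n s)) \<le> dep (?x - h k *\<^sub>R e) - dep ?x"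
   using dep_inside[OF t, of s] dep_inside[of t0 s] t0 t by (simp add: norm_n)
  then show "- ((norm ((t - t0) *\<^sub>R n s + h k *\<^sub>R (- e)) - norm ((t - t0) *\<^sub>R n s)) /\<^sub>R h k) \<le> (dep (?x - h k *\<^sub>R e) - dep ?x) / h k"
   by (rule q[OF h])
 qed
qed

end

lemma integrable_bounded_support_lborel:
 fixes f :: "'a::euclidean_space => 'b::{banach, second_countable_topology}"
 assumes "f \<in> borel_measurable borel" "\<And>x. norm (f x) \<le> B" "\<And>x. x \<notin> C ==> f x = 0" "bounded C"
 shows "integrable lborel f"
proof -
 have "integrable lebesgue f"
  using assms(1) by (intro integrable_bounded_support[OF _ assms(2,3,4)] measurable_completion) auto
 then show ?thesis using assms(1) by (subst integrable_completion[symmetric]) auto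
qed

context tube_curve
begin

text \<open>A locally Lipschitz image of a null segment. The levels 0 and -\<delta> are where the
  layer cut-off has kinks.\<close>

lemma level_null: "\<Phi> ` ({0..L} \<times> {c}) \<in> null_sets lborel"
proof -
 let ?S = "{0..L} \<times> {c}"
 have "negligible {p :: real \<times> real. p \<bullet> (0, 1) = c}"
  by (rule negligible_standard_hyperplane) (auto simp: Basis_prod_def)
 then have S: "negligible ?S" by (rule negligible_subset) (auto simp: inner_prod_def)
 have "negligible (\<Phi> ` ?S)"
 proof (rule negligible_locally_Lipschitz_image[OF _ S])
  fix p assume p: "p \<in> ?S"
  define e where "e = 1 + \<bar>c\<bar>"
  have "norm (\<Phi> q - \<Phi> p) \<le> (1 + 2 * M * e) * norm (q - p)" if q: "q \<in> ?S \<inter> ball p 1" for q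
  proof -
   have "\<bar>fst q - fst p\<bar> \<le> norm (q - p)" using norm_fst_le[of "fst q - fst p" "snd q - snd p"] by (simp add: prod_eq_iff minus_prod_def)
   also have "norm (q - p) < 1" using q by (simp add: dist_norm norm_minus_commute)
   also have "1 \<le> e" by (simp add: e_def)
   finally have "\<bar>fst q - fst p\<bar> \<le> e" by simp
   moreover have "\<bar>snd q\<bar> \<le> e" using q by (auto simp: e_def)
   ultimately show ?thesis
    using \<Phi>_near_isometry[of "fst q" "fst p" e "snd q" "snd p"] by (simp add: algebra_simps abs_le_iff)
  qed
  then show "\<exists>T B. open T \<and> p \<in> T \<and> (\<forall>q\<in>?S \<inter> T. norm (\<Phi> q - \<Phi> p) \<le> B * norm (q - p))"
   by (intro exI[of _ "ball p 1"] exI[of _ "1 + 2 * M * e"]) auto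
 qed simp
 then have "\<Phi> ` ?S \<in> null_sets lebesgue" by (simp add: negligible_iff_null_sets)
 moreover have "compact (\<Phi> ` ?S)" by (intro compact_continuous_image \<Phi>_continuous compact_Times) auto
 ultimately show ?thesis by (auto simp: null_sets_def borel_compact)
qed

lemma Q_emeasure: "0 \<le> e ==> emeasure lborel (Q e) = ennreal (L * (2 * e))" unfolding Q_def lborel_prod[symmetric]
 using L_pos by (subst lborel.emeasure_pair_measure_Times) (auto simp: ennreal_mult[symmetric])

lemma Q_integrable: "0 \<le> e ==> integrable lborel (\<lambda>p. indicator (Q e) p *\<^sub>R (c::real))"
 using Q_emeasure[of e] Q_borel[of e] by (simp add: integrable_mult_left_iff integrable_real_indicator)

lemma Q_integral: "0 \<le> e ==> (\<integral>p. indicator (Q e) p *\<^sub>R (c::real) \<partial>lborel) = L * (2 * e) * c"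
 using Q_emeasure[of e] Q_borel[of e] L_pos by (simp add: measure_def)

end

section \<open>Thin boundary layers and the limit to the curve\<close>

context tube_domain
begin

definition cut :: "real => R2 => real" where "cut \<delta> x = min 1 (dep x / \<delta>)"

lemma
 assumes "\<delta> > 0"
 shows cut_01: "0 \<le> cut \<delta> x" "cut \<delta> x \<le> 1"
  and cut_lipschitz: "\<bar>cut \<delta> x - cut \<delta> y\<bar> \<le> norm (x - y) / \<delta>"
  and cut_continuous: "continuous_on S (cut \<delta>)"
proof -
 show "0 \<le> cut \<delta> x" "cut \<delta> x \<le> 1" using assms dep_nonneg by (auto simp: cut_def)
 have "\<bar>cut \<delta> x - cut \<delta> y\<bar> \<le> \<bar>dep x / \<delta> - dep y / \<delta>\<bar>" by (auto simp: cut_def)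
 also have "\<dots> = \<bar>dep x - dep y\<bar> / \<delta>" using assms by (simp add: diff_divide_distrib[symmetric])
 also have "\<dots> \<le> norm (x - y) / \<delta>" using assms dep_lipschitz by (simp add: divide_right_mono)
 finally show "\<bar>cut \<delta> x - cut \<delta> y\<bar> \<le> norm (x - y) / \<delta>" .
 show "continuous_on S (cut \<delta>)" unfolding cut_def using assms by (intro continuous_intros dep_continuous) auto
qed

lemma closure_cases:
 assumes "0 < \<delta>" "\<delta> < \<beta>"
 obtains "x \<notin> closure Oi" | "x \<in> Oi" "dep x > \<delta>" | s t where "x = \<Phi> (s, t)" "s \<in> {0..<L}" "-\<delta> < t" "t < 0"
  | "x \<in> \<Phi> ` ({0..L} \<times> {0}) \<union> \<Phi> ` ({0..L} \<times> {-\<delta>})"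
proof (cases "x \<in> closure Oi")
 case True
 show ?thesis
 proof (cases "x \<in> Oi")
  case x: True
  show ?thesis
  proof (cases "dep x > \<delta>")
   case False
   then have "x \<in> tub \<beta>" using infdist_le_dep[OF x] assms by (simp add: tub_def)
   then obtain s t where st: "x = \<Phi> (s, t)" "s \<in> {0..<L}" "-\<beta> < t" "t < \<beta>" using tub_eq[of \<beta>] by auto
   have "t < 0"
   proof (rule ccontr)
    assume "\<not> t < 0"
    then consider "t = 0" | "t > 0" by linarith
    then show False
    proof cases
     case 1
     then show False using x \<gamma>_notin st by (simp add: \<Phi>_def)
    next
     case 2
     then show False using outside[of t s] st x closure_subset by (auto simp: \<Phi>_def)
    qed
   qed
   then have "dep x = - t" using dep_inside st by simp
   then show ?thesis using False st \<open>t < 0\<close> that(3)[of s t] that(4) by (cases "t = - \<delta>") force+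
  qed (use x that in blast)
 next
  case False
  then have "x \<in> frontier Oi" using True Oi_open by (simp add: frontier_def interior_open)
  then have "x \<in> \<Phi> ` ({0..L} \<times> {0})" by (force simp: frontier_Oi \<Phi>_def)
  then show ?thesis using that(4) by blast
 qed
qed (use that(1) in blast)

lemma eventually_inverse_less:
 assumes "r > (0::real)"
 shows "\<forall>\<^sub>F k in sequentially. inverse (real (Suc k)) < r"
 using LIMSEQ_inverse_real_of_nat assms by (rule order_tendstoD(2))

text \<open>The gradient of the Lipschitz cut-off is the normal divided by \<open>\<delta>\<close> on the inner layer of
 width \<open>\<delta>\<close> and vanishes elsewhere.\<close>
lemma cut_quotient:
 assumes \<delta>: "0 < \<delta>" "\<delta> < \<beta>" and e: "norm e = 1"
 defines "q \<equiv> \<lambda>k x. (cut \<delta> (x - inverse (real (Suc k)) *\<^sub>R e) - cut \<delta> x) / inverse (real (Suc k))"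
 shows "x \<notin> closure Oi ==> (\<lambda>k. q k x) \<longlonglongrightarrow> 0"
  and "x \<in> Oi ==> dep x > \<delta> ==> (\<lambda>k. q k x) \<longlonglongrightarrow> 0"
  and "-\<delta> < t ==> t < 0 ==> (\<lambda>k. q k (\<Phi> (s, t))) \<longlonglongrightarrow> n s \<bullet> e / \<delta>"
proof -
 have near: "norm (x - inverse (real (Suc k)) *\<^sub>R e - x) = inverse (real (Suc k))" for x k using e by simp
 show "(\<lambda>k. q k x) \<longlonglongrightarrow> 0" if x: "x \<notin> closure Oi"
 proof -
  have "open (- closure Oi)" "x \<in> - closure Oi" using x by auto
  then obtain r where r: "r > 0" "ball x r \<subseteq> - closure Oi" using openE by blast
  show ?thesis
  proof (rule tendsto_eventually, rule eventually_mono[OF eventually_inverse_less[OF r(1)]])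
   fix k assume "inverse (real (Suc k)) < r"
   then have "x - inverse (real (Suc k)) *\<^sub>R e \<in> ball x r" using e by (simp add: dist_norm)
   then have "x - inverse (real (Suc k)) *\<^sub>R e \<notin> Oi" using r(2) closure_subset by blast
   moreover have "x \<notin> Oi" using x closure_subset by blast
   ultimately show "q k x = 0" by (simp add: q_def cut_def dep_outside)
  qed
 qed
 show "(\<lambda>k. q k x) \<longlonglongrightarrow> 0" if x: "x \<in> Oi" "dep x > \<delta>"
 proof (rule tendsto_eventually, rule eventually_mono[OF eventually_inverse_less[of "dep x - \<delta>"]])
  show "0 < dep x - \<delta>" using x by simp
  fix k assume "inverse (real (Suc k)) < dep x - \<delta>"
  then have "dep (x - inverse (real (Suc k)) *\<^sub>R e) \<ge> \<delta>"
   using dep_lipschitz[of "x - inverse (real (Suc k)) *\<^sub>R e" x] near[of x k] by linarith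
  then show "q k x = 0" using x \<delta> by (simp add: q_def cut_def)
 qed
 show "(\<lambda>k. q k (\<Phi> (s, t))) \<longlonglongrightarrow> n s \<bullet> e / \<delta>" if t: "-\<delta> < t" "t < 0"
 proof -
  let ?x = "\<Phi> (s, t)"
  have d: "dep ?x = - t" using dep_inside t \<delta> by simp
  have "(\<lambda>k. (dep (?x - inverse (real (Suc k)) *\<^sub>R e) - dep ?x) / inverse (real (Suc k)) / \<delta>) \<longlonglongrightarrow> n s \<bullet> e / \<delta>"
   using dep_quotient[of t e s] t \<delta> e by (intro tendsto_intros) auto
  moreover have "\<forall>\<^sub>F k in sequentially. (dep (?x - inverse (real (Suc k)) *\<^sub>R e) - dep ?x) / inverse (real (Suc k)) / \<delta> = q k ?x"
  proof (rule eventually_mono[OF eventually_inverse_less[of "\<delta> + t"]])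
   show "0 < \<delta> + t" using t by simp
   fix k assume "inverse (real (Suc k)) < \<delta> + t"
   then have "dep (?x - inverse (real (Suc k)) *\<^sub>R e) \<le> \<delta>"
    using dep_lipschitz[of "?x - inverse (real (Suc k)) *\<^sub>R e" ?x] near[of ?x k] d by linarith
   moreover have "dep ?x \<le> \<delta>" using d t by simp
   ultimately have "cut \<delta> (?x - inverse (real (Suc k)) *\<^sub>R e) = dep (?x - inverse (real (Suc k)) *\<^sub>R e) / \<delta>" "cut \<delta> ?x = dep ?x / \<delta>"
    using \<delta>(1) by (auto simp: cut_def)
   then show "(dep (?x - inverse (real (Suc k)) *\<^sub>R e) - dep ?x) / inverse (real (Suc k)) / \<delta> = q k ?x"
    by (simp add: q_def diff_divide_distrib mult.commute)
  qed
  ultimately show ?thesis by (rule Lim_transform_eventually)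
 qed
qed

text \<open>The curve integral is written as an integral over a layer of thickness \<delta>, of a
  function constant along normals with weight 1/\<delta>, which makes it comparable with layer
  integrals in the plane.\<close>

lemma boundary_integral_prod:
 fixes f :: "real => complex"
 assumes f: "continuous_on UNIV f" and \<delta>: "0 < \<delta>"
 shows "integrable lborel (\<lambda>p. indicator ({0..<L} \<times> {-\<delta><..<0}) p *\<^sub>R (f (fst p) / of_real \<delta>))"
  and "(\<integral>p. indicator ({0..<L} \<times> {-\<delta><..<0}) p *\<^sub>R (f (fst p) / of_real \<delta>) \<partial>lborel) = (\<integral>s. indicator {0..L} s *\<^sub>R f s \<partial>lborel)"
proof -
 let ?g = "\<lambda>p::real \<times> real. indicator ({0..<L} \<times> {-\<delta><..<0}) p *\<^sub>R (f (fst p) / of_real \<delta>)"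
 have "bounded (f ` {0..L})"
  using f by (intro compact_imp_bounded compact_continuous_image) (auto intro: continuous_on_subset)
 then obtain B where B0: "\<forall>y\<in>f ` {0..L}. cmod y \<le> B" and Bp: "B > 0" unfolding bounded_pos by blast
 have B: "cmod (f s) \<le> B" "B > 0" if "s \<in> {0..L}" for s using B0 Bp that by auto
 have gm: "?g \<in> borel_measurable borel"
 proof -
  have "(\<lambda>p::real \<times> real. f (fst p)) \<in> borel_measurable borel"
   by (intro borel_measurable_continuous_onI continuous_on_compose2[OF f] continuous_intros) auto
  moreover have "{0..<L} \<times> {-\<delta><..<0} \<in> sets (borel :: (real \<times> real) measure)" by (intro borel_Times) auto
  ultimately show ?thesis by measurable
 qed
 show i: "integrable lborel ?g"
 proof (rule integrable_bounded_support_lborel[OF gm, of "B / \<delta>" "{0..L} \<times> {-\<delta>..0}"])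
  show "norm (?g p) \<le> B / \<delta>" for p
   using B(1)[of "fst p"] Bp \<delta> by (auto simp: indicator_def norm_divide divide_right_mono)
  show "bounded ({0..L} \<times> {-\<delta>..0})" by (intro bounded_Times) auto
 qed (auto simp: indicator_def)
 have "(\<integral>p. ?g p \<partial>lborel) = (\<integral>s. (\<integral>t. ?g (s, t) \<partial>lborel) \<partial>lborel)"
  using i unfolding lborel_prod[symmetric] by (rule lborel_pair.integral_fst'[symmetric])
 also have "\<dots> = (\<integral>s. indicator {0..<L} s *\<^sub>R f s \<partial>lborel)"
 proof (intro Bochner_Integration.integral_cong refl)
  fix s
  have "(\<integral>t. ?g (s, t) \<partial>lborel) = (\<integral>t. indicator {-\<delta><..<0} t *\<^sub>R (indicator {0..<L} s *\<^sub>R (f s / of_real \<delta>)) \<partial>lborel)"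
   by (intro Bochner_Integration.integral_cong refl) (auto simp: indicator_def)
  also have "\<dots> = indicator {0..<L} s *\<^sub>R f s"
   using \<delta> by (subst integral_scaleR_left) (auto simp: scaleR_conv_of_real)
  finally show "(\<integral>t. ?g (s, t) \<partial>lborel) = indicator {0..<L} s *\<^sub>R f s" .
 qed
 also have "\<dots> = (\<integral>s. indicator {0..L} s *\<^sub>R f s \<partial>lborel)"
 proof (rule integral_cong_AE)
  have fm: "f \<in> borel_measurable borel" using f by (rule borel_measurable_continuous_onI)
  show "(\<lambda>s. indicator {0..<L} s *\<^sub>R f s) \<in> borel_measurable lborel" "(\<lambda>s. indicator {0..L} s *\<^sub>R f s) \<in> borel_measurable lborel"
   using fm by auto
  show "AE s in lborel. indicator {0..<L} s *\<^sub>R f s = indicator {0..L} s *\<^sub>R f s"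
   using AE_lborel_singleton[of L] by eventually_elim (auto simp: indicator_def)
 qed
 finally show "(\<integral>p. ?g p \<partial>lborel) = (\<integral>s. indicator {0..L} s *\<^sub>R f s \<partial>lborel)" .
qed

text \<open>A divergence theorem for the Lipschitz cut-off, up to O(\<delta>). The derivative is
  moved from \<psi> to the cut-off at the level of difference quotients, whose limit is n_j/\<delta>
  on the inner layer and 0 elsewhere. Passing to coordinates costs 12 M \<delta> times the mass 2 L
  C, and replacing \<psi> on the layer by its value at the foot point costs \<open>Lp\<close> times
  \<delta>.\<close>

lemma layer_estimate:
 assumes \<psi>: "test_fun UNIV \<psi>"
 shows "\<exists>K. \<forall>\<delta>. 0 < \<delta> --> \<delta> < \<beta> --> 2 * M * \<delta> < 1 -->
  cmod ((\<integral>x. of_real (cut \<delta> x) * pd j \<psi> x \<partial>lborel)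
   - (\<integral>s. indicator {0..L} s *\<^sub>R (of_real (n s $ j) * \<psi> (\<gamma> s)) \<partial>lborel)) \<le> K * \<delta>"
proof -
 obtain C where C: "\<And>x. cmod (\<psi> x) \<le> C" "C > 0" using test_fun_bounded[OF \<psi>] by metis
 obtain Lp where Lp: "\<And>x y. cmod (\<psi> x - \<psi> y) \<le> Lp * norm (x - y)" "Lp > 0" using test_fun_lipschitz[OF \<psi>] by metis
 obtain R where R: "R > 0" "\<And>x. x \<notin> cball 0 R ==> \<psi> x = 0" using test_fun_support_ball[OF \<psi>] by metis
 have \<psi>c: "continuous_on S \<psi>" for S using \<psi> by (intro smooth_fun_continuous_on test_fun_smooth)
 have \<psi>m: "\<psi> \<in> borel_measurable borel" using \<psi> by (rule test_fun_measurable)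
 define e :: R2 where "e = axis j 1"
 have e: "norm e = 1" by (simp add: e_def)
 define h where "h k = inverse (real (Suc k))" for k
 have h: "0 < h k" "h k \<le> 1" for k unfolding h_def by (auto simp: inverse_eq_divide)
 define J where "J = (\<integral>s. indicator {0..L} s *\<^sub>R (of_real (n s $ j) * \<psi> (\<gamma> s)) \<partial>lborel)"
 have nj: "\<bar>n s $ j\<bar> \<le> 1" for s using component_le_norm_cart[of "n s" j] norm_n[of s] by simp
 have main: "cmod ((\<integral>x. of_real (cut \<delta> x) * pd j \<psi> x \<partial>lborel) - J) \<le> (24 * M * C * L + 2 * Lp * L) * \<delta>"
  if \<delta>: "0 < \<delta>" "\<delta> < \<beta>" "2 * M * \<delta> < 1" for \<delta>
 proof -
  let ?I = "\<integral>x. of_real (cut \<delta> x) * pd j \<psi> x \<partial>lborel" and ?d = "\<lambda>k x. (\<psi> (x + h k *\<^sub>R e) - \<psi> x) /\<^sub>R h k"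
  \<comment> \<open>The backward quotient, with the sign that summation by parts produces: its limit
    \<open>N\<close> is minus the derivative of the cut-off.\<close>
  define q where "q k x = (cut \<delta> (x - h k *\<^sub>R e) - cut \<delta> x) / h k" for k x
  define N where "N x = lim (\<lambda>k. q k x)" for x
  have qm: "q k \<in> borel_measurable borel" for k unfolding q_def using h
   by (intro borel_measurable_continuous_onI continuous_intros continuous_on_compose2[OF cut_continuous[OF \<delta>(1), of UNIV]] cut_continuous[OF \<delta>(1)]) (auto simp: less_imp_neq[THEN not_sym])
  have Nm: "N \<in> borel_measurable borel" unfolding N_def using qm by measurable
  have qb: "\<bar>q k x\<bar> \<le> 1 / \<delta>" for k x
  proof -
   have "\<bar>cut \<delta> (x - h k *\<^sub>R e) - cut \<delta> x\<bar> \<le> h k / \<delta>"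
    using cut_lipschitz[OF \<delta>(1), of "x - h k *\<^sub>R e" x] e h[of k] by simp
   then show ?thesis using h[of k] \<delta>(1) by (simp add: q_def abs_divide field_simps)
  qed
  note cq = cut_quotient[OF \<delta>(1,2) e, folded h_def, folded q_def]
  define Bad where "Bad = \<Phi> ` ({0..L} \<times> {0}) \<union> \<Phi> ` ({0..L} \<times> {-\<delta>})"
  have Bad: "AE x in lborel. x \<notin> Bad" unfolding Bad_def by (intro AE_not_in null_sets.Un level_null)
  have N1: "N x = 0" if "x \<notin> closure Oi" for x using cq(1)[OF that] by (simp add: N_def limI)
  have N2: "N x = 0" if "x \<in> Oi" "dep x > \<delta>" for x using cq(2)[OF that] by (simp add: N_def limI)
  have N3: "N (\<Phi> (s, t)) = n s $ j / \<delta>" if "-\<delta> < t" "t < 0" for s t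
   using cq(3)[OF that, of s] by (simp add: N_def limI e_def inner_axis)
  have conv: "(\<lambda>k. q k x) \<longlonglongrightarrow> N x" if "x \<notin> Bad" for x
  proof (rule closure_cases[OF \<delta>(1,2), of x])
   assume "x \<notin> closure Oi" then show ?thesis using cq(1) N1 by simp
  next
   assume "x \<in> Oi" "dep x > \<delta>" then show ?thesis using cq(2) N2 by simp
  next
   fix s t assume "x = \<Phi> (s, t)" "-\<delta> < t" "t < 0"
   then show ?thesis using cq(3)[of t s] N3 by (simp add: e_def inner_axis)
  next
   assume "x \<in> \<Phi> ` ({0..L} \<times> {0}) \<union> \<Phi> ` ({0..L} \<times> {-\<delta>})"
   then show ?thesis using that by (simp add: Bad_def)
  qed
  have Ntub: "N x = 0" if "x \<notin> Bad" "x \<notin> tub \<delta>" for x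
  proof (rule closure_cases[OF \<delta>(1,2), of x])
   fix s t assume "x = \<Phi> (s, t)" "-\<delta> < t" "t < 0"
   then have "x \<in> tub \<delta>" using \<delta> \<Phi>_in_tub[of t \<delta> s] by simp
   then show ?thesis using that by simp
  qed (use N1 N2 that in \<open>auto simp: Bad_def\<close>)
  define a where "a k = (\<integral>x. of_real (cut \<delta> x) * (?d k x) \<partial>lborel)" for k
  have i1: "integrable lborel (\<lambda>x. of_real (cut \<delta> x) * \<psi> (x + h k *\<^sub>R e))" for k
  proof (rule continuous_compact_integrable[of _ "R + 1"])
   show "continuous_on UNIV (\<lambda>x. of_real (cut \<delta> x) * \<psi> (x + h k *\<^sub>R e))"
    by (intro continuous_intros cut_continuous \<delta> continuous_on_compose2[OF \<psi>c[of UNIV]]) auto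
   fix x :: R2 assume "x \<notin> cball 0 (R + 1)"
   then have "x + h k *\<^sub>R e \<notin> cball 0 R"
    using norm_triangle_ineq4[of "x + h k *\<^sub>R e" "h k *\<^sub>R e"] e h[of k] by auto
   then show "of_real (cut \<delta> x) * \<psi> (x + h k *\<^sub>R e) = 0" using R by simp
  qed
  have i2: "integrable lborel (\<lambda>x. of_real (cut \<delta> x) * \<psi> x)"
   by (rule continuous_compact_integrable[of _ R]) (auto intro!: continuous_intros cut_continuous \<delta> \<psi>c simp: R)
  have i3: "integrable lborel (\<lambda>x. of_real (cut \<delta> (x - h k *\<^sub>R e)) * \<psi> x)" for k
   by (rule continuous_compact_integrable[of _ R])
    (auto intro!: continuous_intros continuous_on_compose2[OF cut_continuous[OF \<delta>(1), of UNIV]] \<psi>c simp: R)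
  \<comment> \<open>Discrete integration by parts: translation invariance moves the shift from
    \<psi> to the cut-off.\<close>
  have aq: "a k = (\<integral>x. of_real (q k x) * \<psi> x \<partial>lborel)" for k
  proof -
   have tr: "(\<integral>x. of_real (cut \<delta> x) * \<psi> (x + h k *\<^sub>R e) \<partial>lborel) = (\<integral>x. of_real (cut \<delta> (x - h k *\<^sub>R e)) * \<psi> x \<partial>lborel)"
   proof -
    have m: "(\<lambda>x. of_real (cut \<delta> (x - h k *\<^sub>R e)) * \<psi> x) \<in> borel_measurable borel" using borel_measurable_integrable[OF i3[of k]] by simp
    show ?thesis using lborel_integral_translate[OF m, of "h k *\<^sub>R e"] by (simp add: add.commute)
   qed
   have "a k = (\<integral>x. (of_real (cut \<delta> x) * \<psi> (x + h k *\<^sub>R e) - of_real (cut \<delta> x) * \<psi> x) /\<^sub>R h k \<partial>lborel)"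
    unfolding a_def by (intro Bochner_Integration.integral_cong refl) (simp add: scaleR_conv_of_real algebra_simps)
   also have "\<dots> = ((\<integral>x. of_real (cut \<delta> x) * \<psi> (x + h k *\<^sub>R e) \<partial>lborel) - (\<integral>x. of_real (cut \<delta> x) * \<psi> x \<partial>lborel)) /\<^sub>R h k"
    using i1 i2 by simp
   also have "\<dots> = (\<integral>x. (of_real (cut \<delta> (x - h k *\<^sub>R e)) * \<psi> x - of_real (cut \<delta> x) * \<psi> x) /\<^sub>R h k \<partial>lborel)"
    unfolding tr using i3 i2 by simp
   also have "\<dots> = (\<integral>x. of_real (q k x) * \<psi> x \<partial>lborel)"
    by (intro Bochner_Integration.integral_cong refl) (simp add: q_def scaleR_conv_of_real divide_inverse algebra_simps)
   finally show ?thesis .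
  qed
  have bndi: "integrable lborel (\<lambda>x. K * indicator (cball (0::R2) r) x :: real)" for K r
   using emeasure_lborel_cball_finite[of "0::R2" r] by (intro integrable_mult_right integrable_real_indicator) auto
  have lim1: "a \<longlonglongrightarrow> ?I" unfolding a_def
  proof (rule integral_dominated_convergence[where w = "\<lambda>x. Lp * indicator (cball 0 (R + 1)) x"])
   have cm: "cut \<delta> \<in> borel_measurable borel" using cut_continuous[OF \<delta>(1)] by (rule borel_measurable_continuous_onI)
   show "(\<lambda>x. of_real (cut \<delta> x) * pd j \<psi> x) \<in> borel_measurable lborel"
    using cm test_fun_measurable[OF test_fun_pd[OF \<psi>]] by measurable
   show "(\<lambda>x. of_real (cut \<delta> x) * (?d k x)) \<in> borel_measurable lborel" for k
    using cm \<psi>m by measurable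
   show "AE x in lborel. (\<lambda>k. of_real (cut \<delta> x) * (?d k x)) \<longlonglongrightarrow> of_real (cut \<delta> x) * pd j \<psi> x"
   proof (intro AE_I2 tendsto_mult tendsto_const)
    fix x
    have "(\<lambda>k. ?d k x) \<longlonglongrightarrow> frechet_derivative \<psi> (at x) e"
     unfolding h_def using smooth_fun_differentiable[OF test_fun_smooth[OF \<psi>]]
     by (intro tendsto_difference_quotient e) (simp add: frechet_derivative_works)
    then show "(\<lambda>k. ?d k x) \<longlonglongrightarrow> pd j \<psi> x" by (simp add: pd_def e_def)
   qed
   show "AE x in lborel. norm (of_real (cut \<delta> x) * (?d k x)) \<le> Lp * indicator (cball 0 (R + 1)) x" for k
   proof (rule AE_I2)
    fix x :: R2
    show "norm (of_real (cut \<delta> x) * (?d k x)) \<le> Lp * indicator (cball 0 (R + 1)) x"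
    proof (cases "x \<in> cball 0 (R + 1)")
     case True
     have "cmod (\<psi> (x + h k *\<^sub>R e) - \<psi> x) \<le> Lp * h k" using Lp(1)[of "x + h k *\<^sub>R e" x] e h[of k] by simp
     moreover have "norm (b /\<^sub>R r) \<le> Lp" if "norm b \<le> Lp * r" "r > 0" for b :: complex and r
      using that by (simp add: field_simps)
     ultimately have "norm (?d k x) \<le> Lp" using h[of k] by blast
     then have "norm (of_real (cut \<delta> x) * (?d k x)) \<le> 1 * Lp"
      unfolding norm_mult using cut_01[OF \<delta>(1), of x] by (intro mult_mono) auto
     then show ?thesis using True by simp
    next
     case False
     then have "x + h k *\<^sub>R e \<notin> cball 0 R" "x \<notin> cball 0 R"
      using norm_triangle_ineq4[of "x + h k *\<^sub>R e" "h k *\<^sub>R e"] e h[of k] by auto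
     then show ?thesis using R Lp(2) by (simp add: less_imp_le)
    qed
   qed
  qed (rule bndi)
  have lim2: "a \<longlonglongrightarrow> (\<integral>x. of_real (N x) * \<psi> x \<partial>lborel)" unfolding aq
  proof (rule integral_dominated_convergence[where w = "\<lambda>x. (C / \<delta>) * indicator (cball 0 R) x"])
   show "(\<lambda>x. of_real (N x) * \<psi> x) \<in> borel_measurable lborel" using Nm \<psi>m by measurable
   show "(\<lambda>x. of_real (q k x) * \<psi> x) \<in> borel_measurable lborel" for k using qm \<psi>m by measurable
   show "AE x in lborel. (\<lambda>k. of_real (q k x) * \<psi> x) \<longlonglongrightarrow> of_real (N x) * \<psi> x"
    using Bad by eventually_elim (intro tendsto_intros conv)
   show "AE x in lborel. norm (of_real (q k x) * \<psi> x) \<le> (C / \<delta>) * indicator (cball 0 R) x" for k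
   proof (rule AE_I2)
    fix x :: R2
    have "norm (of_real (q k x) * \<psi> x) \<le> 1 / \<delta> * C"
     unfolding norm_mult using qb[of k x] C(1)[of x] \<delta>(1) by (intro mult_mono) auto
    then show "norm (of_real (q k x) * \<psi> x) \<le> (C / \<delta>) * indicator (cball 0 R) x"
     using R(2)[of x] by (auto simp: indicator_def)
   qed
  qed (rule bndi)
  have eq1: "?I = (\<integral>x. of_real (N x) * \<psi> x \<partial>lborel)"
   using LIMSEQ_unique[OF lim1 lim2] .
  also have "\<dots> = (\<integral>x. indicator (tub \<delta>) x *\<^sub>R (of_real (N x) * \<psi> x) \<partial>lborel)"
  proof (rule integral_cong_AE)
   show "AE x in lborel. of_real (N x) * \<psi> x = indicator (tub \<delta>) x *\<^sub>R (of_real (N x) * \<psi> x)"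
    using Bad by eventually_elim (auto simp: indicator_def Ntub)
   show "(\<lambda>x. of_real (N x) * \<psi> x) \<in> borel_measurable lborel" using Nm \<psi>m by measurable
   then show "(\<lambda>x. indicator (tub \<delta>) x *\<^sub>R (of_real (N x) * \<psi> x)) \<in> borel_measurable lborel"
    using tub_open[of \<delta>] by (intro borel_measurable_scaleR borel_measurable_indicator) auto
  qed
  finally have eq: "?I = (\<integral>x. indicator (tub \<delta>) x *\<^sub>R (of_real (N x) * \<psi> x) \<partial>lborel)" .
  let ?P = "{0..<L} \<times> {-\<delta><..<0}"
  let ?G = "\<lambda>p. indicator ?P p *\<^sub>R ((of_real (n (fst p) $ j) * \<psi> (\<gamma> (fst p))) / of_real \<delta>)"
  define F where "F p = indicator (Q \<delta>) p *\<^sub>R (of_real (N (\<Phi> p)) * \<psi> (\<Phi> p))" for p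
  \<comment> \<open>The explicit form of the integrand in coordinates. It agrees with
    \<open>F\<close> off the line t = 0, because \<open>N\<close> vanishes outside the closure of
    the domain.\<close>
  define F' where "F' p = indicator ?P p *\<^sub>R (of_real (n (fst p) $ j / \<delta>) * \<psi> (\<Phi> p))" for p
  have Pm: "?P \<in> sets (borel :: (real \<times> real) measure)" by (intro borel_Times) auto
  have nm: "(\<lambda>p :: real \<times> real. n (fst p) $ j) \<in> borel_measurable borel"
   by (intro borel_measurable_continuous_onI continuous_intros continuous_on_compose2[OF n_continuous[of UNIV]]) auto
  have F'm: "F' \<in> borel_measurable borel"
   unfolding F'_def using Pm nm measurable_compose[OF \<Phi>_borel \<psi>m] by measurable
  have Fm: "F \<in> borel_measurable borel"
   unfolding F_def using Q_borel[of \<delta>] measurable_compose[OF \<Phi>_borel \<psi>m] measurable_compose[OF \<Phi>_borel Nm] by measurable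
  have PQ: "?P \<subseteq> Q \<delta>" by (auto simp: Q_def)
  have F'b: "norm (F' p) \<le> indicator (Q \<delta>) p *\<^sub>R (C / \<delta>)" for p
  proof (cases "p \<in> ?P")
   case True
   have "\<bar>n (fst p) $ j\<bar> * cmod (\<psi> (\<Phi> p)) \<le> 1 * C" by (intro mult_mono nj C(1)) auto
   then have "\<bar>n (fst p) $ j\<bar> * cmod (\<psi> (\<Phi> p)) / \<delta> \<le> C / \<delta>" using \<delta>(1) by (intro divide_right_mono) auto
   moreover have "norm (F' p) = \<bar>n (fst p) $ j\<bar> * cmod (\<psi> (\<Phi> p)) / \<delta>"
    using True \<delta>(1) by (simp add: F'_def norm_mult norm_divide)
   ultimately have "norm (F' p) \<le> C / \<delta>" by simp
   then show ?thesis using True PQ by (auto simp: indicator_def)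
  next
   case False
   then show ?thesis using C(2) \<delta>(1) by (simp add: F'_def indicator_def)
  qed
  have "AE p in lborel. (p :: real \<times> real) \<notin> {p. snd p = 0}"
  proof (rule AE_not_in)
   have "negligible {p :: real \<times> real. p \<bullet> (0, 1) = 0}"
    by (rule negligible_standard_hyperplane) (auto simp: Basis_prod_def)
   then have "negligible {p :: real \<times> real. snd p = 0}" by (simp add: inner_prod_def)
   moreover have "closed {p :: real \<times> real. snd p = 0}" by (intro closed_Collect_eq continuous_intros)
   ultimately show "{p :: real \<times> real. snd p = 0} \<in> null_sets lborel"
    by (auto simp: negligible_iff_null_sets null_sets_def)
  qed
  then have FF': "AE p in lborel. F p = F' p"
  proof eventually_elim
   fix p :: "real \<times> real" assume p: "p \<notin> {p. snd p = 0}"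
   obtain s t where st: "p = (s, t)" by (cases p)
   show "F p = F' p"
   proof (cases "p \<in> Q \<delta>")
    case True
    show ?thesis
    proof (cases "t < 0")
     case True
     then show ?thesis using \<open>p \<in> Q \<delta>\<close> N3[of t s] by (simp add: F_def F'_def st Q_def)
    next
     case False
     then have "N (\<Phi> p) = 0" using p outside[of t s] True \<delta>(2) by (intro N1) (auto simp: st \<Phi>_def Q_def)
     then show ?thesis using False by (simp add: F_def F'_def st)
    qed
   next
    case False
    then show ?thesis using PQ by (auto simp: F_def F'_def indicator_def)
   qed
  qed
  have Qc: "integrable lborel (\<lambda>p. indicator (Q \<delta>) p *\<^sub>R (c::real))" for c using Q_integrable \<delta>(1) by simp
  have F'i: "integrable lborel F'"
  proof (rule Bochner_Integration.integrable_bound[OF Qc[of "C / \<delta>"]])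
   show "F' \<in> borel_measurable lborel" using F'm by simp
   show "AE p in lborel. norm (F' p) \<le> norm (indicator (Q \<delta>) p *\<^sub>R (C / \<delta>))"
    unfolding real_norm_def by (intro AE_I2 order_trans[OF F'b abs_ge_self])
  qed
  have Fi: "integrable lborel F" using F'i FF' Fm F'm by (subst integrable_cong_AE) auto
  have nF: "(\<integral>p. norm (F p) \<partial>lborel) \<le> 2 * L * C"
  proof -
   have "(\<integral>p. norm (F p) \<partial>lborel) = (\<integral>p. norm (F' p) \<partial>lborel)" using FF' Fm F'm by (intro integral_cong_AE) auto
   also have "\<dots> \<le> (\<integral>p. indicator (Q \<delta>) p *\<^sub>R (C / \<delta>) \<partial>lborel)"
    by (intro Bochner_Integration.integral_mono integrable_norm F'i Qc F'b)
   also have "\<dots> = 2 * L * C" using \<delta>(1) by (subst Q_integral) auto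
   finally show ?thesis .
  qed
  have NPm: "(\<lambda>x. of_real (N x) * \<psi> x) \<in> borel_measurable borel" using Nm \<psi>m by measurable
  have "cmod ((\<integral>x. indicator (tub \<delta>) x *\<^sub>R (of_real (N x) * \<psi> x) \<partial>lborel) - (\<integral>p. F p \<partial>lborel)) \<le> 12 * M * \<delta> * (\<integral>p. indicator (Q \<delta>) p *\<^sub>R cmod (of_real (N (\<Phi> p)) * \<psi> (\<Phi> p)) \<partial>lborel)"
   using tube_integral[OF \<delta>(1) less_imp_le[OF \<delta>(2)] \<delta>(3) NPm Fi[unfolded F_def[abs_def]]] by (simp only: F_def)
  also have "(\<lambda>p. indicator (Q \<delta>) p *\<^sub>R cmod (of_real (N (\<Phi> p)) * \<psi> (\<Phi> p))) = (\<lambda>p. norm (F p))"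
   by (auto simp: F_def indicator_def)
  also have "12 * M * \<delta> * (\<integral>p. norm (F p) \<partial>lborel) \<le> 12 * M * \<delta> * (2 * L * C)"
   using nF M_pos \<delta>(1) by (intro mult_left_mono) auto
  finally have E1: "cmod (?I - (\<integral>p. F p \<partial>lborel)) \<le> 12 * M * \<delta> * (2 * L * C)"
   unfolding eq .
  have FFi: "(\<integral>p. F p \<partial>lborel) = (\<integral>p. F' p \<partial>lborel)" using FF' Fm F'm by (intro integral_cong_AE) auto
  have fc: "continuous_on UNIV (\<lambda>s. of_real (n s $ j) * \<psi> (\<gamma> s))"
   by (intro continuous_intros n_continuous continuous_on_compose2[OF \<psi>c[of UNIV]] \<gamma>_continuous) auto
  have JG: "J = (\<integral>p. ?G p \<partial>lborel)"
   unfolding J_def using boundary_integral_prod(2)[OF fc \<delta>(1)] by simp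
  note Gi = boundary_integral_prod(1)[OF fc \<delta>(1)]
  have "cmod ((\<integral>p. F' p \<partial>lborel) - J) = cmod (\<integral>p. F' p - ?G p \<partial>lborel)"
   unfolding JG using F'i Gi by simp
  also have "\<dots> \<le> (\<integral>p. indicator (Q \<delta>) p *\<^sub>R Lp \<partial>lborel)"
  proof (rule norm_integral_bound[OF _ Qc])
   show "integrable lborel (\<lambda>p. F' p - ?G p)"
    using F'i Gi by simp
   fix p
   show "norm (F' p - ?G p) \<le> indicator (Q \<delta>) p *\<^sub>R Lp"
   proof (cases "p \<in> ?P")
    case True
    have "F' p - ?G p
      = of_real (n (fst p) $ j) * ((\<psi> (\<Phi> p) - \<psi> (\<gamma> (fst p))) / of_real \<delta>)"
     using True by (simp add: F'_def diff_divide_distrib right_diff_distrib)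
    also have "norm \<dots> \<le> 1 * (Lp * norm (\<Phi> p - \<gamma> (fst p)) / \<delta>)"
     unfolding norm_mult norm_divide using nj[of "fst p"] Lp(1)[of "\<Phi> p" "\<gamma> (fst p)"] \<delta>(1)
     by (intro mult_mono) (auto intro: divide_right_mono)
    also have "\<dots> \<le> Lp"
    proof -
     have "norm (\<Phi> p - \<gamma> (fst p)) \<le> \<delta>" using True by (auto simp: \<Phi>_def norm_n)
     then have "Lp * norm (\<Phi> p - \<gamma> (fst p)) \<le> Lp * \<delta>" using Lp(2) by (intro mult_left_mono) auto
     then show ?thesis using \<delta>(1) by (simp add: divide_le_eq)
    qed
    finally show ?thesis using True PQ by (auto simp: indicator_def)
   next
    case False
    then show ?thesis using Lp(2) by (simp add: F'_def)
   qed
  qed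
  also have "\<dots> = 2 * Lp * L * \<delta>" using \<delta>(1) by (subst Q_integral) auto
  finally have E2: "cmod ((\<integral>p. F p \<partial>lborel) - J) \<le> 2 * Lp * L * \<delta>" unfolding FFi .
  have "cmod (?I - J) \<le> 12 * M * \<delta> * (2 * L * C) + 2 * Lp * L * \<delta>"
   using norm_triangle_ineq[of "?I - (\<integral>p. F p \<partial>lborel)" "(\<integral>p. F p \<partial>lborel) - J"] E1 E2 by simp
  then show ?thesis by (simp add: algebra_simps)
 qed
 then show ?thesis unfolding J_def by blast
qed

text \<open>As \<delta> tends to 0 the cut-offs converge to the indicator of the open set
  \<open>Oi\<close> at every point, because the depth is positive inside; the right side is the
  limit found in \<open>layer_estimate\<close>.\<close>

lemma divergence_theorem:
 assumes \<psi>: "test_fun UNIV \<psi>"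
 shows "(\<integral>x. indicator Oi x *\<^sub>R pd j \<psi> x \<partial>lborel) = (\<integral>s. indicator {0..L} s *\<^sub>R (of_real (n s $ j) * \<psi> (\<gamma> s)) \<partial>lborel)"
  (is "?A = ?J")
proof -
 obtain K where K: "\<And>\<delta>. 0 < \<delta> ==> \<delta> < \<beta> ==> 2 * M * \<delta> < 1 ==>
  cmod ((\<integral>x. of_real (cut \<delta> x) * pd j \<psi> x \<partial>lborel) - ?J) \<le> K * \<delta>" using layer_estimate[OF \<psi>] by blast
 let ?d = "\<lambda>k. inverse (real (Suc k))"
 obtain C where C: "\<And>x. cmod (pd j \<psi> x) \<le> C" "C > 0" using test_fun_bounded[OF test_fun_pd[OF \<psi>]] by metis
 obtain R where R: "R > 0" "\<And>x. x \<notin> cball 0 R ==> pd j \<psi> x = 0" using test_fun_support_ball[OF test_fun_pd[OF \<psi>]] by metis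
 have pm: "pd j \<psi> \<in> borel_measurable borel" using test_fun_measurable[OF test_fun_pd[OF \<psi>]] .
 have "(\<lambda>k. \<integral>x. of_real (cut (?d k) x) * pd j \<psi> x \<partial>lborel) \<longlonglongrightarrow> ?A"
 proof (rule integral_dominated_convergence[where w = "\<lambda>x. C * indicator (cball 0 R) x"])
  show "(\<lambda>x. indicator Oi x *\<^sub>R pd j \<psi> x) \<in> borel_measurable lborel" using pm Oi_open by simp
  have "cut (?d k) \<in> borel_measurable borel" for k using cut_continuous[of "?d k" UNIV] by (intro borel_measurable_continuous_onI) simp
  then show "(\<lambda>x. of_real (cut (?d k) x) * pd j \<psi> x) \<in> borel_measurable lborel" for k using pm by measurable
  show "integrable lborel (\<lambda>x. C * indicator (cball (0::R2) R) x :: real)"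
   using emeasure_lborel_cball_finite[of "0::R2" R] by (intro integrable_mult_right integrable_real_indicator) auto
  show "AE x in lborel. norm (of_real (cut (?d k) x) * pd j \<psi> x) \<le> C * indicator (cball 0 R) x" for k
  proof (rule AE_I2)
   fix x :: R2
   have "norm (of_real (cut (?d k) x) * pd j \<psi> x) \<le> 1 * C"
    unfolding norm_mult using cut_01[of "?d k" x] C(1)[of x] by (intro mult_mono) auto
   then show "norm (of_real (cut (?d k) x) * pd j \<psi> x) \<le> C * indicator (cball 0 R) x"
    using R(2)[of x] by (auto simp: indicator_def)
  qed
  show "AE x in lborel. (\<lambda>k. of_real (cut (?d k) x) * pd j \<psi> x) \<longlonglongrightarrow> indicator Oi x *\<^sub>R pd j \<psi> x"
  proof (rule AE_I2)
   fix x
   show "(\<lambda>k. of_real (cut (?d k) x) * pd j \<psi> x) \<longlonglongrightarrow> indicator Oi x *\<^sub>R pd j \<psi> x"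
   proof (cases "x \<in> Oi")
    case True
    show ?thesis
    proof (rule tendsto_eventually, rule eventually_mono[OF eventually_inverse_less[OF dep_pos[OF True]]])
     fix k assume "?d k < dep x"
     then have "cut (?d k) x = 1" by (simp add: cut_def field_simps del: of_nat_Suc)
     then show "of_real (cut (?d k) x) * pd j \<psi> x = indicator Oi x *\<^sub>R pd j \<psi> x" using True by simp
    qed
   next
    case False
    then show ?thesis by (simp add: cut_def dep_outside)
   qed
  qed
 qed
 moreover have "(\<lambda>k. \<integral>x. of_real (cut (?d k) x) * pd j \<psi> x \<partial>lborel) \<longlonglongrightarrow> ?J"
 proof (rule LIM_zero_cancel, rule Lim_null_comparison)
  have "\<forall>\<^sub>F k in sequentially. ?d k < \<beta>" "\<forall>\<^sub>F k in sequentially. ?d k < 1 / (2 * M)"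
   using eventually_inverse_less[OF \<beta>_pos] eventually_inverse_less[of "1 / (2 * M)"] M_pos by simp_all
  then show "\<forall>\<^sub>F k in sequentially. norm ((\<integral>x. of_real (cut (?d k) x) * pd j \<psi> x \<partial>lborel) - ?J) \<le> K * ?d k"
  proof eventually_elim
   case (elim k)
   then have "2 * M * ?d k < 1" using M_pos by (simp add: less_divide_eq mult.commute)
   then show ?case using elim by (intro K) auto
  qed
  have "(\<lambda>k. K * ?d k) \<longlonglongrightarrow> K * 0" by (intro tendsto_intros LIMSEQ_inverse_real_of_nat)
  then show "(\<lambda>k. K * ?d k) \<longlonglongrightarrow> 0" by simp
 qed
 ultimately show ?thesis by (rule LIMSEQ_unique)
qed

end

subsection \<open>Squeezed potentials\<close>

context tube_curve
begin

definition foot :: "R2 => R2" where "foot x = \<gamma> (SOME s. \<exists>t. \<bar>t\<bar> < \<beta> \<and> x = \<Phi> (s, t))"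

text \<open>The dilation of the normal coordinate by the factor \<open>c\<close>. The scaled
  potential is \<open>V\<close> composed with it, and its Lipschitz property carries measurability
  and null sets between tubes of different width.\<close>

definition scl :: "real => R2 => R2" where "scl c x = foot x + c *\<^sub>R (x - foot x)"

lemma foot_\<Phi>: "\<bar>t\<bar> < \<beta> ==> foot (\<Phi> (s, t)) = \<gamma> s"
proof -
 assume t: "\<bar>t\<bar> < \<beta>"
 define r where "r = (SOME r. \<exists>t'. \<bar>t'\<bar> < \<beta> \<and> \<Phi> (s, t) = \<Phi> (r, t'))"
 have "\<exists>t'. \<bar>t'\<bar> < \<beta> \<and> \<Phi> (s, t) = \<Phi> (r, t')" unfolding r_def by (rule someI[of _ s]) (use t in blast)
 then obtain t' where "\<bar>t'\<bar> < \<beta>" "\<Phi> (s, t) = \<Phi> (r, t')" by blast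
 then have "\<gamma> s = \<gamma> r" using sep[of s t r t'] t by (simp add: \<Phi>_def)
 then show ?thesis unfolding foot_def r_def[symmetric] by simp
qed

lemma scl_\<Phi>: "\<bar>t\<bar> < \<beta> ==> scl c (\<Phi> (s, t)) = \<Phi> (s, c * t)" by (simp add: scl_def foot_\<Phi>) (simp add: \<Phi>_def)

text \<open>The map equals (1 - c) times the projection to the foot point plus c times the identity,
  and the projection has Lipschitz constant 1/(1 - e/\<beta>).\<close>

lemma scl_lipschitz:
 assumes "e < \<beta>" "x \<in> tub e" "y \<in> tub e"
 shows "norm (scl c x - scl c y) \<le> (\<bar>1 - c\<bar> / (1 - e / \<beta>) + \<bar>c\<bar>) * norm (x - y)"
proof -
 obtain s t where x: "x = \<Phi> (s, t)" "\<bar>t\<bar> < e" using assms tub_eq[of e] by auto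
 obtain s' t' where y: "y = \<Phi> (s', t')" "\<bar>t'\<bar> < e" using assms tub_eq[of e] by auto
 have "(1 - e / \<beta>) * norm (foot x - foot y) \<le> norm (x - y)"
  using foot_lipschitz[of t e t' s s'] x y assms(1) by (simp add: foot_\<Phi>)
 moreover have "1 - e / \<beta> > 0" using assms(1) \<beta>_pos by simp
 ultimately have f: "norm (foot x - foot y) \<le> norm (x - y) / (1 - e / \<beta>)" by (simp add: pos_le_divide_eq mult.commute)
 have "scl c x - scl c y = (1 - c) *\<^sub>R (foot x - foot y) + c *\<^sub>R (x - y)" by (simp add: scl_def algebra_simps)
 then have "norm (scl c x - scl c y) \<le> \<bar>1 - c\<bar> * norm (foot x - foot y) + \<bar>c\<bar> * norm (x - y)"
  using norm_triangle_ineq[of "(1 - c) *\<^sub>R (foot x - foot y)" "c *\<^sub>R (x - y)"] by simp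
 also have "\<bar>1 - c\<bar> * norm (foot x - foot y) \<le> \<bar>1 - c\<bar> * (norm (x - y) / (1 - e / \<beta>))"
  using f by (intro mult_left_mono) auto
 finally show ?thesis by (simp add: algebra_simps)
qed

end

section \<open>The scaled potential in tubular coordinates\<close>

locale tube_potential = tube_curve +
 fixes \<nu> :: "R2 => R2" and V :: "R2 => real" and Mv :: real
 assumes \<nu>: "\<nu> (\<gamma> s) = n s" and V_borel: "V \<in> borel_measurable borel" and Mv_pos: "Mv > 0"
  and V_bound: "AE x in lebesgue. \<bar>V x\<bar> \<le> Mv"
begin

definition W :: "real => R2 => real" where "W \<epsilon> = V_eps (\<gamma> ` {0..L}) \<nu> \<beta> V \<epsilon>"

definition al :: "real => real" where "al s = alpha_of \<nu> \<beta> V (\<gamma> s)"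

lemma W_eq:
 assumes \<epsilon>: "0 < \<epsilon>" "\<epsilon> < \<beta>"
 shows "W \<epsilon> x = indicator (tub \<epsilon>) x * (\<beta> / \<epsilon> * V (scl (\<beta> / \<epsilon>) x))"
proof (cases "x \<in> tub \<epsilon>")
 case True
 then obtain s t where st: "x = \<Phi> (s, t)" "s \<in> {0..<L}" "\<bar>t\<bar> < \<epsilon>" using tub_eq[of \<epsilon>] \<epsilon> by auto
 let ?P = "\<lambda>p. fst p \<in> \<gamma> ` {0..L} \<and> \<bar>snd p\<bar> < \<epsilon> \<and> x = fst p + snd p *\<^sub>R \<nu> (fst p)"
 have P: "?P (\<gamma> s, t)" using st by (auto simp: \<nu> \<Phi>_def)
 have "(THE p. ?P p) = (\<gamma> s, t)"
 proof (rule the_equality[of ?P, OF P])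
  fix p assume p: "?P p"
  then obtain s' where s': "fst p = \<gamma> s'" by auto
  have "\<gamma> s + t *\<^sub>R n s = \<gamma> s' + snd p *\<^sub>R n s'" using p st s' by (simp add: \<nu> \<Phi>_def)
  then show "p = (\<gamma> s, t)" using sep[of s t s' "snd p"] p st(3) \<epsilon>(2) s' by (simp add: prod_eq_iff)
 qed
 moreover have "x \<in> tube (\<gamma> ` {0..L}) \<nu> \<epsilon>" using P by (auto simp: tube_def)
 ultimately have "W \<epsilon> x = \<beta> / \<epsilon> * V (\<gamma> s + (\<beta> / \<epsilon> * t) *\<^sub>R \<nu> (\<gamma> s))" by (simp add: W_def V_eps_def Let_def)
 then show ?thesis using True st \<epsilon> scl_\<Phi>[of t "\<beta> / \<epsilon>" s] by (simp add: \<nu> \<Phi>_def)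
next
 case False
 have "x \<notin> tube (\<gamma> ` {0..L}) \<nu> \<epsilon>"
 proof
  assume "x \<in> tube (\<gamma> ` {0..L}) \<nu> \<epsilon>"
  then obtain s t where "x = \<Phi> (s, t)" "\<bar>t\<bar> < \<epsilon>" by (auto simp: tube_def \<Phi>_def \<nu>)
  then show False using False \<Phi>_in_tub[of t \<epsilon> s] \<epsilon> by simp
 qed
 then show ?thesis using False by (simp add: W_def V_eps_def)
qed

lemma W_borel:
 assumes \<epsilon>: "0 < \<epsilon>" "\<epsilon> < \<beta>"
 shows "W \<epsilon> \<in> borel_measurable borel"
proof -
 have "continuous_on (tub \<epsilon>) (scl (\<beta> / \<epsilon>))"
 proof -
  have "(\<bar>1 - \<beta> / \<epsilon>\<bar> / (1 - \<epsilon> / \<beta>) + \<bar>\<beta> / \<epsilon>\<bar>)-lipschitz_on (tub \<epsilon>) (scl (\<beta> / \<epsilon>))"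
  proof (rule lipschitz_onI)
   show "dist (scl (\<beta> / \<epsilon>) x) (scl (\<beta> / \<epsilon>) y) \<le> (\<bar>1 - \<beta> / \<epsilon>\<bar> / (1 - \<epsilon> / \<beta>) + \<bar>\<beta> / \<epsilon>\<bar>) * dist x y"
    if "x \<in> tub \<epsilon>" "y \<in> tub \<epsilon>" for x y unfolding dist_norm by (rule scl_lipschitz[OF \<epsilon>(2) that])
   show "0 \<le> \<bar>1 - \<beta> / \<epsilon>\<bar> / (1 - \<epsilon> / \<beta>) + \<bar>\<beta> / \<epsilon>\<bar>" using \<epsilon> by (intro add_nonneg_nonneg divide_nonneg_nonneg) auto
  qed
  then show ?thesis by (rule lipschitz_on_continuous_on)
 qed
 then have "(\<lambda>x. indicator (tub \<epsilon>) x *\<^sub>R scl (\<beta> / \<epsilon>) x) \<in> borel_measurable borel"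
  using tub_open by (intro borel_measurable_continuous_on_indicator) auto
 from measurable_compose[OF this V_borel]
 have "(\<lambda>x. indicator (tub \<epsilon>) x * (\<beta> / \<epsilon> * V (indicator (tub \<epsilon>) x *\<^sub>R scl (\<beta> / \<epsilon>) x))) \<in> borel_measurable borel"
  using tub_open[of \<epsilon>] by (intro borel_measurable_times borel_measurable_indicator) auto
 moreover have "W \<epsilon> x = indicator (tub \<epsilon>) x * (\<beta> / \<epsilon> * V (indicator (tub \<epsilon>) x *\<^sub>R scl (\<beta> / \<epsilon>) x))" for x
  unfolding W_eq[OF \<epsilon>] by (cases "x \<in> tub \<epsilon>") auto
 ultimately show ?thesis by presburger
qed

text \<open>\<open>V\<close> is bounded only almost everywhere, so the exceptional set must be
  followed: points where \<open>W\<close> is too large are images under \<open>scl\<close> of the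
  exceptional points of \<open>V\<close> in the \<beta>-tube, and locally Lipschitz maps preserve
  null sets.\<close>

lemma W_bound:
 assumes \<epsilon>: "0 < \<epsilon>" "\<epsilon> < \<beta>"
 shows "AE x in lborel. \<bar>W \<epsilon> x\<bar> \<le> Mv * \<beta> / \<epsilon>"
proof -
 let ?b = "Mv * \<beta> / \<epsilon>"
 define N where "N = {x. \<bar>V x\<bar> > Mv} \<inter> tub \<beta>"
 obtain N0 where N0: "\<And>x. x \<in> space lebesgue - N0 ==> \<bar>V x\<bar> \<le> Mv" "N0 \<in> null_sets lebesgue"
  using AE_E3[OF V_bound] by blast
 have Nn: "negligible N"
 proof (rule negligible_subset)
  show "negligible N0" using N0(2) by (simp add: negligible_iff_null_sets)
  show "N \<subseteq> N0" using N0(1) by (fastforce simp: N_def)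
 qed
 have "negligible (scl (\<epsilon> / \<beta>) ` N)"
 proof (rule negligible_locally_Lipschitz_image[OF _ Nn])
  fix x assume x: "x \<in> N"
  \<comment> \<open>The Lipschitz constant of \<open>scl\<close> blows up towards the edge of the
    \<beta>-tube, so the neighbourhood is chosen depending on the point, halfway to the
    edge.\<close>
  define e where "e = (infdist x \<Sigma> + \<beta>) / 2"
  have e: "infdist x \<Sigma> < e" "e < \<beta>" using x by (auto simp: N_def tub_def e_def)
  show "\<exists>T B. open T \<and> x \<in> T \<and> (\<forall>y\<in>N \<inter> T. norm (scl (\<epsilon> / \<beta>) y - scl (\<epsilon> / \<beta>) x) \<le> B * norm (y - x))"
  proof (intro exI conjI ballI)
   show "open (tub e)" by (rule tub_open)
   show xt: "x \<in> tub e" using e by (simp add: tub_def)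
   fix y assume "y \<in> N \<inter> tub e"
   then show "norm (scl (\<epsilon> / \<beta>) y - scl (\<epsilon> / \<beta>) x) \<le> (\<bar>1 - \<epsilon> / \<beta>\<bar> / (1 - e / \<beta>) + \<bar>\<epsilon> / \<beta>\<bar>) * norm (y - x)"
    using scl_lipschitz[OF e(2) _ xt] by blast
  qed
 qed simp
 moreover have "{x. \<bar>W \<epsilon> x\<bar> > ?b} \<subseteq> scl (\<epsilon> / \<beta>) ` N"
 proof
  fix x assume x: "x \<in> {x. \<bar>W \<epsilon> x\<bar> > ?b}"
  have "?b > 0" using Mv_pos \<beta>_pos \<epsilon> by simp
  have xt: "x \<in> tub \<epsilon>"
  proof (rule ccontr)
   assume "x \<notin> tub \<epsilon>"
   then have "W \<epsilon> x = 0" by (simp add: W_eq[OF \<epsilon>])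
   then show False using x \<open>?b > 0\<close> by simp
  qed
  then obtain s t where st: "x = \<Phi> (s, t)" "\<bar>t\<bar> < \<epsilon>" using tub_eq[of \<epsilon>] \<epsilon> by auto
  have bt: "\<bar>\<beta> / \<epsilon> * t\<bar> < \<beta>" using st(2) \<epsilon> \<beta>_pos by (simp add: abs_mult field_simps)
  define y where "y = \<Phi> (s, \<beta> / \<epsilon> * t)"
  have "\<bar>W \<epsilon> x\<bar> = \<beta> / \<epsilon> * \<bar>V y\<bar>" using xt st \<epsilon> scl_\<Phi>[of t "\<beta> / \<epsilon>" s] by (simp add: W_eq[OF \<epsilon>] y_def abs_mult)
  then have "\<bar>V y\<bar> > Mv" using x \<epsilon> \<beta>_pos by (simp add: field_simps)
  then have "y \<in> N" using \<Phi>_in_tub[OF bt] by (simp add: N_def y_def)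
  moreover have "scl (\<epsilon> / \<beta>) y = x" using scl_\<Phi>[OF bt, of "\<epsilon> / \<beta>" s] \<epsilon> \<beta>_pos st by (simp add: y_def)
  ultimately show "x \<in> scl (\<epsilon> / \<beta>) ` N" by force
 qed
 ultimately have "negligible {x. \<bar>W \<epsilon> x\<bar> > ?b}" by (rule negligible_subset)
 moreover have "{x. \<bar>W \<epsilon> x\<bar> > ?b} \<in> sets borel" using W_borel[OF \<epsilon>] by measurable
 ultimately have "{x. \<bar>W \<epsilon> x\<bar> > ?b} \<in> null_sets lborel" by (auto simp: negligible_iff_null_sets null_sets_def)
 from AE_not_in[OF this] show ?thesis by eventually_elim simp
qed

text \<open>The lower measure comparison has a positive factor, so a null set in the plane pulls
  back to a null set of coordinates.\<close>

lemma W_Q_bound: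
 assumes \<epsilon>: "0 < \<epsilon>" "\<epsilon> < \<beta>" "2 * M * \<epsilon> < 1"
 shows "AE p in lborel. p \<in> Q \<epsilon> --> \<bar>W \<epsilon> (\<Phi> p)\<bar> \<le> Mv * \<beta> / \<epsilon>"
proof -
 define A where "A = {x. \<not> \<bar>W \<epsilon> x\<bar> \<le> Mv * \<beta> / \<epsilon>}"
 have A: "A \<in> sets borel" unfolding A_def using W_borel[OF \<epsilon>(1,2)] by measurable
 have "AE x in lborel. x \<notin> A" using W_bound[OF \<epsilon>(1,2)] by eventually_elim (simp add: A_def)
 then have "emeasure lborel A = 0" using A AE_iff_measurable[of A lborel "\<lambda>x. x \<notin> A"] by auto
 then have "emeasure lborel (A \<inter> tub \<epsilon>) = 0" using emeasure_mono[of "A \<inter> tub \<epsilon>" A lborel] A by simp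
 then have "ennreal ((1 - 2 * M * \<epsilon>)\<^sup>2) * emeasure lborel (\<Phi> -` A \<inter> Q \<epsilon>) = 0"
  using tube_measure(2)[OF \<epsilon>(1) less_imp_le[OF \<epsilon>(2)] \<epsilon>(3) A] by simp
 moreover have "(1 - 2 * M * \<epsilon>)\<^sup>2 > 0" using \<epsilon>(3) by simp
 ultimately have "emeasure lborel (\<Phi> -` A \<inter> Q \<epsilon>) = 0" by auto
 moreover have "\<Phi> -` A \<inter> Q \<epsilon> \<in> sets borel" using measurable_sets[OF \<Phi>_borel A] Q_borel by (intro sets.Int) auto
 ultimately have "\<Phi> -` A \<inter> Q \<epsilon> \<in> null_sets lborel" by (simp add: null_sets_def)
 from AE_not_in[OF this] show ?thesis by eventually_elim (auto simp: A_def)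
qed

text \<open>The substitution t to (\<beta>/\<epsilon>) t: the factor \<beta>/\<epsilon> in the
  potential compensates the shorter segment, so the mass on each normal does not depend on
  \<epsilon>. Later, the comparison with the curve integral is exact at this point.\<close>

lemma al_eq:
 assumes \<epsilon>: "0 < \<epsilon>" "\<epsilon> < \<beta>"
 shows "al s = (\<integral>t. indicator {-\<epsilon><..<\<epsilon>} t *\<^sub>R W \<epsilon> (\<Phi> (s, t)) \<partial>lborel)"
proof -
 have "al s = (\<integral>t. indicator {-\<beta><..<\<beta>} t *\<^sub>R V (\<gamma> s + t *\<^sub>R n s) \<partial>lborel)"
  unfolding al_def alpha_of_def \<nu> using \<beta>_pos
  by (subst interval_lebesgue_integral_le_eq) (auto simp: set_lebesgue_integral_def)
 also have "\<dots> = \<bar>\<beta> / \<epsilon>\<bar> *\<^sub>R (\<integral>t. indicator {-\<beta><..<\<beta>} (0 + \<beta> / \<epsilon> * t) *\<^sub>R V (\<gamma> s + (0 + \<beta> / \<epsilon> * t) *\<^sub>R n s) \<partial>lborel)"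
  using \<epsilon> \<beta>_pos by (intro lborel_integral_real_affine) auto
 also have "\<dots> = (\<integral>t. \<bar>\<beta> / \<epsilon>\<bar> *\<^sub>R (indicator {-\<beta><..<\<beta>} (0 + \<beta> / \<epsilon> * t) *\<^sub>R V (\<gamma> s + (0 + \<beta> / \<epsilon> * t) *\<^sub>R n s)) \<partial>lborel)"
  by (rule integral_scaleR_right[symmetric])
 also have "\<dots> = (\<integral>t. indicator {-\<epsilon><..<\<epsilon>} t *\<^sub>R W \<epsilon> (\<Phi> (s, t)) \<partial>lborel)"
 proof (intro Bochner_Integration.integral_cong refl)
  fix t
  have iff: "\<beta> / \<epsilon> * t \<in> {-\<beta><..<\<beta>} \<longleftrightarrow> t \<in> {-\<epsilon><..<\<epsilon>}"
  proof -
   have c: "\<beta> / \<epsilon> > 0" "\<beta> / \<epsilon> * \<epsilon> = \<beta>" "\<beta> / \<epsilon> * (- \<epsilon>) = - \<beta>" using \<epsilon> \<beta>_pos by auto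
   show ?thesis using mult_less_cancel_left_pos[OF c(1), of t \<epsilon>] mult_less_cancel_left_pos[OF c(1), of "- \<epsilon>" t]
    unfolding c by auto
  qed
  show "\<bar>\<beta> / \<epsilon>\<bar> *\<^sub>R (indicator {-\<beta><..<\<beta>} (0 + \<beta> / \<epsilon> * t) *\<^sub>R V (\<gamma> s + (0 + \<beta> / \<epsilon> * t) *\<^sub>R n s)) =
    indicator {-\<epsilon><..<\<epsilon>} t *\<^sub>R W \<epsilon> (\<Phi> (s, t))"
  proof (cases "t \<in> {-\<epsilon><..<\<epsilon>}")
   case True
   then have "\<bar>t\<bar> < \<epsilon>" by auto
   then have "W \<epsilon> (\<Phi> (s, t)) = \<beta> / \<epsilon> * V (\<Phi> (s, \<beta> / \<epsilon> * t))"
    using \<epsilon> \<Phi>_in_tub[of t \<epsilon> s] scl_\<Phi>[of t "\<beta> / \<epsilon>" s] by (simp add: W_eq[OF \<epsilon>])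
   then show ?thesis using True iff \<epsilon> \<beta>_pos by (simp add: \<Phi>_def)
  qed (use iff in simp)
 qed
 finally show ?thesis .
qed

lemma WQ_measurable:
 assumes \<epsilon>: "0 < \<epsilon>" "\<epsilon> < \<beta>"
 shows "(\<lambda>p. W \<epsilon> (\<Phi> p)) \<in> borel_measurable borel" by (rule measurable_compose[OF \<Phi>_borel W_borel[OF \<epsilon>]])

lemma al_borel: "al \<in> borel_measurable borel"
proof -
 define \<epsilon> where "\<epsilon> = \<beta> / 2"
 have \<epsilon>: "0 < \<epsilon>" "\<epsilon> < \<beta>" using \<beta>_pos by (auto simp: \<epsilon>_def)
 have "(\<lambda>p. W \<epsilon> (\<Phi> p)) \<in> borel_measurable (lborel \<Otimes>\<^sub>M lborel)" unfolding lborel_prod using WQ_measurable[OF \<epsilon>] by simp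
 then have "(\<lambda>(s, t). indicator {-\<epsilon><..<\<epsilon>} t *\<^sub>R W \<epsilon> (\<Phi> (s, t))) \<in> borel_measurable (lborel \<Otimes>\<^sub>M lborel)"
  by (simp add: split_beta)
 from lborel.borel_measurable_lebesgue_integral[OF this] show ?thesis unfolding al_eq[OF \<epsilon>] by simp
qed

text \<open>The almost everywhere bound in the plane reaches almost every normal only through Fubini
  in coordinates. Any width works, since \<open>al\<close> does not depend on it.\<close>

lemma al_bound: "AE s in lborel. s \<in> {0..<L} --> \<bar>al s\<bar> \<le> 2 * Mv * \<beta>"
proof -
 \<comment> \<open>A width small enough for 2 M \<epsilon> < 1, as the transfer to coordinates
   demands.\<close>
 define \<epsilon> where "\<epsilon> = min (\<beta> / 2) (1 / (4 * M))"
 have "2 * M * \<epsilon> \<le> 2 * M * (1 / (4 * M))" unfolding \<epsilon>_def using M_pos by (intro mult_left_mono) auto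
 then have \<epsilon>: "0 < \<epsilon>" "\<epsilon> < \<beta>" "2 * M * \<epsilon> < 1" using \<beta>_pos M_pos by (auto simp: \<epsilon>_def)
 have "AE p in lborel \<Otimes>\<^sub>M lborel. p \<in> Q \<epsilon> --> \<bar>W \<epsilon> (\<Phi> p)\<bar> \<le> Mv * \<beta> / \<epsilon>"
  unfolding lborel_prod by (rule W_Q_bound[OF \<epsilon>])
 from lborel_pair.AE_pair[OF this]
 show ?thesis
 proof eventually_elim
  fix s assume ae: "AE t in lborel. (s, t) \<in> Q \<epsilon> --> \<bar>W \<epsilon> (\<Phi> (s, t))\<bar> \<le> Mv * \<beta> / \<epsilon>"
  show "s \<in> {0..<L} --> \<bar>al s\<bar> \<le> 2 * Mv * \<beta>"
  proof
   assume s: "s \<in> {0..<L}"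
   have "\<bar>al s\<bar> \<le> (\<integral>t. \<bar>indicator {-\<epsilon><..<\<epsilon>} t *\<^sub>R W \<epsilon> (\<Phi> (s, t))\<bar> \<partial>lborel)"
    unfolding al_eq[OF \<epsilon>(1,2)] by (rule integral_abs_bound)
   also have "\<dots> \<le> (\<integral>t. indicator {-\<epsilon><..<\<epsilon>} t *\<^sub>R (Mv * \<beta> / \<epsilon>) \<partial>lborel)"
   proof (rule integral_mono_AE')
    show "integrable lborel (\<lambda>t. indicator {-\<epsilon><..<\<epsilon>} t *\<^sub>R (Mv * \<beta> / \<epsilon>))"
     using \<epsilon>(1) by (intro integrable_scaleR_left integrable_real_indicator) auto
    show "AE t in lborel. \<bar>indicator {-\<epsilon><..<\<epsilon>} t *\<^sub>R W \<epsilon> (\<Phi> (s, t))\<bar> \<le> indicator {-\<epsilon><..<\<epsilon>} t *\<^sub>R (Mv * \<beta> / \<epsilon>)"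
     using ae by eventually_elim (use s in \<open>auto simp: indicator_def Q_def\<close>)
    show "AE t in lborel. 0 \<le> indicator {-\<epsilon><..<\<epsilon>} t *\<^sub>R (Mv * \<beta> / \<epsilon>)" using Mv_pos \<beta>_pos \<epsilon>(1) by auto
   qed
   also have "\<dots> = 2 * Mv * \<beta>" using \<epsilon>(1) by simp
   finally show "\<bar>al s\<bar> \<le> 2 * Mv * \<beta>" .
  qed
 qed
qed

end

subsection \<open>One-dimensional Sobolev bounds on normal segments\<close>

text \<open>Optimising the weight, \<theta> = a/b, turns Young's inequality for all weights into
  Cauchy-Schwarz.\<close>

lemma young_limit:
 fixes a b G :: real
 assumes "0 \<le> a" "0 < b" "0 \<le> G" and *: "\<And>\<theta>. \<theta> > 0 ==> a \<le> \<theta> / 2 * b + G / (2 * \<theta>)"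
 shows "a\<^sup>2 \<le> b * G"
proof (cases "a = 0")
 case False
 then have "a > 0" using assms(1) by simp
 have "a \<le> a / b / 2 * b + G / (2 * (a / b))" using \<open>a > 0\<close> assms(2) by (intro *) auto
 also have "\<dots> = a / 2 + G * b / (2 * a)" using \<open>a > 0\<close> assms(2) by (simp add: field_simps)
 finally have "a / 2 \<le> G * b / (2 * a)" by simp
 then show ?thesis using \<open>a > 0\<close> by (simp add: field_simps power2_eq_square)
qed (use assms in simp)

text \<open>The fundamental theorem of calculus with Cauchy-Schwarz on the interval between
  \<open>r\<close> and \<open>t\<close>. Continuity is asked of the majorant \<open>g\<close> rather
  than of q'.\<close>

lemma ftc_square:
 fixes q q' :: "real => complex"
 assumes d: "\<And>t. (q has_vector_derivative q' t) (at t)" and g: "continuous_on UNIV g"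
  and le: "\<And>t. (cmod (q' t))\<^sup>2 \<le> g t" and rt: "r \<in> {a..b}" "t \<in> {a..b}"
 shows "(cmod (q t - q r))\<^sup>2 \<le> \<bar>t - r\<bar> * integral {a..b} g"
proof -
 have gi: "g integrable_on {c..d}" for c d
  by (rule integrable_continuous_real) (rule continuous_on_subset[OF g], simp)
 have g0: "0 \<le> g t" for t using le[of t] by (rule order_trans[OF zero_le_power2])
 have *: "(cmod (q t - q r))\<^sup>2 \<le> \<bar>t - r\<bar> * integral {a..b} g" if rt: "r \<in> {a..b}" "t \<in> {a..b}" and "r < t" for r t
 proof -
  have "(cmod (q t - q r))\<^sup>2 \<le> (t - r) * integral {r..t} g"
  proof (rule young_limit)
   show "0 \<le> integral {r..t} g" using g0 by (intro integral_nonneg gi) auto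
   fix \<theta> :: real assume \<theta>: "\<theta> > 0"
   have F: "(q' has_integral (q t - q r)) {r..t}"
    using \<open>r < t\<close> d by (intro fundamental_theorem_of_calculus) (auto intro: has_vector_derivative_at_within)
   have "norm (integral {r..t} q') \<le> integral {r..t} (\<lambda>x. \<theta> / 2 + g x * (1 / (2 * \<theta>)))"
   proof (rule Henstock_Kurzweil_Integration.integral_norm_bound_integral)
    show "q' integrable_on {r..t}" using F by blast
    show "(\<lambda>x. \<theta> / 2 + g x * (1 / (2 * \<theta>))) integrable_on {r..t}"
     by (intro integrable_add integrable_on_mult_left gi) auto
    fix x
    have "cmod (q' x) * 1 \<le> 1 / \<theta> / 2 * (cmod (q' x))\<^sup>2 + 1 / (2 * (1 / \<theta>)) * 1\<^sup>2"
     using \<theta> by (intro young_mult) auto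
    also have "\<dots> \<le> 1 / \<theta> / 2 * g x + 1 / (2 * (1 / \<theta>)) * 1\<^sup>2"
     using le[of x] \<theta> by (intro add_mono mult_left_mono) auto
    finally show "norm (q' x) \<le> \<theta> / 2 + g x * (1 / (2 * \<theta>))" using \<theta> by (simp add: field_simps)
   qed
   also have "\<dots> = \<theta> / 2 * (t - r) + integral {r..t} g * (1 / (2 * \<theta>))"
   proof -
    have c: "(\<lambda>x. \<theta> / 2) integrable_on {r..t}" "(\<lambda>x. g x * (1 / (2 * \<theta>))) integrable_on {r..t}"
     by (auto intro!: integrable_on_mult_left gi simp del: times_divide_eq_right)
    show ?thesis
     unfolding Henstock_Kurzweil_Integration.integral_add[OF c] Henstock_Kurzweil_Integration.integral_mult_left
     using \<open>r < t\<close> by simp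
   qed
   also have "integral {r..t} q' = q t - q r" using F by (rule integral_unique)
   finally show "cmod (q t - q r) \<le> \<theta> / 2 * (t - r) + integral {r..t} g / (2 * \<theta>)" by simp
  qed (use \<open>r < t\<close> in auto)
  also have "\<dots> \<le> (t - r) * integral {a..b} g" using that g0 by (intro mult_left_mono integral_subset_le gi) auto
  finally show ?thesis using \<open>r < t\<close> by simp
 qed
 consider "r < t" | "t < r" | "r = t" by linarith
 then show ?thesis
 proof cases
  case 2
  then show ?thesis using *[OF rt(2,1)] by (simp add: norm_minus_commute abs_minus_commute)
 qed (use *[OF rt] in auto)
qed

text \<open>Compare q(t) with q(r) and average over r in a subinterval of length \<open>l\<close>
  near t. The energy enters with the weight l and the mass with 1/l; making l small is the source of
  arbitrarily small relative form bounds.\<close>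

lemma sup_square_bound:
 fixes q q' :: "real => complex"
 assumes d: "\<And>t. (q has_vector_derivative q' t) (at t)" and g: "continuous_on UNIV g"
  and le: "\<And>t. (cmod (q' t))\<^sup>2 \<le> g t" and t: "t \<in> {-e..e}" and l: "0 < l" "l \<le> e"
 shows "(cmod (q t))\<^sup>2 \<le> 2 / l * integral {-e..e} (\<lambda>r. (cmod (q r))\<^sup>2) + 2 * l * integral {-e..e} g"
proof -
 let ?G = "integral {-e..e} g"
 have g0: "0 \<le> g t" for t using le[of t] by (rule order_trans[OF zero_le_power2])
 have gi: "g integrable_on {c..d}" for c d
  by (rule integrable_continuous_real) (rule continuous_on_subset[OF g], simp)
 have G0: "?G \<ge> 0" using g0 by (intro integral_nonneg gi) auto
 have qc: "continuous_on S q" for S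
  using d by (meson continuous_at_imp_continuous_on has_vector_derivative_continuous)
 have qi: "(\<lambda>r. (cmod (q r))\<^sup>2) integrable_on {c..d}" for c d
  by (intro integrable_continuous_real continuous_intros qc)
 \<comment> \<open>The interval of length \<open>l\<close> extends from t towards 0, or across it,
   so l \<le> e keeps it inside the segment.\<close>
 define a where "a = (if t \<ge> 0 then t - l else t)"
 have a: "-e \<le> a" "a + l \<le> e" "\<And>r. r \<in> {a..a+l} ==> \<bar>t - r\<bar> \<le> l" using t l by (auto simp: a_def abs_le_iff split: if_splits)
 have pt: "(cmod (q t))\<^sup>2 - 2 * l * ?G \<le> 2 * (cmod (q r))\<^sup>2" if "r \<in> {a..a+l}" for r
 proof -
  have "(cmod (q t))\<^sup>2 = (cmod (q r + (q t - q r)))\<^sup>2" by simp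
  also have "\<dots> \<le> 2 * (cmod (q r))\<^sup>2 + 2 * (cmod (q t - q r))\<^sup>2" by (rule cmod_add_sq_le)
  also have "(cmod (q t - q r))\<^sup>2 \<le> \<bar>t - r\<bar> * ?G" using a that t by (intro ftc_square[OF d g le]) auto
  also have "\<dots> \<le> l * ?G" using a(3)[OF that] G0 by (intro mult_right_mono)
  finally show ?thesis by simp
 qed
 have "l * ((cmod (q t))\<^sup>2 - 2 * l * ?G) = integral {a..a+l} (\<lambda>r. (cmod (q t))\<^sup>2 - 2 * l * ?G)" using l by simp
 also have "\<dots> \<le> integral {a..a+l} (\<lambda>r. 2 * (cmod (q r))\<^sup>2)"
  by (intro integral_le integrable_on_mult_right qi pt integrable_const_ivl)
 also have "\<dots> = 2 * integral {a..a+l} (\<lambda>r. (cmod (q r))\<^sup>2)" by simp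
 also have "\<dots> \<le> 2 * integral {-e..e} (\<lambda>r. (cmod (q r))\<^sup>2)"
  using a by (intro mult_left_mono integral_subset_le qi) auto
 finally have "(cmod (q t))\<^sup>2 - 2 * l * ?G \<le> 2 * integral {-e..e} (\<lambda>r. (cmod (q r))\<^sup>2) / l"
  using l(1) by (simp add: pos_le_divide_eq mult.commute)
 then show ?thesis by simp
qed

section \<open>Integrals along normal segments against the magnetic energy\<close>

definition grad2 :: "(R2 => complex) => R2 => real" where
 "grad2 \<phi> x = (\<Sum>j\<in>UNIV. (cmod (pd j \<phi> x))\<^sup>2)"

definition energy :: "real => (R2 => complex) => real" where
 "energy B \<phi> = (\<Sum>j\<in>UNIV. sqn lebesgue (MG B j \<phi>))"

lemma energy_nonneg: "0 \<le> energy B \<phi>" unfolding energy_def by (intro sum_nonneg sqn_nonneg)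

lemma continuous_grad2: "test_fun U \<phi> ==> continuous_on S (grad2 \<phi>)"
 unfolding grad2_def by (intro continuous_intros smooth_fun_continuous_on smooth_fun_pd test_fun_smooth)

lemma lebesgue_lborel_integral:
 fixes f :: "'a::euclidean_space => 'b::{banach, second_countable_topology}"
 shows "f \<in> borel_measurable borel ==> integral\<^sup>L lebesgue f = integral\<^sup>L lborel f"
 by (intro integral_completion) simp

context tube_curve
begin

lemma test_fun_curve_continuous: "test_fun U \<phi> ==> continuous_on S (\<lambda>s. \<phi> (\<gamma> s))"
 by (intro continuous_on_compose2[OF smooth_fun_continuous_on[OF test_fun_smooth, of U \<phi> UNIV] \<gamma>_continuous]) auto

text \<open>The threshold for the tubular estimates: below it 2 M \<epsilon> \<le> 1/2, so the
  change of variables distorts measure by bounded factors, and \<epsilon> stays away from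
  \<beta>.\<close>

definition e0 :: real where "e0 = min (\<beta> / 2) (1 / (4 * M))"

lemma e0: "0 < e0" "e0 < \<beta>" using \<beta>_pos M_pos by (auto simp: e0_def)

lemma le_e0: "\<epsilon> \<le> e0 ==> \<epsilon> \<le> \<beta>" "\<epsilon> \<le> e0 ==> \<epsilon> < \<beta>" "\<epsilon> \<le> e0 ==> 2 * M * \<epsilon> \<le> 1 / 2" "\<epsilon> \<le> e0 ==> 2 * M * \<epsilon> < 1"
proof -
 assume e: "\<epsilon> \<le> e0"
 then show "\<epsilon> \<le> \<beta>" "\<epsilon> < \<beta>" using e0 by auto
 have "2 * M * \<epsilon> \<le> 2 * M * (1 / (4 * M))" using e M_pos by (intro mult_left_mono) (auto simp: e0_def)
 then show "2 * M * \<epsilon> \<le> 1 / 2" using M_pos by simp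
 then show "2 * M * \<epsilon> < 1" by simp
qed

lemma Q_bound:
 fixes f :: "real \<times> real => 'b::{banach, second_countable_topology}"
 assumes e: "0 < e" and f: "f \<in> borel_measurable borel"
  and h: "integrable lborel (\<lambda>s. indicator {0..<L} s *\<^sub>R (h s :: real))"
  and le: "AE p in lborel. p \<in> Q e --> norm (f p) \<le> h (fst p)"
 shows "integrable lborel (\<lambda>p. indicator (Q e) p *\<^sub>R f p)"
  and "(\<integral>p. indicator (Q e) p *\<^sub>R norm (f p) \<partial>lborel) \<le> 2 * e * (\<integral>s. indicator {0..<L} s *\<^sub>R h s \<partial>lborel)"
proof -
 define k where "k s = indicator {0..<L} s *\<^sub>R h s" for s
 define g where "g p = k (fst p) * indicator {-e<..<e} (snd p)" for p :: "real \<times> real"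
 have km: "k \<in> borel_measurable lborel" using h unfolding k_def by (rule borel_measurable_integrable)
 have ind: "(indicator {-e<..<e} :: real => real) \<in> borel_measurable lborel" by simp
 have gm: "g \<in> borel_measurable (lborel \<Otimes>\<^sub>M lborel)" unfolding g_def
  by (intro borel_measurable_times measurable_compose[OF measurable_fst km] measurable_compose[OF measurable_snd ind])
 have it: "(\<integral>t. indicator {-e<..<e} t \<partial>lborel) = 2 * e" using e by simp
 have ii: "integrable lborel (indicator {-e<..<e} :: real => real)" by (intro integrable_real_indicator) (use e in auto)
 have gi: "integrable (lborel \<Otimes>\<^sub>M lborel) g"
 proof (rule lborel_pair.Fubini_integrable[OF gm])
  have eq: "(\<lambda>s. \<integral>t. norm (g (s, t)) \<partial>lborel) = (\<lambda>s. norm (k s) * (2 * e))"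
   unfolding g_def using it by (simp add: abs_mult)
  show "integrable lborel (\<lambda>s. \<integral>t. norm (g (s, t)) \<partial>lborel)"
   unfolding eq using h by (intro integrable_mult_left integrable_norm) (simp add: k_def)
  show "AE s in lborel. integrable lborel (\<lambda>t. g (s, t))"
   unfolding g_def using ii by (intro AE_I2) (simp add: integrable_mult_right)
 qed
 have gI: "(\<integral>p. g p \<partial>lborel) = 2 * e * (\<integral>s. k s \<partial>lborel)"
 proof -
  have "(\<integral>t. g (s, t) \<partial>lborel) = k s * (2 * e)" for s using e by (simp add: g_def)
  then show ?thesis using lborel_pair.integral_fst'[OF gi, unfolded lborel_prod] by (simp add: mult.commute)
 qed
 have gi': "integrable lborel g" using gi by (simp add: lborel_prod)
 have fm: "(\<lambda>p. indicator (Q e) p *\<^sub>R f p) \<in> borel_measurable lborel" using f Q_borel[of e] by simp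
 have d: "AE p in lborel. norm (indicator (Q e) p *\<^sub>R f p) \<le> g p"
  using le by eventually_elim (auto simp: g_def k_def Q_def indicator_def)
 show fi: "integrable lborel (\<lambda>p. indicator (Q e) p *\<^sub>R f p)"
 proof (rule Bochner_Integration.integrable_bound[OF gi' fm])
  show "AE p in lborel. norm (indicator (Q e) p *\<^sub>R f p) \<le> norm (g p)"
   using d by eventually_elim (rule order_trans, assumption, simp)
 qed
 have "(\<integral>p. indicator (Q e) p *\<^sub>R norm (f p) \<partial>lborel) = (\<integral>p. norm (indicator (Q e) p *\<^sub>R f p) \<partial>lborel)" by simp
 also have "\<dots> \<le> (\<integral>p. g p \<partial>lborel)" by (rule integral_mono_AE[OF integrable_norm[OF fi] gi' d])
 finally show "(\<integral>p. indicator (Q e) p *\<^sub>R norm (f p) \<partial>lborel) \<le> 2 * e * (\<integral>s. indicator {0..<L} s *\<^sub>R h s \<partial>lborel)"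
  unfolding gI k_def .
qed

text \<open>The segment always has half length \<open>e0\<close>, whatever the width of the
  potential. Values on the short segments of length 2\<epsilon> are thus controlled by quantities
  independent of \<epsilon>.\<close>

definition seg :: "(R2 => real) => real => real" where
 "seg f s = integral {-e0..e0} (\<lambda>t. f (\<Phi> (s, t)))"

lemma continuous_normal: "continuous_on UNIV f ==> continuous_on S (\<lambda>t. f (\<Phi> (s, t)))"
 unfolding \<Phi>_def by (rule continuous_on_compose2[of UNIV f]) (auto intro!: continuous_intros)

lemma seg_tube:
 assumes f: "continuous_on UNIV f" "\<And>x. 0 \<le> f x"
 shows "integrable lborel (\<lambda>s. indicator {0..<L} s *\<^sub>R seg f s)"
  and "(\<integral>s. indicator {0..<L} s *\<^sub>R seg f s \<partial>lborel) \<le> 4 * (\<integral>x. indicator (tub e0) x *\<^sub>R f x \<partial>lborel)"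
proof -
 have c: "continuous_on UNIV (\<lambda>p. f (\<Phi> p))" by (intro continuous_on_compose2[OF f(1)] \<Phi>_continuous) auto
 then have "continuous_on (cbox (0, -e0) (L, e0)) (\<lambda>p. f (\<Phi> p))" by (rule continuous_on_subset) simp
 then have "integrable lborel (\<lambda>p. indicator (cbox (0, -e0) (L, e0)) p *\<^sub>R f (\<Phi> p))"
  by (intro borel_integrable_compact compact_cbox)
 then have i: "integrable lborel (\<lambda>p. indicator (Q e0) p *\<^sub>R (indicator (cbox (0, -e0) (L, e0)) p *\<^sub>R f (\<Phi> p)))"
  by (rule integrable_mult_indicator[rotated]) (use Q_borel in simp)
 have eq: "indicator (Q e0) p *\<^sub>R (indicator (cbox (0, -e0) (L, e0)) p *\<^sub>R f (\<Phi> p)) = indicator (Q e0) p *\<^sub>R f (\<Phi> p)" for p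
  by (auto simp: indicator_def Q_def cbox_Pair_eq mem_Times_iff)
 have i: "integrable lborel (\<lambda>p. indicator (Q e0) p *\<^sub>R f (\<Phi> p))" using i unfolding eq .
 have s: "(\<integral>t. indicator (Q e0) (s, t) *\<^sub>R f (\<Phi> (s, t)) \<partial>lborel) = indicator {0..<L} s *\<^sub>R seg f s" for s
 proof -
  have ct: "continuous_on {-e0..e0} (\<lambda>t. f (\<Phi> (s, t)))" by (rule continuous_normal[OF f(1)])
  have "seg f s = (\<integral>t. indicator {-e0..e0} t *\<^sub>R f (\<Phi> (s, t)) \<partial>lborel)"
   using set_borel_integral_eq_integral(2)[OF borel_integrable_atLeastAtMost', OF ct]
   by (simp add: seg_def set_lebesgue_integral_def)
  also have "\<dots> = (\<integral>t. indicator {-e0<..<e0} t *\<^sub>R f (\<Phi> (s, t)) \<partial>lborel)"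
  proof (rule integral_cong_AE)
   have m: "(\<lambda>t. f (\<Phi> (s, t))) \<in> borel_measurable lborel"
    using borel_measurable_continuous_onI[OF continuous_normal[OF f(1), of UNIV s]] by simp
   show "(\<lambda>t. indicator {-e0..e0} t *\<^sub>R f (\<Phi> (s, t))) \<in> borel_measurable lborel"
    "(\<lambda>t. indicator {-e0<..<e0} t *\<^sub>R f (\<Phi> (s, t))) \<in> borel_measurable lborel"
    using m by (auto intro: borel_measurable_scaleR)
   show "AE t in lborel. indicator {-e0..e0} t *\<^sub>R f (\<Phi> (s, t)) = indicator {-e0<..<e0} t *\<^sub>R f (\<Phi> (s, t))"
    using AE_lborel_singleton[of "-e0"] AE_lborel_singleton[of e0] by eventually_elim (auto simp: indicator_def)
  qed
  finally show ?thesis by (auto simp: Q_def indicator_def if_distrib cong: if_cong)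
 qed
 have i': "integrable (lborel \<Otimes>\<^sub>M lborel) (\<lambda>p. indicator (Q e0) p *\<^sub>R f (\<Phi> p))" unfolding lborel_prod by (rule i)
 show "integrable lborel (\<lambda>s. indicator {0..<L} s *\<^sub>R seg f s)"
  using lborel_pair.integrable_fst'[OF i'] unfolding s .
 have I: "(\<integral>s. indicator {0..<L} s *\<^sub>R seg f s \<partial>lborel) = (\<integral>p. indicator (Q e0) p *\<^sub>R f (\<Phi> p) \<partial>lborel)"
  using lborel_pair.integral_fst'[OF i'] unfolding s lborel_prod .
 have fb: "f \<in> borel_measurable borel" using f(1) by (rule borel_measurable_continuous_onI)
 \<comment> \<open>At the threshold (1 - 2 M e0)^2 \<ge> 1/4, hence the factor 4.\<close>
 have "(\<integral>p. indicator (Q e0) p *\<^sub>R f (\<Phi> p) \<partial>lborel) * (1 / 2)\<^sup>2 \<le> (\<integral>p. indicator (Q e0) p *\<^sub>R f (\<Phi> p) \<partial>lborel) * (1 - 2 * M * e0)\<^sup>2"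
  using le_e0(3)[OF order_refl] f(2) by (intro mult_left_mono power_mono integral_nonneg_AE AE_I2) auto
 also have "\<dots> \<le> (\<integral>x. indicator (tub e0) x *\<^sub>R f x \<partial>lborel)"
  using e0(1) le_e0[OF order_refl] i f(2) by (intro tube_integral_nonneg(2) fb) auto
 finally show "(\<integral>s. indicator {0..<L} s *\<^sub>R seg f s \<partial>lborel) \<le> 4 * (\<integral>x. indicator (tub e0) x *\<^sub>R f x \<partial>lborel)"
  unfolding I by (simp add: power2_eq_square)
qed

text \<open>The tube is bounded, so there the plain gradient is controlled by the magnetic gradient
  and the function.\<close>

lemma Amag_tub_bound: "\<exists>a\<ge>0. \<forall>x\<in>tub e0. \<forall>j. \<bar>Amag B j x\<bar> \<le> a"
proof -
 have "bounded \<Sigma>" by (rule compact_imp_bounded[OF \<Sigma>_compact])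
 then obtain R where R: "R > 0" "\<And>x. x \<in> \<Sigma> ==> norm x \<le> R" using bounded_pos by metis
 have "norm x \<le> R + e0" if x: "x \<in> tub e0" for x
 proof -
  obtain s t where "x = \<Phi> (s, t)" "\<bar>t\<bar> < e0" using x tub_eq[of e0] e0 by auto
  then have "norm x \<le> norm (\<gamma> s) + \<bar>t\<bar>" using norm_triangle_ineq[of "\<gamma> s" "t *\<^sub>R n s"] by (simp add: \<Phi>_def norm_n)
  then show ?thesis using R(2)[OF \<gamma>_in_\<Sigma>[of s]] \<open>\<bar>t\<bar> < e0\<close> by linarith
 qed
 then have "\<bar>Amag B j x\<bar> \<le> \<bar>B\<bar> * (R + e0)" if "x \<in> tub e0" for x j
  using that by (intro order_trans[OF Amag_bound] mult_left_mono) auto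
 then show ?thesis using R(1) e0(1) by (intro exI[of _ "\<bar>B\<bar> * (R + e0)"]) auto
qed

text \<open>The right side of \<open>sup_square_bound\<close> on a full normal segment: a majorant
  of |\<phi>|^2 along it with a free length \<open>l\<close>.\<close>

definition sup2 :: "real => (R2 => complex) => real => real" where
 "sup2 l \<phi> s = 2 / l * seg (\<lambda>x. (cmod (\<phi> x))\<^sup>2) s + 2 * l * seg (grad2 \<phi>) s"

lemma normal_derivative:
 assumes \<phi>: "test_fun U \<phi>"
 defines "q' \<equiv> \<lambda>s t. \<Sum>j\<in>UNIV. of_real (n s $ j) * pd j \<phi> (\<Phi> (s, t))"
 shows "((\<lambda>t. \<phi> (\<Phi> (s, t))) has_vector_derivative q' s t) (at t)"
  and "(cmod (q' s t))\<^sup>2 \<le> grad2 \<phi> (\<Phi> (s, t))"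
proof -
 have "(\<phi> has_derivative (\<lambda>h. \<Sum>j\<in>UNIV. of_real (h $ j) * pd j \<phi> (\<Phi> (s, t)))) (at (\<Phi> (s, t)))"
  by (intro has_derivative_pd smooth_fun_differentiable test_fun_smooth[OF \<phi>])
 moreover have "((\<lambda>t. \<Phi> (s, t)) has_derivative (\<lambda>h. h *\<^sub>R n s)) (at t)"
  unfolding \<Phi>_def by (auto intro!: derivative_eq_intros)
 ultimately have "((\<lambda>t. \<phi> (\<Phi> (s, t))) has_derivative (\<lambda>h. \<Sum>j\<in>UNIV. of_real ((h *\<^sub>R n s) $ j) * pd j \<phi> (\<Phi> (s, t)))) (at t)"
  by (rule has_derivative_compose[rotated])
 then show "((\<lambda>t. \<phi> (\<Phi> (s, t))) has_vector_derivative q' s t) (at t)"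
  unfolding has_vector_derivative_def q'_def vector_scaleR_component
  by (simp add: scaleR_conv_of_real sum_distrib_left mult.assoc)
 let ?p = "\<lambda>j. cmod (pd j \<phi> (\<Phi> (s, t)))"
 have n1: "(n s $ 1)\<^sup>2 + (n s $ 2)\<^sup>2 = 1" using norm_n[of s] by (simp add: norm_vec_def L2_set_def UNIV_2)
 have "cmod (q' s t) \<le> \<bar>n s $ 1\<bar> * ?p 1 + \<bar>n s $ 2\<bar> * ?p 2"
  unfolding q'_def UNIV_2 using norm_triangle_ineq[of "of_real (n s $ 1) * pd 1 \<phi> (\<Phi> (s, t))" "of_real (n s $ 2) * pd 2 \<phi> (\<Phi> (s, t))"]
  by (simp add: norm_mult)
 then have "(cmod (q' s t))\<^sup>2 \<le> (\<bar>n s $ 1\<bar> * ?p 1 + \<bar>n s $ 2\<bar> * ?p 2)\<^sup>2" by (rule power_mono) simp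
 \<comment> \<open>Lagrange's identity, which gives Cauchy-Schwarz in the plane by dropping a
   square.\<close>
 also have "\<dots> = ((n s $ 1)\<^sup>2 + (n s $ 2)\<^sup>2) * ((?p 1)\<^sup>2 + (?p 2)\<^sup>2) - (\<bar>n s $ 1\<bar> * ?p 2 - \<bar>n s $ 2\<bar> * ?p 1)\<^sup>2"
  by (simp add: power2_sum power2_diff power_mult_distrib algebra_simps)
 also have "\<dots> \<le> grad2 \<phi> (\<Phi> (s, t))" unfolding n1 by (simp add: grad2_def UNIV_2)
 finally show "(cmod (q' s t))\<^sup>2 \<le> grad2 \<phi> (\<Phi> (s, t))" .
qed

lemma continuous_grad2_normal: "test_fun U \<phi> ==> continuous_on S (\<lambda>t. grad2 \<phi> (\<Phi> (s, t)))"
 by (rule continuous_normal[OF continuous_grad2])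

lemma sup2_bound:
 assumes "test_fun U \<phi>" "\<bar>t\<bar> \<le> e0" "0 < l" "l \<le> e0"
 shows "(cmod (\<phi> (\<Phi> (s, t))))\<^sup>2 \<le> sup2 l \<phi> s" unfolding sup2_def seg_def
 by (rule sup_square_bound[OF normal_derivative(1)[OF assms(1)] continuous_grad2_normal[OF assms(1)] normal_derivative(2)[OF assms(1)]])
   (use assms in auto)

lemma normal_increment:
 assumes "test_fun U \<phi>" "\<bar>t\<bar> \<le> e0"
 shows "(cmod (\<phi> (\<Phi> (s, t)) - \<phi> (\<gamma> s)))\<^sup>2 \<le> \<bar>t\<bar> * seg (grad2 \<phi>) s"
 using ftc_square[OF normal_derivative(1)[OF assms(1)] continuous_grad2_normal[OF assms(1)] normal_derivative(2)[OF assms(1)],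
   of 0 "-e0" e0 t s] assms(2) e0 by (simp add: seg_def \<Phi>_def abs_le_iff)

lemma seg_nonneg: "(\<And>x. 0 \<le> f x) ==> continuous_on UNIV f ==> 0 \<le> seg f s" unfolding seg_def
 by (intro Henstock_Kurzweil_Integration.integral_nonneg integrable_continuous_real continuous_normal) auto

text \<open>On the tube |pd j \<phi>|^2 \<le> 2 |MG B j \<phi>|^2 + 2 a^2 |\<phi>|^2. Summation over
  both components and the factor 4 of the change of variables give 8 and 16 a^2.\<close>

lemma seg_bounds:
 assumes \<phi>: "test_fun UNIV \<phi>" and a: "a \<ge> 0" "\<And>x j. x \<in> tub e0 ==> \<bar>Amag B j x\<bar> \<le> a"
 shows "(\<integral>s. indicator {0..<L} s *\<^sub>R seg (\<lambda>x. (cmod (\<phi> x))\<^sup>2) s \<partial>lborel) \<le> 4 * sqn lebesgue \<phi>"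
  and "(\<integral>s. indicator {0..<L} s *\<^sub>R seg (grad2 \<phi>) s \<partial>lborel) \<le> 8 * energy B \<phi> + 16 * a\<^sup>2 * sqn lebesgue \<phi>"
proof -
 have c: "continuous_on UNIV \<psi>" if "test_fun UNIV \<psi>" for \<psi> by (rule smooth_fun_continuous_on[OF test_fun_smooth[OF that]])
 have i: "integrable lborel (\<lambda>x. (cmod (\<psi> x))\<^sup>2)" "(\<integral>x. (cmod (\<psi> x))\<^sup>2 \<partial>lborel) = sqn lebesgue \<psi>" if "test_fun UNIV \<psi>" for \<psi>
 proof -
  have m: "(\<lambda>x. (cmod (\<psi> x))\<^sup>2) \<in> borel_measurable borel"
   by (intro borel_measurable_continuous_onI continuous_intros c[OF that])
  show "integrable lborel (\<lambda>x. (cmod (\<psi> x))\<^sup>2)"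
   using test_fun_sqi[OF that] m by (simp add: sqi_def integrable_completion)
  show "(\<integral>x. (cmod (\<psi> x))\<^sup>2 \<partial>lborel) = sqn lebesgue \<psi>" unfolding sqn_def by (rule lebesgue_lborel_integral[symmetric, OF m])
 qed
 have tm: "tub e0 \<in> sets lborel" using tub_open[of e0] by simp
 have le: "(\<integral>x. indicator (tub e0) x *\<^sub>R f x \<partial>lborel) \<le> (\<integral>x. g x \<partial>lborel)"
  if "integrable lborel f" "integrable lborel g" "\<And>x. x \<in> tub e0 ==> f x \<le> g x" "\<And>x. 0 \<le> g x" for f g :: "R2 => real"
  using that by (intro integral_mono integrable_mult_indicator tm) (auto simp: indicator_def)
 show "(\<integral>s. indicator {0..<L} s *\<^sub>R seg (\<lambda>x. (cmod (\<phi> x))\<^sup>2) s \<partial>lborel) \<le> 4 * sqn lebesgue \<phi>"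
  using seg_tube(2)[of "\<lambda>x. (cmod (\<phi> x))\<^sup>2"] le[of "\<lambda>x. (cmod (\<phi> x))\<^sup>2" "\<lambda>x. (cmod (\<phi> x))\<^sup>2"] i[OF \<phi>]
  by (force intro!: continuous_intros c[OF \<phi>])
 have pd: "test_fun UNIV (pd j \<phi>)" "test_fun UNIV (MG B j \<phi>)" for j using \<phi> by (auto intro: test_fun_pd test_fun_MG)
 let ?g = "\<lambda>x. \<Sum>j\<in>(UNIV::2 set). 2 * (cmod (MG B j \<phi> x))\<^sup>2 + 2 * a\<^sup>2 * (cmod (\<phi> x))\<^sup>2"
 have "(\<integral>x. indicator (tub e0) x *\<^sub>R grad2 \<phi> x \<partial>lborel) \<le> (\<integral>x. ?g x \<partial>lborel)"
 proof (rule le)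
  show "integrable lborel (grad2 \<phi>)" unfolding grad2_def by (intro Bochner_Integration.integrable_sum i pd)
  show "integrable lborel ?g"
   by (intro Bochner_Integration.integrable_sum Bochner_Integration.integrable_add integrable_mult_right i pd \<phi>)
  fix x assume x: "x \<in> tub e0"
  have "(cmod (pd j \<phi> x))\<^sup>2 \<le> 2 * (cmod (MG B j \<phi> x))\<^sup>2 + 2 * a\<^sup>2 * (cmod (\<phi> x))\<^sup>2" for j
  proof -
   have "(cmod (pd j \<phi> x))\<^sup>2 = (cmod (MG B j \<phi> x + (- of_real (Amag B j x) * \<phi> x)))\<^sup>2"
    by (simp add: MG_def norm_mult)
   also have "\<dots> \<le> 2 * (cmod (MG B j \<phi> x))\<^sup>2 + 2 * (\<bar>Amag B j x\<bar> * cmod (\<phi> x))\<^sup>2"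
    using cmod_add_sq_le[of "MG B j \<phi> x" "- of_real (Amag B j x) * \<phi> x"] by (simp add: norm_mult)
   also have "\<dots> \<le> 2 * (cmod (MG B j \<phi> x))\<^sup>2 + 2 * (a * cmod (\<phi> x))\<^sup>2"
    using a(2)[OF x] by (intro add_mono mult_left_mono power_mono mult_right_mono) auto
   finally show ?thesis by (simp add: power_mult_distrib)
  qed
  then show "grad2 \<phi> x \<le> ?g x" unfolding grad2_def by (rule sum_mono)
 qed (auto intro!: sum_nonneg)
 also have "(\<integral>x. ?g x \<partial>lborel) = (\<Sum>j\<in>(UNIV::2 set). 2 * sqn lebesgue (MG B j \<phi>) + 2 * a\<^sup>2 * sqn lebesgue \<phi>)"
  using i[OF pd(2)] i[OF \<phi>] by (simp add: Bochner_Integration.integral_sum)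
 also have "\<dots> = 2 * energy B \<phi> + 4 * a\<^sup>2 * sqn lebesgue \<phi>" by (simp add: energy_def sum.distrib sum_distrib_left)
 finally show "(\<integral>s. indicator {0..<L} s *\<^sub>R seg (grad2 \<phi>) s \<partial>lborel) \<le> 8 * energy B \<phi> + 16 * a\<^sup>2 * sqn lebesgue \<phi>"
  using seg_tube(2)[OF continuous_grad2[OF \<phi>]] by (simp add: grad2_def sum_nonneg)
qed

lemma seg_integrable:
 assumes \<phi>: "test_fun UNIV \<phi>"
 shows "integrable lborel (\<lambda>s. indicator {0..<L} s *\<^sub>R seg (\<lambda>x. (cmod (\<phi> x))\<^sup>2) s)"
  "integrable lborel (\<lambda>s. indicator {0..<L} s *\<^sub>R seg (grad2 \<phi>) s)"
 by (rule seg_tube(1), use test_fun_smooth[OF \<phi>] in \<open>force intro!: continuous_intros smooth_fun_continuous_on\<close>, simp)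
   (rule seg_tube(1)[OF continuous_grad2[OF \<phi>]], simp add: grad2_def sum_nonneg)

lemma sup2_integral:
 assumes \<phi>: "test_fun UNIV \<phi>" and a: "a \<ge> 0" "\<And>x j. x \<in> tub e0 ==> \<bar>Amag B j x\<bar> \<le> a" and l: "0 < l"
 shows "integrable lborel (\<lambda>s. indicator {0..<L} s *\<^sub>R sup2 l \<phi> s)"
  and "(\<integral>s. indicator {0..<L} s *\<^sub>R sup2 l \<phi> s \<partial>lborel) \<le> 16 * l * energy B \<phi> + (8 / l + 32 * l * a\<^sup>2) * sqn lebesgue \<phi>"
proof -
 note i = seg_integrable[OF \<phi>]
 have eq: "indicator {0..<L} s *\<^sub>R sup2 l \<phi> s = 2 / l * (indicator {0..<L} s *\<^sub>R seg (\<lambda>x. (cmod (\<phi> x))\<^sup>2) s)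
   + 2 * l * (indicator {0..<L} s *\<^sub>R seg (grad2 \<phi>) s)" for s by (simp add: sup2_def algebra_simps)
 show "integrable lborel (\<lambda>s. indicator {0..<L} s *\<^sub>R sup2 l \<phi> s)"
  unfolding eq by (intro Bochner_Integration.integrable_add integrable_mult_right i)
 have "(\<integral>s. indicator {0..<L} s *\<^sub>R sup2 l \<phi> s \<partial>lborel) = 2 / l * (\<integral>s. indicator {0..<L} s *\<^sub>R seg (\<lambda>x. (cmod (\<phi> x))\<^sup>2) s \<partial>lborel)
   + 2 * l * (\<integral>s. indicator {0..<L} s *\<^sub>R seg (grad2 \<phi>) s \<partial>lborel)"
  unfolding eq by (subst Bochner_Integration.integral_add[OF integrable_mult_right[OF i(1)] integrable_mult_right[OF i(2)]])
   (simp only: integral_mult_right_zero)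
 also have "\<dots> \<le> 2 / l * (4 * sqn lebesgue \<phi>) + 2 * l * (8 * energy B \<phi> + 16 * a\<^sup>2 * sqn lebesgue \<phi>)"
  using l seg_bounds[OF \<phi> a] by (intro add_mono mult_left_mono) auto
 finally show "(\<integral>s. indicator {0..<L} s *\<^sub>R sup2 l \<phi> s \<partial>lborel) \<le> 16 * l * energy B \<phi> + (8 / l + 32 * l * a\<^sup>2) * sqn lebesgue \<phi>"
  by (simp add: algebra_simps)
qed

text \<open>One function of the curve parameter that dominates |\<phi>|^2 on the segment and also
  contains the energy that controls increments along it.\<close>

definition hs :: "(R2 => complex) => real => real" where
 "hs \<phi> s = sup2 e0 \<phi> s + seg (grad2 \<phi>) s"

lemma hs_integral: "\<exists>C>0. \<forall>\<phi>. test_fun UNIV \<phi> --> integrable lborel (\<lambda>s. indicator {0..<L} s *\<^sub>R hs \<phi> s) \<and>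
  (\<integral>s. indicator {0..<L} s *\<^sub>R hs \<phi> s \<partial>lborel) \<le> C * (sqn lebesgue \<phi> + energy B \<phi>)"
proof -
 obtain a where a: "a \<ge> 0" "\<And>x j. x \<in> tub e0 ==> \<bar>Amag B j x\<bar> \<le> a" using Amag_tub_bound[of B] by metis
 let ?C1 = "16 * e0 + 8" and ?C2 = "8 / e0 + 32 * e0 * a\<^sup>2 + 16 * a\<^sup>2"
 have C: "0 < ?C1" "0 \<le> ?C2" using e0(1) by (auto intro!: add_nonneg_nonneg)
 show ?thesis
 proof (intro exI[of _ "?C1 + ?C2"] conjI allI impI)
  show "0 < ?C1 + ?C2" using C by linarith
  fix \<phi> assume \<phi>: "test_fun UNIV \<phi>"
  note i = sup2_integral(1)[OF \<phi> a e0(1)] seg_integrable(2)[OF \<phi>]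
  show "integrable lborel (\<lambda>s. indicator {0..<L} s *\<^sub>R hs \<phi> s)"
   unfolding hs_def scaleR_add_right by (rule Bochner_Integration.integrable_add[OF i])
  have "(\<integral>s. indicator {0..<L} s *\<^sub>R hs \<phi> s \<partial>lborel) = (\<integral>s. indicator {0..<L} s *\<^sub>R sup2 e0 \<phi> s \<partial>lborel)
    + (\<integral>s. indicator {0..<L} s *\<^sub>R seg (grad2 \<phi>) s \<partial>lborel)"
   unfolding hs_def scaleR_add_right by (rule Bochner_Integration.integral_add[OF i])
  also have "\<dots> \<le> 16 * e0 * energy B \<phi> + (8 / e0 + 32 * e0 * a\<^sup>2) * sqn lebesgue \<phi> + (8 * energy B \<phi> + 16 * a\<^sup>2 * sqn lebesgue \<phi>)"
   by (intro add_mono sup2_integral(2)[OF \<phi> a e0(1)] seg_bounds(2)[OF \<phi> a])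
  also have "\<dots> = ?C1 * energy B \<phi> + ?C2 * sqn lebesgue \<phi>" by (simp add: algebra_simps)
  also have "\<dots> \<le> ?C1 * energy B \<phi> + ?C2 * sqn lebesgue \<phi> + (?C1 * sqn lebesgue \<phi> + ?C2 * energy B \<phi>)"
   using C sqn_nonneg[of lebesgue \<phi>] energy_nonneg[of B \<phi>] by simp
  also have "\<dots> = (?C1 + ?C2) * (sqn lebesgue \<phi> + energy B \<phi>)" by (simp add: ring_distribs)
  finally show "(\<integral>s. indicator {0..<L} s *\<^sub>R hs \<phi> s \<partial>lborel) \<le> (?C1 + ?C2) * (sqn lebesgue \<phi> + energy B \<phi>)" .
 qed
qed

lemma hs_bounds:
 assumes "test_fun UNIV \<phi>"
 shows "\<bar>t\<bar> \<le> e0 ==> (cmod (\<phi> (\<Phi> (s, t))))\<^sup>2 \<le> hs \<phi> s" "(cmod (\<phi> (\<gamma> s)))\<^sup>2 \<le> hs \<phi> s"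
  "\<bar>t\<bar> \<le> e0 ==> (cmod (\<phi> (\<Phi> (s, t)) - \<phi> (\<gamma> s)))\<^sup>2 \<le> \<bar>t\<bar> * seg (grad2 \<phi>) s"
proof -
 have n: "0 \<le> seg (grad2 \<phi>) s"
  using continuous_grad2[OF assms] by (intro seg_nonneg) (simp_all add: grad2_def sum_nonneg)
 show 1: "(cmod (\<phi> (\<Phi> (s, t))))\<^sup>2 \<le> hs \<phi> s" if "\<bar>t\<bar> \<le> e0" for t
  using sup2_bound[OF assms that, of e0 s] e0(1) n by (simp add: hs_def)
 show "(cmod (\<phi> (\<gamma> s)))\<^sup>2 \<le> hs \<phi> s" using 1[of 0] e0(1) by (simp add: \<Phi>_def)
qed (rule normal_increment[OF assms])

text \<open>The trace inequality by integrating \<open>hs\<close> along the curve. It keeps the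
  traces of approximating sequences bounded in L2 of the curve.\<close>

lemma trace_bound: "\<exists>C>0. \<forall>\<phi>. test_fun UNIV \<phi> -->
  integrable lborel (\<lambda>s. indicator {0..<L} s *\<^sub>R (cmod (\<phi> (\<gamma> s)))\<^sup>2) \<and>
  (\<integral>s. indicator {0..<L} s *\<^sub>R (cmod (\<phi> (\<gamma> s)))\<^sup>2 \<partial>lborel) \<le> C * (sqn lebesgue \<phi> + energy B \<phi>)"
proof -
 obtain C where C: "C > 0" "\<And>\<phi>. test_fun UNIV \<phi> ==> integrable lborel (\<lambda>s. indicator {0..<L} s *\<^sub>R hs \<phi> s)"
  "\<And>\<phi>. test_fun UNIV \<phi> ==> (\<integral>s. indicator {0..<L} s *\<^sub>R hs \<phi> s \<partial>lborel) \<le> C * (sqn lebesgue \<phi> + energy B \<phi>)"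
  using hs_integral[of B] by blast
 show ?thesis
 proof (intro exI[of _ C] conjI allI impI C(1))
  fix \<phi> assume \<phi>: "test_fun UNIV \<phi>"
  have m: "(\<lambda>s. indicator {0..<L} s *\<^sub>R (cmod (\<phi> (\<gamma> s)))\<^sup>2) \<in> borel_measurable lborel"
  proof -
   have "continuous_on UNIV (\<lambda>s. (cmod (\<phi> (\<gamma> s)))\<^sup>2)"
    by (intro continuous_intros test_fun_curve_continuous[OF \<phi>])
   then show ?thesis by (intro borel_measurable_scaleR) (auto intro: borel_measurable_continuous_onI)
  qed
  show i: "integrable lborel (\<lambda>s. indicator {0..<L} s *\<^sub>R (cmod (\<phi> (\<gamma> s)))\<^sup>2)"
   by (rule Bochner_Integration.integrable_bound[OF C(2)[OF \<phi>] m])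
     (use hs_bounds(2)[OF \<phi>] in \<open>auto simp: indicator_def intro: order_trans[OF _ abs_ge_self]\<close>)
  have "(\<integral>s. indicator {0..<L} s *\<^sub>R (cmod (\<phi> (\<gamma> s)))\<^sup>2 \<partial>lborel) \<le> (\<integral>s. indicator {0..<L} s *\<^sub>R hs \<phi> s \<partial>lborel)"
   by (intro integral_mono i C(2)[OF \<phi>]) (auto simp: indicator_def hs_bounds(2)[OF \<phi>])
  also note C(3)[OF \<phi>]
  finally show "(\<integral>s. indicator {0..<L} s *\<^sub>R (cmod (\<phi> (\<gamma> s)))\<^sup>2 \<partial>lborel) \<le> C * (sqn lebesgue \<phi> + energy B \<phi>)" .
 qed
qed

end

section \<open>Uniform form bounds and convergence of the potential forms\<close>

context tube_potential
begin

text \<open>The potential is at most Mv \<beta> / \<epsilon> on a strip of width 2\<epsilon>, so the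
  powers of \<epsilon> cancel for functions dominated along the normals.\<close>

lemma W_Q_integral:
 fixes F :: "real \<times> real => complex"
 assumes \<epsilon>: "0 < \<epsilon>" "\<epsilon> \<le> e0" and F: "F \<in> borel_measurable borel"
  and h: "integrable lborel (\<lambda>s. indicator {0..<L} s *\<^sub>R (h s :: real))"
  and le: "\<And>s t. \<bar>t\<bar> < \<epsilon> ==> cmod (F (s, t)) \<le> h s"
 shows "integrable lborel (\<lambda>p. indicator (Q \<epsilon>) p *\<^sub>R (of_real (W \<epsilon> (\<Phi> p)) * F p))"
  and "(\<integral>p. indicator (Q \<epsilon>) p *\<^sub>R cmod (of_real (W \<epsilon> (\<Phi> p)) * F p) \<partial>lborel)
   \<le> 2 * (Mv * \<beta>) * (\<integral>s. indicator {0..<L} s *\<^sub>R h s \<partial>lborel)"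
proof -
 note e = le_e0[OF \<epsilon>(2)]
 have m: "(\<lambda>p. of_real (W \<epsilon> (\<Phi> p)) * F p) \<in> borel_measurable borel" using WQ_measurable[OF \<epsilon>(1) e(2)] F by measurable
 have hi: "integrable lborel (\<lambda>s. indicator {0..<L} s *\<^sub>R (Mv * \<beta> / \<epsilon> * h s))"
  using integrable_mult_right[OF h, of "Mv * \<beta> / \<epsilon>"] by (simp add: mult_ac)
 have ae: "AE p in lborel. p \<in> Q \<epsilon> --> cmod (of_real (W \<epsilon> (\<Phi> p)) * F p) \<le> Mv * \<beta> / \<epsilon> * h (fst p)"
  using W_Q_bound[OF \<epsilon>(1) e(2,4)]
 proof eventually_elim
  fix p assume w: "p \<in> Q \<epsilon> --> \<bar>W \<epsilon> (\<Phi> p)\<bar> \<le> Mv * \<beta> / \<epsilon>"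
  show "p \<in> Q \<epsilon> --> cmod (of_real (W \<epsilon> (\<Phi> p)) * F p) \<le> Mv * \<beta> / \<epsilon> * h (fst p)"
  proof
   assume p: "p \<in> Q \<epsilon>"
   then have "\<bar>snd p\<bar> < \<epsilon>" by (auto simp: Q_def)
   then have "cmod (F p) \<le> h (fst p)" using le[of "snd p" "fst p"] by simp
   then show "cmod (of_real (W \<epsilon> (\<Phi> p)) * F p) \<le> Mv * \<beta> / \<epsilon> * h (fst p)"
    unfolding norm_mult norm_of_real using w p Mv_pos \<beta>_pos \<epsilon>(1) by (intro mult_mono) auto
  qed
 qed
 note * = Q_bound[OF \<epsilon>(1) m hi ae]
 show "integrable lborel (\<lambda>p. indicator (Q \<epsilon>) p *\<^sub>R (of_real (W \<epsilon> (\<Phi> p)) * F p))" by (rule *(1))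
 have eq: "(\<integral>s. indicator {0..<L} s *\<^sub>R (Mv * \<beta> / \<epsilon> * h s) \<partial>lborel) = Mv * \<beta> / \<epsilon> * (\<integral>s. indicator {0..<L} s *\<^sub>R h s \<partial>lborel)"
  unfolding integral_mult_right_zero[symmetric] by (intro Bochner_Integration.integral_cong) auto
 show "(\<integral>p. indicator (Q \<epsilon>) p *\<^sub>R cmod (of_real (W \<epsilon> (\<Phi> p)) * F p) \<partial>lborel)
   \<le> 2 * (Mv * \<beta>) * (\<integral>s. indicator {0..<L} s *\<^sub>R h s \<partial>lborel)" using *(2) \<epsilon>(1) unfolding eq by simp
qed

text \<open>The potentials are infinitesimally form bounded, uniformly in \<epsilon>: their mass on
  each normal is bounded, and the supremum of |\<phi>|^2 on the normal costs little energy when the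
  averaging length is short.\<close>

lemma potential_bound:
 assumes \<eta>: "\<eta> > 0"
 shows "\<exists>C\<ge>0. \<forall>\<epsilon> \<phi>. 0 < \<epsilon> --> \<epsilon> \<le> e0 --> test_fun UNIV \<phi> -->
  (\<integral>x. \<bar>W \<epsilon> x\<bar> * (cmod (\<phi> x))\<^sup>2 \<partial>lebesgue) \<le> \<eta> * energy B \<phi> + C * sqn lebesgue \<phi>"
proof -
 obtain a where a: "a \<ge> 0" "\<And>x j. x \<in> tub e0 ==> \<bar>Amag B j x\<bar> \<le> a" using Amag_tub_bound[of B] by metis
 define w where "w = Mv * \<beta>"
 have w: "w > 0" using Mv_pos \<beta>_pos by (simp add: w_def)
 \<comment> \<open>The energy coefficient is 128 w l: the factor 2 w from
   \<open>W_Q_integral\<close>, 4 as a bound for the change of variables, and 16 l from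
   \<open>sup2_integral\<close>.\<close>
 define l where "l = min e0 (\<eta> / (128 * w))"
 have l: "0 < l" "l \<le> e0" "l \<le> \<eta> / (128 * w)" using \<eta> w e0(1) by (auto simp: l_def)
 let ?C = "8 * w * (8 / l + 32 * l * a\<^sup>2)"
 show ?thesis
 proof (intro exI[of _ ?C] conjI allI impI)
  show "0 \<le> ?C" using l w by (intro mult_nonneg_nonneg add_nonneg_nonneg) auto
  fix \<epsilon> \<phi> assume \<epsilon>: "0 < \<epsilon>" "\<epsilon> \<le> e0" and \<phi>: "test_fun UNIV \<phi>"
  note e = le_e0[OF \<epsilon>(2)]
  have cb: "\<phi> \<in> borel_measurable borel"
   by (intro borel_measurable_continuous_onI smooth_fun_continuous_on test_fun_smooth[OF \<phi>])
  let ?F = "\<lambda>p. complex_of_real ((cmod (\<phi> (\<Phi> p)))\<^sup>2)"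
  have Fm: "?F \<in> borel_measurable borel" using measurable_compose[OF \<Phi>_borel cb] by measurable
  have Fle: "cmod (?F (s, t)) \<le> sup2 l \<phi> s" if "\<bar>t\<bar> < \<epsilon>" for s t
   unfolding norm_of_real using sup2_bound[OF \<phi> _ l(1,2), of t s] that \<epsilon>(2) by simp
  note si = sup2_integral[OF \<phi> a l(1)]
  note * = W_Q_integral[OF \<epsilon> Fm si(1) Fle]
  let ?f = "\<lambda>x. \<bar>W \<epsilon> x\<bar> * (cmod (\<phi> x))\<^sup>2"
  have fm: "?f \<in> borel_measurable borel" using W_borel[OF \<epsilon>(1) e(2)] cb by measurable
  have fF: "?f (\<Phi> p) = cmod (of_real (W \<epsilon> (\<Phi> p)) * ?F p)" for p by (simp add: norm_mult norm_power)
  have fi: "integrable lborel (\<lambda>p. indicator (Q \<epsilon>) p *\<^sub>R ?f (\<Phi> p))"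
   using integrable_norm[OF *(1)] unfolding fF by simp
  let ?I = "\<integral>p. indicator (Q \<epsilon>) p *\<^sub>R ?f (\<Phi> p) \<partial>lborel"
  have fI: "?I \<le> 2 * w * (\<integral>s. indicator {0..<L} s *\<^sub>R sup2 l \<phi> s \<partial>lborel)" unfolding fF w_def by (rule *(2))
  have I0: "0 \<le> ?I" by (intro Bochner_Integration.integral_nonneg) auto
  have "(\<integral>x. ?f x \<partial>lebesgue) = (\<integral>x. ?f x \<partial>lborel)" by (rule lebesgue_lborel_integral[OF fm])
  also have "\<dots> = (\<integral>x. indicator (tub \<epsilon>) x *\<^sub>R ?f x \<partial>lborel)"
   by (intro Bochner_Integration.integral_cong refl) (simp add: W_eq[OF \<epsilon>(1) e(2)] indicator_def)
  also have "\<dots> \<le> ?I + 6 * M * \<epsilon> * ?I"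
   using tube_integral_nonneg(1)[OF \<epsilon>(1) e(1,4) fm _ fi] by (simp add: abs_le_iff)
  also have "\<dots> \<le> ?I + 3 * ?I" using e(3) I0 by (intro add_left_mono mult_right_mono) auto
  also have "\<dots> \<le> 8 * w * (\<integral>s. indicator {0..<L} s *\<^sub>R sup2 l \<phi> s \<partial>lborel)" using fI by simp
  also have "\<dots> \<le> 8 * w * (16 * l * energy B \<phi> + (8 / l + 32 * l * a\<^sup>2) * sqn lebesgue \<phi>)"
   using w by (intro mult_left_mono si(2)) auto
  also have "\<dots> = (128 * w * l) * energy B \<phi> + ?C * sqn lebesgue \<phi>" by (simp add: algebra_simps)
  also have "\<dots> \<le> \<eta> * energy B \<phi> + ?C * sqn lebesgue \<phi>"
  proof (intro add_right_mono mult_right_mono energy_nonneg)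
   show "128 * w * l \<le> \<eta>" using l(3) w by (simp add: field_simps)
  qed
  finally show "(\<integral>x. ?f x \<partial>lebesgue) \<le> \<eta> * energy B \<phi> + ?C * sqn lebesgue \<phi>" .
 qed
qed

lemma half_squares: "x * y \<le> 1 / 2 * (p + q)" if "x\<^sup>2 \<le> p" "y\<^sup>2 \<le> q" for x y p q :: real
 using sum_squares_bound[of x y] that by (simp add: power2_eq_square)

text \<open>Three comparisons: plane with coordinates, at relative cost O(\<epsilon>); values on the
  segment with values at the foot point, at cost O(sqrt \<epsilon>) from the increment; and an exact
  integration over the normal, where the potential yields \<open>al\<close>.\<close>

lemma potential_convergence:
 "\<exists>C>0. \<forall>\<epsilon> \<phi> \<psi>. 0 < \<epsilon> --> \<epsilon> \<le> e0 --> test_fun UNIV \<phi> --> test_fun UNIV \<psi> -->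
  cmod ((\<integral>x. of_real (W \<epsilon> x) * (\<phi> x * cnj (\<psi> x)) \<partial>lebesgue)
   - (\<integral>s. indicator {0..<L} s *\<^sub>R (of_real (al s) * (\<phi> (\<gamma> s) * cnj (\<psi> (\<gamma> s)))) \<partial>lborel))
  \<le> C * sqrt \<epsilon> * ((sqn lebesgue \<phi> + energy B \<phi>) + (sqn lebesgue \<psi> + energy B \<psi>))"
proof -
 obtain C where C: "C > 0" "\<And>\<phi>. test_fun UNIV \<phi> ==> integrable lborel (\<lambda>s. indicator {0..<L} s *\<^sub>R hs \<phi> s)"
  "\<And>\<phi>. test_fun UNIV \<phi> ==> (\<integral>s. indicator {0..<L} s *\<^sub>R hs \<phi> s \<partial>lborel) \<le> C * (sqn lebesgue \<phi> + energy B \<phi>)"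
  using hs_integral[of B] by blast
 define w where "w = Mv * \<beta>"
 have w: "w > 0" using Mv_pos \<beta>_pos by (simp add: w_def)
 let ?D = "(24 * M * w * sqrt e0 + 2 * w) * C"
 show ?thesis
 proof (intro exI[of _ ?D] conjI allI impI)
  show "0 < ?D" using w M_pos C(1) e0(1) by (simp add: add_pos_pos)
  fix \<epsilon> \<phi> \<psi> assume \<epsilon>: "0 < \<epsilon>" "\<epsilon> \<le> e0" and \<phi>: "test_fun UNIV \<phi>" and \<psi>: "test_fun UNIV \<psi>"
  note e = le_e0[OF \<epsilon>(2)]
  define N where "N = (sqn lebesgue \<phi> + energy B \<phi>) + (sqn lebesgue \<psi> + energy B \<psi>)"
  have N0: "0 \<le> N" unfolding N_def by (intro add_nonneg_nonneg sqn_nonneg energy_nonneg)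
  define F where "F x = \<phi> x * cnj (\<psi> x)" for x
  have cF: "continuous_on UNIV F" unfolding F_def
   by (intro continuous_intros smooth_fun_continuous_on test_fun_smooth[OF \<phi>] test_fun_smooth[OF \<psi>])
  have Fb: "F \<in> borel_measurable borel" by (rule borel_measurable_continuous_onI[OF cF])
  have cG: "continuous_on UNIV (\<lambda>s. F (\<gamma> s))" by (rule continuous_on_compose2[OF cF \<gamma>_continuous]) auto
  define h where "h s = 1 / 2 * (hs \<phi> s + hs \<psi> s)" for s
  have heq: "indicator {0..<L} s *\<^sub>R h s = 1 / 2 * (indicator {0..<L} s *\<^sub>R hs \<phi> s + indicator {0..<L} s *\<^sub>R hs \<psi> s)" for s
   by (simp add: h_def algebra_simps)
  have hi: "integrable lborel (\<lambda>s. indicator {0..<L} s *\<^sub>R h s)"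
   unfolding heq by (intro integrable_mult_right Bochner_Integration.integrable_add C(2) \<phi> \<psi>)
  have "(\<integral>s. indicator {0..<L} s *\<^sub>R h s \<partial>lborel)
    = 1 / 2 * ((\<integral>s. indicator {0..<L} s *\<^sub>R hs \<phi> s \<partial>lborel) + (\<integral>s. indicator {0..<L} s *\<^sub>R hs \<psi> s \<partial>lborel))"
   unfolding heq integral_mult_right_zero Bochner_Integration.integral_add[OF C(2)[OF \<phi>] C(2)[OF \<psi>]] ..
  also have "\<dots> \<le> 1 / 2 * (C * N)" using C(3)[OF \<phi>] C(3)[OF \<psi>] by (simp add: N_def distrib_left)
  also have "\<dots> \<le> C * N" using C(1) N0 by simp
  finally have hI: "(\<integral>s. indicator {0..<L} s *\<^sub>R h s \<partial>lborel) \<le> C * N" .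
  have b1: "cmod (F (\<Phi> (s, t))) \<le> h s" if "\<bar>t\<bar> \<le> e0" for s t unfolding F_def norm_mult complex_mod_cnj h_def
   by (rule half_squares[OF hs_bounds(1)[OF \<phi> that] hs_bounds(1)[OF \<psi> that]])
  have b0: "cmod (F (\<gamma> s)) \<le> h s" for s using b1[of 0 s] e0(1) by (simp add: \<Phi>_def)
  have b2: "cmod (F (\<Phi> (s, t)) - F (\<gamma> s)) \<le> sqrt \<epsilon> * h s" if t: "\<bar>t\<bar> < \<epsilon>" for s t
  proof -
   have te: "\<bar>t\<bar> \<le> e0" using t \<epsilon> by simp
   let ?a = "\<phi> (\<Phi> (s, t))" and ?b = "\<psi> (\<Phi> (s, t))" and ?ag = "\<phi> (\<gamma> s)" and ?bg = "\<psi> (\<gamma> s)"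
   have inc: "(cmod (\<chi>' (\<Phi> (s, t)) - \<chi>' (\<gamma> s)))\<^sup>2 \<le> \<epsilon> * seg (grad2 \<chi>') s" if "test_fun UNIV \<chi>'" for \<chi>'
   proof -
    have "0 \<le> seg (grad2 \<chi>') s"
     using continuous_grad2[OF that] by (intro seg_nonneg) (simp_all add: grad2_def sum_nonneg)
    then have "\<bar>t\<bar> * seg (grad2 \<chi>') s \<le> \<epsilon> * seg (grad2 \<chi>') s" using t by (intro mult_right_mono) auto
    then show ?thesis using hs_bounds(3)[OF that te, of s] by linarith
   qed
   have half: "x * y \<le> sqrt \<epsilon> * (1 / 2 * (p + g))" if "x\<^sup>2 \<le> p" "y\<^sup>2 \<le> \<epsilon> * g" for x y p g
   proof -
    have "(y / sqrt \<epsilon>)\<^sup>2 \<le> g" using that(2) \<epsilon>(1) by (simp add: power_divide field_simps)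
    from half_squares[OF that(1) this] have "x * (y / sqrt \<epsilon>) \<le> 1 / 2 * (p + g)" .
    from mult_left_mono[OF this, of "sqrt \<epsilon>"] \<epsilon>(1) show ?thesis by simp
   qed
   \<comment> \<open>Each summand pairs a supremum bound of one function with the increment of the
     other, so only one factor sqrt \<epsilon> is gained.\<close>
   have "F (\<Phi> (s, t)) - F (\<gamma> s) = ?a * cnj (?b - ?bg) + cnj ?bg * (?a - ?ag)" by (simp add: F_def algebra_simps)
   then have "cmod (F (\<Phi> (s, t)) - F (\<gamma> s)) \<le> cmod ?a * cmod (?b - ?bg) + cmod ?bg * cmod (?a - ?ag)"
    using norm_triangle_ineq[of "?a * cnj (?b - ?bg)" "cnj ?bg * (?a - ?ag)"]
    by (simp only: norm_mult complex_mod_cnj)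
   also have "\<dots> \<le> sqrt \<epsilon> * (1 / 2 * (sup2 e0 \<phi> s + seg (grad2 \<psi>) s)) + sqrt \<epsilon> * (1 / 2 * (sup2 e0 \<psi> s + seg (grad2 \<phi>) s))"
    using sup2_bound[OF \<phi> te e0(1) order_refl, of s] sup2_bound[OF \<psi>, of 0 e0 s] e0(1)
    by (intro add_mono half inc \<phi> \<psi>) (auto simp: \<Phi>_def)
   also have "\<dots> = sqrt \<epsilon> * h s" by (simp add: h_def hs_def algebra_simps)
   finally show ?thesis .
  qed
  let ?W = "\<lambda>p. complex_of_real (W \<epsilon> (\<Phi> p))"
  have m1: "(\<lambda>p. F (\<Phi> p)) \<in> borel_measurable borel" by (rule measurable_compose[OF \<Phi>_borel Fb])
  have m0: "(\<lambda>p::real \<times> real. F (\<gamma> (fst p))) \<in> borel_measurable borel"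
   by (intro borel_measurable_continuous_onI continuous_on_compose2[OF cG]) (auto intro: continuous_intros)
  have i1: "integrable lborel (\<lambda>p. indicator (Q \<epsilon>) p *\<^sub>R (?W p * F (\<Phi> p)))"
   and n1: "(\<integral>p. indicator (Q \<epsilon>) p *\<^sub>R cmod (?W p * F (\<Phi> p)) \<partial>lborel) \<le> 2 * (Mv * \<beta>) * (\<integral>s. indicator {0..<L} s *\<^sub>R h s \<partial>lborel)"
   using W_Q_integral[OF \<epsilon> m1 hi] b1 \<epsilon>(2) by auto
  have i0: "integrable lborel (\<lambda>p. indicator (Q \<epsilon>) p *\<^sub>R (?W p * F (\<gamma> (fst p))))"
   using W_Q_integral(1)[OF \<epsilon> m0 hi] b0 by auto
  have hi2: "integrable lborel (\<lambda>s. indicator {0..<L} s *\<^sub>R (sqrt \<epsilon> * h s))"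
   using integrable_mult_right[OF hi, of "sqrt \<epsilon>"] by (simp add: mult_ac)
  have hI2: "(\<integral>s. indicator {0..<L} s *\<^sub>R (sqrt \<epsilon> * h s) \<partial>lborel) = sqrt \<epsilon> * (\<integral>s. indicator {0..<L} s *\<^sub>R h s \<partial>lborel)"
   unfolding integral_mult_right_zero[symmetric] by (intro Bochner_Integration.integral_cong) auto
  have i2: "integrable lborel (\<lambda>p. indicator (Q \<epsilon>) p *\<^sub>R (?W p * (F (\<Phi> p) - F (\<gamma> (fst p)))))"
   and n2: "(\<integral>p. indicator (Q \<epsilon>) p *\<^sub>R cmod (?W p * (F (\<Phi> p) - F (\<gamma> (fst p)))) \<partial>lborel)
    \<le> 2 * (Mv * \<beta>) * (\<integral>s. indicator {0..<L} s *\<^sub>R (sqrt \<epsilon> * h s) \<partial>lborel)"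
   using W_Q_integral[OF \<epsilon> borel_measurable_diff[OF m1 m0] hi2] b2 by auto
  define A where "A = (\<integral>x. of_real (W \<epsilon> x) * F x \<partial>lebesgue)"
  define A1 where "A1 = (\<integral>p. indicator (Q \<epsilon>) p *\<^sub>R (?W p * F (\<Phi> p)) \<partial>lborel)"
  define A0 where "A0 = (\<integral>p. indicator (Q \<epsilon>) p *\<^sub>R (?W p * F (\<gamma> (fst p))) \<partial>lborel)"
  define A' where "A' = (\<integral>s. indicator {0..<L} s *\<^sub>R (of_real (al s) * F (\<gamma> s)) \<partial>lborel)"
  have fm: "(\<lambda>x. complex_of_real (W \<epsilon> x) * F x) \<in> borel_measurable borel"
   using W_borel[OF \<epsilon>(1) e(2)] Fb by measurable
  have "A = (\<integral>x. of_real (W \<epsilon> x) * F x \<partial>lborel)" unfolding A_def by (rule lebesgue_lborel_integral[OF fm])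
  also have "\<dots> = (\<integral>x. indicator (tub \<epsilon>) x *\<^sub>R (of_real (W \<epsilon> x) * F x) \<partial>lborel)"
   by (intro Bochner_Integration.integral_cong refl) (simp add: W_eq[OF \<epsilon>(1) e(2)] indicator_def)
  finally have "cmod (A - A1) \<le> 12 * M * \<epsilon> * (\<integral>p. indicator (Q \<epsilon>) p *\<^sub>R cmod (?W p * F (\<Phi> p)) \<partial>lborel)"
   unfolding A1_def using tube_integral[OF \<epsilon>(1) e(1,4) fm i1] by simp
  also have "\<dots> \<le> 12 * M * \<epsilon> * (2 * w * (C * N))"
  proof (rule mult_left_mono)
   have "2 * w * (\<integral>s. indicator {0..<L} s *\<^sub>R h s \<partial>lborel) \<le> 2 * w * (C * N)"
    using w hI by (intro mult_left_mono) auto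
   then show "(\<integral>p. indicator (Q \<epsilon>) p *\<^sub>R cmod (?W p * F (\<Phi> p)) \<partial>lborel) \<le> 2 * w * (C * N)"
    using n1 unfolding w_def by linarith
  qed (use M_pos \<epsilon> in simp)
  \<comment> \<open>The Jacobian error is of order \<epsilon>, better than required; one root of
    \<epsilon> is bounded by the root of \<open>e0\<close> to match the other error.\<close>
  also have "\<dots> = 24 * M * w * (sqrt \<epsilon> * sqrt \<epsilon>) * (C * N)" using \<epsilon>(1) by simp
  also have "\<dots> \<le> 24 * M * w * (sqrt e0 * sqrt \<epsilon>) * (C * N)"
   using \<epsilon> M_pos w C(1) N0 by (intro mult_right_mono mult_left_mono) auto
  finally have d1: "cmod (A - A1) \<le> 24 * M * w * (sqrt e0 * sqrt \<epsilon>) * (C * N)" .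
  have "A1 - A0 = (\<integral>p. indicator (Q \<epsilon>) p *\<^sub>R (?W p * (F (\<Phi> p) - F (\<gamma> (fst p)))) \<partial>lborel)"
   unfolding A1_def A0_def Bochner_Integration.integral_diff[OF i1 i0, symmetric]
   by (intro Bochner_Integration.integral_cong refl) (simp add: algebra_simps)
  then have "cmod (A1 - A0) \<le> (\<integral>p. norm (indicator (Q \<epsilon>) p *\<^sub>R (?W p * (F (\<Phi> p) - F (\<gamma> (fst p))))) \<partial>lborel)"
   by (simp only: Bochner_Integration.integral_norm_bound)
  also have "\<dots> = (\<integral>p. indicator (Q \<epsilon>) p *\<^sub>R cmod (?W p * (F (\<Phi> p) - F (\<gamma> (fst p)))) \<partial>lborel)" by simp
  also note n2
  also have "2 * (Mv * \<beta>) * (\<integral>s. indicator {0..<L} s *\<^sub>R (sqrt \<epsilon> * h s) \<partial>lborel) \<le> 2 * w * (sqrt \<epsilon> * (C * N))"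
   unfolding hI2 w_def[symmetric] using w hI \<epsilon>(1) by (intro mult_left_mono) auto
  finally have d2: "cmod (A1 - A0) \<le> 2 * w * (sqrt \<epsilon> * (C * N))" .
  have d3: "A0 = A'"
  proof -
   have i0': "integrable (lborel \<Otimes>\<^sub>M lborel) (\<lambda>p. indicator (Q \<epsilon>) p *\<^sub>R (?W p * F (\<gamma> (fst p))))"
    unfolding lborel_prod by (rule i0)
   have "(\<integral>t. indicator (Q \<epsilon>) (s, t) *\<^sub>R (?W (s, t) * F (\<gamma> (fst (s, t)))) \<partial>lborel)
     = indicator {0..<L} s *\<^sub>R (of_real (al s) * F (\<gamma> s))" for s
   proof -
    have "(\<integral>t. indicator (Q \<epsilon>) (s, t) *\<^sub>R (?W (s, t) * F (\<gamma> (fst (s, t)))) \<partial>lborel)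
      = (\<integral>t. complex_of_real (indicator {-\<epsilon><..<\<epsilon>} t *\<^sub>R W \<epsilon> (\<Phi> (s, t))) * (indicator {0..<L} s *\<^sub>R F (\<gamma> s)) \<partial>lborel)"
     by (intro Bochner_Integration.integral_cong refl) (auto simp: Q_def indicator_def)
    also have "\<dots> = of_real (al s) * (indicator {0..<L} s *\<^sub>R F (\<gamma> s))"
     unfolding integral_mult_left_zero integral_complex_of_real al_eq[OF \<epsilon>(1) e(2)] ..
    finally show ?thesis by simp
   qed
   then show ?thesis unfolding A0_def A'_def using lborel_pair.integral_fst'[OF i0'] by (simp add: lborel_prod)
  qed
  have "cmod (A - A') \<le> cmod (A - A1) + cmod (A1 - A0)"
   using norm_triangle_ineq[of "A - A1" "A1 - A0"] by (simp add: d3)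
  also have "\<dots> \<le> 24 * M * w * (sqrt e0 * sqrt \<epsilon>) * (C * N) + 2 * w * (sqrt \<epsilon> * (C * N))" using d1 d2 by linarith
  also have "\<dots> = ?D * sqrt \<epsilon> * N" by (simp add: algebra_simps)
  finally show "cmod ((\<integral>x. of_real (W \<epsilon> x) * (\<phi> x * cnj (\<psi> x)) \<partial>lebesgue)
   - (\<integral>s. indicator {0..<L} s *\<^sub>R (of_real (al s) * (\<phi> (\<gamma> s) * cnj (\<psi> (\<gamma> s)))) \<partial>lborel))
   \<le> ?D * sqrt \<epsilon> * ((sqn lebesgue \<phi> + energy B \<phi>) + (sqn lebesgue \<psi> + energy B \<psi>))"
   unfolding A_def A'_def F_def N_def .
 qed
qed

end

subsection \<open>Gluing the two one-sided problems\<close>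

lemma ip_sum_left:
 assumes "\<And>j. sqU U (f j)" "test_fun W \<phi>"
 shows "ip U (\<lambda>x. \<Sum>j\<in>(UNIV::2 set). f j x) \<phi> = (\<Sum>j\<in>UNIV. ip U (f j) \<phi>)"
 unfolding UNIV_2 using assms by (simp add: ip_add_left)

lemma ip_sum_right:
 assumes "sqU U f" "\<And>j. test_fun W (\<phi> j)"
 shows "ip U f (\<lambda>x. \<Sum>j\<in>(UNIV::2 set). \<phi> j x) = (\<Sum>j\<in>UNIV. ip U f (\<phi> j))"
 unfolding UNIV_2 using assms by (simp add: ip_add_right[of U f W "\<phi> 1" W "\<phi> 2"])

lemma ip_restrict:
 assumes "V \<subseteq> U" "\<And>x. x \<in> U ==> x \<notin> V ==> \<phi> x = 0"
 shows "ip U f \<phi> = ip V f \<phi>" unfolding ip_altdef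
proof (intro Bochner_Integration.integral_cong refl)
 show "indicator U x * f x * cnj (\<phi> x) = indicator V x * f x * cnj (\<phi> x)" for x
  using assms by (cases "x \<in> V"; cases "x \<in> U") auto
qed

lemma ip_cong_AE:
 assumes "AE x in lebesgue. x \<in> U --> f x = g x" "sqU U f" "sqU U g" "test_fun W \<phi>"
 shows "ip U f \<phi> = ip U g \<phi>" unfolding ip_altdef
proof (rule integral_cong_AE)
 show "AE x in lebesgue. indicator U x * f x * cnj (\<phi> x) = indicator U x * g x * cnj (\<phi> x)"
  using assms(1) by eventually_elim (auto simp: indicator_def)
qed (intro borel_measurable_times sqi_measurable[OF assms(2)] sqi_measurable[OF assms(3)]
  sqi_measurable[OF sqi_cnj[OF test_fun_sqi[OF assms(4)]]])+

lemma weak_mgrad_mono: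
 assumes "weak_mgrad B U u g" "V \<subseteq> U"
 shows "weak_mgrad B V u g" unfolding weak_mgrad_def
proof (intro allI impI)
 fix \<phi> j assume \<phi>: "test_fun V \<phi>"
 have "ip U (\<lambda>x. g x $ j) \<phi> = ip U u (MG B j \<phi>)"
  using assms(1) test_fun_mono[OF \<phi> assms(2)] by (simp add: weak_mgrad_def)
 then show "ip V (\<lambda>x. g x $ j) \<phi> = ip V u (MG B j \<phi>)"
  using ip_restrict[OF assms(2) test_fun_eq_0[OF \<phi>]] ip_restrict[OF assms(2) test_fun_eq_0[OF test_fun_MG[OF \<phi>]]] by simp
qed

lemma test_fun_mlap: "test_fun U \<phi> ==> test_fun U (mlap B \<phi>)"
 unfolding mlap_def by (intro test_fun_sum test_fun_MG) simp

lemma weak_mlap_mono: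
 assumes "weak_mlap B U u g" "V \<subseteq> U"
 shows "weak_mlap B V u g" unfolding weak_mlap_def
proof (intro allI impI)
 fix \<phi> assume \<phi>: "test_fun V \<phi>"
 have "ip U g \<phi> = ip U u (mlap B \<phi>)" using assms(1) test_fun_mono[OF \<phi> assms(2)] by (simp add: weak_mlap_def)
 then show "ip V g \<phi> = ip V u (mlap B \<phi>)"
  using ip_restrict[OF assms(2) test_fun_eq_0[OF \<phi>]] ip_restrict[OF assms(2) test_fun_eq_0[OF test_fun_mlap[OF \<phi>]]] by simp
qed

lemma sqU_mono:
 assumes "sqU U f" "V \<subseteq> U" "open V"
 shows "sqU V f"
proof -
 have "(\<lambda>x. indicator V x * f x) = (\<lambda>x. indicator V x * (indicator U x * f x))"
  by (rule ext) (use assms(2) in \<open>auto simp: indicator_def\<close>)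
 then show ?thesis using sqi_indicator[OF assms(1), of V] assms(3) by simp
qed

lemma sqU_cmult: "sqU U f ==> sqU U (\<lambda>x. c * f x)"
 using sqi_cmult[of lebesgue "\<lambda>x. indicator U x * f x" c] by (simp add: mult_ac)

lemma sqU_add: "sqU U f ==> sqU U g ==> sqU U (\<lambda>x. f x + g x)"
 using sqi_add[of lebesgue "\<lambda>x. indicator U x * f x" "\<lambda>x. indicator U x * g x"] by (simp add: distrib_left)

lemma sqU_Amag:
 assumes "bounded U" "open U" "sqU U v"
 shows "sqU U (\<lambda>x. of_real (Amag B j x) * v x)"
proof -
 obtain R where R: "\<And>x. x \<in> U ==> norm x \<le> R" using assms(1) by (auto simp: bounded_iff)
 have "cmod (indicator U x * of_real (Amag B j x)) \<le> \<bar>B\<bar> * \<bar>R\<bar>" for x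
 proof (cases "x \<in> U")
  case True
  then have "\<bar>B\<bar> * norm x \<le> \<bar>B\<bar> * \<bar>R\<bar>" using R[OF True] by (intro mult_left_mono) auto
  then show ?thesis using Amag_bound[of B j x] True by simp
 qed simp
 moreover have "(\<lambda>x. indicator U x * complex_of_real (Amag B j x)) \<in> borel_measurable lebesgue"
  using assms(2) by (intro borel_measurable_times Amag_measurable indicator_lebesgue) auto
 ultimately have "sqi lebesgue (\<lambda>x. (indicator U x * complex_of_real (Amag B j x)) * (indicator U x * v x))"
  by (intro sqi_bmult[OF assms(3)]) auto
 moreover have "(indicator U x * complex_of_real (Amag B j x)) * (indicator U x * v x) = indicator U x * (of_real (Amag B j x) * v x)" for x
  by (simp add: indicator_def)
 ultimately show ?thesis by (simp only:)
qed

text \<open>Since div A = 0, the square of i grad + A is -Laplacian + 2 i A . grad + |A|^2. The weak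
  equation identifies \<open>F\<close> with this expression, after which the two boundary formulas
  can be inserted for test functions that reach the curve. Boundedness of \<open>U\<close> makes
  multiplication by A harmless in L2. The last boundary sum contains only the trace and cancels when
  the two sides are added.\<close>

lemma one_sided_green:
 fixes \<gamma> :: "real => R2" and U W :: "R2 set"
 assumes U: "open U" "bounded U" "U \<subseteq> W" and u: "sqU U u" and F: "sqU U F" and ml: "weak_mlap B U u F"
  and tr: "is_trace \<gamma> L \<nu> U W sg u t" and nd: "is_normal_deriv \<gamma> L U W sg u m"
 shows "\<exists>G. (\<forall>j. sqU U (G j)) \<and> (\<forall>\<phi> j. test_fun W \<phi> --> ip U (G j) \<phi> = ip U u (MG B j \<phi>)
   + \<i> * (of_real sg * (LINT s:{0..L}|lborel. t (\<gamma> s) * cnj (\<phi> (\<gamma> s)) * of_real (\<nu> (\<gamma> s) $ j)))) \<and>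
  (\<forall>\<phi>. test_fun W \<phi> --> ip U F \<phi> = (\<Sum>j\<in>UNIV. ip U (G j) (MG B j \<phi>))
   - of_real sg * (LINT s:{0..L}|lborel. m (\<gamma> s) * cnj (\<phi> (\<gamma> s)))
   + \<i> * (\<Sum>j\<in>UNIV. of_real sg * (LINT s:{0..L}|lborel. t (\<gamma> s) * cnj (of_real (Amag B j (\<gamma> s)) * \<phi> (\<gamma> s)) * of_real (\<nu> (\<gamma> s) $ j))))"
proof -
 obtain g where g: "weak_grad U u g" "L2v U g" and gt: "\<And>\<phi> j. test_fun W \<phi> ==>
    ip U (\<lambda>x. g x $ j) \<phi> + ip U u (pd j \<phi>) = of_real sg * (LINT s:{0..L}|lborel. t (\<gamma> s) * cnj (\<phi> (\<gamma> s)) * of_real (\<nu> (\<gamma> s) $ j))"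
  using tr unfolding is_trace_def by blast
 obtain g' d where g': "weak_grad U u g'" "L2v U g'" and d: "weak_lap U u d" "L2 U d" and dt: "\<And>\<phi>. test_fun W \<phi> ==>
    ip U d \<phi> + (\<Sum>j\<in>UNIV. ip U (\<lambda>x. g' x $ j) (pd j \<phi>)) = of_real sg * (LINT s:{0..L}|lborel. m (\<gamma> s) * cnj (\<phi> (\<gamma> s)))"
  using nd unfolding is_normal_deriv_def by blast
 have gs: "sqU U (\<lambda>x. g x $ j)" "sqU U (\<lambda>x. g' x $ j)" for j
  using g(2) g'(2) L2_sqU[OF _ U(1)] unfolding L2v_def by blast+
 have ds: "sqU U d" using L2_sqU[OF d(2) U(1)] .
 \<comment> \<open>The trace and the normal derivative come with separate weak gradients; these
   agree almost everywhere.\<close>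
 have gg: "ip U (\<lambda>x. g x $ j) \<phi> = ip U (\<lambda>x. g' x $ j) \<phi>" if "test_fun W \<phi>" for j \<phi>
 proof (rule ip_cong_AE[OF _ gs(1) gs(2) that])
  show "AE x in lebesgue. x \<in> U --> g x $ j = g' x $ j"
   by (rule test_eq_imp_AE[OF U(1) gs(1) gs(2)]) (use g(1) g'(1) in \<open>simp add: weak_grad_def\<close>)
 qed
 let ?A = "\<lambda>j x. complex_of_real (Amag B j x)"
 note Au = sqU_Amag[OF U(2,1) u] and Ag = sqU_Amag[OF U(2,1) gs(1)]
 define G where "G j x = \<i> * g x $ j + ?A j x * u x" for j x
 have Gs: "sqU U (G j)" for j unfolding G_def by (intro sqU_add sqU_cmult gs Au)
 have A1: "ip U (G j) \<phi> = ip U u (MG B j \<phi>) + \<i> * (ip U (\<lambda>x. g x $ j) \<phi> + ip U u (pd j \<phi>))" if "test_fun V \<phi>" for j \<phi> V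
 proof -
  have "ip U (G j) \<phi> = \<i> * ip U (\<lambda>x. g x $ j) \<phi> + ip U u (\<lambda>x. ?A j x * \<phi> x)"
   unfolding G_def ip_add_left[OF sqU_cmult[OF gs(1)] Au that] by (simp add: ip_cmult_left ip_move)
  moreover have "ip U u (MG B j \<phi>) = - \<i> * ip U u (pd j \<phi>) + ip U u (\<lambda>x. ?A j x * \<phi> x)"
   unfolding MG_def ip_add_right[OF u test_fun_cmult[OF test_fun_pd[OF that]] test_fun_Amag[OF that]] by (simp add: ip_cmult_right)
  ultimately show ?thesis by (simp add: algebra_simps)
 qed
 let ?X = "\<lambda>\<phi>. \<Sum>j\<in>UNIV. 2 * \<i> * ip U (\<lambda>x. g x $ j) (\<lambda>x. ?A j x * \<phi> x) + ip U (\<lambda>x. ?A j x * u x) (\<lambda>x. ?A j x * \<phi> x)"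
 have A2: "(\<Sum>j\<in>UNIV. ip U (G j) (MG B j \<phi>)) = (\<Sum>j\<in>UNIV. ip U (\<lambda>x. g x $ j) (pd j \<phi>)) + ?X \<phi>
   - \<i> * (\<Sum>j\<in>UNIV. ip U (\<lambda>x. g x $ j) (\<lambda>x. ?A j x * \<phi> x) + ip U u (pd j (\<lambda>x. ?A j x * \<phi> x)))" if "test_fun V \<phi>" for \<phi> V
 proof -
  have p: "pd j (\<lambda>x. ?A j x * \<phi> x) = (\<lambda>x. ?A j x * pd j \<phi> x)" for j
   by (rule ext) (simp add: pd_mult smooth_fun_differentiable smooth_fun_Amag test_fun_smooth[OF that] pd_Amag_same)
  have "ip U (G j) (MG B j \<phi>) = ip U (\<lambda>x. g x $ j) (pd j \<phi>) + \<i> * ip U (\<lambda>x. g x $ j) (\<lambda>x. ?A j x * \<phi> x)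
    - \<i> * ip U u (\<lambda>x. ?A j x * pd j \<phi> x) + ip U (\<lambda>x. ?A j x * u x) (\<lambda>x. ?A j x * \<phi> x)" for j
  proof -
   note t = test_fun_cmult[OF test_fun_pd[OF that]] test_fun_Amag[OF that]
   have m: "ip U (\<lambda>x. ?A j x * u x) (pd j \<phi>) = ip U u (\<lambda>x. ?A j x * pd j \<phi> x)" by (simp add: ip_move)
   have "ip U (G j) (MG B j \<phi>) = ip U (G j) (\<lambda>x. \<i> * pd j \<phi> x) + ip U (G j) (\<lambda>x. ?A j x * \<phi> x)"
    unfolding MG_def by (rule ip_add_right[OF Gs t])
   also have "ip U (G j) (\<lambda>x. \<i> * pd j \<phi> x) = ip U (\<lambda>x. g x $ j) (pd j \<phi>) - \<i> * ip U u (\<lambda>x. ?A j x * pd j \<phi> x)"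
    unfolding G_def ip_cmult_right ip_add_left[OF sqU_cmult[OF gs(1)] Au test_fun_pd[OF that]] ip_cmult_left m
    by (simp add: algebra_simps)
   also have "ip U (G j) (\<lambda>x. ?A j x * \<phi> x) = \<i> * ip U (\<lambda>x. g x $ j) (\<lambda>x. ?A j x * \<phi> x) + ip U (\<lambda>x. ?A j x * u x) (\<lambda>x. ?A j x * \<phi> x)"
    unfolding G_def ip_add_left[OF sqU_cmult[OF gs(1)] Au t(2)] ip_cmult_left ..
   finally show ?thesis by simp
  qed
  moreover have "x = P + \<i> * Y - \<i> * V + Z ==> x = P + (2 * \<i> * Y + Z) - \<i> * (Y + V)" for x P Y V Z :: complex
   by (simp add: algebra_simps)
  ultimately have "ip U (G j) (MG B j \<phi>) = ip U (\<lambda>x. g x $ j) (pd j \<phi>)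
    + (2 * \<i> * ip U (\<lambda>x. g x $ j) (\<lambda>x. ?A j x * \<phi> x) + ip U (\<lambda>x. ?A j x * u x) (\<lambda>x. ?A j x * \<phi> x))
    - \<i> * (ip U (\<lambda>x. g x $ j) (\<lambda>x. ?A j x * \<phi> x) + ip U u (pd j (\<lambda>x. ?A j x * \<phi> x)))" for j
   unfolding p by presburger
  then show ?thesis by (simp only: UNIV_2 sum.insert sum.empty finite.intros) (simp add: distrib_left)
 qed
 \<comment> \<open>The expanded magnetic Laplacian of \<open>u\<close>, built from the weak
   Laplacian \<open>d\<close>, the gradient and \<open>u\<close>.\<close>
 define H where "H x = - 1 * d x + (\<Sum>j\<in>UNIV. 2 * \<i> * (?A j x * g x $ j) + ?A j x * (?A j x * u x))" for x
 have Hj: "sqU U (\<lambda>x. 2 * \<i> * (?A j x * g x $ j) + ?A j x * (?A j x * u x))" for j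
  by (intro sqU_add sqU_cmult Ag sqU_Amag[OF U(2,1) Au])
 have Hsum: "sqU U (\<lambda>x. \<Sum>j\<in>UNIV. 2 * \<i> * (?A j x * g x $ j) + ?A j x * (?A j x * u x))"
  unfolding UNIV_2 using sqU_add[OF Hj[of 1] Hj[of 2]] by simp
 have Hs: "sqU U H" unfolding H_def by (intro sqU_add[OF sqU_cmult[OF ds] Hsum])
 have A3: "ip U H \<phi> = - ip U d \<phi> + ?X \<phi>" if "test_fun V \<phi>" for \<phi> V
 proof -
  have "ip U H \<phi> = - ip U d \<phi> + (\<Sum>j\<in>UNIV. ip U (\<lambda>x. 2 * \<i> * (?A j x * g x $ j) + ?A j x * (?A j x * u x)) \<phi>)"
   unfolding H_def ip_add_left[OF sqU_cmult[OF ds] Hsum that] ip_cmult_left ip_sum_left[OF Hj that] by simp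
  also have "(\<Sum>j\<in>UNIV. ip U (\<lambda>x. 2 * \<i> * (?A j x * g x $ j) + ?A j x * (?A j x * u x)) \<phi>) = ?X \<phi>"
  proof (intro sum.cong refl)
   fix j
   show "ip U (\<lambda>x. 2 * \<i> * (?A j x * g x $ j) + ?A j x * (?A j x * u x)) \<phi>
     = 2 * \<i> * ip U (\<lambda>x. g x $ j) (\<lambda>x. ?A j x * \<phi> x) + ip U (\<lambda>x. ?A j x * u x) (\<lambda>x. ?A j x * \<phi> x)"
    unfolding ip_add_left[OF sqU_cmult[OF Ag] sqU_Amag[OF U(2,1) Au] that] ip_cmult_left
    unfolding ip_move[of U "?A j"] by simp
  qed
  finally show ?thesis .
 qed
 \<comment> \<open>Equality almost everywhere follows from test functions inside \<open>U\<close>;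
   it then permits testing with functions that do not vanish on the boundary.\<close>
 have FH: "AE x in lebesgue. x \<in> U --> F x = H x"
 proof (rule test_eq_imp_AE[OF U(1) F Hs])
  fix \<phi> assume \<phi>: "test_fun U \<phi>"
  note wg = g(1)[unfolded weak_grad_def, rule_format]
  have "ip U F \<phi> = ip U u (mlap B \<phi>)" using ml \<phi> by (simp add: weak_mlap_def)
  also have "\<dots> = (\<Sum>j\<in>UNIV. ip U u (MG B j (MG B j \<phi>)))"
   unfolding mlap_def by (rule ip_sum_right[OF u test_fun_MG[OF test_fun_MG[OF \<phi>]]])
  also have "\<dots> = (\<Sum>j\<in>UNIV. ip U (G j) (MG B j \<phi>))" using A1[OF test_fun_MG[OF \<phi>]] wg[OF test_fun_MG[OF \<phi>]] by simp
  also have "\<dots> = (\<Sum>j\<in>UNIV. ip U (\<lambda>x. g x $ j) (pd j \<phi>)) + ?X \<phi>"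
   unfolding A2[OF \<phi>] using wg[OF test_fun_Amag[OF \<phi>]] by simp
  also have "(\<Sum>j\<in>UNIV. ip U (\<lambda>x. g x $ j) (pd j \<phi>)) = - ip U u (lap \<phi>)"
   unfolding lap_def ip_sum_right[OF u test_fun_pd[OF test_fun_pd[OF \<phi>]]] using wg[OF test_fun_pd[OF \<phi>]] by (simp add: sum_negf)
  also have "\<dots> = - ip U d \<phi>" using d(1) \<phi> by (simp add: weak_lap_def)
  finally show "ip U F \<phi> = ip U H \<phi>" unfolding A3[OF \<phi>] .
 qed
 show ?thesis
 proof (intro exI[of _ G] conjI allI impI Gs)
  fix \<phi> assume \<phi>: "test_fun W \<phi>"
  show "ip U (G j) \<phi> = ip U u (MG B j \<phi>)
   + \<i> * (of_real sg * (LINT s:{0..L}|lborel. t (\<gamma> s) * cnj (\<phi> (\<gamma> s)) * of_real (\<nu> (\<gamma> s) $ j)))" for j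
   unfolding A1[OF \<phi>] gt[OF \<phi>] ..
  have "ip U F \<phi> = - ip U d \<phi> + ?X \<phi>" unfolding ip_cong_AE[OF FH F Hs \<phi>] A3[OF \<phi>] ..
  also have "- ip U d \<phi> = (\<Sum>j\<in>UNIV. ip U (\<lambda>x. g x $ j) (pd j \<phi>)) - of_real sg * (LINT s:{0..L}|lborel. m (\<gamma> s) * cnj (\<phi> (\<gamma> s)))"
   unfolding dt[OF \<phi>, symmetric] gg[OF test_fun_pd[OF \<phi>]] by simp
  finally show "ip U F \<phi> = (\<Sum>j\<in>UNIV. ip U (G j) (MG B j \<phi>))
   - of_real sg * (LINT s:{0..L}|lborel. m (\<gamma> s) * cnj (\<phi> (\<gamma> s)))
   + \<i> * (\<Sum>j\<in>UNIV. of_real sg * (LINT s:{0..L}|lborel. t (\<gamma> s) * cnj (of_real (Amag B j (\<gamma> s)) * \<phi> (\<gamma> s)) * of_real (\<nu> (\<gamma> s) $ j)))"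
   unfolding A2[OF \<phi>] gt[OF test_fun_Amag[OF \<phi>]] by simp
 qed
qed

lemma MG_add:
 assumes "smooth_fun \<phi>" "smooth_fun \<psi>"
 shows "MG B j (\<lambda>x. \<phi> x + \<psi> x) = (\<lambda>x. MG B j \<phi> x + MG B j \<psi> x)"
 by (rule ext) (simp add: MG_def pd_add smooth_fun_differentiable assms algebra_simps)

lemma L2_Sigma_integrable:
 assumes h: "L2_Sigma \<gamma> L h" and k: "continuous_on UNIV k"
 shows "integrable lborel (\<lambda>s. indicator {0..L} s *\<^sub>R (h (\<gamma> s) * (k s :: complex)))"
proof -
 have hm: "(\<lambda>s. h (\<gamma> s)) \<in> borel_measurable lborel" and hi: "integrable lborel (\<lambda>s. indicator {0..L} s *\<^sub>R (cmod (h (\<gamma> s)))\<^sup>2)"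
  using h by (auto simp: L2_Sigma_def set_integrable_def)
 have "sqi lborel (\<lambda>s. indicator {0..L} s *\<^sub>R h (\<gamma> s))" unfolding sqi_def
 proof
  show "(\<lambda>s. indicator {0..L} s *\<^sub>R h (\<gamma> s)) \<in> borel_measurable lborel" by (intro borel_measurable_scaleR hm) auto
  have "(cmod (indicator {0..L} s *\<^sub>R h (\<gamma> s)))\<^sup>2 = indicator {0..L} s *\<^sub>R (cmod (h (\<gamma> s)))\<^sup>2" for s
   by (simp add: indicator_def)
  then show "integrable lborel (\<lambda>s. (cmod (indicator {0..L} s *\<^sub>R h (\<gamma> s)))\<^sup>2)" using hi by presburger
 qed
 moreover have "sqi lborel (\<lambda>s. indicator {0..L} s *\<^sub>R k s)" unfolding sqi_def
 proof
  show "(\<lambda>s. indicator {0..L} s *\<^sub>R k s) \<in> borel_measurable lborel"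
   using borel_measurable_continuous_onI[OF k] by (intro borel_measurable_scaleR) auto
  have "integrable lborel (\<lambda>s. indicator {0..L} s *\<^sub>R (cmod (k s))\<^sup>2)"
   using k by (intro borel_integrable_compact continuous_intros) (auto intro: continuous_on_subset)
  moreover have "(cmod (indicator {0..L} s *\<^sub>R k s))\<^sup>2 = indicator {0..L} s *\<^sub>R (cmod (k s))\<^sup>2" for s
   by (simp add: indicator_def)
  ultimately show "integrable lborel (\<lambda>s. (cmod (indicator {0..L} s *\<^sub>R k s))\<^sup>2)" by presburger
 qed
 ultimately have "integrable lborel (\<lambda>s. (indicator {0..L} s *\<^sub>R h (\<gamma> s)) * (indicator {0..L} s *\<^sub>R k s))"
  by (rule sqi_mult_integrable)
 moreover have "(indicator {0..L} s *\<^sub>R h (\<gamma> s)) * (indicator {0..L} s *\<^sub>R k s) = indicator {0..L} s *\<^sub>R (h (\<gamma> s) * k s)" for s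
  by (simp add: indicator_def)
 ultimately show ?thesis by (simp only:)
qed

lemma set_integral_cong_AE:
 fixes p q :: "real => complex"
 assumes "AE s in lborel. s \<in> S --> p s = q s" "p \<in> borel_measurable borel" "q \<in> borel_measurable borel" "S \<in> sets borel"
 shows "(LINT s:S|lborel. p s) = (LINT s:S|lborel. q s)" unfolding set_lebesgue_integral_def
proof (rule integral_cong_AE)
 show "AE s in lborel. indicator S s *\<^sub>R p s = indicator S s *\<^sub>R q s"
  using assms(1) by eventually_elim (auto simp: indicator_def)
qed (use assms in \<open>auto intro!: borel_measurable_scaleR\<close>)

context tube_domain
begin

text \<open>The frontier is the level t = 0 of the tubular map, hence null.\<close>

lemma AE_sides: "AE x in lebesgue. x \<in> Oi \<or> x \<in> - closure Oi"
proof -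
 have "\<Phi> ` ({0..L} \<times> {0}) = \<gamma> ` {0..L}" by (force simp: \<Phi>_def image_iff)
 then have "frontier Oi \<in> null_sets lborel" using level_null[of 0] frontier_Oi by simp
 then have "AE x in lborel. x \<notin> frontier Oi" by (rule AE_not_in)
 from AE_completion[OF this] show ?thesis by eventually_elim (use Oi_open in \<open>auto simp: frontier_def interior_open\<close>)
qed

lemma ip_split:
 assumes v: "sqi lebesgue v" and \<psi>: "test_fun W \<psi>"
 shows "ip UNIV v \<psi> = ip Oi v \<psi> + ip (- closure Oi) v \<psi>"
proof -
 have s: "sqU UNIV (\<lambda>x. indicator Oi x * v x)" "sqU UNIV (\<lambda>x. indicator (- closure Oi) x * v x)"
  using sqi_indicator[OF v] Oi_open by (simp_all add: open_Compl)
 have "ip UNIV v \<psi> = ip UNIV (\<lambda>x. indicator Oi x * v x + indicator (- closure Oi) x * v x) \<psi>"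
 proof (rule ip_cong_AE[OF _ _ sqU_add[OF s] \<psi>])
  show "AE x in lebesgue. x \<in> UNIV --> v x = indicator Oi x * v x + indicator (- closure Oi) x * v x"
   using AE_sides by eventually_elim (use closure_subset[of Oi] in \<open>auto simp: indicator_def\<close>)
 qed (use v in simp)
 also have "\<dots> = ip Oi v \<psi> + ip (- closure Oi) v \<psi>" unfolding ip_add_left[OF s \<psi>] by (simp add: ip_altdef)
 finally show ?thesis .
qed

text \<open>The exterior formula is available only on K near the curve, while far away there is only
  the weak equation. A test function is split by a cut-off equal to 1 near the closed domain: the
  part in K sees both Green formulas, whose trace terms cancel and whose normal derivatives leave
  the jump; the rest is supported away from the curve.\<close>

lemma glue:
 assumes K: "open K" "bounded K" "closure Oi \<subseteq> K" and f: "sqi lebesgue f"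
  and \<nu>: "\<And>s. \<nu> (\<gamma> s) = n s" and \<alpha>: "(\<lambda>s. \<alpha> (\<gamma> s)) \<in> borel_measurable borel"
  and A: "resolvent_eq_A B Oi K \<gamma> L \<nu> \<alpha> lam f u"
 shows "\<exists>G t. sqi lebesgue u \<and> (\<forall>j. sqi lebesgue (\<lambda>x. G x $ j)) \<and> weak_mgrad B UNIV u G \<and> L2_Sigma \<gamma> L t \<and>
  (\<forall>\<phi> j. test_fun UNIV \<phi> --> ip Oi (\<lambda>x. G x $ j) \<phi> = ip Oi u (MG B j \<phi>)
   + \<i> * (LINT s:{0..L}|lborel. t (\<gamma> s) * cnj (\<phi> (\<gamma> s)) * of_real (n s $ j))) \<and>
  (\<forall>\<phi>. test_fun UNIV \<phi> --> (\<Sum>j\<in>UNIV. ip UNIV (\<lambda>x. G x $ j) (MG B j \<phi>))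
   + (LINT s:{0..L}|lborel. of_real (\<alpha> (\<gamma> s)) * (t (\<gamma> s) * cnj (\<phi> (\<gamma> s)))) = ip UNIV (\<lambda>x. f x + lam * u x) \<phi>)"
proof -
 define Oe where "Oe = - closure Oi"
 define Ok where "Ok = K \<inter> Oe"
 define F where "F x = f x + lam * u x" for x
 note A' = A[unfolded resolvent_eq_A_def Let_def, folded Oe_def, folded Ok_def, folded F_def]
 have O: "open Oe" "open Ok" "bounded Ok" "Ok \<subseteq> K" "Ok \<subseteq> Oe" "Oi \<inter> Oe = {}"
  using K closure_subset[of Oi] by (auto simp: Oe_def Ok_def bounded_Int)
 have uL: "L2 Oi u" "L2 Oe u" using A' by (auto simp: H32_def H1A_def)
 obtain gA where gA: "weak_mgrad B Oe u gA" "L2v Oe gA" using A' by (auto simp: H1A_def)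
 obtain ti te ni ne where tr: "is_trace \<gamma> L \<nu> Oi UNIV 1 u ti" "is_trace \<gamma> L \<nu> Ok K (-1) u te"
  and nd: "is_normal_deriv \<gamma> L Oi UNIV 1 u ni" "is_normal_deriv \<gamma> L Ok K (-1) u ne"
  and tt: "AE s in lborel. s \<in> {0..L} --> ti (\<gamma> s) = te (\<gamma> s)"
  and nn: "AE s in lborel. s \<in> {0..L} --> ne (\<gamma> s) - ni (\<gamma> s) = of_real (\<alpha> (\<gamma> s)) * ti (\<gamma> s)" using A' by blast
 have ml: "weak_mlap B Oi u F" "weak_mlap B Oe u F" using A' by blast+
 have us: "sqU Oi u" "sqU Oe u" by (rule L2_sqU[OF uL(1) Oi_open], rule L2_sqU[OF uL(2) O(1)])
 have u: "sqi lebesgue u"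
 proof (rule sqi_bound[OF sqi_add[OF us]])
  show "u \<in> borel_measurable lebesgue" using uL(1) by (simp add: L2_def)
  show "AE x in lebesgue. cmod (u x) \<le> 1 * cmod (indicator Oi x * u x + indicator Oe x * u x)"
   using AE_sides by eventually_elim (use closure_subset[of Oi] in \<open>auto simp: indicator_def Oe_def\<close>)
 qed
 have F: "sqi lebesgue F" unfolding F_def by (intro sqi_add sqi_cmult f u)
 have Fs: "sqU Oi F" "sqU Oe F" "sqU Ok F" "sqU Ok u" using sqi_indicator[OF F] sqi_indicator[OF u] Oi_open O by auto
 obtain Gi where Gi: "\<And>j. sqU Oi (Gi j)" and GiT: "\<And>\<phi> j. test_fun UNIV \<phi> ==> ip Oi (Gi j) \<phi> = ip Oi u (MG B j \<phi>)
   + \<i> * (of_real 1 * (LINT s:{0..L}|lborel. ti (\<gamma> s) * cnj (\<phi> (\<gamma> s)) * of_real (\<nu> (\<gamma> s) $ j)))" and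
  GiN: "\<And>\<phi>. test_fun UNIV \<phi> ==> ip Oi F \<phi> = (\<Sum>j\<in>UNIV. ip Oi (Gi j) (MG B j \<phi>))
   - of_real 1 * (LINT s:{0..L}|lborel. ni (\<gamma> s) * cnj (\<phi> (\<gamma> s)))
   + \<i> * (\<Sum>j\<in>UNIV. of_real 1 * (LINT s:{0..L}|lborel. ti (\<gamma> s) * cnj (of_real (Amag B j (\<gamma> s)) * \<phi> (\<gamma> s)) * of_real (\<nu> (\<gamma> s) $ j)))"
  using one_sided_green[OF Oi_open Oi_bounded _ us(1) Fs(1) ml(1) tr(1) nd(1)] by (fastforce simp del: of_real_1)
 obtain Ge where Ge: "\<And>j. sqU Ok (Ge j)" and GeT: "\<And>\<phi> j. test_fun K \<phi> ==> ip Ok (Ge j) \<phi> = ip Ok u (MG B j \<phi>)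
   + \<i> * (of_real (-1) * (LINT s:{0..L}|lborel. te (\<gamma> s) * cnj (\<phi> (\<gamma> s)) * of_real (\<nu> (\<gamma> s) $ j)))" and
  GeN: "\<And>\<phi>. test_fun K \<phi> ==> ip Ok F \<phi> = (\<Sum>j\<in>UNIV. ip Ok (Ge j) (MG B j \<phi>))
   - of_real (-1) * (LINT s:{0..L}|lborel. ne (\<gamma> s) * cnj (\<phi> (\<gamma> s)))
   + \<i> * (\<Sum>j\<in>UNIV. of_real (-1) * (LINT s:{0..L}|lborel. te (\<gamma> s) * cnj (of_real (Amag B j (\<gamma> s)) * \<phi> (\<gamma> s)) * of_real (\<nu> (\<gamma> s) $ j)))"
  using one_sided_green[OF O(2,3,4) Fs(4,3) weak_mlap_mono[OF ml(2) O(5)] tr(2) nd(2)] by blast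
 have gAs: "sqU Oe (\<lambda>x. gA x $ j)" for j using gA(2) L2_sqU[OF _ O(1)] by (auto simp: L2v_def)
 \<comment> \<open>Near the curve the exterior magnetic gradient \<open>gA\<close> must be the field
   \<open>Ge\<close> of Green's formula: inside \<open>Ok\<close> both are weak magnetic gradients
   of the same function, because test functions there vanish on the curve.\<close>
 have gAk: "ip Oe (\<lambda>x. gA x $ j) \<phi> = ip Ok (Ge j) \<phi>" if \<phi>: "test_fun K \<phi>" for j \<phi>
 proof -
  have gk: "sqU Ok (\<lambda>x. gA x $ j)" by (rule sqU_mono[OF gAs O(5,2)])
  have "ip Oe (\<lambda>x. gA x $ j) \<phi> = ip Ok (\<lambda>x. gA x $ j) \<phi>"
   using test_fun_eq_0[OF \<phi>] by (intro ip_restrict O) (auto simp: Ok_def)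
  also have "\<dots> = ip Ok (Ge j) \<phi>"
  proof (rule ip_cong_AE[OF test_eq_imp_AE[OF O(2) gk Ge] gk Ge \<phi>])
   fix \<psi> assume \<psi>: "test_fun Ok \<psi>"
   have "\<psi> (\<gamma> s) = 0" if "s \<in> {0..L}" for s
   proof -
    have "\<gamma> s \<in> frontier Oi" using frontier_Oi that by blast
    then have "\<gamma> s \<notin> Ok" by (auto simp: Ok_def Oe_def frontier_def)
    then show ?thesis by (rule test_fun_eq_0[OF \<psi>])
   qed
   then have "(LINT s:{0..L}|lborel. te (\<gamma> s) * cnj (\<psi> (\<gamma> s)) * of_real (\<nu> (\<gamma> s) $ j)) = (LINT s:{0..L}|lborel. 0)"
    by (intro set_lebesgue_integral_cong) auto
   then have "ip Ok (Ge j) \<psi> = ip Ok u (MG B j \<psi>)" using GeT[OF test_fun_mono[OF \<psi> O(4)]] by simp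
   also have "\<dots> = ip Ok (\<lambda>x. gA x $ j) \<psi>" using weak_mgrad_mono[OF gA(1) O(5)] \<psi> by (simp add: weak_mgrad_def)
   finally show "ip Ok (\<lambda>x. gA x $ j) \<psi> = ip Ok (Ge j) \<psi>" ..
  qed
  finally show ?thesis .
 qed
 define G :: "R2 => complex^2" where "G x = (\<chi> j. indicator Oi x * Gi j x + indicator Oe x * gA x $ j)" for x
 have Gs: "sqi lebesgue (\<lambda>x. G x $ j)" for j unfolding G_def using sqi_add[OF Gi gAs] by simp
 have Gip: "ip UNIV (\<lambda>x. G x $ j) \<phi> = ip Oi (Gi j) \<phi> + ip Oe (\<lambda>x. gA x $ j) \<phi>" if \<phi>: "test_fun W \<phi>" for j \<phi> W
 proof -
  have s: "sqU UNIV (\<lambda>x. indicator Oi x * Gi j x)" "sqU UNIV (\<lambda>x. indicator Oe x * gA x $ j)" using Gi gAs by simp_all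
  show ?thesis unfolding G_def vec_lambda_beta ip_add_left[OF s \<phi>] by (simp add: ip_altdef)
 qed
 have Gi': "ip Oi (\<lambda>x. G x $ j) \<phi> = ip Oi (Gi j) \<phi>" for j \<phi> unfolding ip_altdef
 proof (intro Bochner_Integration.integral_cong refl)
  show "indicator Oi x * G x $ j * cnj (\<phi> x) = indicator Oi x * Gi j x * cnj (\<phi> x)" for x
   using O(6) by (auto simp: G_def indicator_def)
 qed
 note split = ip_split[OF u, folded Oe_def] ip_split[OF F, folded Oe_def]
 have cont: "continuous_on UNIV (\<lambda>s. cnj (\<phi> (\<gamma> s)))" if "test_fun W \<phi>" for \<phi> W
  by (intro continuous_intros test_fun_curve_continuous[OF that])
 have bm: "(\<lambda>s. h (\<gamma> s) * cnj (\<phi> (\<gamma> s))) \<in> borel_measurable borel" if "L2_Sigma \<gamma> L h" "test_fun W \<phi>" for h \<phi> W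
  using that(1) borel_measurable_continuous_onI[OF cont[OF that(2)]] by (auto simp: L2_Sigma_def intro!: borel_measurable_times)
 have nm: "(\<lambda>s. complex_of_real (\<nu> (\<gamma> s) $ j)) \<in> borel_measurable borel" for j
  unfolding \<nu> by (intro borel_measurable_continuous_onI continuous_intros n_continuous)
 have L: "L2_Sigma \<gamma> L ti" "L2_Sigma \<gamma> L te" "L2_Sigma \<gamma> L ni" "L2_Sigma \<gamma> L ne"
  using tr nd by (auto simp: is_trace_def is_normal_deriv_def)
 have teq: "(LINT s:{0..L}|lborel. te (\<gamma> s) * cnj (\<phi> (\<gamma> s)) * of_real (\<nu> (\<gamma> s) $ j))
   = (LINT s:{0..L}|lborel. ti (\<gamma> s) * cnj (\<phi> (\<gamma> s)) * of_real (\<nu> (\<gamma> s) $ j))" if "test_fun W \<phi>" for \<phi> j W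
 proof (rule set_integral_cong_AE[OF _ borel_measurable_times[OF bm[OF L(2) that] nm] borel_measurable_times[OF bm[OF L(1) that] nm]])
  show "AE s in lborel. s \<in> {0..L} --> te (\<gamma> s) * cnj (\<phi> (\<gamma> s)) * of_real (\<nu> (\<gamma> s) $ j) = ti (\<gamma> s) * cnj (\<phi> (\<gamma> s)) * of_real (\<nu> (\<gamma> s) $ j)"
   using tt by eventually_elim simp
 qed simp
 let ?bd = "\<lambda>\<phi>. LINT s:{0..L}|lborel. of_real (\<alpha> (\<gamma> s)) * (ti (\<gamma> s) * cnj (\<phi> (\<gamma> s)))"
 have PK: "ip UNIV (\<lambda>x. G x $ j) \<phi> = ip UNIV u (MG B j \<phi>)"
  "(\<Sum>j\<in>UNIV. ip UNIV (\<lambda>x. G x $ j) (MG B j \<phi>)) + ?bd \<phi> = ip UNIV F \<phi>" if \<phi>: "test_fun K \<phi>" for \<phi> j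
 proof -
  note \<phi>' = test_fun_UNIV[OF \<phi>]
  have k: "ip Oe v \<psi> = ip Ok v \<psi>" if "test_fun K \<psi>" for v \<psi>
   using test_fun_eq_0[OF that] by (intro ip_restrict O) (auto simp: Ok_def)
  show "ip UNIV (\<lambda>x. G x $ j) \<phi> = ip UNIV u (MG B j \<phi>)"
   unfolding Gip[OF \<phi>] split(1)[OF test_fun_MG[OF \<phi>]] gAk[OF \<phi>] GiT[OF \<phi>'] GeT[OF \<phi>] teq[OF \<phi>] k[OF test_fun_MG[OF \<phi>]] by simp
  have "(LINT s:{0..L}|lborel. ne (\<gamma> s) * cnj (\<phi> (\<gamma> s))) - (LINT s:{0..L}|lborel. ni (\<gamma> s) * cnj (\<phi> (\<gamma> s)))
    = (LINT s:{0..L}|lborel. ne (\<gamma> s) * cnj (\<phi> (\<gamma> s)) - ni (\<gamma> s) * cnj (\<phi> (\<gamma> s)))"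
   using L2_Sigma_integrable[OF L(4) cont[OF \<phi>]] L2_Sigma_integrable[OF L(3) cont[OF \<phi>]]
   by (intro set_integral_diff(2)[symmetric]) (simp_all add: set_integrable_def)
  also have "\<dots> = ?bd \<phi>"
  proof (rule set_integral_cong_AE)
   show "AE s in lborel. s \<in> {0..L} --> ne (\<gamma> s) * cnj (\<phi> (\<gamma> s)) - ni (\<gamma> s) * cnj (\<phi> (\<gamma> s)) = of_real (\<alpha> (\<gamma> s)) * (ti (\<gamma> s) * cnj (\<phi> (\<gamma> s)))"
    using nn by eventually_elim (simp add: left_diff_distrib[symmetric] mult.assoc[symmetric])
   show "(\<lambda>s. ne (\<gamma> s) * cnj (\<phi> (\<gamma> s)) - ni (\<gamma> s) * cnj (\<phi> (\<gamma> s))) \<in> borel_measurable borel"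
    by (intro borel_measurable_diff bm[OF _ \<phi>] L)
   have "(\<lambda>s. complex_of_real (\<alpha> (\<gamma> s))) \<in> borel_measurable borel" using \<alpha> by measurable
   then show "(\<lambda>s. of_real (\<alpha> (\<gamma> s)) * (ti (\<gamma> s) * cnj (\<phi> (\<gamma> s)))) \<in> borel_measurable borel"
    by (intro borel_measurable_times[OF _ bm[OF L(1) \<phi>]])
  qed simp
  finally have bd: "?bd \<phi> = (LINT s:{0..L}|lborel. ne (\<gamma> s) * cnj (\<phi> (\<gamma> s))) - (LINT s:{0..L}|lborel. ni (\<gamma> s) * cnj (\<phi> (\<gamma> s)))" ..
  show "(\<Sum>j\<in>UNIV. ip UNIV (\<lambda>x. G x $ j) (MG B j \<phi>)) + ?bd \<phi> = ip UNIV F \<phi>"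
   unfolding bd Gip[OF test_fun_MG[OF \<phi>]] split(2)[OF \<phi>] k[OF \<phi>] GiN[OF \<phi>'] GeN[OF \<phi>]
    gAk[OF test_fun_MG[OF \<phi>]] teq[OF test_fun_Amag[OF \<phi>]] sum.distrib by (simp add: sum_negf)
 qed
 have PE: "ip UNIV (\<lambda>x. G x $ j) \<phi> = ip UNIV u (MG B j \<phi>)"
  "(\<Sum>j\<in>UNIV. ip UNIV (\<lambda>x. G x $ j) (MG B j \<phi>)) = ip UNIV F \<phi>" if \<phi>: "test_fun Oe \<phi>" for \<phi> j
 proof -
  have z: "ip Oi v \<psi> = 0" if "test_fun Oe \<psi>" for v \<psi>
  proof -
   have "ip Oi v \<psi> = ip {} v \<psi>" using test_fun_eq_0[OF that] O(6) by (intro ip_restrict) auto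
   then show ?thesis by (simp add: ip_altdef)
  qed
  have gw: "ip Oe (\<lambda>x. gA x $ j) \<psi> = ip Oe u (MG B j \<psi>)" if "test_fun Oe \<psi>" for \<psi> j
   using gA(1) that by (simp add: weak_mgrad_def)
  show "ip UNIV (\<lambda>x. G x $ j) \<phi> = ip UNIV u (MG B j \<phi>)"
   unfolding Gip[OF \<phi>] split(1)[OF test_fun_MG[OF \<phi>]] z[OF \<phi>] z[OF test_fun_MG[OF \<phi>]] gw[OF \<phi>] ..
  have "ip Oe F \<phi> = (\<Sum>j\<in>UNIV. ip Oe u (MG B j (MG B j \<phi>)))"
   using ml(2) \<phi> unfolding weak_mlap_def mlap_def ip_sum_right[OF us(2) test_fun_MG[OF test_fun_MG[OF \<phi>]], symmetric] by blast
  then show "(\<Sum>j\<in>UNIV. ip UNIV (\<lambda>x. G x $ j) (MG B j \<phi>)) = ip UNIV F \<phi>"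
   unfolding Gip[OF test_fun_MG[OF \<phi>]] split(2)[OF \<phi>] z[OF \<phi>] z[OF test_fun_MG[OF \<phi>]] gw[OF test_fun_MG[OF \<phi>]] by simp
 qed
 obtain \<eta> W where \<eta>: "test_fun K \<eta>" "open W" "closure Oi \<subseteq> W" "\<And>x. x \<in> W ==> \<eta> x = 1"
  using exists_cutoff[OF _ K(1,3)] Oi_bounded by (metis compact_closure)
 have dec: "\<exists>\<phi>1 \<phi>2. test_fun K \<phi>1 \<and> test_fun Oe \<phi>2 \<and> \<phi> = (\<lambda>x. \<phi>1 x + \<phi>2 x)" if \<phi>: "test_fun UNIV \<phi>" for \<phi>
 proof (intro exI conjI)
  note sm = test_fun_smooth[OF \<phi>] test_fun_smooth[OF \<eta>(1)]
  show "test_fun K (\<lambda>x. \<phi> x * \<eta> x)" by (rule test_fun_mult1[OF \<eta>(1) sm(1)])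
  show "test_fun Oe (\<lambda>x. (1 + - 1 * \<eta> x) * \<phi> x)"
  proof (rule test_funI)
   show "smooth_fun (\<lambda>x. (1 + - 1 * \<eta> x) * \<phi> x)" by (intro smooth_fun_mult smooth_fun_add smooth_fun_const sm)
   show "compact (closure {x. \<phi> x \<noteq> 0} \<inter> - W)" using \<phi> \<eta>(2) by (auto simp: test_fun_def intro!: compact_Int_closed)
   show "closure {x. \<phi> x \<noteq> 0} \<inter> - W \<subseteq> Oe" using \<eta>(3) by (auto simp: Oe_def)
   show "x \<in> closure {x. \<phi> x \<noteq> 0} \<inter> - W" if "(1 + - 1 * \<eta> x) * \<phi> x \<noteq> 0" for x
    using that \<eta>(4)[of x] closure_subset[of "{x. \<phi> x \<noteq> 0}"] by auto
  qed
  show "\<phi> = (\<lambda>x. \<phi> x * \<eta> x + (1 + - 1 * \<eta> x) * \<phi> x)" by (simp add: algebra_simps)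
 qed
 have sU: "sqU UNIV u" "sqU UNIV F" "\<And>j. sqU UNIV (\<lambda>x. G x $ j)" using u F Gs by simp_all
 have w: "weak_mgrad B UNIV u G" unfolding weak_mgrad_def
 proof (intro allI impI)
  fix \<phi> j assume "test_fun UNIV \<phi>"
  from dec[OF this] obtain \<phi>1 \<phi>2 where 1: "test_fun K \<phi>1" and 2: "test_fun Oe \<phi>2" and \<phi>: "\<phi> = (\<lambda>x. \<phi>1 x + \<phi>2 x)" by blast
  show "ip UNIV (\<lambda>x. G x $ j) \<phi> = ip UNIV u (MG B j \<phi>)"
   unfolding \<phi> MG_add[OF test_fun_smooth[OF 1] test_fun_smooth[OF 2]] ip_add_right[OF sU(3) 1 2]
    ip_add_right[OF sU(1) test_fun_MG[OF 1] test_fun_MG[OF 2]] PK(1)[OF 1] PE(1)[OF 2] ..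
 qed
 show ?thesis
 proof (intro exI[of _ G] exI[of _ ti] conjI allI impI u Gs w L(1))
  show "ip Oi (\<lambda>x. G x $ j) \<phi> = ip Oi u (MG B j \<phi>) + \<i> * (LINT s:{0..L}|lborel. ti (\<gamma> s) * cnj (\<phi> (\<gamma> s)) * of_real (n s $ j))"
   if "test_fun UNIV \<phi>" for \<phi> j unfolding Gi' GiT[OF that] \<nu> by simp
  fix \<phi> assume "test_fun UNIV \<phi>"
  from dec[OF this] obtain \<phi>1 \<phi>2 where 1: "test_fun K \<phi>1" and 2: "test_fun Oe \<phi>2" and \<phi>: "\<phi> = (\<lambda>x. \<phi>1 x + \<phi>2 x)" by blast
  have "\<phi>2 (\<gamma> s) = 0" if "s \<in> {0..L}" for s
  proof -
   have "\<gamma> s \<in> frontier Oi" using frontier_Oi that by blast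
   then have "\<gamma> s \<notin> Oe" by (auto simp: Oe_def frontier_def)
   then show ?thesis by (rule test_fun_eq_0[OF 2])
  qed
  then have bd: "?bd \<phi> = ?bd \<phi>1" by (intro set_lebesgue_integral_cong) (auto simp: \<phi>)
  show "(\<Sum>j\<in>UNIV. ip UNIV (\<lambda>x. G x $ j) (MG B j \<phi>)) + ?bd \<phi> = ip UNIV (\<lambda>x. f x + lam * u x) \<phi>"
   unfolding bd F_def[symmetric]
   unfolding \<phi> MG_add[OF test_fun_smooth[OF 1] test_fun_smooth[OF 2]] ip_add_right[OF sU(3) test_fun_MG[OF 1] test_fun_MG[OF 2]]
    ip_add_right[OF sU(2) 1 2] sum.distrib using PK(2)[OF 1] PE(2)[OF 2] by (simp add: algebra_simps)
 qed
qed

end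

subsection \<open>Identification of the trace\<close>

context tube_curve
begin

text \<open>The periodic function descends to the curve, since the parametrisation is injective up
  to its end points. Tietze's theorem extends it to the plane, a cut-off makes the support compact,
  and mollification makes it smooth at uniform cost \<delta>.\<close>

lemma extend_from_curve:
 assumes g: "continuous_on UNIV (g :: real => complex)" "g 0 = g L" and \<delta>: "\<delta> > 0"
 shows "\<exists>\<psi>. test_fun UNIV \<psi> \<and> (\<forall>s\<in>{0..L}. cmod (\<psi> (\<gamma> s) - g s) \<le> \<delta>)"
proof -
 define gh where "gh x = g (SOME s. s \<in> {0..L} \<and> \<gamma> s = x)" for x
 have same: "g s = g s'" if "s \<in> {0..L}" "s' \<in> {0..L}" "\<gamma> s = \<gamma> s'" for s s'
 proof -
  have r: "\<exists>r. r \<in> {0..<L} \<and> \<gamma> s = \<gamma> r \<and> g s = g r" if "s \<in> {0..L}" for s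
  proof (cases "s = L")
   case True
   then show ?thesis using per[of 0] g(2) L_pos by (intro exI[of _ 0]) auto
  next
   case False
   then show ?thesis using that by (intro exI[of _ s]) auto
  qed
  from r[OF that(1)] r[OF that(2)] obtain r r' where "r \<in> {0..<L}" "\<gamma> s = \<gamma> r" "g s = g r" "r' \<in> {0..<L}" "\<gamma> s' = \<gamma> r'" "g s' = g r'"
   by blast
  then show ?thesis using inj_onD[OF inj, of r r'] that(3) by metis
 qed
 have gh: "gh (\<gamma> s) = g s" if "s \<in> {0..L}" for s
 proof -
  have "(SOME s'. s' \<in> {0..L} \<and> \<gamma> s' = \<gamma> s) \<in> {0..L} \<and> \<gamma> (SOME s'. s' \<in> {0..L} \<and> \<gamma> s' = \<gamma> s) = \<gamma> s"
   by (rule someI[of _ s]) (use that in simp)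
  then show ?thesis unfolding gh_def using same that by blast
 qed
 have \<Sigma>c: "closed \<Sigma>" using \<Sigma>_compact by (rule compact_imp_closed)
 \<comment> \<open>A closed preimage on the curve is the image of a compact parameter set, so
   continuity holds without an inverse of the parametrisation.\<close>
 have "continuous_on \<Sigma> gh"
 proof (subst continuous_on_closed_vimage[OF \<Sigma>c], intro allI impI)
  fix T :: "complex set" assume T: "closed T"
  have "gh -` T \<inter> \<Sigma> = \<gamma> ` ({0..L} \<inter> g -` T)"
  proof
   show "gh -` T \<inter> \<Sigma> \<subseteq> \<gamma> ` ({0..L} \<inter> g -` T)"
   proof
    fix x assume x: "x \<in> gh -` T \<inter> \<Sigma>"
    then obtain s where s: "s \<in> {0..L}" "x = \<gamma> s" unfolding \<Sigma>_def by blast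
    then have "g s \<in> T" using x gh[OF s(1)] by simp
    then show "x \<in> \<gamma> ` ({0..L} \<inter> g -` T)" using s by blast
   qed
   show "\<gamma> ` ({0..L} \<inter> g -` T) \<subseteq> gh -` T \<inter> \<Sigma>" using gh by (auto simp: \<Sigma>_def)
  qed
  moreover have "closed (g -` T)" using g(1) T by (simp add: closed_vimage)
  ultimately show "closed (gh -` T \<inter> \<Sigma>)"
   by (auto intro!: compact_imp_closed compact_continuous_image \<gamma>_continuous compact_Int_closed)
 qed
 from Tietze_unbounded[OF this, of UNIV] \<Sigma>c
 obtain g1 where g1: "continuous_on UNIV g1" "\<And>x. x \<in> \<Sigma> ==> g1 x = gh x" by auto
 obtain \<eta> W where \<eta>: "test_fun UNIV \<eta>" "\<Sigma> \<subseteq> W" "\<And>x. x \<in> W ==> \<eta> x = 1"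
  using exists_cutoff[OF \<Sigma>_compact open_UNIV] by auto
 define C where "C = closure {x. \<eta> x \<noteq> 0}"
 have C: "compact C" using \<eta>(1) by (simp add: C_def test_fun_def)
 define g2 where "g2 x = g1 x * \<eta> x" for x
 have g2: "continuous_on UNIV g2" unfolding g2_def
  by (intro continuous_intros g1 smooth_fun_continuous_on test_fun_smooth[OF \<eta>(1)])
 have g20: "g2 x = 0" if "x \<notin> C" for x using that closure_subset[of "{x. \<eta> x \<noteq> 0}"] by (auto simp: C_def g2_def)
 have "integrable lborel (\<lambda>x. indicator C x *\<^sub>R g2 x)"
  using C g2 by (intro borel_integrable_compact) (auto intro: continuous_on_subset)
 moreover have "(\<lambda>x. indicator C x *\<^sub>R g2 x) = g2" by (rule ext) (use g20 in \<open>auto simp: indicator_def\<close>)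
 ultimately have "integrable lborel g2" by simp
 then have g2i: "integrable lebesgue g2" using borel_measurable_continuous_onI[OF g2] by (simp add: integrable_completion)
 from mollify_uniform[OF g2 C g20 \<delta>] obtain d where d: "d > 0" "\<And>e x. 0 < e ==> e \<le> d ==> cmod (mollify e g2 x - g2 x) \<le> \<delta>"
  by blast
 show ?thesis
 proof (intro exI[of _ "mollify d g2"] conjI ballI)
  show "test_fun UNIV (mollify d g2)" by (rule mollify_test_fun[OF d(1) g2i g20 C]) auto
  fix s assume s: "s \<in> {0..L}"
  have "\<gamma> s \<in> \<Sigma>" by (rule \<gamma>_in_\<Sigma>)
  then have "g2 (\<gamma> s) = g s" using \<eta>(2,3) g1(2) gh[OF s] by (auto simp: g2_def)
  then show "cmod (mollify d g2 (\<gamma> s) - g s) \<le> \<delta>" using d(2)[of d "\<gamma> s"] d(1) by simp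
 qed
qed

lemma trace_sqi:
 assumes "L2_Sigma \<gamma> L t"
 shows "sqi lborel (\<lambda>s. indicator {0..L} s * t (\<gamma> s))"
proof -
 have hm: "(\<lambda>s. t (\<gamma> s)) \<in> borel_measurable lborel" and hi: "integrable lborel (\<lambda>s. indicator {0..L} s *\<^sub>R (cmod (t (\<gamma> s)))\<^sup>2)"
  using assms by (auto simp: L2_Sigma_def set_integrable_def)
 have "(\<lambda>s. (cmod (indicator {0..L} s * t (\<gamma> s)))\<^sup>2) = (\<lambda>s. indicator {0..L} s *\<^sub>R (cmod (t (\<gamma> s)))\<^sup>2)"
  by (rule ext) (simp add: indicator_def)
 moreover have "(\<lambda>s. indicator {0..L} s * t (\<gamma> s)) \<in> borel_measurable lborel"
  using hm by (intro borel_measurable_times borel_measurable_indicator) auto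
 ultimately show ?thesis using hi by (simp add: sqi_def)
qed

lemma test_trace_sqi:
 assumes "test_fun UNIV \<phi>"
 shows "L2_Sigma \<gamma> L \<phi>"
proof -
 have c: "continuous_on UNIV (\<lambda>s. \<phi> (\<gamma> s))"
  by (intro test_fun_curve_continuous[OF assms])
 have "integrable lborel (\<lambda>s. indicator {0..L} s *\<^sub>R (cmod (\<phi> (\<gamma> s)))\<^sup>2)"
  by (intro borel_integrable_compact continuous_intros continuous_on_subset[OF c]) auto
 then show ?thesis unfolding L2_Sigma_def set_integrable_def using borel_measurable_continuous_onI[OF c] by simp
qed

text \<open>Approximating on the open interval gives continuous functions that vanish near both end
  points, so they match at the seam and can be extended from the curve.\<close>

lemma trace_dense:
 assumes h: "sqi lborel (\<lambda>s. indicator {0..L} s * h s)" and e: "e > 0"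
 shows "\<exists>\<psi>. test_fun UNIV \<psi> \<and> sqn lborel (\<lambda>s. indicator {0..L} s * (\<psi> (\<gamma> s) - h s)) < e"
proof -
 let ?I = "{0<..<L}"
 define v where "v s = indicator ?I s * (indicator {0..L} s * h s)" for s
 have vb: "v \<in> borel_measurable borel" unfolding v_def
  using borel_measurable_times[OF _ sqi_measurable[OF h], of "indicator ?I"] by simp
 have "sqi lborel v" unfolding v_def using sqi_measurable[OF h]
  by (intro sqi_bmult[OF h, of _ 1]) (auto simp: indicator_def)
 then have v: "sqi lebesgue v" using vb by (auto simp: sqi_def integrable_completion measurable_completion)
 have v0: "v s = 0" if "s \<notin> ?I" for s using that by (simp add: v_def)
 have e4: "e / 4 > 0" using e by simp
 obtain g C where g: "continuous_on UNIV g" "C \<subseteq> ?I" "\<forall>x. x \<notin> C --> g x = 0" "sqi lebesgue g" "sqn lebesgue (\<lambda>x. g x - v x) < e / 4"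
  by (rule exE[OF continuous_compact_dense[OF v open_greaterThanLessThan[of 0 L] _ e4]], erule v0, elim exE conjE) (rule that)
 define \<delta> where "\<delta> = sqrt (e / (4 * L))"
 have \<delta>: "\<delta> > 0" "\<delta>\<^sup>2 = e / (4 * L)" using e L_pos by (simp_all add: \<delta>_def)
 have "0 \<notin> C" "L \<notin> C" using g(2) by auto
 then have "g 0 = g L" using g(3) by simp
 from extend_from_curve[OF g(1) this \<delta>(1)] obtain \<psi> where
  \<psi>: "test_fun UNIV \<psi>" "\<And>s. s \<in> {0..L} ==> cmod (\<psi> (\<gamma> s) - g s) \<le> \<delta>" by blast
 have c\<psi>: "continuous_on UNIV (\<lambda>s. \<psi> (\<gamma> s))"
  by (intro test_fun_curve_continuous[OF \<psi>(1)])
 define p where "p s = indicator ?I s * (\<psi> (\<gamma> s) - g s)" for s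
 have pb: "p \<in> borel_measurable borel" unfolding p_def
  using borel_measurable_continuous_onI[OF c\<psi>] borel_measurable_continuous_onI[OF g(1)]
  by (intro borel_measurable_times borel_measurable_indicator borel_measurable_diff) auto
 have ple: "(cmod (p s))\<^sup>2 \<le> indicator {0..L} s * \<delta>\<^sup>2" for s
  using \<psi>(2)[of s] \<delta>(1) by (auto simp: p_def indicator_def intro: power_mono)
 have ii: "integrable lborel (\<lambda>s. indicator {0..L} s * \<delta>\<^sup>2)" by (intro integrable_mult_left integrable_real_indicator) (use L_pos in auto)
 have pi: "integrable lborel (\<lambda>s. (cmod (p s))\<^sup>2)"
  by (rule Bochner_Integration.integrable_bound[OF ii]) (use pb ple in \<open>auto intro!: AE_I2\<close>)
 then have ps: "sqi lborel p" using pb by (simp add: sqi_def)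
 have "sqn lborel p \<le> (\<integral>s. indicator {0..L} s * \<delta>\<^sup>2 \<partial>lborel)" unfolding sqn_def by (rule integral_mono[OF pi ii ple])
 also have "\<dots> = e / 4" using L_pos \<delta>(2) by simp
 finally have pn: "sqn lborel p \<le> e / 4" .
 have gv: "(\<lambda>x. g x - v x) \<in> borel_measurable borel" using borel_measurable_continuous_onI[OF g(1)] vb by simp
 then have gvm: "(\<lambda>x. (cmod (g x - v x))\<^sup>2) \<in> borel_measurable borel" by measurable
 have "sqi lebesgue (\<lambda>x. g x - v x)" by (rule sqi_diff[OF g(4) v])
 then have gvi: "sqi lborel (\<lambda>x. g x - v x)" using gv gvm by (simp add: sqi_def integrable_completion)
 have gvn: "sqn lborel (\<lambda>x. g x - v x) < e / 4" using g(5) unfolding sqn_def lebesgue_lborel_integral[OF gvm] .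
 show ?thesis
 proof (intro exI[of _ \<psi>] conjI \<psi>(1))
  have "sqn lborel (\<lambda>s. indicator {0..L} s * (\<psi> (\<gamma> s) - h s)) = sqn lborel (\<lambda>s. p s + (g s - v s))"
   unfolding sqn_def
  proof (rule integral_cong_AE)
   have "indicator {0..L} s * (\<psi> (\<gamma> s) - h s) = indicator {0..L} s * \<psi> (\<gamma> s) - indicator {0..L} s * h s" for s
    by (simp add: right_diff_distrib)
   moreover have "(\<lambda>s. indicator {0..L} s * \<psi> (\<gamma> s) - indicator {0..L} s * h s) \<in> borel_measurable lborel"
    by (intro borel_measurable_diff[OF _ sqi_measurable[OF h]] sqi_measurable[OF trace_sqi[OF test_trace_sqi[OF \<psi>(1)]]])
   ultimately show "(\<lambda>s. (cmod (indicator {0..L} s * (\<psi> (\<gamma> s) - h s)))\<^sup>2) \<in> borel_measurable lborel" by simp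
   show "(\<lambda>s. (cmod (p s + (g s - v s)))\<^sup>2) \<in> borel_measurable lborel" using pb gv by measurable
   show "AE s in lborel. (cmod (indicator {0..L} s * (\<psi> (\<gamma> s) - h s)))\<^sup>2 = (cmod (p s + (g s - v s)))\<^sup>2"
    using AE_lborel_singleton[of 0] AE_lborel_singleton[of L]
   proof eventually_elim
    fix s assume s: "s \<noteq> 0" "s \<noteq> L"
    show "(cmod (indicator {0..L} s * (\<psi> (\<gamma> s) - h s)))\<^sup>2 = (cmod (p s + (g s - v s)))\<^sup>2"
     by (cases "s \<in> ?I") (use s g(2,3) in \<open>auto simp: p_def v_def indicator_def\<close>)
   qed
  qed
  also have "\<dots> \<le> 2 * sqn lborel p + 2 * sqn lborel (\<lambda>s. g s - v s)" by (rule sqn_add_le[OF ps gvi])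
  also have "\<dots> < e" using pn gvn by linarith
  finally show "sqn lborel (\<lambda>s. indicator {0..L} s * (\<psi> (\<gamma> s) - h s)) < e" .
 qed
qed

lemma trace_sqn_bounded:
 assumes \<phi>: "\<And>m. test_fun UNIV (\<phi> m)" and u: "sqlim lebesgue \<phi> u" and G: "\<And>j. sqlim lebesgue (\<lambda>m. MG B j (\<phi> m)) (\<lambda>x. G x $ j)"
  and t: "L2_Sigma \<gamma> L t"
 shows "\<exists>K. \<forall>m. sqn lborel (\<lambda>s. indicator {0..L} s * (\<phi> m (\<gamma> s) - t (\<gamma> s))) \<le> K"
proof -
 obtain C where C: "C > 0" "\<And>\<phi>. test_fun UNIV \<phi> ==> (\<integral>s. indicator {0..<L} s *\<^sub>R (cmod (\<phi> (\<gamma> s)))\<^sup>2 \<partial>lborel) \<le> C * (sqn lebesgue \<phi> + energy B \<phi>)"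
  using trace_bound[of B] by blast
 have "(\<lambda>m. sqn lebesgue (\<phi> m) + energy B (\<phi> m)) \<longlonglongrightarrow> sqn lebesgue u + (\<Sum>j\<in>UNIV. sqn lebesgue (\<lambda>x. G x $ j))"
  unfolding energy_def by (intro tendsto_add tendsto_sum sqlim_sqn u G)
 then have "Bseq (\<lambda>m. sqn lebesgue (\<phi> m) + energy B (\<phi> m))" by (rule convergent_imp_Bseq[OF convergentI])
 then obtain N where N: "\<And>m. norm (sqn lebesgue (\<phi> m) + energy B (\<phi> m)) \<le> N" by (auto simp: Bseq_def)
 show ?thesis
 proof (intro exI allI)
  fix m
  note s = trace_sqi[OF test_trace_sqi[OF \<phi>[of m]]] trace_sqi[OF t]
  have "sqn lborel (\<lambda>s. indicator {0..L} s * \<phi> m (\<gamma> s)) = (\<integral>s. indicator {0..<L} s *\<^sub>R (cmod (\<phi> m (\<gamma> s)))\<^sup>2 \<partial>lborel)"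
   unfolding sqn_def
  proof (rule integral_cong_AE)
   show "(\<lambda>s. (cmod (indicator {0..L} s * \<phi> m (\<gamma> s)))\<^sup>2) \<in> borel_measurable lborel"
    using sqi_measurable[OF s(1)] by measurable
   show "(\<lambda>s. indicator {0..<L} s *\<^sub>R (cmod (\<phi> m (\<gamma> s)))\<^sup>2) \<in> borel_measurable lborel"
    using test_trace_sqi[OF \<phi>[of m]] by (auto simp: L2_Sigma_def)
   show "AE s in lborel. (cmod (indicator {0..L} s * \<phi> m (\<gamma> s)))\<^sup>2 = indicator {0..<L} s *\<^sub>R (cmod (\<phi> m (\<gamma> s)))\<^sup>2"
    using AE_lborel_singleton[of L] by eventually_elim (auto simp: indicator_def)
  qed
  also have "\<dots> \<le> C * (sqn lebesgue (\<phi> m) + energy B (\<phi> m))" by (rule C(2)[OF \<phi>])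
  also have "\<dots> \<le> C * N" using N[of m] C(1) by (intro mult_left_mono) auto
  finally have 1: "sqn lborel (\<lambda>s. indicator {0..L} s * \<phi> m (\<gamma> s)) \<le> C * N" .
  have "sqn lborel (\<lambda>s. indicator {0..L} s * (\<phi> m (\<gamma> s) - t (\<gamma> s)))
    = sqn lborel (\<lambda>s. indicator {0..L} s * \<phi> m (\<gamma> s) + (- 1) * (indicator {0..L} s * t (\<gamma> s)))"
   by (simp add: right_diff_distrib)
  also have "\<dots> \<le> 2 * sqn lborel (\<lambda>s. indicator {0..L} s * \<phi> m (\<gamma> s)) + 2 * sqn lborel (\<lambda>s. (- 1) * (indicator {0..L} s * t (\<gamma> s)))"
   by (intro sqn_add_le s sqi_cmult)
  also have "sqn lborel (\<lambda>s. (- 1) * (indicator {0..L} s * t (\<gamma> s))) = sqn lborel (\<lambda>s. indicator {0..L} s * t (\<gamma> s))"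
   unfolding sqn_cmult by simp
  finally show "sqn lborel (\<lambda>s. indicator {0..L} s * (\<phi> m (\<gamma> s) - t (\<gamma> s))) \<le> 2 * (C * N) + 2 * sqn lborel (\<lambda>s. indicator {0..L} s * t (\<gamma> s))"
   using 1 by linarith
 qed
qed

end

context tube_domain
begin

text \<open>For test functions the divergence theorem, applied to \<phi> m times the conjugate of
  \<psi>, expresses the curve integral weighted with n_j through inner products over
  \<open>Oi\<close>. These converge with \<phi> m, and \<open>link\<close> is the same identity for
  the limit.\<close>

lemma trace_limit_normal:
 assumes \<phi>: "\<And>m. test_fun UNIV (\<phi> m)" and u: "sqlim lebesgue \<phi> u" and G: "\<And>j. sqlim lebesgue (\<lambda>m. MG B j (\<phi> m)) (\<lambda>x. G x $ j)"
  and link: "\<And>\<psi> j. test_fun UNIV \<psi> ==> ip Oi (\<lambda>x. G x $ j) \<psi> = ip Oi u (MG B j \<psi>)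
   + \<i> * (LINT s:{0..L}|lborel. t (\<gamma> s) * cnj (\<psi> (\<gamma> s)) * of_real (n s $ j))" and \<psi>: "test_fun UNIV \<psi>"
 shows "(\<lambda>m. LINT s:{0..L}|lborel. \<phi> m (\<gamma> s) * cnj (\<psi> (\<gamma> s)) * of_real (n s $ j))
  \<longlonglongrightarrow> (LINT s:{0..L}|lborel. t (\<gamma> s) * cnj (\<psi> (\<gamma> s)) * of_real (n s $ j))"
proof -
 have Om: "Oi \<in> sets lebesgue" using Oi_open by simp
 have lim: "(\<lambda>m. ip Oi (f m) \<chi>') \<longlonglongrightarrow> ip Oi F \<chi>'" if "sqlim lebesgue f F" "test_fun UNIV \<chi>'" for f F \<chi>'
  unfolding ip_altdef
  by (intro sqlim_mult1 sqi_cnj test_fun_sqi[OF that(2)] sqlim_bmult[OF that(1), of _ 1] indicator_lebesgue[OF Om])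
    (simp add: cmod_indicator_le)
 have "(\<lambda>m. - \<i> * (ip Oi (MG B j (\<phi> m)) \<psi> - ip Oi (\<phi> m) (MG B j \<psi>))) \<longlonglongrightarrow> - \<i> * (ip Oi (\<lambda>x. G x $ j) \<psi> - ip Oi u (MG B j \<psi>))"
  by (intro tendsto_intros lim G u \<psi> test_fun_MG)
 also have "- \<i> * (ip Oi (\<lambda>x. G x $ j) \<psi> - ip Oi u (MG B j \<psi>)) = (LINT s:{0..L}|lborel. t (\<gamma> s) * cnj (\<psi> (\<gamma> s)) * of_real (n s $ j))"
  unfolding link[OF \<psi>] by simp
 also have "(\<lambda>m. - \<i> * (ip Oi (MG B j (\<phi> m)) \<psi> - ip Oi (\<phi> m) (MG B j \<psi>))) = (\<lambda>m. LINT s:{0..L}|lborel. \<phi> m (\<gamma> s) * cnj (\<psi> (\<gamma> s)) * of_real (n s $ j))"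
 proof
  fix m
  let ?f = "\<lambda>x. \<phi> m x * cnj (\<psi> x)"
  have f: "test_fun UNIV ?f" by (rule test_fun_mult2[OF \<phi> test_fun_smooth[OF test_fun_cnj[OF \<psi>]]])
  have d: "\<phi> m differentiable at x" "\<psi> differentiable at x" "(\<lambda>x. cnj (\<psi> x)) differentiable at x" for x
   by (intro smooth_fun_differentiable test_fun_smooth[OF \<phi>] test_fun_smooth[OF \<psi>] test_fun_smooth[OF test_fun_cnj[OF \<psi>]])+
  have i: "integrable lebesgue (\<lambda>x. (indicator Oi x * a x) * cnj (b x))" if "test_fun UNIV a" "test_fun UNIV b" for a b
   by (intro sqi_mult_integrable sqi_indicator[OF test_fun_sqi[OF that(1)] Om] sqi_cnj[OF test_fun_sqi[OF that(2)]])
  have "ip Oi (MG B j (\<phi> m)) \<psi> - ip Oi (\<phi> m) (MG B j \<psi>)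
    = (\<integral>x. indicator Oi x * MG B j (\<phi> m) x * cnj (\<psi> x) - indicator Oi x * \<phi> m x * cnj (MG B j \<psi> x) \<partial>lebesgue)"
   unfolding ip_altdef by (intro Bochner_Integration.integral_diff[symmetric] i test_fun_MG \<phi> \<psi>)
  also have "\<dots> = (\<integral>x. \<i> * (indicator Oi x *\<^sub>R pd j ?f x) \<partial>lebesgue)"
  proof (intro Bochner_Integration.integral_cong refl)
   fix x
   have "pd j ?f x = \<phi> m x * cnj (pd j \<psi> x) + pd j (\<phi> m) x * cnj (\<psi> x)"
    unfolding pd_mult[OF d(1,3)] pd_cnj[OF d(2)] ..
   then show "indicator Oi x * MG B j (\<phi> m) x * cnj (\<psi> x) - indicator Oi x * \<phi> m x * cnj (MG B j \<psi> x) = \<i> * (indicator Oi x *\<^sub>R pd j ?f x)"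
    by (cases "x \<in> Oi") (simp_all add: MG_def algebra_simps)
  qed
  also have "\<dots> = \<i> * (\<integral>x. indicator Oi x *\<^sub>R pd j ?f x \<partial>lebesgue)" by (rule integral_mult_right_zero)
  also have "(\<integral>x. indicator Oi x *\<^sub>R pd j ?f x \<partial>lebesgue) = (\<integral>x. indicator Oi x *\<^sub>R pd j ?f x \<partial>lborel)"
  proof (rule lebesgue_lborel_integral)
   have "pd j ?f \<in> borel_measurable borel"
    by (intro borel_measurable_continuous_onI smooth_fun_continuous_on test_fun_smooth[OF test_fun_pd[OF f]])
   then show "(\<lambda>x. indicator Oi x *\<^sub>R pd j ?f x) \<in> borel_measurable borel" using Oi_open by (intro borel_measurable_scaleR) auto
  qed
  also have "\<dots> = (LINT s:{0..L}|lborel. \<phi> m (\<gamma> s) * cnj (\<psi> (\<gamma> s)) * of_real (n s $ j))"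
   unfolding divergence_theorem[OF f] set_lebesgue_integral_def by (simp add: mult_ac)
  finally show "- \<i> * (ip Oi (MG B j (\<phi> m)) \<psi> - ip Oi (\<phi> m) (MG B j \<psi>)) = (LINT s:{0..L}|lborel. \<phi> m (\<gamma> s) * cnj (\<psi> (\<gamma> s)) * of_real (n s $ j))"
   by simp
 qed
 finally show ?thesis .
qed

text \<open>Weak convergence of the traces in L2 of the curve. They are bounded, so a dense class of
  weights suffices. The weight n_j appears in the known limits and is removed by writing h as the
  sum of n_j (n_j h) and approximating the conjugates of n_j h by restrictions of test
  functions.\<close>

lemma trace_limit:
 assumes \<phi>: "\<And>m. test_fun UNIV (\<phi> m)" and u: "sqlim lebesgue \<phi> u" and G: "\<And>j. sqlim lebesgue (\<lambda>m. MG B j (\<phi> m)) (\<lambda>x. G x $ j)"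
  and t: "L2_Sigma \<gamma> L t" and link: "\<And>\<psi> j. test_fun UNIV \<psi> ==> ip Oi (\<lambda>x. G x $ j) \<psi> = ip Oi u (MG B j \<psi>)
   + \<i> * (LINT s:{0..L}|lborel. t (\<gamma> s) * cnj (\<psi> (\<gamma> s)) * of_real (n s $ j))"
  and h: "sqi lborel (\<lambda>s. indicator {0..L} s * h s)"
 shows "(\<lambda>m. LINT s:{0..L}|lborel. h s * \<phi> m (\<gamma> s)) \<longlonglongrightarrow> (LINT s:{0..L}|lborel. h s * t (\<gamma> s))"
proof -
 let ?i = "\<lambda>s. indicator {0..L} s :: complex"
 define D where "D m s = ?i s * (\<phi> m (\<gamma> s) - t (\<gamma> s))" for m s
 obtain K' where K': "\<And>m. sqn lborel (D m) \<le> K'" using trace_sqn_bounded[OF \<phi> u G t] unfolding D_def by blast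
 define K where "K = max 1 K'"
 have K: "\<And>m. sqn lborel (D m) \<le> K" "K > 0" using K' by (auto simp: K_def intro: max.coboundedI2)
 note ts = trace_sqi[OF test_trace_sqi[OF \<phi>]] trace_sqi[OF t]
 have Ds: "sqi lborel (D m)" for m unfolding D_def right_diff_distrib by (intro sqi_diff ts)
 have nb: "\<bar>n s $ j\<bar> \<le> 1" for s j using component_le_norm_cart[of "n s" j] norm_n[of s] by simp
 have nm: "(\<lambda>s. complex_of_real (n s $ j)) \<in> borel_measurable lborel" for j
  using borel_measurable_continuous_onI[of "\<lambda>s. complex_of_real (n s $ j)"] by (auto intro!: continuous_intros n_continuous)
 have nsq: "(\<Sum>j\<in>UNIV. complex_of_real (n s $ j) * of_real (n s $ j)) = 1" for s
 proof -
  have "(n s $ 1)\<^sup>2 + (n s $ 2)\<^sup>2 = 1" using norm_n[of s] by (simp add: norm_vec_def L2_set_def UNIV_2)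
  then show ?thesis unfolding UNIV_2 by (simp add: power2_eq_square flip: of_real_mult of_real_add)
 qed
 have Dn: "sqi lborel (\<lambda>s. of_real (n s $ j) * D m s)" "sqn lborel (\<lambda>s. of_real (n s $ j) * D m s) \<le> K" for j m
 proof -
  show "sqi lborel (\<lambda>s. of_real (n s $ j) * D m s)" by (rule sqi_bmult[OF Ds nm, of _ 1]) (simp add: nb)
  have "sqn lborel (\<lambda>s. of_real (n s $ j) * D m s) \<le> 1\<^sup>2 * sqn lborel (D m)" by (rule sqn_bmult_le[OF Ds nm]) (simp add: nb)
  then show "sqn lborel (\<lambda>s. of_real (n s $ j) * D m s) \<le> K" using K(1)[of m] by simp
 qed
 have hn: "sqi lborel (\<lambda>s. ?i s * cnj (of_real (n s $ j) * h s))" for j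
 proof -
  have "sqi lborel (\<lambda>s. of_real (n s $ j) * cnj (?i s * h s))" by (rule sqi_bmult[OF sqi_cnj[OF h] nm, of _ 1]) (simp add: nb)
  moreover have "of_real (n s $ j) * cnj (?i s * h s) = ?i s * cnj (of_real (n s $ j) * h s)" for s by (simp add: indicator_def)
  ultimately show ?thesis by (simp only:)
 qed
 have Dh: "(LINT s:{0..L}|lborel. h s * \<phi> m (\<gamma> s)) - (LINT s:{0..L}|lborel. h s * t (\<gamma> s)) = (\<integral>s. D m s * (?i s * h s) \<partial>lborel)" for m
 proof -
  have eq: "indicator {0..L} s *\<^sub>R (h s * w) = (?i s * w) * (?i s * h s)" for s w by (simp add: indicator_def)
  have w: "integrable lborel (\<lambda>s. (?i s * \<phi> m (\<gamma> s)) * (?i s * h s))" "integrable lborel (\<lambda>s. (?i s * t (\<gamma> s)) * (?i s * h s))"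
   by (intro sqi_mult_integrable ts h)+
  have "(LINT s:{0..L}|lborel. h s * \<phi> m (\<gamma> s)) - (LINT s:{0..L}|lborel. h s * t (\<gamma> s))
    = (\<integral>s. (?i s * \<phi> m (\<gamma> s)) * (?i s * h s) - (?i s * t (\<gamma> s)) * (?i s * h s) \<partial>lborel)"
   unfolding set_lebesgue_integral_def eq by (rule Bochner_Integration.integral_diff[OF w, symmetric])
  also have "\<dots> = (\<integral>s. D m s * (?i s * h s) \<partial>lborel)"
   by (intro Bochner_Integration.integral_cong refl) (simp add: D_def algebra_simps)
  finally show ?thesis .
 qed
 have "(\<lambda>m. \<integral>s. D m s * (?i s * h s) \<partial>lborel) \<longlonglongrightarrow> 0"
 proof (rule LIMSEQ_I)
  fix e :: real assume e: "e > 0"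
  \<comment> \<open>With these values each remainder is at most e/4 + e/8. The two components give
    3e/4, and e/4 is left for the convergent part.\<close>
  define \<theta> where "\<theta> = e / (2 * K)"
  have \<theta>: "\<theta> > 0" using e K(2) by (simp add: \<theta>_def)
  define \<eta> where "\<eta> = e * \<theta> / 4"
  have \<eta>: "\<eta> > 0" using e \<theta> by (simp add: \<eta>_def)
  have "\<forall>j. \<exists>\<psi>. test_fun UNIV \<psi> \<and> sqn lborel (\<lambda>s. ?i s * (\<psi> (\<gamma> s) - cnj (of_real (n s $ j) * h s))) < \<eta>"
   using trace_dense[OF hn \<eta>] by blast
  from choice[OF this] obtain \<psi> :: "2 => R2 => complex" where \<psi>: "\<And>j. test_fun UNIV (\<psi> j)"
   "\<And>j. sqn lborel (\<lambda>s. ?i s * (\<psi> j (\<gamma> s) - cnj (of_real (n s $ j) * h s))) < \<eta>" by blast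
  define r where "r j s = cnj (?i s * (\<psi> j (\<gamma> s) - cnj (of_real (n s $ j) * h s)))" for j s
  have rs: "sqi lborel (r j)" for j unfolding r_def right_diff_distrib[of "?i _"]
   by (intro sqi_cnj sqi_diff hn trace_sqi[OF test_trace_sqi[OF \<psi>(1)]])
  have rn: "sqn lborel (r j) < \<eta>" for j using \<psi>(2)[of j] unfolding r_def sqn_def complex_mod_cnj .
  have P: "integrable lborel (\<lambda>s. (of_real (n s $ j) * D m s) * (?i s * cnj (\<psi> j (\<gamma> s))))" for j m
  proof (rule sqi_mult_integrable[OF Dn(1)])
   have "sqi lborel (\<lambda>s. cnj (?i s * \<psi> j (\<gamma> s)))" by (rule sqi_cnj[OF trace_sqi[OF test_trace_sqi[OF \<psi>(1)]]])
   moreover have "cnj (?i s * \<psi> j (\<gamma> s)) = ?i s * cnj (\<psi> j (\<gamma> s))" for s by (simp add: indicator_def)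
   ultimately show "sqi lborel (\<lambda>s. ?i s * cnj (\<psi> j (\<gamma> s)))" by (simp only:)
  qed
  have R: "integrable lborel (\<lambda>s. (of_real (n s $ j) * D m s) * r j s)" for j m by (rule sqi_mult_integrable[OF Dn(1) rs])
  have Pl: "(\<integral>s. (of_real (n s $ j) * D m s) * (?i s * cnj (\<psi> j (\<gamma> s))) \<partial>lborel)
    = (LINT s:{0..L}|lborel. \<phi> m (\<gamma> s) * cnj (\<psi> j (\<gamma> s)) * of_real (n s $ j)) - (LINT s:{0..L}|lborel. t (\<gamma> s) * cnj (\<psi> j (\<gamma> s)) * of_real (n s $ j))" for j m
  proof -
   have c: "continuous_on UNIV (\<lambda>s. cnj (\<psi> j (\<gamma> s)) * of_real (n s $ j))"
    by (intro continuous_intros n_continuous test_fun_curve_continuous[OF \<psi>(1)])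
   show ?thesis unfolding set_lebesgue_integral_def mult.assoc[of _ "cnj (\<psi> j (\<gamma> _))"]
    by (subst Bochner_Integration.integral_diff[OF L2_Sigma_integrable[OF test_trace_sqi[OF \<phi>] c] L2_Sigma_integrable[OF t c], symmetric])
      (intro Bochner_Integration.integral_cong refl, simp add: D_def indicator_def algebra_simps)
  qed
  have dec: "(\<integral>s. D m s * (?i s * h s) \<partial>lborel)
    = (\<Sum>j\<in>UNIV. \<integral>s. (of_real (n s $ j) * D m s) * (?i s * cnj (\<psi> j (\<gamma> s))) \<partial>lborel) - (\<Sum>j\<in>UNIV. \<integral>s. (of_real (n s $ j) * D m s) * r j s \<partial>lborel)" for m
  proof -
   have "D m s * (?i s * h s) = (\<Sum>j\<in>UNIV. (of_real (n s $ j) * D m s) * (?i s * cnj (\<psi> j (\<gamma> s))) - (of_real (n s $ j) * D m s) * r j s)" for s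
   proof -
    have "(of_real (n s $ j) * D m s) * (?i s * cnj (\<psi> j (\<gamma> s))) - (of_real (n s $ j) * D m s) * r j s
      = (of_real (n s $ j) * of_real (n s $ j)) * (D m s * (?i s * h s))" for j
     by (simp add: r_def indicator_def algebra_simps)
    then show ?thesis using nsq[of s] by (simp add: sum_distrib_right[symmetric])
   qed
   then show ?thesis using P R by (simp add: Bochner_Integration.integral_sum Bochner_Integration.integral_diff sum_subtractf)
  qed
  have "(\<lambda>m. \<Sum>j\<in>UNIV. (LINT s:{0..L}|lborel. \<phi> m (\<gamma> s) * cnj (\<psi> j (\<gamma> s)) * of_real (n s $ j)) - (LINT s:{0..L}|lborel. t (\<gamma> s) * cnj (\<psi> j (\<gamma> s)) * of_real (n s $ j)))
    \<longlonglongrightarrow> (\<Sum>j\<in>(UNIV::2 set). 0)" by (intro tendsto_sum LIM_zero trace_limit_normal[OF \<phi> u G link \<psi>(1)])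
  then have "(\<lambda>m. \<Sum>j\<in>UNIV. \<integral>s. (of_real (n s $ j) * D m s) * (?i s * cnj (\<psi> j (\<gamma> s))) \<partial>lborel) \<longlonglongrightarrow> 0" unfolding Pl by simp
  from LIMSEQ_D[OF this, of "e / 2 - e / 4"] e obtain m0 where
   m0: "\<And>m. m \<ge> m0 ==> cmod (\<Sum>j\<in>UNIV. \<integral>s. (of_real (n s $ j) * D m s) * (?i s * cnj (\<psi> j (\<gamma> s))) \<partial>lborel) < e / 4" by auto
  have rb: "cmod (\<integral>s. (of_real (n s $ j) * D m s) * r j s \<partial>lborel) \<le> 3 * e / 8" for j m
  proof -
   have "cmod (\<integral>s. (of_real (n s $ j) * D m s) * r j s \<partial>lborel)
     \<le> \<theta> / 2 * sqn lborel (\<lambda>s. of_real (n s $ j) * D m s) + 1 / (2 * \<theta>) * sqn lborel (r j)"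
    by (rule sqn_mult_bound[OF Dn(1) rs \<theta>])
   also have "\<dots> \<le> \<theta> / 2 * K + 1 / (2 * \<theta>) * \<eta>"
    using \<theta> Dn(2) less_imp_le[OF rn] by (intro add_mono mult_left_mono) auto
   also have "\<theta> / 2 * K = e / 4" using K(2) by (simp add: \<theta>_def)
   also have "1 / (2 * \<theta>) * \<eta> = e / 8" using \<theta> by (simp add: \<eta>_def)
   finally show ?thesis by simp
  qed
  show "\<exists>m0. \<forall>m\<ge>m0. norm ((\<integral>s. D m s * (?i s * h s) \<partial>lborel) - 0) < e" unfolding diff_zero dec
  proof (intro exI allI impI)
   fix m assume m: "m \<ge> m0"
   let ?P = "\<Sum>j\<in>UNIV. \<integral>s. (of_real (n s $ j) * D m s) * (?i s * cnj (\<psi> j (\<gamma> s))) \<partial>lborel"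
   let ?R = "\<Sum>j\<in>UNIV. \<integral>s. (of_real (n s $ j) * D m s) * r j s \<partial>lborel"
   have "cmod ?R \<le> 3 * e / 8 + 3 * e / 8" unfolding UNIV_2
    using norm_triangle_mono[OF rb[of 1 m] rb[of 2 m]] by simp
   then show "cmod (?P - ?R) < e" using norm_triangle_ineq4[of ?P ?R] m0[OF m] by linarith
  qed
 qed
 then show ?thesis unfolding Dh[symmetric] by (rule LIM_zero_cancel)
qed

end

subsection \<open>The resolvent estimate\<close>

text \<open>Energy and potential term are real, so the imaginary part bounds |Im lam| s by |R|. In
  the real part the potential takes away half of the energy; solving for E doubles the other terms,
  which gives the constant 2 (|lam| + C1) + 1 in front of s.\<close>

lemma coercive_identity:
 fixes lam R :: complex and E s v C1 :: real
 assumes "Im lam \<noteq> 0" "0 \<le> E" "0 \<le> s" and v: "\<bar>v\<bar> \<le> E / 2 + C1 * s"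
  and eq: "of_real E + of_real v + R = lam * of_real s" and "0 \<le> C1"
 shows "E + s \<le> ((2 * (cmod lam + C1) + 1) / \<bar>Im lam\<bar> + 2) * cmod R"
proof -
 have "Im R = Im lam * s" using arg_cong[OF eq, of Im] by simp
 then have "\<bar>Im lam\<bar> * s \<le> cmod R" using abs_Im_le_cmod[of R] assms(3) by (simp add: abs_mult)
 then have s: "s \<le> cmod R / \<bar>Im lam\<bar>" using assms(1) by (simp add: pos_le_divide_eq mult.commute)
 have "E = Re lam * s - v - Re R" using arg_cong[OF eq, of Re] by simp
 moreover have "Re lam * s \<le> cmod lam * s" using assms(3) by (intro mult_right_mono complex_Re_le_cmod)
 moreover have "- Re R \<le> cmod R" using abs_Re_le_cmod[of R] by linarith
 ultimately have "E \<le> cmod lam * s + (E / 2 + C1 * s) + cmod R" using v by linarith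
 then have "E + s \<le> (2 * (cmod lam + C1) + 1) * s + 2 * cmod R" by (simp add: algebra_simps)
 also have "\<dots> \<le> (2 * (cmod lam + C1) + 1) * (cmod R / \<bar>Im lam\<bar>) + 2 * cmod R"
  using s assms(6) by (intro add_right_mono mult_left_mono) auto
 finally show ?thesis by (simp add: algebra_simps add_divide_distrib)
qed

text \<open>The gradient \<open>G\<close> is tied to \<open>u\<close> through a common approximating
  sequence. Differences of two such functions stay in the class, and no trace of the limit has to be
  named.\<close>

definition form_approx :: "real => (R2 => complex) => (R2 => complex^2) => (nat => R2 => complex) => bool" where
 "form_approx B u G \<phi> \<longleftrightarrow> (\<forall>m. test_fun UNIV (\<phi> m)) \<and> sqlim lebesgue \<phi> u
  \<and> (\<forall>j. sqlim lebesgue (\<lambda>m. MG B j (\<phi> m)) (\<lambda>x. G x $ j))"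

definition grad_sqn :: "(R2 => complex^2) => real" where
 "grad_sqn G = (\<Sum>j\<in>UNIV. sqn lebesgue (\<lambda>x. G x $ j))"

abbreviation dform :: "real => (R2 => complex^2) => (R2 => complex) => complex" where
 "dform B G \<psi> \<equiv> \<Sum>j\<in>UNIV. ip UNIV (\<lambda>x. G x $ j) (MG B j \<psi>)"

lemma grad_sqn_nonneg: "0 \<le> grad_sqn G" unfolding grad_sqn_def by (intro sum_nonneg sqn_nonneg)

lemma MG_cmult: "smooth_fun \<phi> ==> MG B j (\<lambda>x. c * \<phi> x) = (\<lambda>x. c * MG B j \<phi> x)"
 by (rule ext) (simp add: MG_def pd_cmult smooth_fun_differentiable algebra_simps)

lemma energy_cmult: "smooth_fun \<phi> ==> energy B (\<lambda>x. c * \<phi> x) = (cmod c)\<^sup>2 * energy B \<phi>"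
 by (simp add: energy_def MG_cmult sqn_cmult sum_distrib_left)

lemma ip_sqlim:
 assumes "sqi lebesgue v" "sqlim lebesgue \<omega> w"
 shows "(\<lambda>k. ip UNIV v (\<omega> k)) \<longlonglongrightarrow> ip UNIV v w"
 using sqlim_mult[OF sqlim_const[OF assms(1)] sqlim_cnj[OF assms(2)]] unfolding ip_UNIV .

lemma ip_self: "sqi lebesgue u ==> ip UNIV u u = of_real (sqn lebesgue u)"
 unfolding ip_UNIV by (rule integral_cmod_sq)

lemma ip_bound: "sqi lebesgue f ==> sqi lebesgue u ==> t > 0 ==> cmod (ip UNIV f u) \<le> t / 2 * sqn lebesgue f + 1 / (2 * t) * sqn lebesgue u"
 using sqn_mult_bound[of lebesgue f "\<lambda>x. cnj (u x)" t] sqi_cnj[of lebesgue u] unfolding ip_UNIV by (simp add: sqn_def)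

lemma form_approx_limits:
 assumes "form_approx B u G \<phi>"
 shows "(\<lambda>k. sqn lebesgue (\<phi> k) + energy B (\<phi> k)) \<longlonglongrightarrow> sqn lebesgue u + grad_sqn G"
  and "(\<lambda>k. dform B G (\<phi> k)) \<longlonglongrightarrow> of_real (grad_sqn G)"
  and "(\<lambda>k. ip UNIV u (\<phi> k)) \<longlonglongrightarrow> of_real (sqn lebesgue u)"
proof -
 have a: "sqlim lebesgue \<phi> u" "\<And>j. sqlim lebesgue (\<lambda>m. MG B j (\<phi> m)) (\<lambda>x. G x $ j)"
  using assms by (auto simp: form_approx_def)
 show "(\<lambda>k. sqn lebesgue (\<phi> k) + energy B (\<phi> k)) \<longlonglongrightarrow> sqn lebesgue u + grad_sqn G"
  unfolding energy_def grad_sqn_def by (intro tendsto_add tendsto_sum sqlim_sqn a)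
 have "(\<lambda>k. dform B G (\<phi> k)) \<longlonglongrightarrow> (\<Sum>j\<in>UNIV. ip UNIV (\<lambda>x. G x $ j) (\<lambda>x. G x $ j))"
  by (intro tendsto_sum ip_sqlim a sqlimD(2)[OF a(2)])
 then show "(\<lambda>k. dform B G (\<phi> k)) \<longlonglongrightarrow> of_real (grad_sqn G)"
  unfolding ip_self[OF sqlimD(2)[OF a(2)]] grad_sqn_def by simp
 show "(\<lambda>k. ip UNIV u (\<phi> k)) \<longlonglongrightarrow> of_real (sqn lebesgue u)"
  using ip_sqlim[OF sqlimD(2)[OF a(1)] a(1)] unfolding ip_self[OF sqlimD(2)[OF a(1)]] .
qed

lemma form_approx_diff:
 assumes "form_approx B u G \<phi>" "form_approx B v H \<psi>"
 shows "form_approx B (\<lambda>x. u x - v x) (\<lambda>x. G x - H x) (\<lambda>k x. \<phi> k x - \<psi> k x)"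
proof -
 have t: "test_fun UNIV (\<phi> k)" "test_fun UNIV (\<psi> k)" for k using assms by (auto simp: form_approx_def)
 have e: "(\<lambda>x. \<phi> k x - \<psi> k x) = (\<lambda>x. \<phi> k x + (- 1) * \<psi> k x)" for k by simp
 have m: "MG B j (\<lambda>x. \<phi> k x - \<psi> k x) = (\<lambda>x. MG B j (\<phi> k) x - MG B j (\<psi> k) x)" for j k
  unfolding e MG_add[OF test_fun_smooth[OF t(1)] test_fun_smooth[OF test_fun_cmult[OF t(2)]]] MG_cmult[OF test_fun_smooth[OF t(2)]] by simp
 show ?thesis unfolding form_approx_def m
 proof (intro conjI allI)
  show "test_fun UNIV (\<lambda>x. \<phi> k x - \<psi> k x)" for k unfolding e by (intro test_fun_add test_fun_cmult t)
  show "sqlim lebesgue (\<lambda>k x. \<phi> k x - \<psi> k x) (\<lambda>x. u x - v x)"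
   using assms by (intro sqlim_diff) (auto simp: form_approx_def)
  show "sqlim lebesgue (\<lambda>k x. MG B j (\<phi> k) x - MG B j (\<psi> k) x) (\<lambda>x. (G x - H x) $ j)" for j
   unfolding vector_minus_component using assms by (intro sqlim_diff) (auto simp: form_approx_def)
 qed
qed

locale tube_setting = tube_domain \<gamma> n T L M \<beta> Oi + tube_potential \<gamma> n T L M \<beta> \<nu> V Mv
 for \<gamma> n T :: "real => R2" and L M \<beta> :: real and Oi :: "R2 set" and \<nu> :: "R2 => R2" and V :: "R2 => real" and Mv :: real
begin

abbreviation bform :: "(R2 => complex) => (R2 => complex) => complex" where
 "bform \<phi> \<psi> \<equiv> \<integral>s. indicator {0..<L} s *\<^sub>R (of_real (al s) * (\<phi> (\<gamma> s) * cnj (\<psi> (\<gamma> s)))) \<partial>lborel"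

definition pot :: "real => (R2 => complex) => real" where
 "pot \<epsilon> u = Re (ip UNIV (\<lambda>x. of_real (W \<epsilon> x) * u x) u)"

lemma W_lebesgue:
 assumes "0 < \<epsilon>" "\<epsilon> < \<beta>"
 shows "(\<lambda>x. complex_of_real (W \<epsilon> x)) \<in> borel_measurable lebesgue" "AE x in lebesgue. cmod (of_real (W \<epsilon> x)) \<le> Mv * \<beta> / \<epsilon>"
proof -
 have "(\<lambda>x. complex_of_real (W \<epsilon> x)) \<in> borel_measurable borel" using W_borel[OF assms] by measurable
 then show "(\<lambda>x. complex_of_real (W \<epsilon> x)) \<in> borel_measurable lebesgue" by (simp add: measurable_completion)
 show "AE x in lebesgue. cmod (of_real (W \<epsilon> x)) \<le> Mv * \<beta> / \<epsilon>" using AE_completion[OF W_bound[OF assms]] by simp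
qed

lemma W_sqi: "0 < \<epsilon> ==> \<epsilon> < \<beta> ==> sqi lebesgue u ==> sqi lebesgue (\<lambda>x. of_real (W \<epsilon> x) * u x)"
 by (rule sqi_bmult[OF _ W_lebesgue])

lemma ip_pot: "ip UNIV (\<lambda>x. of_real (W \<epsilon> x) * u x) u = of_real (pot \<epsilon> u)"
proof -
 have "(\<lambda>x. of_real (W \<epsilon> x) * u x * cnj (u x)) = (\<lambda>x. complex_of_real (W \<epsilon> x * (cmod (u x))\<^sup>2))"
  by (rule ext) (simp add: mult.assoc flip: complex_norm_square)
 then have "ip UNIV (\<lambda>x. of_real (W \<epsilon> x) * u x) u = of_real (\<integral>x. W \<epsilon> x * (cmod (u x))\<^sup>2 \<partial>lebesgue)"
  unfolding ip_UNIV by (simp only: integral_complex_of_real)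
 then show ?thesis unfolding pot_def by simp
qed

text \<open>Relative bound 1/2 is what \<open>coercive_identity\<close> can absorb. For fixed
  \<epsilon> the potential is a bounded function, so the estimate passes from test functions to
  their limits.\<close>

lemma pot_bound:
 "\<exists>C\<ge>0. \<forall>\<epsilon> u G \<phi>. 0 < \<epsilon> --> \<epsilon> \<le> e0 --> form_approx B u G \<phi> --> \<bar>pot \<epsilon> u\<bar> \<le> grad_sqn G / 2 + C * sqn lebesgue u"
proof -
 obtain C where C: "C \<ge> 0" "\<And>\<epsilon> \<phi>. 0 < \<epsilon> ==> \<epsilon> \<le> e0 ==> test_fun UNIV \<phi> ==>
  (\<integral>x. \<bar>W \<epsilon> x\<bar> * (cmod (\<phi> x))\<^sup>2 \<partial>lebesgue) \<le> 1 / 2 * energy B \<phi> + C * sqn lebesgue \<phi>"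
  using potential_bound[of "1/2" B] by auto
 show ?thesis
 proof (intro exI[of _ C] conjI allI impI C(1))
  fix \<epsilon> u G \<phi> assume \<epsilon>: "0 < \<epsilon>" "\<epsilon> \<le> e0" and a: "form_approx B u G \<phi>"
  note e = le_e0(2)[OF \<epsilon>(2)]
  have l: "sqlim lebesgue \<phi> u" "\<And>j. sqlim lebesgue (\<lambda>m. MG B j (\<phi> m)) (\<lambda>x. G x $ j)" and t: "\<And>k. test_fun UNIV (\<phi> k)"
   using a by (auto simp: form_approx_def)
  have "(\<lambda>k. cmod (ip UNIV (\<lambda>x. of_real (W \<epsilon> x) * \<phi> k x) (\<phi> k))) \<longlonglongrightarrow> cmod (ip UNIV (\<lambda>x. of_real (W \<epsilon> x) * u x) u)"
   unfolding ip_UNIV by (intro tendsto_norm sqlim_mult sqlim_cnj l(1) sqlim_bmult[OF l(1) W_lebesgue[OF \<epsilon>(1) e]])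
  moreover have "(\<lambda>k. 1 / 2 * energy B (\<phi> k) + C * sqn lebesgue (\<phi> k)) \<longlonglongrightarrow> 1 / 2 * grad_sqn G + C * sqn lebesgue u"
   unfolding energy_def grad_sqn_def by (intro tendsto_intros sqlim_sqn l)
  moreover have "\<exists>k0. \<forall>k\<ge>k0. cmod (ip UNIV (\<lambda>x. of_real (W \<epsilon> x) * \<phi> k x) (\<phi> k)) \<le> 1 / 2 * energy B (\<phi> k) + C * sqn lebesgue (\<phi> k)"
  proof (intro exI allI impI)
   fix k
   have "cmod (ip UNIV (\<lambda>x. of_real (W \<epsilon> x) * \<phi> k x) (\<phi> k)) \<le> (\<integral>x. cmod (of_real (W \<epsilon> x) * \<phi> k x * cnj (\<phi> k x)) \<partial>lebesgue)"
    unfolding ip_UNIV by (rule Bochner_Integration.integral_norm_bound)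
   also have "\<dots> = (\<integral>x. \<bar>W \<epsilon> x\<bar> * (cmod (\<phi> k x))\<^sup>2 \<partial>lebesgue)" by (simp add: norm_mult power2_eq_square mult.assoc)
   also note C(2)[OF \<epsilon> t]
   finally show "cmod (ip UNIV (\<lambda>x. of_real (W \<epsilon> x) * \<phi> k x) (\<phi> k)) \<le> 1 / 2 * energy B (\<phi> k) + C * sqn lebesgue (\<phi> k)" .
  qed
  ultimately have "cmod (ip UNIV (\<lambda>x. of_real (W \<epsilon> x) * u x) u) \<le> 1 / 2 * grad_sqn G + C * sqn lebesgue u"
   by (rule LIMSEQ_le)
  then show "\<bar>pot \<epsilon> u\<bar> \<le> grad_sqn G / 2 + C * sqn lebesgue u" unfolding ip_pot by simp
 qed
qed

text \<open>For fixed \<epsilon> the potential term is in L2; testing the weak magnetic gradient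
  with \<open>MG B j \<psi>\<close> turns the weak magnetic Laplacian into the energy form.\<close>

lemma approx_form:
 assumes A: "resolvent_eq_H B (W \<epsilon>) lam f u" and \<epsilon>: "0 < \<epsilon>" "\<epsilon> < \<beta>" and f: "sqi lebesgue f"
 shows "\<exists>G \<phi>. form_approx B u G \<phi> \<and> (\<forall>\<psi>. test_fun UNIV \<psi> -->
  dform B G \<psi> + ip UNIV (\<lambda>x. of_real (W \<epsilon> x) * u x) \<psi> = ip UNIV f \<psi> + lam * ip UNIV u \<psi>)"
proof -
 obtain G where u: "L2 UNIV u" and w: "weak_mgrad B UNIV u G" and G: "L2v UNIV G"
  using A by (auto simp: resolvent_eq_H_def H1A_def)
 have us: "sqi lebesgue u" and Gs: "sqi lebesgue (\<lambda>x. G x $ j)" for j using u G by (auto simp: L2_UNIV_sqi L2v_def)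
 obtain \<phi> where \<phi>: "\<And>k. test_fun UNIV (\<phi> k)" "sqlim lebesgue \<phi> u" "\<And>j. sqlim lebesgue (\<lambda>k. MG B j (\<phi> k)) (\<lambda>x. G x $ j)"
  using H1A_dense[OF us Gs w] by blast
 have ml: "weak_mlap B UNIV u (\<lambda>x. f x + lam * u x - of_real (W \<epsilon> x) * u x)" using A by (simp add: resolvent_eq_H_def)
 show ?thesis
 proof (intro exI[of _ G] exI[of _ \<phi>] conjI allI impI)
  show "form_approx B u G \<phi>" using \<phi> by (simp add: form_approx_def)
  fix \<psi> assume \<psi>: "test_fun UNIV \<psi>"
  have s: "sqU UNIV f" "sqU UNIV (\<lambda>x. lam * u x)" "sqU UNIV (\<lambda>x. of_real (W \<epsilon> x) * u x)" "sqU UNIV u"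
   "sqU UNIV (\<lambda>x. f x + lam * u x)" using f us W_sqi[OF \<epsilon> us] by (simp_all add: sqi_cmult sqi_add)
  have "ip UNIV f \<psi> + lam * ip UNIV u \<psi> - ip UNIV (\<lambda>x. of_real (W \<epsilon> x) * u x) \<psi> = ip UNIV u (mlap B \<psi>)"
   using ml \<psi> unfolding weak_mlap_def ip_diff_left[OF s(5,3) \<psi>] ip_add_left[OF s(1,2) \<psi>] ip_cmult_left
   by (simp add: ip_diff_left[OF s(5,3)] ip_add_left[OF s(1,2)] ip_cmult_left)
  also have "\<dots> = (\<Sum>j\<in>UNIV. ip UNIV u (MG B j (MG B j \<psi>)))"
   unfolding mlap_def by (rule ip_sum_right[OF s(4) test_fun_MG[OF test_fun_MG[OF \<psi>]]])
  also have "\<dots> = dform B G \<psi>" using w test_fun_MG[OF \<psi>] by (simp add: weak_mgrad_def)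
  finally show "dform B G \<psi> + ip UNIV (\<lambda>x. of_real (W \<epsilon> x) * u x) \<psi> = ip UNIV f \<psi> + lam * ip UNIV u \<psi>"
   by (simp add: algebra_simps)
 qed
qed

text \<open>The jump term of the glued identity is the limit of the boundary forms of the
  approximating test functions. This is the only place where the trace of \<open>u\<close> enters;
  afterwards the boundary form is known as a limit.\<close>

lemma limit_form:
 assumes K: "open K" "bounded K" "closure Oi \<subseteq> K" and f: "sqi lebesgue f"
  and A: "resolvent_eq_A B Oi K \<gamma> L \<nu> (alpha_of \<nu> \<beta> V) lam f u"
 shows "\<exists>G \<phi>. form_approx B u G \<phi> \<and> (\<forall>\<psi>. test_fun UNIV \<psi> --> (\<lambda>m. bform (\<phi> m) \<psi>)
  \<longlonglongrightarrow> ip UNIV f \<psi> + lam * ip UNIV u \<psi> - dform B G \<psi>)"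
proof -
 have alb: "(\<lambda>s. alpha_of \<nu> \<beta> V (\<gamma> s)) \<in> borel_measurable borel" using al_borel unfolding al_def .
 from glue[OF K f \<nu> alb A, folded al_def] obtain G t where u: "sqi lebesgue u" and Gs: "\<And>j. sqi lebesgue (\<lambda>x. G x $ j)"
  and w: "weak_mgrad B UNIV u G" and t: "L2_Sigma \<gamma> L t"
  and link: "\<And>\<psi> j. test_fun UNIV \<psi> ==> ip Oi (\<lambda>x. G x $ j) \<psi> = ip Oi u (MG B j \<psi>)
   + \<i> * (LINT s:{0..L}|lborel. t (\<gamma> s) * cnj (\<psi> (\<gamma> s)) * of_real (n s $ j))"
  and form: "\<And>\<psi>. test_fun UNIV \<psi> ==> dform B G \<psi>
   + (LINT s:{0..L}|lborel. of_real (al s) * (t (\<gamma> s) * cnj (\<psi> (\<gamma> s)))) = ip UNIV (\<lambda>x. f x + lam * u x) \<psi>" by blast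
 obtain \<phi> where \<phi>: "\<And>k. test_fun UNIV (\<phi> k)" "sqlim lebesgue \<phi> u" "\<And>j. sqlim lebesgue (\<lambda>k. MG B j (\<phi> k)) (\<lambda>x. G x $ j)"
  using H1A_dense[OF u Gs w] by blast
 show ?thesis
 proof (intro exI[of _ G] exI[of _ \<phi>] conjI allI impI)
  show "form_approx B u G \<phi>" using \<phi> by (simp add: form_approx_def)
  fix \<psi> assume \<psi>: "test_fun UNIV \<psi>"
  have am: "(\<lambda>s. complex_of_real (al s)) \<in> borel_measurable lborel" using al_borel by measurable
  have ab: "AE s in lborel. cmod (indicator {0..<L} s * complex_of_real (al s)) \<le> 2 * Mv * \<beta>"
   using al_bound by eventually_elim (use Mv_pos \<beta>_pos in \<open>auto simp: indicator_def\<close>)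
  \<comment> \<open>The half-open indicator is built in because the bound for \<open>al\<close>
    holds almost everywhere on one period.\<close>
  define h where "h s = (indicator {0..<L} s * complex_of_real (al s)) * cnj (\<psi> (\<gamma> s))" for s
  have h: "sqi lborel (\<lambda>s. indicator {0..L} s * h s)"
  proof -
   have "sqi lborel (\<lambda>s. (indicator {0..<L} s * complex_of_real (al s)) * cnj (indicator {0..L} s * \<psi> (\<gamma> s)))"
    by (rule sqi_bmult[OF sqi_cnj[OF trace_sqi[OF test_trace_sqi[OF \<psi>]]] _ ab])
      (intro borel_measurable_times[OF _ am] borel_measurable_indicator, simp)
   moreover have "(indicator {0..<L} s * complex_of_real (al s)) * cnj (indicator {0..L} s * \<psi> (\<gamma> s)) = indicator {0..L} s * h s" for s
    by (simp add: h_def indicator_def)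
   ultimately show ?thesis by (simp only:)
  qed
  have hI: "(LINT s:{0..L}|lborel. h s * w s) = (\<integral>s. indicator {0..<L} s *\<^sub>R (of_real (al s) * (w s * cnj (\<psi> (\<gamma> s)))) \<partial>lborel)" for w
   unfolding set_lebesgue_integral_def h_def by (intro Bochner_Integration.integral_cong refl) (simp add: indicator_def)
  have "(LINT s:{0..L}|lborel. h s * t (\<gamma> s)) = (LINT s:{0..L}|lborel. of_real (al s) * (t (\<gamma> s) * cnj (\<psi> (\<gamma> s))))"
  proof (rule set_integral_cong_AE)
   show "AE s in lborel. s \<in> {0..L} --> h s * t (\<gamma> s) = of_real (al s) * (t (\<gamma> s) * cnj (\<psi> (\<gamma> s)))"
    using AE_lborel_singleton[of L] by eventually_elim (auto simp: h_def indicator_def)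
   have c: "(\<lambda>s. cnj (\<psi> (\<gamma> s))) \<in> borel_measurable borel"
    by (intro borel_measurable_continuous_onI continuous_intros
      test_fun_curve_continuous[OF \<psi>])
   have am': "(\<lambda>s. complex_of_real (al s)) \<in> borel_measurable borel" and tm: "(\<lambda>s. t (\<gamma> s)) \<in> borel_measurable borel"
    using am t by (simp_all add: L2_Sigma_def)
   show "(\<lambda>s. h s * t (\<gamma> s)) \<in> borel_measurable borel" unfolding h_def
    by (intro borel_measurable_times borel_measurable_indicator am' c tm) auto
   show "(\<lambda>s. of_real (al s) * (t (\<gamma> s) * cnj (\<psi> (\<gamma> s)))) \<in> borel_measurable borel"
    by (intro borel_measurable_times am' c tm)
  qed simp
  also have "\<dots> = ip UNIV f \<psi> + lam * ip UNIV u \<psi> - dform B G \<psi>"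
  proof -
   have s: "sqU UNIV f" "sqU UNIV (\<lambda>x. lam * u x)" using f u by (simp_all add: sqi_cmult)
   show ?thesis using form[OF \<psi>] unfolding ip_add_left[OF s \<psi>] ip_cmult_left by (simp add: algebra_simps)
  qed
  finally have "(LINT s:{0..L}|lborel. h s * t (\<gamma> s)) = ip UNIV f \<psi> + lam * ip UNIV u \<psi> - dform B G \<psi>" .
  with trace_limit[OF \<phi> t link h, unfolded hI]
  show "(\<lambda>m. bform (\<phi> m) \<psi>)
   \<longlonglongrightarrow> ip UNIV f \<psi> + lam * ip UNIV u \<psi> - dform B G \<psi>" unfolding hI by simp
 qed
qed

text \<open>Replacing \<phi> by sqrt \<theta> times \<phi> and \<psi> by \<psi> / sqrt \<theta>
  leaves both forms unchanged and weights the two norms. The free \<theta> makes absorption possible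
  when \<psi> approximates the unknown difference.\<close>

lemma defect_bound:
 "\<exists>C>0. \<forall>\<epsilon> u G \<phi> f \<psi> \<theta>. 0 < \<epsilon> --> \<epsilon> \<le> e0 --> 0 < \<theta> --> form_approx B u G \<phi> --> test_fun UNIV \<psi> -->
  (\<lambda>m. bform (\<phi> m) \<psi>) \<longlonglongrightarrow> f -->
  cmod (ip UNIV (\<lambda>x. of_real (W \<epsilon> x) * u x) \<psi> - f)
   \<le> C * sqrt \<epsilon> * (\<theta> * (sqn lebesgue u + grad_sqn G) + (sqn lebesgue \<psi> + energy B \<psi>) / \<theta>)"
proof -
 let ?N = "\<lambda>\<phi>. sqn lebesgue \<phi> + energy B \<phi>"
 obtain C where C: "C > 0" "\<And>\<epsilon> \<phi> \<psi>. 0 < \<epsilon> ==> \<epsilon> \<le> e0 ==> test_fun UNIV \<phi> ==> test_fun UNIV \<psi> ==>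
  cmod ((\<integral>x. of_real (W \<epsilon> x) * (\<phi> x * cnj (\<psi> x)) \<partial>lebesgue) - bform \<phi> \<psi>) \<le> C * sqrt \<epsilon> * (?N \<phi> + ?N \<psi>)"
  using potential_convergence[of B] by blast
 show ?thesis
 proof (intro exI[of _ C] conjI allI impI C(1))
  fix \<epsilon> \<theta> :: real and u G \<phi> \<psi> and f :: complex
  assume \<epsilon>: "0 < \<epsilon>" "\<epsilon> \<le> e0" and \<theta>: "0 < \<theta>" and a: "form_approx B u G \<phi>" and \<psi>: "test_fun UNIV \<psi>"
   and f: "(\<lambda>m. bform (\<phi> m) \<psi>) \<longlonglongrightarrow> f"
  note e = le_e0(2)[OF \<epsilon>(2)]
  have l: "sqlim lebesgue \<phi> u" and t: "\<And>k. test_fun UNIV (\<phi> k)" using a by (auto simp: form_approx_def)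
  define \<tau> where "\<tau> = complex_of_real (sqrt \<theta>)"
  have \<tau>: "\<tau> \<noteq> 0" "cnj (inverse \<tau>) = inverse \<tau>" "(cmod \<tau>)\<^sup>2 = \<theta>" "(cmod (inverse \<tau>))\<^sup>2 = inverse \<theta>"
   using \<theta> by (simp_all add: \<tau>_def norm_inverse power_inverse)
  have bd: "cmod (ip UNIV (\<lambda>x. of_real (W \<epsilon> x) * \<phi> m x) \<psi> - bform (\<phi> m) \<psi>) \<le> C * sqrt \<epsilon> * (\<theta> * ?N (\<phi> m) + ?N \<psi> / \<theta>)" for m
  proof -
   have c: "(\<tau> * a) * cnj (inverse \<tau> * b) = a * cnj b" for a b using \<tau>(1,2) by simp
   have "cmod ((\<integral>x. of_real (W \<epsilon> x) * (\<phi> m x * cnj (\<psi> x)) \<partial>lebesgue) - bform (\<phi> m) \<psi>)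
     \<le> C * sqrt \<epsilon> * (?N (\<lambda>x. \<tau> * \<phi> m x) + ?N (\<lambda>x. inverse \<tau> * \<psi> x))"
    using C(2)[OF \<epsilon> test_fun_cmult[OF t] test_fun_cmult[OF \<psi>], of \<tau> m "inverse \<tau>"] unfolding c .
   also have "?N (\<lambda>x. \<tau> * \<phi> m x) = \<theta> * ?N (\<phi> m)"
    unfolding sqn_cmult energy_cmult[OF test_fun_smooth[OF t]] \<tau> by (simp add: distrib_left)
   also have "?N (\<lambda>x. inverse \<tau> * \<psi> x) = ?N \<psi> / \<theta>"
    unfolding sqn_cmult energy_cmult[OF test_fun_smooth[OF \<psi>]] \<tau> by (simp add: divide_inverse algebra_simps)
   finally show ?thesis by (simp add: ip_UNIV mult.assoc)
  qed
  have "(\<lambda>m. cmod (ip UNIV (\<lambda>x. of_real (W \<epsilon> x) * \<phi> m x) \<psi> - bform (\<phi> m) \<psi>)) \<longlonglongrightarrow> cmod (ip UNIV (\<lambda>x. of_real (W \<epsilon> x) * u x) \<psi> - f)"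
  proof (intro tendsto_norm tendsto_diff f)
   show "(\<lambda>m. ip UNIV (\<lambda>x. of_real (W \<epsilon> x) * \<phi> m x) \<psi>) \<longlonglongrightarrow> ip UNIV (\<lambda>x. of_real (W \<epsilon> x) * u x) \<psi>"
    unfolding ip_UNIV by (intro sqlim_mult1 sqlim_bmult[OF l W_lebesgue[OF \<epsilon>(1) e]] sqi_cnj test_fun_sqi[OF \<psi>])
  qed
  moreover have "(\<lambda>m. C * sqrt \<epsilon> * (\<theta> * ?N (\<phi> m) + ?N \<psi> / \<theta>)) \<longlonglongrightarrow> C * sqrt \<epsilon> * (\<theta> * (sqn lebesgue u + grad_sqn G) + ?N \<psi> / \<theta>)"
   by (intro tendsto_intros form_approx_limits(1)[OF a])
  ultimately show "cmod (ip UNIV (\<lambda>x. of_real (W \<epsilon> x) * u x) \<psi> - f) \<le> C * sqrt \<epsilon> * (\<theta> * (sqn lebesgue u + grad_sqn G) + ?N \<psi> / \<theta>)"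
   by (rule LIMSEQ_le) (use bd in blast)
 qed
qed

lemma resolvent_estimate:
 assumes K: "open K" "bounded K" "closure Oi \<subseteq> K" and lam: "Im lam \<noteq> 0"
 shows "\<exists>c>0. \<forall>\<epsilon> f u\<epsilon> u. 0 < \<epsilon> --> \<epsilon> < \<beta> --> L2 UNIV f
   --> resolvent_eq_H B (W \<epsilon>) lam f u\<epsilon> --> resolvent_eq_A B Oi K \<gamma> L \<nu> (alpha_of \<nu> \<beta> V) lam f u
   --> norm2 (\<lambda>x. u\<epsilon> x - u x) \<le> c * sqrt \<epsilon> * norm2 f"
proof -
 obtain C1 where C1: "C1 \<ge> 0" "\<And>\<epsilon> u G \<phi>. 0 < \<epsilon> ==> \<epsilon> \<le> e0 ==> form_approx B u G \<phi> ==> \<bar>pot \<epsilon> u\<bar> \<le> grad_sqn G / 2 + C1 * sqn lebesgue u"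
  using pot_bound[of B] by blast
 obtain C where C: "C > 0" "\<And>\<epsilon> u G \<phi> f \<psi> \<theta>. 0 < \<epsilon> ==> \<epsilon> \<le> e0 ==> 0 < \<theta> ==> form_approx B u G \<phi> ==> test_fun UNIV \<psi> ==>
  (\<lambda>m. bform (\<phi> m) \<psi>) \<longlonglongrightarrow> f ==>
  cmod (ip UNIV (\<lambda>x. of_real (W \<epsilon> x) * u x) \<psi> - f)
   \<le> C * sqrt \<epsilon> * (\<theta> * (sqn lebesgue u + grad_sqn G) + (sqn lebesgue \<psi> + energy B \<psi>) / \<theta>)"
  using defect_bound[of B] by blast
 define D where "D = (2 * (cmod lam + C1) + 1) / \<bar>Im lam\<bar> + 2"
 have D: "D > 0" using C1(1) lam by (auto simp: D_def intro!: add_nonneg_pos divide_nonneg_nonneg)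
 note co = coercive_identity[OF lam grad_sqn_nonneg sqn_nonneg _ _ C1(1), folded D_def]
 have ipW: "(\<lambda>k. ip UNIV (\<lambda>x. of_real (W \<epsilon> x) * u x) (\<phi> k)) \<longlonglongrightarrow> of_real (pot \<epsilon> u)"
  if "0 < \<epsilon>" "\<epsilon> < \<beta>" "form_approx B u G \<phi>" for \<epsilon> u G \<phi>
  using that unfolding ip_pot[symmetric] by (intro ip_sqlim W_sqi) (auto simp: form_approx_def dest: sqlimD)
 \<comment> \<open>The a priori bound of \<open>u\<close> exchanges the boundary form for the
   potential \<open>W\<close> at one small fixed width, for which the relative bound is known; the
   exchange costs a small multiple of the same norm.\<close>
 have u_bound: "sqn lebesgue u + grad_sqn G \<le> 2 * D\<^sup>2 * sqn lebesgue f"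
  if f: "sqi lebesgue f" and a: "form_approx B u G \<phi>" and lim: "\<And>\<psi>. test_fun UNIV \<psi> ==> (\<lambda>m. bform (\<phi> m) \<psi>)
   \<longlonglongrightarrow> ip UNIV f \<psi> + lam * ip UNIV u \<psi> - dform B G \<psi>" for f u G \<phi>
 proof -
  \<comment> \<open>This makes D 2 C sqrt \<epsilon> at most 1/4. The Young weight 2 D below
    produces another 1/4, and together they leave half of the norm on the left.\<close>
  define \<epsilon> where "\<epsilon> = min e0 ((1 / (8 * D * C))\<^sup>2)"
  have \<epsilon>: "0 < \<epsilon>" "\<epsilon> \<le> e0" using e0(1) C(1) D by (auto simp: \<epsilon>_def)
  have "sqrt \<epsilon> \<le> sqrt ((1 / (8 * D * C))\<^sup>2)" unfolding \<epsilon>_def by (intro real_sqrt_le_mono) simp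
  then have "sqrt \<epsilon> \<le> 1 / (8 * D * C)" using C(1) D by simp
  then have small: "D * (2 * C * sqrt \<epsilon>) \<le> 1 / 4" using C(1) D by (simp add: field_simps)
  have t: "\<And>k. test_fun UNIV (\<phi> k)" and l: "sqlim lebesgue \<phi> u" using a by (auto simp: form_approx_def)
  let ?N = "sqn lebesgue u + grad_sqn G"
  define r where "r = of_real (pot \<epsilon> u) - (ip UNIV f u + lam * of_real (sqn lebesgue u) - of_real (grad_sqn G))"
  have "cmod r \<le> C * sqrt \<epsilon> * (1 * ?N + ?N / 1)"
  proof (rule LIMSEQ_le)
   show "(\<lambda>k. cmod (ip UNIV (\<lambda>x. of_real (W \<epsilon> x) * u x) (\<phi> k)
     - (ip UNIV f (\<phi> k) + lam * ip UNIV u (\<phi> k) - dform B G (\<phi> k)))) \<longlonglongrightarrow> cmod r"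
    unfolding r_def by (intro tendsto_norm tendsto_diff tendsto_add tendsto_mult_left ipW[OF \<epsilon>(1) le_e0(2)[OF \<epsilon>(2)] a]
      ip_sqlim[OF f l] form_approx_limits[OF a])
   show "(\<lambda>k. C * sqrt \<epsilon> * (1 * ?N + (sqn lebesgue (\<phi> k) + energy B (\<phi> k)) / 1)) \<longlonglongrightarrow> C * sqrt \<epsilon> * (1 * ?N + ?N / 1)"
    by (intro tendsto_mult_left tendsto_add tendsto_const tendsto_divide form_approx_limits(1)[OF a]) simp
  qed (use C(2)[OF \<epsilon> zero_less_one a t lim[OF t]] in blast)
  then have rb: "cmod r \<le> 2 * C * sqrt \<epsilon> * ?N" by (simp add: algebra_simps)
  have us: "sqi lebesgue u" by (rule sqlimD(2)[OF l])
  have "grad_sqn G + sqn lebesgue u \<le> D * cmod (- r - ip UNIV f u)" by (rule co[OF C1(2)[OF \<epsilon> a]]) (simp add: r_def)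
  also have "\<dots> \<le> D * (2 * C * sqrt \<epsilon> * ?N + (2 * D / 2 * sqn lebesgue f + 1 / (2 * (2 * D)) * sqn lebesgue u))"
  proof (rule mult_left_mono)
   have "cmod (ip UNIV f u) \<le> 2 * D / 2 * sqn lebesgue f + 1 / (2 * (2 * D)) * sqn lebesgue u"
    using D by (intro ip_bound f us) simp
   then show "cmod (- r - ip UNIV f u) \<le> 2 * C * sqrt \<epsilon> * ?N + (2 * D / 2 * sqn lebesgue f + 1 / (2 * (2 * D)) * sqn lebesgue u)"
    using norm_triangle_ineq4[of "- r" "ip UNIV f u"] rb by simp
  qed (use D in simp)
  also have "\<dots> = D * (2 * C * sqrt \<epsilon>) * ?N + D\<^sup>2 * sqn lebesgue f + 1 / 4 * sqn lebesgue u"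
   using D by (simp add: field_simps power2_eq_square)
  also have "\<dots> \<le> 1 / 4 * ?N + D\<^sup>2 * sqn lebesgue f + 1 / 4 * ?N"
   using mult_right_mono[OF small, of ?N] grad_sqn_nonneg[of G] sqn_nonneg[of lebesgue u] by simp
  finally show ?thesis by (simp add: field_simps)
 qed
 \<comment> \<open>The usual resolvent bound of a symmetric form, valid for every width below
   \<beta>, since the real potential does not enter the imaginary part.\<close>
 have H_bound: "sqn lebesgue u \<le> sqn lebesgue f / (Im lam)\<^sup>2"
  if \<epsilon>: "0 < \<epsilon>" "\<epsilon> < \<beta>" and f: "sqi lebesgue f" and a: "form_approx B u G \<phi>" and eq: "\<And>\<psi>. test_fun UNIV \<psi> ==>
   dform B G \<psi> + ip UNIV (\<lambda>x. of_real (W \<epsilon> x) * u x) \<psi> = ip UNIV f \<psi> + lam * ip UNIV u \<psi>"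
  for \<epsilon> f u G \<phi>
 proof -
  have t: "\<And>k. test_fun UNIV (\<phi> k)" and l: "sqlim lebesgue \<phi> u" using a by (auto simp: form_approx_def)
  have us: "sqi lebesgue u" by (rule sqlimD(2)[OF l])
  have "(\<lambda>k. ip UNIV f (\<phi> k) + lam * ip UNIV u (\<phi> k)) \<longlonglongrightarrow> of_real (grad_sqn G) + of_real (pot \<epsilon> u)"
   unfolding eq[OF t, symmetric] by (intro tendsto_add form_approx_limits(2)[OF a] ipW[OF \<epsilon> a])
  moreover have "(\<lambda>k. ip UNIV f (\<phi> k) + lam * ip UNIV u (\<phi> k)) \<longlonglongrightarrow> ip UNIV f u + lam * of_real (sqn lebesgue u)"
   by (intro tendsto_add tendsto_mult_left ip_sqlim[OF f l] form_approx_limits(3)[OF a])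
  ultimately have "ip UNIV f u + lam * of_real (sqn lebesgue u) = of_real (grad_sqn G) + of_real (pot \<epsilon> u)"
   by (rule LIMSEQ_unique[rotated])
  from arg_cong[OF this, of Im] have "Im lam * sqn lebesgue u = - Im (ip UNIV f u)" by simp
  then have "\<bar>Im lam\<bar> * sqn lebesgue u = \<bar>Im (ip UNIV f u)\<bar>" using sqn_nonneg[of lebesgue u] by (metis abs_minus_cancel abs_mult abs_of_nonneg)
  also have "\<dots> \<le> cmod (ip UNIV f u)" by (rule abs_Im_le_cmod)
  also have "\<dots> \<le> 1 / \<bar>Im lam\<bar> / 2 * sqn lebesgue f + 1 / (2 * (1 / \<bar>Im lam\<bar>)) * sqn lebesgue u"
   using lam by (intro ip_bound f us) simp
  finally have "\<bar>Im lam\<bar> / 2 * sqn lebesgue u \<le> sqn lebesgue f / (2 * \<bar>Im lam\<bar>)" by simp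
  then have "\<bar>Im lam\<bar> * \<bar>Im lam\<bar> * sqn lebesgue u \<le> sqn lebesgue f" using lam by (simp add: field_simps)
  moreover have "\<bar>Im lam\<bar> * \<bar>Im lam\<bar> = (Im lam)\<^sup>2" by (simp add: power2_eq_square)
  ultimately show ?thesis using lam by (simp add: pos_le_divide_eq mult.commute)
 qed
 \<comment> \<open>The first summand serves widths up to \<open>e0\<close>; the second is the bound
   from the two separate resolvent estimates, divided by \<open>e0\<close>.\<close>
 let ?c2 = "8 * D ^ 4 * C\<^sup>2 + 2 * (1 / (Im lam)\<^sup>2 + 2 * D\<^sup>2) / e0"
 have c2: "?c2 > 0" using D C(1) e0(1) by (intro add_pos_nonneg) (auto intro!: add_nonneg_nonneg divide_nonneg_pos)
 show ?thesis
 proof (intro exI[of _ "sqrt ?c2"] conjI allI impI)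
  show "0 < sqrt ?c2" using c2 by simp
  fix \<epsilon> :: real and f u\<epsilon> u
  assume \<epsilon>: "0 < \<epsilon>" "\<epsilon> < \<beta>" and "L2 UNIV f" and H: "resolvent_eq_H B (W \<epsilon>) lam f u\<epsilon>"
   and A: "resolvent_eq_A B Oi K \<gamma> L \<nu> (alpha_of \<nu> \<beta> V) lam f u"
  then have f: "sqi lebesgue f" by (simp add: L2_UNIV_sqi)
  let ?f = "sqn lebesgue f"
  have f0: "0 \<le> ?f" by (rule sqn_nonneg)
  obtain Ge \<phi>e where ae: "form_approx B u\<epsilon> Ge \<phi>e" and He: "\<And>\<psi>. test_fun UNIV \<psi> ==>
   dform B Ge \<psi> + ip UNIV (\<lambda>x. of_real (W \<epsilon> x) * u\<epsilon> x) \<psi> = ip UNIV f \<psi> + lam * ip UNIV u\<epsilon> \<psi>"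
   using approx_form[OF H \<epsilon> f] by blast
  obtain G \<phi> where a: "form_approx B u G \<phi>" and lim: "\<And>\<psi>. test_fun UNIV \<psi> ==> (\<lambda>m. bform (\<phi> m) \<psi>)
   \<longlonglongrightarrow> ip UNIV f \<psi> + lam * ip UNIV u \<psi> - dform B G \<psi>" using limit_form[OF K f A] by blast
  have us: "sqi lebesgue u\<epsilon>" "sqi lebesgue u" using ae a by (auto simp: form_approx_def dest: sqlimD)
  have Gs: "sqi lebesgue (\<lambda>x. Ge x $ j)" "sqi lebesgue (\<lambda>x. G x $ j)" for j using ae a by (auto simp: form_approx_def dest: sqlimD)
  let ?w = "\<lambda>x. u\<epsilon> x - u x" and ?Gw = "\<lambda>x. Ge x - G x" and ?\<omega> = "\<lambda>k x. \<phi>e k x - \<phi> k x"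
  have aw: "form_approx B ?w ?Gw ?\<omega>" by (rule form_approx_diff[OF ae a])
  have uN: "sqn lebesgue u + grad_sqn G \<le> 2 * D\<^sup>2 * ?f" by (rule u_bound[OF f a lim])
  have "sqn lebesgue ?w \<le> ?c2 * \<epsilon> * ?f"
  proof (cases "\<epsilon> \<le> e0")
   case True
   let ?N = "sqn lebesgue u + grad_sqn G" and ?Nw = "sqn lebesgue ?w + grad_sqn ?Gw"
   have t: "\<And>k. test_fun UNIV (?\<omega> k)" using aw by (auto simp: form_approx_def)
   \<comment> \<open>With this weight the norm of the difference returns with coefficient exactly
     1/2 and is absorbed; what remains is \<theta>^2, of order \<epsilon>, times the norm of
     \<open>u\<close>. The root of \<epsilon> appears after taking norms.\<close>
   define \<theta> where "\<theta> = 2 * D * C * sqrt \<epsilon>"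
   have \<theta>: "\<theta> > 0" using D C(1) \<epsilon>(1) by (simp add: \<theta>_def)
   define r where "r k = ip UNIV (\<lambda>x. of_real (W \<epsilon> x) * u x) (?\<omega> k)
     - (ip UNIV f (?\<omega> k) + lam * ip UNIV u (?\<omega> k) - dform B G (?\<omega> k))" for k
   \<comment> \<open>Subtracting the equation of \<open>u\<epsilon>\<close> eliminates
     \<open>f\<close>: the defect of \<open>u\<close> is the residual in the weak equation of the
     difference.\<close>
   have r_eq: "r k = lam * ip UNIV ?w (?\<omega> k) - dform B ?Gw (?\<omega> k) - ip UNIV (\<lambda>x. of_real (W \<epsilon> x) * ?w x) (?\<omega> k)" for k
   proof -
    have s: "sqU UNIV u\<epsilon>" "sqU UNIV u" "\<And>j. sqU UNIV (\<lambda>x. Ge x $ j)" "\<And>j. sqU UNIV (\<lambda>x. G x $ j)"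
     "sqU UNIV (\<lambda>x. of_real (W \<epsilon> x) * u\<epsilon> x)" "sqU UNIV (\<lambda>x. of_real (W \<epsilon> x) * u x)"
     using us Gs W_sqi[OF \<epsilon>] by simp_all
    show ?thesis
     unfolding r_def vector_minus_component right_diff_distrib[of "of_real (W \<epsilon> _)"] ip_diff_left[OF s(1,2) t] ip_diff_left[OF s(5,6) t]
      ip_diff_left[OF s(3,4) test_fun_MG[OF t]] sum_subtractf using He[OF t, of k] by (simp add: algebra_simps)
   qed
   define R where "R = lam * of_real (sqn lebesgue ?w) - of_real (grad_sqn ?Gw) - of_real (pot \<epsilon> ?w)"
   have Rb: "cmod R \<le> C * sqrt \<epsilon> * (\<theta> * ?N + ?Nw / \<theta>)"
   proof (rule LIMSEQ_le)
    show "(\<lambda>k. cmod (r k)) \<longlonglongrightarrow> cmod R"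
     unfolding r_eq R_def by (intro tendsto_norm tendsto_diff tendsto_mult_left ipW[OF \<epsilon> aw] form_approx_limits(2,3)[OF aw])
    show "(\<lambda>k. C * sqrt \<epsilon> * (\<theta> * ?N + (sqn lebesgue (?\<omega> k) + energy B (?\<omega> k)) / \<theta>)) \<longlonglongrightarrow> C * sqrt \<epsilon> * (\<theta> * ?N + ?Nw / \<theta>)"
     using \<theta> by (intro tendsto_mult_left tendsto_add tendsto_const tendsto_divide form_approx_limits(1)[OF aw]) simp
    show "\<exists>N. \<forall>k\<ge>N. cmod (r k) \<le> C * sqrt \<epsilon> * (\<theta> * ?N + (sqn lebesgue (?\<omega> k) + energy B (?\<omega> k)) / \<theta>)"
     unfolding r_def using C(2)[OF \<epsilon>(1) True \<theta> a t lim[OF t]] by blast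
   qed
   have "grad_sqn ?Gw + sqn lebesgue ?w \<le> D * cmod R" by (rule co[OF C1(2)[OF \<epsilon>(1) True aw]]) (simp add: R_def)
   then have "?Nw \<le> D * (C * sqrt \<epsilon> * (\<theta> * ?N + ?Nw / \<theta>))"
    using mult_left_mono[OF Rb less_imp_le[OF D]] by linarith
   moreover have "x \<le> \<theta>\<^sup>2 * y" if "x \<le> D * (C * sqrt \<epsilon> * (\<theta> * y + x / \<theta>))" for x y
   proof -
    have "D * (C * sqrt \<epsilon> * z) = \<theta> / 2 * z" for z by (simp add: \<theta>_def)
    also have "\<theta> / 2 * (\<theta> * y + x / \<theta>) = \<theta>\<^sup>2 * y / 2 + x / 2" using \<theta> by (simp add: field_simps power2_eq_square)
    finally have "D * (C * sqrt \<epsilon> * (\<theta> * y + x / \<theta>)) = \<theta>\<^sup>2 * y / 2 + x / 2" .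
    then show ?thesis using that by linarith
   qed
   ultimately have "?Nw \<le> \<theta>\<^sup>2 * ?N" by blast
   then have "?Nw \<le> 4 * D\<^sup>2 * C\<^sup>2 * \<epsilon> * ?N" using \<epsilon>(1) by (simp add: \<theta>_def power_mult_distrib)
   also have "\<dots> \<le> 4 * D\<^sup>2 * C\<^sup>2 * \<epsilon> * (2 * D\<^sup>2 * ?f)" using uN \<epsilon>(1) by (intro mult_left_mono) auto
   also have "\<dots> = 8 * D ^ 4 * C\<^sup>2 * \<epsilon> * ?f" by (simp add: power2_eq_square power4_eq_xxxx)
   also have "\<dots> \<le> ?c2 * \<epsilon> * ?f" using e0(1) D \<epsilon>(1) f0 by (intro mult_right_mono) (auto intro!: add_nonneg_nonneg divide_nonneg_pos)
   finally show ?thesis using grad_sqn_nonneg[of ?Gw] by linarith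
  next
   case False
   have "sqn lebesgue ?w = sqn lebesgue (\<lambda>x. u\<epsilon> x + (- 1) * u x)" by simp
   also have "\<dots> \<le> 2 * sqn lebesgue u\<epsilon> + 2 * sqn lebesgue (\<lambda>x. (- 1) * u x)" by (intro sqn_add_le sqi_cmult us)
   also have "sqn lebesgue (\<lambda>x. (- 1) * u x) = sqn lebesgue u" unfolding sqn_cmult by simp
   also have "2 * sqn lebesgue u\<epsilon> + 2 * sqn lebesgue u \<le> 2 * (?f / (Im lam)\<^sup>2) + 2 * (2 * D\<^sup>2 * ?f)"
    using H_bound[OF \<epsilon> f ae He] uN grad_sqn_nonneg[of G] by linarith
   also have "\<dots> = 2 * (1 / (Im lam)\<^sup>2 + 2 * D\<^sup>2) / e0 * e0 * ?f" using e0(1) by (simp add: field_simps)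
   also have "\<dots> \<le> 2 * (1 / (Im lam)\<^sup>2 + 2 * D\<^sup>2) / e0 * \<epsilon> * ?f"
    using False e0(1) f0 by (intro mult_right_mono mult_left_mono) (auto intro!: add_nonneg_nonneg divide_nonneg_pos)
   also have "\<dots> \<le> ?c2 * \<epsilon> * ?f" using D \<epsilon>(1) f0 by (intro mult_right_mono) auto
   finally show ?thesis .
  qed
  then have "sqrt (sqn lebesgue ?w) \<le> sqrt (?c2 * \<epsilon> * ?f)" by (rule real_sqrt_le_mono)
  then show "norm2 ?w \<le> sqrt ?c2 * sqrt \<epsilon> * norm2 f" unfolding norm2_def sqn_def real_sqrt_mult .
 qed
qed

end

theorem theorem4p5:
  fixes B \<beta> L :: real and Oi K :: "(real^2) set" and \<gamma> :: "real \<Rightarrow> real^2"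
    and \<nu> :: "real^2 \<Rightarrow> real^2" and V :: "real^2 \<Rightarrow> real" and lam :: complex
  assumes "B > 0"
    and "C11_domain Oi \<gamma> L"
    and "outward_normal Oi \<gamma> L \<nu>"
    and "\<beta> > 0"
    and "inj_on (\<lambda>p. fst p + snd p *\<^sub>R \<nu> (fst p)) (\<gamma> ` {0..L} \<times> {-\<beta><..<\<beta>})"
    and "open K" and "bounded K" and "closure Oi \<subseteq> K"
    and "V \<in> borel_measurable borel"
    and "\<exists>M. AE x in lebesgue. \<bar>V x\<bar> \<le> M"
    and "\<forall>x. x \<notin> tube (\<gamma> ` {0..L}) \<nu> \<beta> \<longrightarrow> V x = 0"
    and "Im lam \<noteq> 0"
  shows "\<exists>c>0. \<forall>\<epsilon> f u\<epsilon> u. 0 < \<epsilon> \<longrightarrow> \<epsilon> < \<beta> \<longrightarrow> L2 UNIV f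
      \<longrightarrow> resolvent_eq_H B (V_eps (\<gamma> ` {0..L}) \<nu> \<beta> V \<epsilon>) lam f u\<epsilon>
      \<longrightarrow> resolvent_eq_A B Oi K \<gamma> L \<nu> (alpha_of \<nu> \<beta> V) lam f u
      \<longrightarrow> norm2 (\<lambda>x. u\<epsilon> x - u x) \<le> c * sqrt \<epsilon> * norm2 f"
proof -
  obtain T M where "tube_domain \<gamma> (\<lambda>s. \<nu> (\<gamma> s)) T L M \<beta> Oi"
    using tube_domain_exists assms(2-5) by blast
  then interpret tube_domain \<gamma> "\<lambda>s. \<nu> (\<gamma> s)" T L M \<beta> Oi .
  obtain Mv where Mv: "AE x in lebesgue. \<bar>V x\<bar> \<le> Mv" using assms(10) by blast
  \<comment> \<open>The essential bound is raised to at least 1 because the locale asks for a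
    positive constant.\<close>
  interpret tube_setting \<gamma> "\<lambda>s. \<nu> (\<gamma> s)" T L M \<beta> Oi \<nu> V "max Mv 1"
  proof unfold_locales
    show "AE x in lebesgue. \<bar>V x\<bar> \<le> max Mv 1" using Mv by eventually_elim simp
  qed (use assms(9) in auto)
  show ?thesis using resolvent_estimate[OF assms(6-8,12), of B] unfolding W_def .
qed

end
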